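(* Let $\mathbb{K}$ be a field and let $\mathcal{V}$ be a homogeneous variety of $\mathbb{K}$-algebras. If $\mathcal{V}$ is cosmash associative, then $\mathcal{V}$ satisfies at least one of the identities $xy-yx$, $xy$ or $x$. As a consequence, $\mathcal{V}$ is a subvariety of the variety $\mathsf{CA}_{\mathbb{K}}$ of commutative associative $\mathbb{K}$-algebras.
   Context: Algebras and varieties. A $\mathbb{K}$-algebra is a $\mathbb{K}$-vector space with a bilinear multiplication (no associativity or unit is assumed); morphisms are linear maps preserving the multiplication. A non-associative polynomial on a set $S$ of variables is an element of the free $\mathbb{K}$-algebra on $S$, i.e. a $\mathbb{K}$-linear combination of non-empty parenthesised words in $S$; a monomial is a scalar multiple of such a word. The type of a monomial on $\{x_1,\dots,x_n\}$ is $(k_1,\dots,k_n)$, where $k_i$ is the number of occurrences of $x_i$. A polynomial is homogeneous if all its monomials have the same type. A polynomial $\varphi(x_1,\dots,x_n)$ is an identity of an algebra $A$ if $\varphi(a_1,\dots,a_n)=0$ for all $a_i\in A$. The variety determined by a set $I$ of polynomials is the class (full subcategory) of all $\mathbb{K}$-algebras having all elements of $I$ as identities; a variety satisfies an identity if all its algebras do. A variety is homogeneous if it is determined by a set of homogeneous polynomials. $\mathsf{CA}_{\mathbb{K}}$ is the variety determined by $xy-yx$ and $x(yz)-(xy)z$. Cosmash products. Let $\mathcal{C}$ be a pointed category with finite sums (coproducts), finite products and kernels (e.g. any variety of $\mathbb{K}$-algebras). The binary cosmash product $\iota_{X,Y}\colon X\diamond Y\to X+Y$ is the kernel of the canonical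 morphism $X+Y\to X\times Y$ with components $\langle 1_X,0\rangle$ and $\langle 0,1_Y\rangle$. The ternary cosmash product $\iota_{X,Y,Z}\colon X\diamond Y\diamond Z\to X+Y+Z$ is the kernel of the canonical morphism $X+Y+Z\to (X+Y)\times(X+Z)\times(Y+Z)$ with components $\langle\iota_X,\iota_Y,0\rangle$, $\langle\iota_X,0,\iota_Z\rangle$, $\langle 0,\iota_Y,\iota_Z\rangle$. The comparison map $\Phi_{X,Y,Z}\colon X\diamond(Y\diamond Z)\to X\diamond Y\diamond Z$ is the unique morphism with $\iota_{X,Y,Z}\circ\Phi_{X,Y,Z}=(1_X+\iota_{Y,Z})\circ\iota_{X,Y\diamond Z}$, and $\Psi_{X,Y,Z}\colon (X\diamond Y)\diamond Z\to X\diamond Y\diamond Z$ is the unique morphism with $\iota_{X,Y,Z}\circ\Psi_{X,Y,Z}=(\iota_{X,Y}+1_Z)\circ\iota_{X\diamond Y,Z}$. The category $\mathcal{C}$ is cosmash associative if $\Phi_{X,Y,Z}$ and $\Psi_{X,Y,Z}$ are isomorphisms for all objects $X,Y,Z$. *)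

theory Defs
  imports
    "HOL-Algebra.Module"
    "HOL-Library.FuncSet"
    "HOL-Library.Poly_Mapping"
begin

section \<open>Cosmash products in a category\<close>

text \<open>
  Categories are given by objects, arrows, domains, codomains, identities and composition
  (\<open>Comp C g f\<close> is \<open>g\<close> after \<open>f\<close>).  Limits and colimits are
  described by their universal properties, so that no choice of representatives is made.
\<close>

record ('o, 'm) category =
  Obj :: "'o set"
  Arr :: "'m set"
  Dom :: "'m \<Rightarrow> 'o"
  Cod :: "'m \<Rightarrow> 'o"
  ident :: "'o \<Rightarrow> 'm"
  Comp :: "'m \<Rightarrow> 'm \<Rightarrow> 'm"

definition homset :: "('o, 'm) category \<Rightarrow> 'o \<Rightarrow> 'o \<Rightarrow> 'm set" where
  "homset C A B = {f \<in> Arr C. Dom C f = A \<and> Cod C f = B}"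

definition is_iso :: "('o, 'm) category \<Rightarrow> 'm \<Rightarrow> bool" where
  "is_iso C f \<longleftrightarrow> f \<in> Arr C \<and>
     (\<exists>g \<in> homset C (Cod C f) (Dom C f).
        Comp C g f = ident C (Dom C f) \<and> Comp C f g = ident C (Cod C f))"

definition is_zero_object :: "('o, 'm) category \<Rightarrow> 'o \<Rightarrow> bool" where
  "is_zero_object C Z \<longleftrightarrow> Z \<in> Obj C \<and>
     (\<forall>A \<in> Obj C. (\<exists>!f. f \<in> homset C Z A) \<and> (\<exists>!f. f \<in> homset C A Z))"

definition zero_arr :: "('o, 'm) category \<Rightarrow> 'o \<Rightarrow> 'o \<Rightarrow> 'm" where
  "zero_arr C A B = (THE f. \<exists>Z. is_zero_object C Z \<and>
     (\<exists>a \<in> homset C A Z. \<exists>b \<in> homset C Z B. f = Comp C b a))"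

definition is_coproduct :: "('o, 'm) category \<Rightarrow> 'o list \<Rightarrow> 'o \<Rightarrow> 'm list \<Rightarrow> bool" where
  "is_coproduct C Xs S is \<longleftrightarrow> S \<in> Obj C \<and> list_all2 (\<lambda>X i. i \<in> homset C X S) Xs is \<and>
     (\<forall>T \<in> Obj C. \<forall>fs. list_all2 (\<lambda>X f. f \<in> homset C X T) Xs fs \<longrightarrow>
        (\<exists>!h. h \<in> homset C S T \<and> map (\<lambda>i. Comp C h i) is = fs))"

definition cotuple :: "('o, 'm) category \<Rightarrow> 'o \<Rightarrow> 'm list \<Rightarrow> 'o \<Rightarrow> 'm list \<Rightarrow> 'm" where
  "cotuple C S is T fs = (THE h. h \<in> homset C S T \<and> map (\<lambda>i. Comp C h i) is = fs)"

definition is_product :: "('o, 'm) category \<Rightarrow> 'o list \<Rightarrow> 'o \<Rightarrow> 'm list \<Rightarrow> bool" where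
  "is_product C Xs P ps \<longleftrightarrow> P \<in> Obj C \<and> list_all2 (\<lambda>X p. p \<in> homset C P X) Xs ps \<and>
     (\<forall>T \<in> Obj C. \<forall>fs. list_all2 (\<lambda>X f. f \<in> homset C T X) Xs fs \<longrightarrow>
        (\<exists>!h. h \<in> homset C T P \<and> map (\<lambda>p. Comp C p h) ps = fs))"

definition tuple :: "('o, 'm) category \<Rightarrow> 'o \<Rightarrow> 'm list \<Rightarrow> 'o \<Rightarrow> 'm list \<Rightarrow> 'm" where
  "tuple C P ps T fs = (THE h. h \<in> homset C T P \<and> map (\<lambda>p. Comp C p h) ps = fs)"

text \<open>
  \<open>sum_arr C S is T js fs\<close> is the arrow \<open>f\<^sub>1 + f\<^sub>2 + \<dots>\<close> from
  the coproduct \<open>S\<close> with injections \<open>is\<close> to the coproduct \<open>T\<close> with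
  injections \<open>js\<close>.
\<close>

definition sum_arr ::
    "('o, 'm) category \<Rightarrow> 'o \<Rightarrow> 'm list \<Rightarrow> 'o \<Rightarrow> 'm list \<Rightarrow> 'm list \<Rightarrow> 'm" where
  "sum_arr C S is T js fs = cotuple C S is T (map2 (Comp C) js fs)"

definition is_kernel :: "('o, 'm) category \<Rightarrow> 'm \<Rightarrow> 'm \<Rightarrow> bool" where
  "is_kernel C f k \<longleftrightarrow> f \<in> Arr C \<and> k \<in> Arr C \<and> Cod C k = Dom C f \<and>
     Comp C f k = zero_arr C (Dom C k) (Cod C f) \<and>
     (\<forall>g \<in> Arr C. Cod C g = Dom C f \<and> Comp C f g = zero_arr C (Dom C g) (Cod C f) \<longrightarrow>
        (\<exists>!u. u \<in> homset C (Dom C g) (Dom C k) \<and> Comp C k u = g))"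

text \<open>
  \<open>k : X \<diamond> Y \<rightarrow> S\<close> is a binary cosmash product, where \<open>S = X + Y\<close> has
  injections \<open>i, j\<close>; the object \<open>X \<diamond> Y\<close> is \<open>Dom C k\<close>.
\<close>

definition is_cosmash2 ::
    "('o, 'm) category \<Rightarrow> 'o \<Rightarrow> 'o \<Rightarrow> 'o \<Rightarrow> 'm \<Rightarrow> 'm \<Rightarrow> 'm \<Rightarrow> bool" where
  "is_cosmash2 C X Y S i j k \<longleftrightarrow> is_coproduct C [X, Y] S [i, j] \<and>
     (\<exists>P p q. is_product C [X, Y] P [p, q] \<and>
        is_kernel C
          (tuple C P [p, q] S
             [cotuple C S [i, j] X [ident C X, zero_arr C Y X],
              cotuple C S [i, j] Y [zero_arr C X Y, ident C Y]]) k)"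

definition is_cosmash3 ::
    "('o, 'm) category \<Rightarrow> 'o \<Rightarrow> 'o \<Rightarrow> 'o \<Rightarrow> 'o \<Rightarrow> 'm \<Rightarrow> 'm \<Rightarrow> 'm \<Rightarrow> 'm \<Rightarrow> bool" where
  "is_cosmash3 C X Y Z S i j l k \<longleftrightarrow> is_coproduct C [X, Y, Z] S [i, j, l] \<and>
     (\<exists>XY a\<^sub>1 a\<^sub>2 XZ b\<^sub>1 b\<^sub>2 YZ c\<^sub>1 c\<^sub>2 P p q r.
        is_coproduct C [X, Y] XY [a\<^sub>1, a\<^sub>2] \<and>
        is_coproduct C [X, Z] XZ [b\<^sub>1, b\<^sub>2] \<and>
        is_coproduct C [Y, Z] YZ [c\<^sub>1, c\<^sub>2] \<and>
        is_product C [XY, XZ, YZ] P [p, q, r] \<and>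
        is_kernel C
          (tuple C P [p, q, r] S
             [cotuple C S [i, j, l] XY [a\<^sub>1, a\<^sub>2, zero_arr C Z XY],
              cotuple C S [i, j, l] XZ [b\<^sub>1, zero_arr C Y XZ, b\<^sub>2],
              cotuple C S [i, j, l] YZ [zero_arr C X YZ, c\<^sub>1, c\<^sub>2]]) k)"

text \<open>
  The unique \<open>\<Phi>\<close> with
  \<open>\<iota>\<^sub>X\<^sub>,\<^sub>Y\<^sub>,\<^sub>Z \<circ> \<Phi> = (1\<^sub>X + \<iota>\<^sub>Y\<^sub>,\<^sub>Z) \<circ> \<iota>\<^sub>X\<^sub>,\<^sub>Y\<^sub>\<diamond>\<^sub>Z\<close>.  Here \<open>k3\<close> is
  \<open>\<iota>\<^sub>X\<^sub>,\<^sub>Y\<^sub>,\<^sub>Z : X \<diamond> Y \<diamond> Z \<rightarrow> S\<close> with \<open>S = X + Y + Z\<close> (injections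
  \<open>i, j, l\<close>), \<open>k\<close> is \<open>\<iota>\<^sub>Y\<^sub>,\<^sub>Z : Y \<diamond> Z \<rightarrow> B\<close> with
  \<open>B = Y + Z\<close> (injections \<open>b\<^sub>1, b\<^sub>2\<close>), and \<open>m\<close> is
  \<open>\<iota>\<^sub>X\<^sub>,\<^sub>Y\<^sub>\<diamond>\<^sub>Z : X \<diamond> (Y \<diamond> Z) \<rightarrow> T\<close> with \<open>T = X + (Y \<diamond> Z)\<close> (injections
  \<open>t\<^sub>1, t\<^sub>2\<close>).  The codomain \<open>X + (Y + Z)\<close> of \<open>1\<^sub>X + \<iota>\<^sub>Y\<^sub>,\<^sub>Z\<close> is
  identified with \<open>S\<close>, the injections being \<open>i\<close> and
  \<open>\<langle>j, l\<rangle> : B \<rightarrow> S\<close>.  Similarly for \<open>\<Psi>\<close>.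
\<close>

definition comparison_Phi ::
    "('o, 'm) category \<Rightarrow> 'o \<Rightarrow> 'o \<Rightarrow> 'm \<Rightarrow> 'm \<Rightarrow> 'm \<Rightarrow> 'm \<Rightarrow>
      'o \<Rightarrow> 'm \<Rightarrow> 'm \<Rightarrow> 'm \<Rightarrow> 'o \<Rightarrow> 'm \<Rightarrow> 'm \<Rightarrow> 'm \<Rightarrow> 'm" where
  "comparison_Phi C X S i j l k3 B b\<^sub>1 b\<^sub>2 k T t\<^sub>1 t\<^sub>2 m =
     (THE \<phi>. \<phi> \<in> homset C (Dom C m) (Dom C k3) \<and>
        Comp C k3 \<phi> =
          Comp C (sum_arr C T [t\<^sub>1, t\<^sub>2] S [i, cotuple C B [b\<^sub>1, b\<^sub>2] S [j, l]] [ident C X, k]) m)"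

definition comparison_Psi ::
    "('o, 'm) category \<Rightarrow> 'o \<Rightarrow> 'o \<Rightarrow> 'm \<Rightarrow> 'm \<Rightarrow> 'm \<Rightarrow> 'm \<Rightarrow>
      'o \<Rightarrow> 'm \<Rightarrow> 'm \<Rightarrow> 'm \<Rightarrow> 'o \<Rightarrow> 'm \<Rightarrow> 'm \<Rightarrow> 'm \<Rightarrow> 'm" where
  "comparison_Psi C Z S i j l k3 B b\<^sub>1 b\<^sub>2 k T t\<^sub>1 t\<^sub>2 m =
     (THE \<psi>. \<psi> \<in> homset C (Dom C m) (Dom C k3) \<and>
        Comp C k3 \<psi> =
          Comp C (sum_arr C T [t\<^sub>1, t\<^sub>2] S [cotuple C B [b\<^sub>1, b\<^sub>2] S [i, j], l] [k, ident C Z]) m)"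

text \<open>
  Intended for pointed categories with finite sums, finite products and kernels.  Since all
  these are unique up to isomorphism, requiring \<open>\<Phi>\<close> and \<open>\<Psi>\<close> to be invertible for
  all choices of them is the same as requiring it for one choice.
\<close>

definition cosmash_associative :: "('o, 'm) category \<Rightarrow> bool" where
  "cosmash_associative C \<longleftrightarrow>
     (\<forall>X \<in> Obj C. \<forall>Y \<in> Obj C. \<forall>Z \<in> Obj C. \<forall>S i j l k3. is_cosmash3 C X Y Z S i j l k3 \<longrightarrow>
        (\<forall>B b\<^sub>1 b\<^sub>2 k T t\<^sub>1 t\<^sub>2 m.
           is_cosmash2 C Y Z B b\<^sub>1 b\<^sub>2 k \<and> is_cosmash2 C X (Dom C k) T t\<^sub>1 t\<^sub>2 m \<longrightarrow>
           is_iso C (comparison_Phi C X S i j l k3 B b\<^sub>1 b\<^sub>2 k T t\<^sub>1 t\<^sub>2 m)) \<and>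
        (\<forall>B b\<^sub>1 b\<^sub>2 k T t\<^sub>1 t\<^sub>2 m.
           is_cosmash2 C X Y B b\<^sub>1 b\<^sub>2 k \<and> is_cosmash2 C (Dom C k) Z T t\<^sub>1 t\<^sub>2 m \<longrightarrow>
           is_iso C (comparison_Psi C Z S i j l k3 B b\<^sub>1 b\<^sub>2 k T t\<^sub>1 t\<^sub>2 m)))"


section \<open>Non-associative algebras and their identities\<close>

definition field_ring :: "'k::field ring" where
  "field_ring = \<lparr>carrier = UNIV, monoid.mult = (*), one = 1, zero = 0, add = (+)\<rparr>"

text \<open>
  The record type of modules inherits a component \<open>one\<close> from rings.  It carries no
  meaning here: no axiom below mentions it and homomorphisms need not respect it.
\<close>

definition is_algebra :: "('k::field, 'u) module \<Rightarrow> bool" where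
  "is_algebra A \<longleftrightarrow> module field_ring A \<and>
     (\<forall>x \<in> carrier A. \<forall>y \<in> carrier A. x \<otimes>\<^bsub>A\<^esub> y \<in> carrier A) \<and>
     (\<forall>x \<in> carrier A. \<forall>y \<in> carrier A. \<forall>z \<in> carrier A.
        (x \<oplus>\<^bsub>A\<^esub> y) \<otimes>\<^bsub>A\<^esub> z = (x \<otimes>\<^bsub>A\<^esub> z) \<oplus>\<^bsub>A\<^esub> (y \<otimes>\<^bsub>A\<^esub> z) \<and>
        z \<otimes>\<^bsub>A\<^esub> (x \<oplus>\<^bsub>A\<^esub> y) = (z \<otimes>\<^bsub>A\<^esub> x) \<oplus>\<^bsub>A\<^esub> (z \<otimes>\<^bsub>A\<^esub> y)) \<and>
     (\<forall>c. \<forall>x \<in> carrier A. \<forall>y \<in> carrier A.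
        (c \<odot>\<^bsub>A\<^esub> x) \<otimes>\<^bsub>A\<^esub> y = c \<odot>\<^bsub>A\<^esub> (x \<otimes>\<^bsub>A\<^esub> y) \<and>
        x \<otimes>\<^bsub>A\<^esub> (c \<odot>\<^bsub>A\<^esub> y) = c \<odot>\<^bsub>A\<^esub> (x \<otimes>\<^bsub>A\<^esub> y))"

text \<open>
  Homomorphisms are normalised to \<open>undefined\<close> outside the carrier, so that equality of
  functions is equality of homomorphisms.
\<close>

definition alg_hom :: "('k::field, 'u) module \<Rightarrow> ('k, 'u) module \<Rightarrow> ('u \<Rightarrow> 'u) set" where
  "alg_hom A B = {f \<in> carrier A \<rightarrow>\<^sub>E carrier B.
     (\<forall>x \<in> carrier A. \<forall>y \<in> carrier A. f (x \<oplus>\<^bsub>A\<^esub> y) = f x \<oplus>\<^bsub>B\<^esub> f y) \<and>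
     (\<forall>c. \<forall>x \<in> carrier A. f (c \<odot>\<^bsub>A\<^esub> x) = c \<odot>\<^bsub>B\<^esub> f x) \<and>
     (\<forall>x \<in> carrier A. \<forall>y \<in> carrier A. f (x \<otimes>\<^bsub>A\<^esub> y) = f x \<otimes>\<^bsub>B\<^esub> f y)}"

text \<open>
  Non-associative words and polynomials in the variables \<open>x\<^sub>0, x\<^sub>1, x\<^sub>2, \<dots>\<close>.
\<close>

datatype naword = Var nat | Mul naword naword

type_synonym 'k napoly = "naword \<Rightarrow>\<^sub>0 'k"

abbreviation word_poly :: "naword \<Rightarrow> 'k::field napoly" where
  "word_poly w \<equiv> Poly_Mapping.single w 1"

primrec occurrences :: "nat \<Rightarrow> naword \<Rightarrow> nat" where
  "occurrences i (Var j) = (if i = j then 1 else 0)"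
| "occurrences i (Mul u v) = occurrences i u + occurrences i v"

definition homogeneous :: "'k::field napoly \<Rightarrow> bool" where
  "homogeneous p \<longleftrightarrow>
     (\<forall>u \<in> Poly_Mapping.keys p. \<forall>v \<in> Poly_Mapping.keys p. \<forall>i. occurrences i u = occurrences i v)"

primrec word_value :: "('k::field, 'u) module \<Rightarrow> (nat \<Rightarrow> 'u) \<Rightarrow> naword \<Rightarrow> 'u" where
  "word_value A a (Var i) = a i"
| "word_value A a (Mul u v) = word_value A a u \<otimes>\<^bsub>A\<^esub> word_value A a v"

definition poly_value :: "('k::field, 'u) module \<Rightarrow> (nat \<Rightarrow> 'u) \<Rightarrow> 'k napoly \<Rightarrow> 'u" where
  "poly_value A a p =
     (\<Oplus>\<^bsub>A\<^esub>w \<in> Poly_Mapping.keys p. Poly_Mapping.lookup p w \<odot>\<^bsub>A\<^esub> word_value A a w)"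

definition is_identity :: "('k::field, 'u) module \<Rightarrow> 'k napoly \<Rightarrow> bool" where
  "is_identity A p \<longleftrightarrow> (\<forall>a. range a \<subseteq> carrier A \<longrightarrow> poly_value A a p = \<zero>\<^bsub>A\<^esub>)"


section \<open>Varieties\<close>

text \<open>
  The algebras considered have their carriers inside a type \<open>'u\<close>, which plays the role of
  a universe.  If \<open>'u\<close> is infinite and at least as large as the field \<open>'k\<close>, this universe
  is closed up to isomorphism under finite products and subalgebras, and under finite
  coproducts in any given variety; it also contains the free algebras of any variety on
  countably many generators.
\<close>

definition variety :: "'k::field napoly set \<Rightarrow> ('k, 'u) module set" where
  "variety I = {A. is_algebra A \<and> (\<forall>p \<in> I. is_identity A p)}"

definition homogeneous_variety :: "('k::field, 'u) module set \<Rightarrow> bool" where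
  "homogeneous_variety V \<longleftrightarrow> (\<exists>I. (\<forall>p \<in> I. homogeneous p) \<and> V = variety I)"

definition satisfies :: "('k::field, 'u) module set \<Rightarrow> 'k napoly \<Rightarrow> bool" where
  "satisfies V p \<longleftrightarrow> (\<forall>A \<in> V. is_identity A p)"

text \<open>The full subcategory on the algebras in \<open>V\<close>.\<close>

definition alg_category ::
    "('k::field, 'u) module set \<Rightarrow>
      (('k, 'u) module, ('k, 'u) module \<times> ('k, 'u) module \<times> ('u \<Rightarrow> 'u)) category" where
  "alg_category V =
     \<lparr>Obj = V,
      Arr = {(A, B, f). A \<in> V \<and> B \<in> V \<and> f \<in> alg_hom A B},
      Dom = (\<lambda>(A, B, f). A),
      Cod = (\<lambda>(A, B, f). B),
      ident = (\<lambda>A. (A, A, \<lambda>x \<in> carrier A. x)),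
      Comp = (\<lambda>(_, D, g) (A, _, f). (A, D, compose (carrier A) g f))\<rparr>"

definition poly_comm :: "'k::field napoly" where
  "poly_comm = word_poly (Mul (Var 0) (Var 1)) - word_poly (Mul (Var 1) (Var 0))"

definition poly_assoc :: "'k::field napoly" where
  "poly_assoc =
     word_poly (Mul (Var 0) (Mul (Var 1) (Var 2))) - word_poly (Mul (Mul (Var 0) (Var 1)) (Var 2))"

definition CA :: "('k::field, 'u) module set" where
  "CA = variety {poly_comm, poly_assoc}"

end

theory Submission
  imports Defs
begin

text \<open>
  Evaluating free algebras in \<open>A \<otimes> t K[t]/t\<^sup>4\<close> turns surjectivity of \<open>\<Phi>\<close> into identities: every
  multilinear word of degree 3 in \<open>a, b, c\<close> is a combination of the words \<open>g(a, h(b, c))\<close>, where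
  \<open>g, h\<close> are the multiplication or its opposite.  Homogeneity makes these identities exact.
  Injectivity of \<open>\<Phi>\<close> for \<open>X = Y = K x\<close> with \<open>x\<^sup>2 = 0\<close> shows in turn that, when \<open>x y\<close> and \<open>y x\<close>
  are independent, so are the right-normed words of degrees 3 and 4.

  In that case the coefficients \<open>M\<close> of \<open>e(f(a, b), c) = \<Sum> M g(a, h(b, c))\<close> form an invertible
  solution of a pentagon equation.  By an argument on \<open>2 \<times> 2\<close> matrices there is then a combination
  \<open>u\<close> of the two multiplications with \<open>u(f(a, b), c) = \<Sum> \<chi> g(a, u(b, c))\<close>.  Permuting the
  variables in this identity contradicts independence.  Hence \<open>x y = y x\<close> or \<open>x y = - y x\<close> in
  the variety.  If the multiplication is nonzero and \<open>x y = - y x\<close>, the right-normed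
  words of degrees 3 and 4 are still nonzero; permuting variables gives \<open>(a b) c = - a (b c)\<close>, and
  then rebracketing \<open>((a b) c) d\<close> in two ways forces characteristic 2.  If it is commutative, then
  \<open>(a b) c = l a (b c)\<close> for a scalar \<open>l\<close>, and permuting variables shows that \<open>l\<close> acts as 1.
\<close>

text \<open>\<open>\<Phi>\<close> is a map between kernels inside coproducts, and coproducts in an
  arbitrary variety have no normal forms. Both halves of its bijectivity are therefore tested by
  evaluating coproducts in algebras built for the purpose. The truncated tensor product separates
  degrees over every field, also over finite ones, where rescaling the variables cannot do so. A
  generator of square zero makes the multiplication of Y \<diamond> G vanish, so that only
  identities of degree 2 can obstruct a map out of X + (Y \<diamond> G). The second obstacle is that
  K need not be algebraically closed: the 2 x 2 matrices cut out of \<open>M\<close> might have no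
  eigenvector with entries in K. The pentagon equation provides a character on their span, and
  invertibility of \<open>M\<close> extends it to a linear functional on all matrices; this is what
  forces an eigenvector over K. Characteristic 2 is never excluded. There anticommutativity is
  commutativity, so it is enough that the anticommutative case ends in 2 = 0.\<close>

unbundle cardinal_syntax

section \<open>Algebras over a field and their homomorphisms\<close>

lemma field_ring_cring: "cring (field_ring :: 'k::field ring)"
proof (rule cringI)
  show "abelian_group (field_ring :: 'k ring)"
  proof (rule abelian_groupI)
    fix x :: 'k
    show "\<exists>y\<in>carrier field_ring. y \<oplus>\<^bsub>field_ring\<^esub> x = \<zero>\<^bsub>field_ring\<^esub>"
      by (rule bexI[of _ "- x"]) (auto simp: field_ring_def)
  qed (auto simp: field_ring_def algebra_simps)
  show "comm_monoid (field_ring :: 'k ring)"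
    by (rule comm_monoidI) (auto simp: field_ring_def algebra_simps)
qed (auto simp: field_ring_def algebra_simps)

text \<open>The negative of x is given as \<open>(-1) \<odot> x\<close>, so that apart from closure
  every axiom is an equation between terms in the operations. Such equations can be checked
  evaluation by evaluation in the term quotients below.\<close>

lemma is_algebraI:
  fixes A :: "('k::field, 'u) module" (structure)
  assumes "\<And>x y. \<lbrakk>x \<in> carrier A; y \<in> carrier A\<rbrakk> \<Longrightarrow> x \<oplus> y \<in> carrier A"
    and "\<zero> \<in> carrier A"
    and "\<And>c x. x \<in> carrier A \<Longrightarrow> c \<odot> x \<in> carrier A"
    and "\<And>x y. \<lbrakk>x \<in> carrier A; y \<in> carrier A\<rbrakk> \<Longrightarrow> x \<otimes> y \<in> carrier A"
    and "\<And>x y z. \<lbrakk>x \<in> carrier A; y \<in> carrier A; z \<in> carrier A\<rbrakk> \<Longrightarrow> (x \<oplus> y) \<oplus> z = x \<oplus> (y \<oplus> z)"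
    and "\<And>x y. \<lbrakk>x \<in> carrier A; y \<in> carrier A\<rbrakk> \<Longrightarrow> x \<oplus> y = y \<oplus> x"
    and "\<And>x. x \<in> carrier A \<Longrightarrow> \<zero> \<oplus> x = x"
    and "\<And>x. x \<in> carrier A \<Longrightarrow> (-1) \<odot> x \<oplus> x = \<zero>"
    and "\<And>c d x. x \<in> carrier A \<Longrightarrow> (c + d) \<odot> x = c \<odot> x \<oplus> d \<odot> x"
    and "\<And>c x y. \<lbrakk>x \<in> carrier A; y \<in> carrier A\<rbrakk> \<Longrightarrow> c \<odot> (x \<oplus> y) = c \<odot> x \<oplus> c \<odot> y"
    and "\<And>c d x. x \<in> carrier A \<Longrightarrow> (c * d) \<odot> x = c \<odot> (d \<odot> x)"
    and "\<And>x. x \<in> carrier A \<Longrightarrow> 1 \<odot> x = x"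
    and "\<And>x y z. \<lbrakk>x \<in> carrier A; y \<in> carrier A; z \<in> carrier A\<rbrakk> \<Longrightarrow> (x \<oplus> y) \<otimes> z = x \<otimes> z \<oplus> y \<otimes> z"
    and "\<And>x y z. \<lbrakk>x \<in> carrier A; y \<in> carrier A; z \<in> carrier A\<rbrakk> \<Longrightarrow> z \<otimes> (x \<oplus> y) = z \<otimes> x \<oplus> z \<otimes> y"
    and "\<And>c x y. \<lbrakk>x \<in> carrier A; y \<in> carrier A\<rbrakk> \<Longrightarrow> (c \<odot> x) \<otimes> y = c \<odot> (x \<otimes> y)"
    and "\<And>c x y. \<lbrakk>x \<in> carrier A; y \<in> carrier A\<rbrakk> \<Longrightarrow> x \<otimes> (c \<odot> y) = c \<odot> (x \<otimes> y)"
  shows "is_algebra A"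
proof -
  have "abelian_group A"
  proof (rule abelian_groupI)
    fix x assume "x \<in> carrier A"
    then show "\<exists>y\<in>carrier A. y \<oplus> x = \<zero>" by (intro bexI[of _ "(-1) \<odot> x"] assms(3,8))
  qed (use assms in auto)
  then have "module field_ring A"
    by (intro moduleI field_ring_cring) (use assms in \<open>auto simp: field_ring_def\<close>)
  then show ?thesis by (simp add: is_algebra_def assms)
qed

locale nalg =
  fixes A :: "('k::field, 'u) module" (structure)
  assumes alg: "is_algebra A"
begin

sublocale M: module field_ring A
  using alg by (simp add: is_algebra_def)

lemma sm_closed [simp]: "x \<in> carrier A \<Longrightarrow> c \<odot> x \<in> carrier A"
  by (simp add: field_ring_def M.smult_closed)

lemma mult_closed [simp]: "\<lbrakk>x \<in> carrier A; y \<in> carrier A\<rbrakk> \<Longrightarrow> x \<otimes> y \<in> carrier A"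
  using alg by (simp add: is_algebra_def)

lemma sm_add_left: "x \<in> carrier A \<Longrightarrow> (c + d) \<odot> x = c \<odot> x \<oplus> d \<odot> x"
  using M.smult_l_distr[of c d x] by (simp add: field_ring_def)

lemma sm_add_right: "\<lbrakk>x \<in> carrier A; y \<in> carrier A\<rbrakk> \<Longrightarrow> c \<odot> (x \<oplus> y) = c \<odot> x \<oplus> c \<odot> y"
  using M.smult_r_distr[of c x y] by (simp add: field_ring_def)

lemma sm_sm: "x \<in> carrier A \<Longrightarrow> c \<odot> (d \<odot> x) = (c * d) \<odot> x"
  using M.smult_assoc1[of c d x] by (simp add: field_ring_def)

lemma sm_one [simp]: "x \<in> carrier A \<Longrightarrow> 1 \<odot> x = x"
  using M.smult_one[of x] by (simp add: field_ring_def)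

lemma sm_zero_left [simp]: "x \<in> carrier A \<Longrightarrow> 0 \<odot> x = \<zero>"
  using M.smult_l_null[of x] by (simp add: field_ring_def)

lemma sm_zero_right [simp]: "c \<odot> \<zero> = \<zero>"
  using M.smult_r_null[of c] by (simp add: field_ring_def)

lemma sm_uminus: "x \<in> carrier A \<Longrightarrow> (-1) \<odot> x = \<ominus> x"
proof -
  assume x: "x \<in> carrier A"
  have "(-1) \<odot> x \<oplus> x = (-1) \<odot> x \<oplus> 1 \<odot> x" using x by simp
  also have "\<dots> = \<zero>" using sm_add_left[OF x, of "-1" 1] x by simp
  finally show ?thesis using x by (simp add: M.minus_equality)
qed

lemma sm_minus_one_add [simp]: "x \<in> carrier A \<Longrightarrow> (-1) \<odot> x \<oplus> x = \<zero>"
  by (simp add: sm_uminus M.l_neg)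

lemma mult_add_left: "\<lbrakk>x \<in> carrier A; y \<in> carrier A; z \<in> carrier A\<rbrakk> \<Longrightarrow> (x \<oplus> y) \<otimes> z = x \<otimes> z \<oplus> y \<otimes> z"
  using alg by (simp add: is_algebra_def)

lemma mult_add_right: "\<lbrakk>x \<in> carrier A; y \<in> carrier A; z \<in> carrier A\<rbrakk> \<Longrightarrow> z \<otimes> (x \<oplus> y) = z \<otimes> x \<oplus> z \<otimes> y"
  using alg by (simp add: is_algebra_def)

lemma mult_sm_left: "\<lbrakk>x \<in> carrier A; y \<in> carrier A\<rbrakk> \<Longrightarrow> (c \<odot> x) \<otimes> y = c \<odot> (x \<otimes> y)"
  using alg by (simp add: is_algebra_def)

lemma mult_sm_right: "\<lbrakk>x \<in> carrier A; y \<in> carrier A\<rbrakk> \<Longrightarrow> x \<otimes> (c \<odot> y) = c \<odot> (x \<otimes> y)"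
  using alg by (simp add: is_algebra_def)

lemma mult_zero_left [simp]: "x \<in> carrier A \<Longrightarrow> \<zero> \<otimes> x = \<zero>"
  using mult_sm_left[of \<zero> x 0] by simp

lemma mult_zero_right [simp]: "x \<in> carrier A \<Longrightarrow> x \<otimes> \<zero> = \<zero>"
  using mult_sm_right[of x \<zero> 0] by simp

lemma eq_if_diff_zero: "\<lbrakk>x \<in> carrier A; y \<in> carrier A; x \<oplus> (-1) \<odot> y = \<zero>\<rbrakk> \<Longrightarrow> x = y"
  by (simp add: sm_uminus M.add.inv_comm M.minus_equality) (metis M.minus_equality M.minus_minus M.a_inv_closed)

lemma sm_eq_zero: "\<lbrakk>c \<odot> x = \<zero>; x \<in> carrier A; c \<noteq> 0\<rbrakk> \<Longrightarrow> x = \<zero>"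
  using sm_sm[of x "inverse c" c] by simp

lemma word_value_closed [simp]: "range a \<subseteq> carrier A \<Longrightarrow> word_value A a w \<in> carrier A"
  by (induction w) auto

lemma poly_value_closed [simp]: "range a \<subseteq> carrier A \<Longrightarrow> poly_value A a p \<in> carrier A"
  unfolding poly_value_def by (intro M.finsum_closed) auto

lemma word_value_zero:
  "\<lbrakk>range a \<subseteq> carrier A; a i = \<zero>; occurrences i w > 0\<rbrakk> \<Longrightarrow> word_value A a w = \<zero>"
  by (induction w) (auto split: if_splits)

end

text \<open>Homomorphisms between algebras whose carriers live in different types; nothing is
  said about values outside the carrier.\<close>

definition ahom :: "('k::field, 'u) module \<Rightarrow> ('k, 'w) module \<Rightarrow> ('u \<Rightarrow> 'w) \<Rightarrow> bool" where
  "ahom A B f \<longleftrightarrow> f \<in> carrier A \<rightarrow> carrier B \<and>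
     (\<forall>x \<in> carrier A. \<forall>y \<in> carrier A. f (x \<oplus>\<^bsub>A\<^esub> y) = f x \<oplus>\<^bsub>B\<^esub> f y) \<and>
     (\<forall>c. \<forall>x \<in> carrier A. f (c \<odot>\<^bsub>A\<^esub> x) = c \<odot>\<^bsub>B\<^esub> f x) \<and>
     (\<forall>x \<in> carrier A. \<forall>y \<in> carrier A. f (x \<otimes>\<^bsub>A\<^esub> y) = f x \<otimes>\<^bsub>B\<^esub> f y)"

lemma alg_hom_iff: "f \<in> alg_hom A B \<longleftrightarrow> ahom A B f \<and> f \<in> extensional (carrier A)"
  by (auto simp: alg_hom_def ahom_def PiE_def)

lemma ahom_zero:
  assumes "is_algebra A" "is_algebra B" "ahom A B f"
  shows "f \<zero>\<^bsub>A\<^esub> = \<zero>\<^bsub>B\<^esub>"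
proof -
  interpret A: nalg A by (rule nalg.intro) fact
  interpret B: nalg B by (rule nalg.intro) fact
  have "f (0 \<odot>\<^bsub>A\<^esub> \<zero>\<^bsub>A\<^esub>) = 0 \<odot>\<^bsub>B\<^esub> f \<zero>\<^bsub>A\<^esub>"
    using assms(3) A.M.zero_closed unfolding ahom_def by blast
  moreover have "f \<zero>\<^bsub>A\<^esub> \<in> carrier B" using assms(3) by (auto simp: ahom_def)
  ultimately show ?thesis by simp
qed

text \<open>Multiplicativity is left out on purpose: besides homomorphisms, the lemma serves the
  coordinate projections of the truncated tensor product, which are linear but not
  multiplicative.\<close>

lemma linear_finsum:
  assumes "is_algebra A" "is_algebra B" "f \<in> carrier A \<rightarrow> carrier B" "f \<zero>\<^bsub>A\<^esub> = \<zero>\<^bsub>B\<^esub>"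
    and add: "\<And>x y. \<lbrakk>x \<in> carrier A; y \<in> carrier A\<rbrakk> \<Longrightarrow> f (x \<oplus>\<^bsub>A\<^esub> y) = f x \<oplus>\<^bsub>B\<^esub> f y"
    and "finite S" "g \<in> S \<rightarrow> carrier A"
  shows "f (finsum A g S) = finsum B (\<lambda>i. f (g i)) S"
proof -
  interpret A: nalg A by (rule nalg.intro) fact
  interpret B: nalg B by (rule nalg.intro) fact
  show ?thesis using \<open>finite S\<close> \<open>g \<in> S \<rightarrow> carrier A\<close>
  proof (induction S)
    case empty
    then show ?case by (simp add: assms(4))
  next
    case (insert i S)
    then have "g \<in> S \<rightarrow> carrier A" "g i \<in> carrier A" by auto
    moreover have "(\<lambda>i. f (g i)) \<in> S \<rightarrow> carrier B" "f (g i) \<in> carrier B"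
      using insert assms(3) by auto
    ultimately show ?case using insert by (simp add: add)
  qed
qed

lemma ahom_word_value:
  assumes "is_algebra A" "ahom A B f" "range a \<subseteq> carrier A"
  shows "f (word_value A a w) = word_value B (f \<circ> a) w"
proof -
  interpret A: nalg A by (rule nalg.intro) fact
  show ?thesis using assms(2,3) by (induction w) (auto simp: ahom_def)
qed

lemma ahom_poly_value:
  assumes "is_algebra A" "is_algebra B" "ahom A B f" "range a \<subseteq> carrier A"
  shows "f (poly_value A a p) = poly_value B (f \<circ> a) p"
proof -
  interpret A: nalg A by (rule nalg.intro) fact
  interpret B: nalg B by (rule nalg.intro) fact
  have f: "f \<in> carrier A \<rightarrow> carrier B" using assms(3) by (simp add: ahom_def)
  have fa: "range (f \<circ> a) \<subseteq> carrier B" using assms(4) f by auto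
  have "f (poly_value A a p) = (\<Oplus>\<^bsub>B\<^esub>w\<in>Poly_Mapping.keys p. f (Poly_Mapping.lookup p w \<odot>\<^bsub>A\<^esub> word_value A a w))"
    unfolding poly_value_def using assms f
    by (intro linear_finsum ahom_zero) (auto simp: ahom_def)
  also have "\<dots> = poly_value B (f \<circ> a) p"
    unfolding poly_value_def using assms f
    by (intro B.M.finsum_cong') (auto simp: ahom_def ahom_word_value[OF assms(1,3,4)] B.word_value_closed[OF fa])
  finally show ?thesis .
qed

text \<open>A nonzero value of p in A would survive under some f as a value of p in T. In other
  words, identities pass to subdirect products; the factors may live in another type.\<close>

lemma is_identity_separated:
  assumes "is_algebra A"
    and sep: "\<And>x. \<lbrakk>x \<in> carrier A; x \<noteq> \<zero>\<^bsub>A\<^esub>\<rbrakk> \<Longrightarrow>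
      \<exists>(T :: ('k::field, 'w) module) f. is_algebra T \<and> is_identity T p \<and> ahom A T f \<and> f x \<noteq> \<zero>\<^bsub>T\<^esub>"
  shows "is_identity A p"
  unfolding is_identity_def
proof (intro allI impI, rule ccontr)
  interpret A: nalg A by (rule nalg.intro) fact
  fix a :: "nat \<Rightarrow> 'a" assume a: "range a \<subseteq> carrier A" and "poly_value A a p \<noteq> \<zero>\<^bsub>A\<^esub>"
  then obtain T :: "('k, 'w) module" and f where T: "is_algebra T" "is_identity T p" "ahom A T f"
    "f (poly_value A a p) \<noteq> \<zero>\<^bsub>T\<^esub>" using sep[of "poly_value A a p"] by auto
  moreover have "range (f \<circ> a) \<subseteq> carrier T" using a T(3) by (auto simp: ahom_def)
  ultimately show False using a assms(1) by (simp add: ahom_poly_value is_identity_def)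
qed

text \<open>Transport of structure along an injection. It moves test algebras built on product types
  into the universe \<open>'u\<close>.\<close>

definition image_alg :: "('p \<Rightarrow> 'u) \<Rightarrow> ('k::field, 'p) module \<Rightarrow> ('k, 'u) module" where
  "image_alg c A = (let r = inv_into (carrier A) c in
    \<lparr>carrier = c ` carrier A, monoid.mult = (\<lambda>x y. c (r x \<otimes>\<^bsub>A\<^esub> r y)), one = undefined,
     zero = c \<zero>\<^bsub>A\<^esub>, add = (\<lambda>x y. c (r x \<oplus>\<^bsub>A\<^esub> r y)), smult = (\<lambda>k x. c (k \<odot>\<^bsub>A\<^esub> r x))\<rparr>)"

lemma image_alg:
  assumes "is_algebra A" "inj_on c (carrier A)"
  shows is_algebra_image_alg: "is_algebra (image_alg c A)"
    and ahom_image_alg: "ahom A (image_alg c A) c"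
    and ahom_image_alg_inv: "ahom (image_alg c A) A (inv_into (carrier A) c)"
    and carrier_image_alg: "carrier (image_alg c A) = c ` carrier A"
    and zero_image_alg: "\<zero>\<^bsub>image_alg c A\<^esub> = c \<zero>\<^bsub>A\<^esub>"
proof -
  interpret A: nalg A by (rule nalg.intro) fact
  note inv = inv_into_f_f[OF assms(2)]
  have sm: "x \<oplus>\<^bsub>A\<^esub> (-1) \<odot>\<^bsub>A\<^esub> x = \<zero>\<^bsub>A\<^esub>" if "x \<in> carrier A" for x
    using A.sm_minus_one_add[OF that] that by (simp add: A.M.a_comm)
  show "is_algebra (image_alg c A)"
    by (rule is_algebraI)
      (auto simp: image_alg_def Let_def inv A.sm_add_left A.sm_add_right A.sm_sm A.mult_add_left
        A.mult_add_right A.mult_sm_left A.mult_sm_right A.M.a_ac sm)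
  show "ahom A (image_alg c A) c" "carrier (image_alg c A) = c ` carrier A"
    "\<zero>\<^bsub>image_alg c A\<^esub> = c \<zero>\<^bsub>A\<^esub>"
    by (auto simp: ahom_def image_alg_def Let_def inv)
  show "ahom (image_alg c A) A (inv_into (carrier A) c)"
    by (auto simp: ahom_def image_alg_def Let_def inv)
qed

lemma is_identity_image_alg:
  fixes A :: "('k::field, 'b) module"
  assumes "is_algebra A" "inj_on c (carrier A)" "is_identity A p"
  shows "is_identity (image_alg c A) p"
proof (rule is_identity_separated[where 'w = 'b, OF is_algebra_image_alg[OF assms(1,2)]])
  interpret A: nalg A by (rule nalg.intro) fact
  fix x assume x: "x \<in> carrier (image_alg c A)" "x \<noteq> \<zero>\<^bsub>image_alg c A\<^esub>"
  then have "inv_into (carrier A) c x \<noteq> \<zero>\<^bsub>A\<^esub>"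
    using assms by (auto simp: carrier_image_alg zero_image_alg inv_into_f_f)
  then show "\<exists>(T :: ('k, 'b) module) f. is_algebra T \<and> is_identity T p \<and> ahom (image_alg c A) T f \<and> f x \<noteq> \<zero>\<^bsub>T\<^esub>"
    using assms ahom_image_alg_inv[OF assms(1,2)]
    by blast
qed

section \<open>Algebras presented inside the variety\<close>

text \<open>Formal expressions take the place of polynomials: linear combinations need no normal
  form, and a single injection of expressions into \<open>'u\<close> makes room for all the algebras
  presented below.\<close>

datatype ('k, 'g) alg_term = TGen 'g | TZero | TAdd "('k, 'g) alg_term" "('k, 'g) alg_term"
  | TSmul 'k "('k, 'g) alg_term" | TMul "('k, 'g) alg_term" "('k, 'g) alg_term"

primrec term_value :: "('k::field, 'u) module \<Rightarrow> ('g \<Rightarrow> 'u) \<Rightarrow> ('k, 'g) alg_term \<Rightarrow> 'u" where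
  "term_value A a (TGen g) = a g"
| "term_value A a TZero = \<zero>\<^bsub>A\<^esub>"
| "term_value A a (TAdd s t) = term_value A a s \<oplus>\<^bsub>A\<^esub> term_value A a t"
| "term_value A a (TSmul c t) = c \<odot>\<^bsub>A\<^esub> term_value A a t"
| "term_value A a (TMul s t) = term_value A a s \<otimes>\<^bsub>A\<^esub> term_value A a t"

lemma (in nalg) term_value_closed [simp]: "range a \<subseteq> carrier A \<Longrightarrow> term_value A a t \<in> carrier A"
  by (induction t) auto

text \<open>An infinite set absorbs its square, which yields a pairing function \<open>p\<close>.
  With distinct tags for the five constructors and the embedding of the scalars, a term is coded by
  recursion in the style of a Goedel numbering.\<close>

lemma ex_inj_alg_term:
  assumes "infinite (UNIV :: 'u set)" "inj (ck :: 'k \<Rightarrow> 'u)"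
  shows "\<exists>c :: ('k, nat \<times> 'u) alg_term \<Rightarrow> 'u. inj c"
proof -
  obtain tag :: "nat \<Rightarrow> 'u" where tag: "inj tag"
    using infinite_countable_subset[OF assms(1)] by auto
  have "|UNIV \<times> UNIV :: ('u \<times> 'u) set| \<le>o |UNIV :: 'u set|"
    using card_of_Times_same_infinite[OF assms(1)] ordIso_iff_ordLeq by blast
  then obtain p :: "'u \<times> 'u \<Rightarrow> 'u" where p: "inj p"
    unfolding card_of_ordLeq[symmetric] by auto
  define c :: "('k, nat \<times> 'u) alg_term \<Rightarrow> 'u" where
    "c = rec_alg_term (\<lambda>g. p (tag 0, p (tag (fst g), snd g))) (p (tag 1, tag 0))
      (\<lambda>s t x y. p (tag 2, p (x, y))) (\<lambda>k t x. p (tag 3, p (ck k, x))) (\<lambda>s t x y. p (tag 4, p (x, y)))"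
  have "c s = c t \<Longrightarrow> s = t" for s t
  proof (induction s arbitrary: t)
    case (TGen g)
    then show ?case by (cases t) (auto simp: c_def inj_eq[OF p] inj_eq[OF tag] prod_eq_iff)
  next
    case TZero
    then show ?case by (cases t) (auto simp: c_def inj_eq[OF p] inj_eq[OF tag])
  next
    case (TAdd s1 s2)
    then show ?case by (cases t) (auto simp: c_def inj_eq[OF p] inj_eq[OF tag])
  next
    case (TSmul k s)
    then show ?case by (cases t) (auto simp: c_def inj_eq[OF p] inj_eq[OF tag] inj_eq[OF assms(2)])
  next
    case (TMul s1 s2)
    then show ?case by (cases t) (auto simp: c_def inj_eq[OF p] inj_eq[OF tag])
  qed
  then show ?thesis by (auto simp: inj_def)
qed

context nalg
begin

lemma add_assoc: "\<lbrakk>x \<in> carrier A; y \<in> carrier A; z \<in> carrier A\<rbrakk> \<Longrightarrow> (x \<oplus> y) \<oplus> z = x \<oplus> (y \<oplus> z)"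
  by (rule M.a_assoc)

lemma add_comm: "\<lbrakk>x \<in> carrier A; y \<in> carrier A\<rbrakk> \<Longrightarrow> x \<oplus> y = y \<oplus> x"
  by (rule M.a_comm)

lemma zero_add: "x \<in> carrier A \<Longrightarrow> \<zero> \<oplus> x = x"
  by (rule M.l_zero)

end

text \<open>The generators \<open>nat \<times> 'u\<close> are chosen for coproducts and products:
  the number is the index of the summand or factor, the second component an element of it.\<close>

locale nvariety =
  fixes I :: "'k::field napoly set" and V :: "('k, 'u) module set" and code :: "('k, nat \<times> 'u) alg_term \<Rightarrow> 'u"
  assumes V_eq: "V = variety I" and homog: "\<And>p. p \<in> I \<Longrightarrow> homogeneous p" and inj_code: "inj code"
begin

lemma V_alg: "A \<in> V \<Longrightarrow> is_algebra A"
  by (simp add: V_eq variety_def)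

lemma V_nalg: "A \<in> V \<Longrightarrow> nalg A"
  by (simp add: V_alg nalg.intro)

lemma in_V_if_separated:
  assumes "is_algebra A"
    and "\<And>x. \<lbrakk>x \<in> carrier A; x \<noteq> \<zero>\<^bsub>A\<^esub>\<rbrakk> \<Longrightarrow> \<exists>T\<in>V. \<exists>f. ahom A T f \<and> f x \<noteq> \<zero>\<^bsub>T\<^esub>"
  shows "A \<in> V"
proof -
  have "is_identity A p" if "p \<in> I" for p
    using assms(2) that by (intro is_identity_separated[where 'w = 'u, OF assms(1)]) (fastforce simp: V_eq variety_def)
  then show ?thesis using assms(1) by (simp add: V_eq variety_def)
qed

definition term_eq where
  "term_eq F s t \<longleftrightarrow> (\<forall>(T :: ('k, 'u) module, a) \<in> F. term_value T a s = term_value T a t)"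

text \<open>Since \<open>code\<close> is injective, a congruence class of terms is represented by the code of a
  chosen member, an element of the given carrier type \<open>'u\<close>.\<close>

definition pq :: "(('k, 'u) module \<times> (nat \<times> 'u \<Rightarrow> 'u)) set \<Rightarrow> ('k, nat \<times> 'u) alg_term \<Rightarrow> 'u" where
  "pq F t = code (SOME s. term_eq F t s)"

definition pr where "pr F x = (SOME t. pq F t = x)"

text \<open>The image of the term algebra in the product of the evaluations listed in \<open>F\<close>.\<close>

definition palg :: "(('k, 'u) module \<times> (nat \<times> 'u \<Rightarrow> 'u)) set \<Rightarrow> ('k, 'u) module" where
  "palg F = \<lparr>carrier = range (pq F), monoid.mult = (\<lambda>x y. pq F (TMul (pr F x) (pr F y))),
     one = undefined, zero = pq F TZero, add = (\<lambda>x y. pq F (TAdd (pr F x) (pr F y))),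
     smult = (\<lambda>c x. pq F (TSmul c (pr F x)))\<rparr>"

definition admissible where
  "admissible F \<longleftrightarrow> (\<forall>(T, a) \<in> F. T \<in> V \<and> range a \<subseteq> carrier T)"

lemma pq_eq_iff: "pq F s = pq F t \<longleftrightarrow> term_eq F s t"
proof
  have ex: "term_eq F t (SOME s. term_eq F t s)" for t by (rule someI[of "term_eq F t" t]) (auto simp: term_eq_def)
  assume "pq F s = pq F t"
  then have "(SOME r. term_eq F s r) = (SOME r. term_eq F t r)" using inj_code by (simp add: pq_def inj_eq)
  then show "term_eq F s t" using ex[of s] ex[of t] by (fastforce simp: term_eq_def)
next
  assume "term_eq F s t"
  then have "term_eq F s = term_eq F t" by (fastforce simp: term_eq_def fun_eq_iff)
  then show "pq F s = pq F t" by (simp add: pq_def)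
qed

lemma pq_pr: "term_eq F (pr F (pq F t)) t"
  unfolding pq_eq_iff[symmetric] pr_def by (rule someI) simp

lemma term_value_pr [simp]: "(T, a) \<in> F \<Longrightarrow> term_value T a (pr F (pq F t)) = term_value T a t"
  using pq_pr[of F t] by (auto simp: term_eq_def)

lemma carrier_palg: "carrier (palg F) = range (pq F)"
  by (simp add: palg_def)

lemma pq_ops:
  "pq F s \<oplus>\<^bsub>palg F\<^esub> pq F t = pq F (TAdd s t)"
  "pq F s \<otimes>\<^bsub>palg F\<^esub> pq F t = pq F (TMul s t)"
  "c \<odot>\<^bsub>palg F\<^esub> pq F t = pq F (TSmul c t)"
  "\<zero>\<^bsub>palg F\<^esub> = pq F TZero"
  using pq_pr[of F s] pq_pr[of F t] by (fastforce simp: palg_def pq_eq_iff term_eq_def)+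

text \<open>Two classes agree as soon as all evaluations in \<open>F\<close> agree, so each axiom
  follows from the same axiom in the algebras that occur in \<open>F\<close>.\<close>

lemma is_algebra_palg:
  assumes "admissible F"
  shows "is_algebra (palg F)"
proof -
  have tv: "term_value T a t \<in> carrier T" if "(T, a) \<in> F" for T a t
    using assms that nalg.term_value_closed[OF V_nalg] by (fastforce simp: admissible_def)
  have na: "nalg T" if "(T, a) \<in> F" for T a
    using assms that V_nalg by (fastforce simp: admissible_def)
  note ops = nalg.add_assoc[OF na tv tv tv] nalg.add_comm[OF na tv tv] nalg.zero_add[OF na tv]
    nalg.sm_add_left[OF na tv] nalg.sm_add_right[OF na tv tv]
    nalg.sm_sm[OF na tv] nalg.mult_add_left[OF na tv tv tv] nalg.mult_add_right[OF na tv tv tv]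
    nalg.mult_sm_left[OF na tv tv] nalg.mult_sm_right[OF na tv tv] nalg.sm_one[OF na tv]
    nalg.sm_minus_one_add[OF na tv]
  have eq: "pq F s = pq F t" if "\<And>T a. (T, a) \<in> F \<Longrightarrow> term_value T a s = term_value T a t" for s t
    using that by (auto simp: pq_eq_iff term_eq_def)
  show ?thesis
    \<comment> \<open>Elements are replaced by classes of terms. What remains is either membership
      in the range or an equation of classes, which \<open>eq\<close> turns into one of the facts
      \<open>ops\<close>, read in one of the two directions.\<close>
    by (rule is_algebraI; simp only: carrier_palg; (elim rangeE)?; (hypsubst)?; (simp only: pq_ops)?;
        (rule rangeI | (rule eq, simp only: term_value.simps, (rule ops; assumption))
          | (rule eq, simp only: term_value.simps, (rule ops[symmetric]; assumption))))
qed

definition pev where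
  "pev F T a = (\<lambda>x \<in> carrier (palg F). term_value T a (pr F x))"

lemma pev_pq: "(T, a) \<in> F \<Longrightarrow> pev F T a (pq F t) = term_value T a t"
  by (simp add: pev_def carrier_palg)

lemma pev_hom: "\<lbrakk>admissible F; (T, a) \<in> F\<rbrakk> \<Longrightarrow> pev F T a \<in> alg_hom (palg F) T"
  unfolding alg_hom_iff ahom_def
  using nalg.term_value_closed[OF V_nalg, of T a]
  by (auto simp: carrier_palg pq_ops pev_pq admissible_def) (auto simp: pev_def carrier_palg)

text \<open>Distinct classes are by construction separated by some evaluation, and evaluations are
  homomorphisms to members of \<open>V\<close>: the quotient is a subdirect product of
  members.\<close>

lemma palg_in_V:
  assumes "admissible F"
  shows "palg F \<in> V"
proof (rule in_V_if_separated[OF is_algebra_palg[OF assms]])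
  fix x assume "x \<in> carrier (palg F)" "x \<noteq> \<zero>\<^bsub>palg F\<^esub>"
  then obtain t where t: "x = pq F t" "pq F t \<noteq> pq F TZero" by (auto simp: carrier_palg pq_ops)
  then obtain T a where "(T, a) \<in> F" "term_value T a t \<noteq> \<zero>\<^bsub>T\<^esub>" by (auto simp: pq_eq_iff term_eq_def)
  then show "\<exists>T\<in>V. \<exists>f. ahom (palg F) T f \<and> f x \<noteq> \<zero>\<^bsub>T\<^esub>"
    using assms pev_hom[OF assms, of T a] t pev_pq[of T a F t]
    by (auto simp: admissible_def alg_hom_iff intro!: bexI[of _ T] exI[of _ "pev F T a"])
qed

lemma pq_in [simp]: "pq F t \<in> carrier (palg F)"
  by (simp add: carrier_palg)

lemma palg_induct:
  assumes "x \<in> carrier (palg F)"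
    and "\<And>g. P (pq F (TGen g))" "P \<zero>\<^bsub>palg F\<^esub>"
    and "\<And>x y. \<lbrakk>x \<in> carrier (palg F); y \<in> carrier (palg F); P x; P y\<rbrakk> \<Longrightarrow> P (x \<oplus>\<^bsub>palg F\<^esub> y)"
    and "\<And>c x. \<lbrakk>x \<in> carrier (palg F); P x\<rbrakk> \<Longrightarrow> P (c \<odot>\<^bsub>palg F\<^esub> x)"
    and "\<And>x y. \<lbrakk>x \<in> carrier (palg F); y \<in> carrier (palg F); P x; P y\<rbrakk> \<Longrightarrow> P (x \<otimes>\<^bsub>palg F\<^esub> y)"
  shows "P x"
proof -
  have "P (pq F t)" for t
    using assms(2-) by (induction t) (simp_all flip: pq_ops)
  then show ?thesis using assms(1) by (auto simp: carrier_palg)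
qed

section \<open>Coproducts, products and kernels\<close>

text \<open>A pair \<open>(T, a)\<close> is a cocone: \<open>a\<close> restricts to a homomorphism
  on each summand. Dividing terms by the relations common to all cocones gives the coproduct.
  Generators that name no element of a summand are sent to zero by every cocone, hence vanish in the
  quotient.\<close>

definition copF :: "('k, 'u) module list \<Rightarrow> (('k, 'u) module \<times> (nat \<times> 'u \<Rightarrow> 'u)) set" where
  "copF Xs = {(T, a). T \<in> V \<and> range a \<subseteq> carrier T \<and>
     (\<forall>m x. \<not> (m < length Xs \<and> x \<in> carrier (Xs ! m)) \<longrightarrow> a (m, x) = \<zero>\<^bsub>T\<^esub>) \<and>
     (\<forall>m < length Xs. ahom (Xs ! m) T (\<lambda>x. a (m, x)))}"

definition copS where "copS Xs = palg (copF Xs)"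

definition copI where "copI Xs m = (\<lambda>x \<in> carrier (Xs ! m). pq (copF Xs) (TGen (m, x)))"

lemma admissible_copF: "admissible (copF Xs)"
  by (auto simp: admissible_def copF_def)

lemma copS_in_V [simp]: "copS Xs \<in> V"
  unfolding copS_def by (rule palg_in_V[OF admissible_copF])

lemma copI_hom: "\<lbrakk>m < length Xs; Xs ! m \<in> V\<rbrakk> \<Longrightarrow> copI Xs m \<in> alg_hom (Xs ! m) (copS Xs)"
proof -
  assume m: "m < length Xs" "Xs ! m \<in> V"
  interpret X: nalg "Xs ! m" using m by (intro V_nalg)
  show ?thesis unfolding alg_hom_iff ahom_def
    by (auto simp: copI_def copS_def pq_ops pq_eq_iff term_eq_def copF_def m) (auto simp: ahom_def m)
qed

lemma copS_induct [consumes 1, case_names inj zero add smult mult]: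
  assumes "x \<in> carrier (copS Xs)"
    and "\<And>m y. \<lbrakk>m < length Xs; y \<in> carrier (Xs ! m)\<rbrakk> \<Longrightarrow> P (copI Xs m y)" "P \<zero>\<^bsub>copS Xs\<^esub>"
    and "\<And>x y. \<lbrakk>x \<in> carrier (copS Xs); y \<in> carrier (copS Xs); P x; P y\<rbrakk> \<Longrightarrow> P (x \<oplus>\<^bsub>copS Xs\<^esub> y)"
    and "\<And>c x. \<lbrakk>x \<in> carrier (copS Xs); P x\<rbrakk> \<Longrightarrow> P (c \<odot>\<^bsub>copS Xs\<^esub> x)"
    and "\<And>x y. \<lbrakk>x \<in> carrier (copS Xs); y \<in> carrier (copS Xs); P x; P y\<rbrakk> \<Longrightarrow> P (x \<otimes>\<^bsub>copS Xs\<^esub> y)"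
  shows "P x"
proof -
  have "P (pq (copF Xs) (TGen g))" for g
  proof (cases "fst g < length Xs \<and> snd g \<in> carrier (Xs ! fst g)")
    case True
    then show ?thesis using assms(2)[of "fst g" "snd g"] by (simp add: copI_def)
  next
    case False
    then have "pq (copF Xs) (TGen g) = \<zero>\<^bsub>copS Xs\<^esub>"
      unfolding copS_def pq_ops pq_eq_iff term_eq_def copF_def by (cases g) auto
    then show ?thesis using assms(3) by simp
  qed
  then show ?thesis using palg_induct[of x "copF Xs" P] assms unfolding copS_def by blast
qed

end

lemma map_map_upt_eq_iff:
  "length fs = n \<Longrightarrow> map f (map g [0..<n]) = fs \<longleftrightarrow> (\<forall>m<n. f (g m) = fs ! m)"
  by (auto simp: list_eq_iff_nth_eq)

lemma ahom_add: "\<lbrakk>ahom A B f; x \<in> carrier A; y \<in> carrier A\<rbrakk> \<Longrightarrow> f (x \<oplus>\<^bsub>A\<^esub> y) = f x \<oplus>\<^bsub>B\<^esub> f y"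
  and ahom_smult: "\<lbrakk>ahom A B f; x \<in> carrier A\<rbrakk> \<Longrightarrow> f (c \<odot>\<^bsub>A\<^esub> x) = c \<odot>\<^bsub>B\<^esub> f x"
  and ahom_mult: "\<lbrakk>ahom A B f; x \<in> carrier A; y \<in> carrier A\<rbrakk> \<Longrightarrow> f (x \<otimes>\<^bsub>A\<^esub> y) = f x \<otimes>\<^bsub>B\<^esub> f y"
  and ahom_closed: "\<lbrakk>ahom A B f; x \<in> carrier A\<rbrakk> \<Longrightarrow> f x \<in> carrier B"
  by (auto simp: ahom_def)

lemma ahom_comp: "\<lbrakk>ahom A B f; ahom B D g\<rbrakk> \<Longrightarrow> ahom A D (\<lambda>x. g (f x))"
  unfolding ahom_def by (simp add: Pi_iff)

lemma alg_hom_closed: "\<lbrakk>f \<in> alg_hom A B; x \<in> carrier A\<rbrakk> \<Longrightarrow> f x \<in> carrier B"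
  by (auto simp: alg_hom_def)

lemma alg_hom_ahom: "f \<in> alg_hom A B \<Longrightarrow> ahom A B f"
  by (simp add: alg_hom_iff)

context nvariety
begin

lemma copS_universal:
  assumes "T \<in> V" and X: "\<And>m. m < length Xs \<Longrightarrow> Xs ! m \<in> V"
    and fs: "\<And>m. m < length Xs \<Longrightarrow> fs m \<in> alg_hom (Xs ! m) T"
  shows "\<exists>h \<in> alg_hom (copS Xs) T. \<forall>m<length Xs. \<forall>x\<in>carrier (Xs ! m). h (copI Xs m x) = fs m x"
proof -
  interpret T: nalg T using assms(1) by (rule V_nalg)
  define a where "a = (\<lambda>(m, x). if m < length Xs \<and> x \<in> carrier (Xs ! m) then fs m x else \<zero>\<^bsub>T\<^esub>)"
  have "ahom (Xs ! m) T (\<lambda>x. a (m, x))" if m: "m < length Xs" for m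
  proof -
    interpret X: nalg "Xs ! m" using X[OF m] by (rule V_nalg)
    show ?thesis using fs[OF m] m by (auto simp: alg_hom_iff ahom_def a_def)
  qed
  moreover have "range a \<subseteq> carrier T"
    by (auto simp: a_def alg_hom_closed[OF fs])
  ultimately have a: "(T, a) \<in> copF Xs" using assms(1) by (auto simp: copF_def a_def)
  show ?thesis
    by (rule bexI[OF _ pev_hom[OF admissible_copF a, folded copS_def]])
      (auto simp: copI_def pev_pq[OF a], simp add: a_def)
qed

lemma copS_hom_unique:
  assumes "is_algebra T" "ahom (copS Xs) T f" "ahom (copS Xs) T g"
    and "\<And>m x. \<lbrakk>m < length Xs; x \<in> carrier (Xs ! m)\<rbrakk> \<Longrightarrow> f (copI Xs m x) = g (copI Xs m x)"
    and "x \<in> carrier (copS Xs)"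
  shows "f x = g x"
  using assms(5)
  by (induction rule: copS_induct)
    (simp_all add: assms(4) ahom_zero[OF V_alg[OF copS_in_V] assms(1)] assms(2,3)
      ahom_add[OF assms(2)] ahom_add[OF assms(3)] ahom_smult[OF assms(2)] ahom_smult[OF assms(3)]
      ahom_mult[OF assms(2)] ahom_mult[OF assms(3)])

abbreviation C where "C \<equiv> alg_category V"

lemma cat_simps [simp]:
  "Obj C = V" "Dom C (A, B, f) = A" "Cod C (A, B, f) = B" "ident C A = (A, A, \<lambda>x\<in>carrier A. x)"
  "Comp C (B', D, g) (A, B, f) = (A, D, compose (carrier A) g f)"
  "(A, B, f) \<in> Arr C \<longleftrightarrow> A \<in> V \<and> B \<in> V \<and> f \<in> alg_hom A B"
  by (simp_all add: alg_category_def)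

lemma in_homset: "h \<in> homset C A B \<longleftrightarrow> (\<exists>f. h = (A, B, f) \<and> A \<in> V \<and> B \<in> V \<and> f \<in> alg_hom A B)"
  by (cases h) (auto simp: homset_def)

lemma alg_hom_ext: "\<lbrakk>f \<in> alg_hom A B; g \<in> alg_hom A B'; \<And>x. x \<in> carrier A \<Longrightarrow> f x = g x\<rbrakk> \<Longrightarrow> f = g"
  unfolding alg_hom_iff by (blast intro: extensionalityI)

lemma restrict_alg_hom: "is_algebra A \<Longrightarrow> ahom A B f \<Longrightarrow> (\<lambda>x\<in>carrier A. f x) \<in> alg_hom A B"
  using nalg.sm_closed[OF nalg.intro, of A] nalg.mult_closed[OF nalg.intro, of A]
    abelian_monoid.a_closed[OF abelian_group.axioms(1)[OF module.axioms(2)], of field_ring A]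
  by (auto simp: alg_hom_iff ahom_def is_algebra_def)

lemma compose_alg_hom: "\<lbrakk>is_algebra A; f \<in> alg_hom A B; g \<in> alg_hom B D\<rbrakk> \<Longrightarrow> compose (carrier A) g f \<in> alg_hom A D"
  unfolding compose_def by (rule restrict_alg_hom) (auto simp: alg_hom_iff intro: ahom_comp)

definition copArr where "copArr Xs m = (Xs ! m, copS Xs, copI Xs m)"

lemma is_coproduct_copS:
  assumes "set Xs \<subseteq> V"
  shows "is_coproduct C Xs (copS Xs) (map (copArr Xs) [0..<length Xs])"
proof -
  have X: "Xs ! m \<in> V" if "m < length Xs" for m using assms that by (meson nth_mem subsetD)
  show ?thesis unfolding is_coproduct_def
  proof (intro conjI ballI allI impI)
    show "list_all2 (\<lambda>X i. i \<in> homset C X (copS Xs)) Xs (map (copArr Xs) [0..<length Xs])"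
      by (auto simp: list_all2_conv_all_nth in_homset copArr_def X copI_hom)
    fix T fs assume T: "T \<in> Obj C" and "list_all2 (\<lambda>X f. f \<in> homset C X T) Xs fs"
    then have len: "length fs = length Xs" and f: "\<And>m. m < length Xs \<Longrightarrow> fs ! m \<in> homset C (Xs ! m) T"
      by (auto simp: list_all2_conv_all_nth)
    define gs where "gs m = snd (snd (fs ! m))" for m
    have fs: "fs ! m = (Xs ! m, T, gs m)" "gs m \<in> alg_hom (Xs ! m) T" if "m < length Xs" for m
      using f[OF that] by (auto simp: in_homset gs_def)
    have *: "map (\<lambda>i. Comp C (copS Xs, T, h) i) (map (copArr Xs) [0..<length Xs]) = fs \<longleftrightarrow>
       (\<forall>m<length Xs. \<forall>x\<in>carrier (Xs ! m). h (copI Xs m x) = gs m x)" if h: "h \<in> alg_hom (copS Xs) T" for h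
    proof -
      have "map (\<lambda>i. Comp C (copS Xs, T, h) i) (map (copArr Xs) [0..<length Xs]) = fs \<longleftrightarrow>
        (\<forall>m<length Xs. compose (carrier (Xs ! m)) h (copI Xs m) = gs m)"
      proof -
        have "map (\<lambda>i. Comp C (copS Xs, T, h) i) (map (copArr Xs) [0..<length Xs]) = fs \<longleftrightarrow>
          (\<forall>m<length Xs. Comp C (copS Xs, T, h) (copArr Xs m) = fs ! m)"
          by (rule map_map_upt_eq_iff[OF len])
        also have "\<dots> \<longleftrightarrow> (\<forall>m<length Xs. compose (carrier (Xs ! m)) h (copI Xs m) = gs m)"
          by (rule all_cong) (simp add: fs(1) copArr_def)
        finally show ?thesis .
      qed
      also have "\<dots> \<longleftrightarrow> (\<forall>m<length Xs. \<forall>x\<in>carrier (Xs ! m). h (copI Xs m x) = gs m x)"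
      proof (intro all_cong iffI)
        fix m assume m: "m < length Xs"
        show "compose (carrier (Xs ! m)) h (copI Xs m) = gs m"
          if "\<forall>x\<in>carrier (Xs ! m). h (copI Xs m x) = gs m x"
          by (rule alg_hom_ext[OF compose_alg_hom[OF V_alg[OF X[OF m]] copI_hom[OF m X[OF m]] h] fs(2)[OF m]])
            (simp add: compose_def that)
      qed (metis compose_eq)
      finally show ?thesis .
    qed
    obtain h where h: "h \<in> alg_hom (copS Xs) T" "\<forall>m<length Xs. \<forall>x\<in>carrier (Xs ! m). h (copI Xs m x) = gs m x"
      using copS_universal[of T Xs gs] T X fs(2) by auto
    show "\<exists>!h. h \<in> homset C (copS Xs) T \<and> map (\<lambda>i. Comp C h i) (map (copArr Xs) [0..<length Xs]) = fs"
    proof (rule ex1I[of _ "(copS Xs, T, h)"])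
      show "(copS Xs, T, h) \<in> homset C (copS Xs) T \<and>
          map (\<lambda>i. Comp C (copS Xs, T, h) i) (map (copArr Xs) [0..<length Xs]) = fs"
        unfolding *[OF h(1)] in_homset using h T copS_in_V by simp
      fix h' assume h': "h' \<in> homset C (copS Xs) T \<and> map (\<lambda>i. Comp C h' i) (map (copArr Xs) [0..<length Xs]) = fs"
      then obtain g where g: "h' = (copS Xs, T, g)" "g \<in> alg_hom (copS Xs) T" by (auto simp: in_homset)
      then have "\<forall>m<length Xs. \<forall>x\<in>carrier (Xs ! m). g (copI Xs m x) = gs m x"
        using h' *[OF g(2)] by simp
      then have *: "\<And>m x. \<lbrakk>m < length Xs; x \<in> carrier (Xs ! m)\<rbrakk> \<Longrightarrow> g (copI Xs m x) = h (copI Xs m x)"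
        using h(2) by simp
      have "T \<in> V" using T by simp
      then have "g = h"
        using copS_hom_unique[of T Xs g h] alg_hom_ahom[OF g(2)] alg_hom_ahom[OF h(1)] * V_alg
        by (intro alg_hom_ext[OF g(2) h(1)]) blast
      then show "h' = (copS Xs, T, h)" using g by simp
    qed
  qed simp
qed

text \<open>With no evaluation to tell terms apart, all of them are identified.\<close>

definition zero_alg where "zero_alg = palg {}"

lemma zero_alg: "zero_alg \<in> V" "carrier zero_alg = {\<zero>\<^bsub>zero_alg\<^esub>}"
proof -
  show "zero_alg \<in> V" unfolding zero_alg_def by (rule palg_in_V) (simp add: admissible_def)
  show "carrier zero_alg = {\<zero>\<^bsub>zero_alg\<^esub>}" unfolding zero_alg_def by (auto simp: carrier_palg pq_ops pq_eq_iff term_eq_def)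
qed

definition zero_map :: "('k, 'u) module \<Rightarrow> ('k, 'u) module \<Rightarrow> 'u \<Rightarrow> 'u" where
  "zero_map A B = (\<lambda>x\<in>carrier A. \<zero>\<^bsub>B\<^esub>)"

lemma zero_map_hom: "\<lbrakk>A \<in> V; B \<in> V\<rbrakk> \<Longrightarrow> zero_map A B \<in> alg_hom A B"
proof -
  assume "A \<in> V" "B \<in> V"
  then interpret A: nalg A + B: nalg B by (auto intro: V_nalg)
  show ?thesis by (auto simp: zero_map_def alg_hom_iff ahom_def)
qed

lemma hom_from_zero:
  assumes "Z \<in> V" "A \<in> V" "carrier Z = {\<zero>\<^bsub>Z\<^esub>}" "f \<in> alg_hom Z A"
  shows "f = zero_map Z A"
  using assms ahom_zero[of Z A f] V_alg
  by (intro alg_hom_ext[OF assms(4) zero_map_hom]) (auto simp: zero_map_def alg_hom_iff)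

lemma hom_to_zero:
  assumes "Z \<in> V" "A \<in> V" "carrier Z = {\<zero>\<^bsub>Z\<^esub>}" "f \<in> alg_hom A Z"
  shows "f = zero_map A Z"
proof (intro alg_hom_ext[OF assms(4) zero_map_hom])
  fix x assume x: "x \<in> carrier A"
  then have "f x \<in> carrier Z" using assms(4) by (auto simp: alg_hom_def)
  then show "f x = zero_map A Z x" using assms(3) x by (simp add: zero_map_def)
qed (use assms in auto)

lemma is_zero_zero_alg: "is_zero_object C zero_alg"
  unfolding is_zero_object_def
proof (intro conjI ballI)
  fix A assume "A \<in> Obj C"
  then have A: "A \<in> V" by simp
  show "\<exists>!f. f \<in> homset C zero_alg A"
  proof (rule ex1I)
    show "(zero_alg, A, zero_map zero_alg A) \<in> homset C zero_alg A"
      unfolding in_homset using zero_map_hom[OF zero_alg(1) A] A zero_alg(1) by blast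
  qed (use hom_from_zero[OF zero_alg(1) A zero_alg(2)] in \<open>unfold in_homset, blast\<close>)
  show "\<exists>!f. f \<in> homset C A zero_alg"
  proof (rule ex1I)
    show "(A, zero_alg, zero_map A zero_alg) \<in> homset C A zero_alg"
      unfolding in_homset using zero_map_hom[OF A zero_alg(1)] A zero_alg(1) by blast
  qed (use hom_to_zero[OF zero_alg(1) A zero_alg(2)] in \<open>unfold in_homset, blast\<close>)
qed (simp add: zero_alg)

text \<open>The zero map and the identity are both endomorphisms of a zero object, so they
  coincide.\<close>

lemma zero_object_carrier:
  assumes "is_zero_object C Z"
  shows "Z \<in> V" "carrier Z = {\<zero>\<^bsub>Z\<^esub>}"
proof -
  show Z: "Z \<in> V" using assms by (simp add: is_zero_object_def)
  interpret Z: nalg Z using Z by (rule V_nalg)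
  have "\<exists>!f. f \<in> homset C Z Z" using assms Z by (simp add: is_zero_object_def)
  moreover have "(Z, Z, zero_map Z Z) \<in> homset C Z Z" using zero_map_hom[OF Z Z] Z by (simp add: in_homset)
  moreover have "(Z, Z, \<lambda>x\<in>carrier Z. x) \<in> homset C Z Z"
    using restrict_alg_hom[OF V_alg[OF Z], of Z "\<lambda>x. x"] Z by (simp add: in_homset ahom_def)
  ultimately have "zero_map Z Z = (\<lambda>x\<in>carrier Z. x)" by blast
  then have "\<zero>\<^bsub>Z\<^esub> = x" if "x \<in> carrier Z" for x
    using that by (metis zero_map_def restrict_apply')
  then show "carrier Z = {\<zero>\<^bsub>Z\<^esub>}" by auto
qed

text \<open>The definite description ranges over all zero objects. Each of them has a one-element
  carrier, so every such composite is the zero map.\<close>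

lemma zero_arr_eq:
  assumes "A \<in> V" "B \<in> V"
  shows "zero_arr C A B = (A, B, zero_map A B)"
  unfolding zero_arr_def
proof (rule the_equality)
  have *: "Comp C (Z, B, zero_map Z B) (A, Z, zero_map A Z) = (A, B, zero_map A B)" if "Z \<in> V" for Z
  proof -
    interpret Z: nalg Z using that by (rule V_nalg)
    show ?thesis by (auto simp: compose_def zero_map_def fun_eq_iff)
  qed
  show "\<exists>Z. is_zero_object C Z \<and> (\<exists>a\<in>homset C A Z. \<exists>b\<in>homset C Z B. (A, B, zero_map A B) = Comp C b a)"
  proof (intro exI[of _ zero_alg] conjI bexI)
    show "(A, B, zero_map A B) = Comp C (zero_alg, B, zero_map zero_alg B) (A, zero_alg, zero_map A zero_alg)"
      by (rule *[OF zero_alg(1), symmetric])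
    show "(A, zero_alg, zero_map A zero_alg) \<in> homset C A zero_alg" "(zero_alg, B, zero_map zero_alg B) \<in> homset C zero_alg B"
      unfolding in_homset using zero_map_hom[OF assms(1) zero_alg(1)] zero_map_hom[OF zero_alg(1) assms(2)] assms zero_alg(1) by blast+
  qed (rule is_zero_zero_alg)
  fix f assume "\<exists>Z. is_zero_object C Z \<and> (\<exists>a\<in>homset C A Z. \<exists>b\<in>homset C Z B. f = Comp C b a)"
  then obtain Z a b where Z: "is_zero_object C Z" and ab: "a \<in> homset C A Z" "b \<in> homset C Z B" "f = Comp C b a"
    by auto
  note Z' = zero_object_carrier[OF Z]
  have "a = (A, Z, zero_map A Z)" using hom_to_zero[OF Z'(1) assms(1) Z'(2)] ab(1) unfolding in_homset by blast
  moreover have "b = (Z, B, zero_map Z B)" using hom_from_zero[OF Z'(1) assms(2) Z'(2)] ab(2) unfolding in_homset by blast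
  ultimately show "f = (A, B, zero_map A B)" using * Z'(1) ab(3) by simp
qed

text \<open>The generator \<open>(n, x)\<close> stands for the tuple with x in coordinate n and zero
  elsewhere, and each coordinate gives one evaluation. A tuple is then the class of a finite sum of
  generators, which is what \<open>product_term\<close> writes down.\<close>

definition product_eval :: "('k, 'u) module list \<Rightarrow> nat \<Rightarrow> nat \<times> 'u \<Rightarrow> 'u" where
  "product_eval Xs m = (\<lambda>(n, x). if n = m \<and> x \<in> carrier (Xs ! m) then x else \<zero>\<^bsub>Xs ! m\<^esub>)"

definition product_rel :: "('k, 'u) module list \<Rightarrow> (('k, 'u) module \<times> (nat \<times> 'u \<Rightarrow> 'u)) set" where
  "product_rel Xs = {(Xs ! m, product_eval Xs m) |m. m < length Xs}"

definition product_proj where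
  "product_proj Xs m = pev (product_rel Xs) (Xs ! m) (product_eval Xs m)"

definition product_alg where "product_alg Xs = palg (product_rel Xs)"

primrec product_term :: "(nat \<Rightarrow> 'u) \<Rightarrow> nat \<Rightarrow> ('k, nat \<times> 'u) alg_term" where
  "product_term f 0 = TZero"
| "product_term f (Suc n) = TAdd (product_term f n) (TGen (n, f n))"

lemma admissible_product_rel:
  assumes "set Xs \<subseteq> V"
  shows "admissible (product_rel Xs)"
  unfolding admissible_def product_rel_def
proof (clarsimp, goal_cases)
  case (1 m)
  then have X: "Xs ! m \<in> V" using assms by (meson nth_mem subsetD)
  then interpret X: nalg "Xs ! m" by (rule V_nalg)
  show ?case using X by (auto simp: product_eval_def)
qed

lemma product_proj_product_term:
  assumes "set Xs \<subseteq> V" "m < length Xs" "\<And>m. m < length Xs \<Longrightarrow> f m \<in> carrier (Xs ! m)" "n \<le> length Xs"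
  shows "product_proj Xs m (pq (product_rel Xs) (product_term f n)) = (if m < n then f m else \<zero>\<^bsub>Xs ! m\<^esub>)"
proof -
  have "Xs ! m \<in> V" using assms by (meson nth_mem subsetD)
  then interpret X: nalg "Xs ! m" by (rule V_nalg)
  let ?a = "product_eval Xs m"
  have "product_proj Xs m (pq (product_rel Xs) (product_term f n)) = term_value (Xs ! m) ?a (product_term f n)"
    unfolding product_proj_def by (rule pev_pq) (use assms(2) in \<open>auto simp: product_rel_def\<close>)
  also have "\<dots> = (if m < n then f m else \<zero>\<^bsub>Xs ! m\<^esub>)"
    using assms(3,4) assms(2) by (induction n) (auto simp: less_Suc_eq product_eval_def)
  finally show ?thesis .
qed

lemma product_proj_hom:
  assumes "set Xs \<subseteq> V" "m < length Xs"
  shows "product_proj Xs m \<in> alg_hom (product_alg Xs) (Xs ! m)"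
  unfolding product_proj_def product_alg_def
  by (rule pev_hom[OF admissible_product_rel[OF assms(1)]]) (use assms(2) in \<open>auto simp: product_rel_def\<close>)

lemma product_alg_eqI:
  assumes "x \<in> carrier (product_alg Xs)" "y \<in> carrier (product_alg Xs)"
    and "\<And>m. m < length Xs \<Longrightarrow> product_proj Xs m x = product_proj Xs m y"
  shows "x = y"
proof -
  obtain s t where st: "x = pq (product_rel Xs) s" "y = pq (product_rel Xs) t" using assms by (auto simp: product_alg_def carrier_palg)
  have "term_value T a s = term_value T a t" if Ta: "(T, a) \<in> product_rel Xs" for T a
  proof -
    obtain m where m: "m < length Xs" "T = Xs ! m"
      "a = product_eval Xs m"
      using Ta unfolding product_rel_def mem_Collect_eq prod.inject by (elim exE conjE)
    have e: "product_proj Xs m = pev (product_rel Xs) T a" unfolding product_proj_def m(2,3) ..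
    have "term_value T a s = product_proj Xs m x" unfolding e st(1) pev_pq[OF Ta] ..
    also have "\<dots> = product_proj Xs m y" by (rule assms(3)[OF m(1)])
    also have "\<dots> = term_value T a t" unfolding e st(2) pev_pq[OF Ta] ..
    finally show ?thesis .
  qed
  then show ?thesis by (auto simp: st pq_eq_iff term_eq_def)
qed

definition product_arr where "product_arr Xs m = (product_alg Xs, Xs ! m, product_proj Xs m)"

lemma product_alg_in_V: "set Xs \<subseteq> V \<Longrightarrow> product_alg Xs \<in> V"
  unfolding product_alg_def by (intro palg_in_V admissible_product_rel)

lemma is_product_product_alg:
  assumes "set Xs \<subseteq> V"
  shows "is_product C Xs (product_alg Xs) (map (product_arr Xs) [0..<length Xs])"
proof -
  have X: "Xs ! m \<in> V" if "m < length Xs" for m using assms that by (meson nth_mem subsetD)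
  note P = product_alg_in_V[OF assms]
  interpret P: nalg "product_alg Xs" using P by (rule V_nalg)
  show ?thesis unfolding is_product_def
  proof (intro conjI ballI allI impI)
    show "list_all2 (\<lambda>X i. i \<in> homset C (product_alg Xs) X) Xs (map (product_arr Xs) [0..<length Xs])"
      by (auto simp: list_all2_conv_all_nth in_homset product_arr_def X product_proj_hom assms P)
    fix T fs assume T: "T \<in> Obj C" and "list_all2 (\<lambda>X f. f \<in> homset C T X) Xs fs"
    then have len: "length fs = length Xs" and f: "\<And>m. m < length Xs \<Longrightarrow> fs ! m \<in> homset C T (Xs ! m)"
      by (auto simp: list_all2_conv_all_nth)
    interpret T: nalg T using T by (simp add: V_nalg)
    define gs where "gs m = snd (snd (fs ! m))" for m
    have fs: "fs ! m = (T, Xs ! m, gs m)" "gs m \<in> alg_hom T (Xs ! m)" if "m < length Xs" for m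
      using f[OF that] by (auto simp: in_homset gs_def)
    have gs: "ahom T (Xs ! m) (gs m)" "x \<in> carrier T \<Longrightarrow> gs m x \<in> carrier (Xs ! m)" if "m < length Xs" for m x
      using fs(2)[OF that] by (auto simp: alg_hom_iff ahom_def)
    have *: "map (\<lambda>p. Comp C p (T, product_alg Xs, h)) (map (product_arr Xs) [0..<length Xs]) = fs \<longleftrightarrow>
       (\<forall>m<length Xs. \<forall>x\<in>carrier T. product_proj Xs m (h x) = gs m x)" if h: "h \<in> alg_hom T (product_alg Xs)" for h
    proof -
      have "map (\<lambda>p. Comp C p (T, product_alg Xs, h)) (map (product_arr Xs) [0..<length Xs]) = fs \<longleftrightarrow>
        (\<forall>m<length Xs. compose (carrier T) (product_proj Xs m) h = gs m)"
      proof -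
        have "map (\<lambda>p. Comp C p (T, product_alg Xs, h)) (map (product_arr Xs) [0..<length Xs]) = fs \<longleftrightarrow>
          (\<forall>m<length Xs. Comp C (product_arr Xs m) (T, product_alg Xs, h) = fs ! m)"
          by (rule map_map_upt_eq_iff[OF len])
        also have "\<dots> \<longleftrightarrow> (\<forall>m<length Xs. compose (carrier T) (product_proj Xs m) h = gs m)"
          by (rule all_cong) (simp add: fs(1) product_arr_def)
        finally show ?thesis .
      qed
      also have "\<dots> \<longleftrightarrow> (\<forall>m<length Xs. \<forall>x\<in>carrier T. product_proj Xs m (h x) = gs m x)"
      proof (intro all_cong iffI)
        fix m assume m: "m < length Xs"
        show "compose (carrier T) (product_proj Xs m) h = gs m"
          if "\<forall>x\<in>carrier T. product_proj Xs m (h x) = gs m x"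
          by (rule alg_hom_ext[OF compose_alg_hom[OF T.alg h product_proj_hom[OF assms m]] fs(2)[OF m]])
            (simp add: compose_def that)
      qed (metis compose_eq)
      finally show ?thesis .
    qed
    define h where "h = (\<lambda>x\<in>carrier T. pq (product_rel Xs) (product_term (\<lambda>m. gs m x) (length Xs)))"
    have hx: "product_proj Xs m (h x) = gs m x" if "m < length Xs" "x \<in> carrier T" for m x
      using product_proj_product_term[OF assms that(1), of "\<lambda>m. gs m x" "length Xs"] that gs(2) by (simp add: h_def)
    have hc: "h x \<in> carrier (product_alg Xs)" if "x \<in> carrier T" for x
      using that by (simp add: h_def product_alg_def)
    have "h \<in> alg_hom T (product_alg Xs)"
      unfolding alg_hom_iff ahom_def
    proof (intro conjI ballI allI)
      fix x y c assume xy: "x \<in> carrier T" "y \<in> carrier T"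
      have e: "ahom (product_alg Xs) (Xs ! m) (product_proj Xs m)" if "m < length Xs" for m
        using product_proj_hom[OF assms that] by (simp add: alg_hom_iff)
      show "h (x \<oplus>\<^bsub>T\<^esub> y) = h x \<oplus>\<^bsub>product_alg Xs\<^esub> h y"
        by (rule product_alg_eqI[where Xs = Xs]) (simp_all add: xy hc hx ahom_add[OF e] ahom_add[OF gs(1)])
      show "h (x \<otimes>\<^bsub>T\<^esub> y) = h x \<otimes>\<^bsub>product_alg Xs\<^esub> h y"
        by (rule product_alg_eqI[where Xs = Xs]) (simp_all add: xy hc hx ahom_mult[OF e] ahom_mult[OF gs(1)])
      show "h (c \<odot>\<^bsub>T\<^esub> x) = c \<odot>\<^bsub>product_alg Xs\<^esub> h x"
        by (rule product_alg_eqI[where Xs = Xs]) (simp_all add: xy hc hx ahom_smult[OF e] ahom_smult[OF gs(1)])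
    qed (use hc in \<open>auto simp: h_def\<close>)
    note h = this
    show "\<exists>!h. h \<in> homset C T (product_alg Xs) \<and> map (\<lambda>p. Comp C p h) (map (product_arr Xs) [0..<length Xs]) = fs"
    proof (rule ex1I[of _ "(T, product_alg Xs, h)"])
      show "(T, product_alg Xs, h) \<in> homset C T (product_alg Xs) \<and>
          map (\<lambda>p. Comp C p (T, product_alg Xs, h)) (map (product_arr Xs) [0..<length Xs]) = fs"
        unfolding *[OF h] in_homset using h T P hx by simp
      fix h' assume h': "h' \<in> homset C T (product_alg Xs) \<and> map (\<lambda>p. Comp C p h') (map (product_arr Xs) [0..<length Xs]) = fs"
      then obtain g where g: "h' = (T, product_alg Xs, g)" "g \<in> alg_hom T (product_alg Xs)" by (auto simp: in_homset)
      then have "\<forall>m<length Xs. \<forall>x\<in>carrier T. product_proj Xs m (g x) = gs m x"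
        using h' *[OF g(2)] by simp
      then have "g = h"
        by (rule_tac alg_hom_ext[OF g(2) h], rule_tac product_alg_eqI[where Xs = Xs])
          (simp_all add: hx hc alg_hom_closed[OF g(2)])
      then show "h' = (T, product_alg Xs, h)" using g by simp
    qed
  qed (simp add: P)
qed

definition subalg :: "('k, 'u) module \<Rightarrow> 'u set \<Rightarrow> ('k, 'u) module" where
  "subalg A W = A\<lparr>carrier := W\<rparr>"

definition kerset where "kerset A B f = {x \<in> carrier A. f x = \<zero>\<^bsub>B\<^esub>}"

lemma subalg_in_V:
  assumes A: "A \<in> V" and W: "W \<subseteq> carrier A" "\<zero>\<^bsub>A\<^esub> \<in> W"
    "\<And>x y. \<lbrakk>x \<in> W; y \<in> W\<rbrakk> \<Longrightarrow> x \<oplus>\<^bsub>A\<^esub> y \<in> W" "\<And>x y. \<lbrakk>x \<in> W; y \<in> W\<rbrakk> \<Longrightarrow> x \<otimes>\<^bsub>A\<^esub> y \<in> W"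
    "\<And>c x. x \<in> W \<Longrightarrow> c \<odot>\<^bsub>A\<^esub> x \<in> W"
  shows "subalg A W \<in> V" "ahom (subalg A W) A (\<lambda>x. x)"
proof -
  interpret A: nalg A using A by (rule V_nalg)
  have c: "x \<in> carrier A" if "x \<in> W" for x using that W(1) by auto
  show h: "ahom (subalg A W) A (\<lambda>x. x)" using W(1) by (auto simp: ahom_def subalg_def)
  have "is_algebra (subalg A W)"
    by (rule is_algebraI)
      (auto simp: subalg_def W(2-5) A.add_assoc A.zero_add A.sm_add_left A.sm_add_right A.sm_sm
         A.mult_add_left A.mult_add_right A.mult_sm_left A.mult_sm_right c intro: A.add_comm)
  then show "subalg A W \<in> V"
    using h A by (intro in_V_if_separated) (auto simp: subalg_def)
qed

lemma kerset_in_V: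
  assumes "A \<in> V" "B \<in> V" "ahom A B f"
  shows "subalg A (kerset A B f) \<in> V" "ahom (subalg A (kerset A B f)) A (\<lambda>x. x)"
proof -
  interpret A: nalg A using assms(1) by (rule V_nalg)
  interpret B: nalg B using assms(2) by (rule V_nalg)
  show "subalg A (kerset A B f) \<in> V" "ahom (subalg A (kerset A B f)) A (\<lambda>x. x)"
    by (rule subalg_in_V[OF assms(1)]; auto simp: kerset_def ahom_zero[OF A.alg B.alg assms(3)]
      ahom_add[OF assms(3)] ahom_mult[OF assms(3)] ahom_smult[OF assms(3)])+
qed

definition kerArr where
  "kerArr A B f = (subalg A (kerset A B f), A, \<lambda>x \<in> kerset A B f. x)"

lemma kerArr_hom:
  assumes "A \<in> V" "B \<in> V" "ahom A B f"
  shows "(\<lambda>x \<in> kerset A B f. x) \<in> alg_hom (subalg A (kerset A B f)) A"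
  using restrict_alg_hom[OF V_alg[OF kerset_in_V(1)[OF assms]] kerset_in_V(2)[OF assms]]
  by (simp add: subalg_def)

lemma is_kernel_kerArr:
  assumes "A \<in> V" "B \<in> V" "f \<in> alg_hom A B"
  shows "is_kernel C (A, B, f) (kerArr A B f)"
proof -
  have f: "ahom A B f" using assms(3) by (simp add: alg_hom_iff)
  interpret A: nalg A using assms(1) by (rule V_nalg)
  interpret B: nalg B using assms(2) by (rule V_nalg)
  let ?K = "subalg A (kerset A B f)"
  have K: "?K \<in> V" by (rule kerset_in_V[OF assms(1,2) f])
  have cK: "carrier ?K = kerset A B f" by (simp add: subalg_def)
  show ?thesis unfolding is_kernel_def
  proof (intro conjI ballI impI)
    show "Comp C (A, B, f) (kerArr A B f) = zero_arr C (Dom C (kerArr A B f)) (Cod C (A, B, f))"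
      by (simp add: kerArr_def zero_arr_eq K assms) (auto simp: compose_def zero_map_def cK fun_eq_iff, simp add: kerset_def)
    fix g assume g: "g \<in> Arr C" "Cod C g = Dom C (A, B, f) \<and> Comp C (A, B, f) g = zero_arr C (Dom C g) (Cod C (A, B, f))"
    obtain D g' where g': "g = (D, A, g')" "D \<in> V" "g' \<in> alg_hom D A" using g by (cases g) auto
    interpret D: nalg D using g'(2) by (rule V_nalg)
    have "compose (carrier D) f g' = zero_map D B" using g g' assms by (simp add: zero_arr_eq)
    then have ker: "g' x \<in> kerset A B f" if "x \<in> carrier D" for x
      using that g'(3) by (auto simp: kerset_def alg_hom_def zero_map_def compose_def dest: fun_cong[of _ _ x])
    have g'K: "g' \<in> alg_hom D ?K"
      using g'(3) ker by (auto simp: alg_hom_iff ahom_def subalg_def)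
    show "\<exists>!u. u \<in> homset C (Dom C g) (Dom C (kerArr A B f)) \<and> Comp C (kerArr A B f) u = g"
    proof (rule ex1I[of _ "(D, ?K, g')"])
      show "(D, ?K, g') \<in> homset C (Dom C g) (Dom C (kerArr A B f)) \<and> Comp C (kerArr A B f) (D, ?K, g') = g"
        using g' g'K K ker by (auto simp: in_homset kerArr_def compose_def alg_hom_iff extensional_def fun_eq_iff)
      fix u assume u: "u \<in> homset C (Dom C g) (Dom C (kerArr A B f)) \<and> Comp C (kerArr A B f) u = g"
      then obtain h where h: "u = (D, ?K, h)" "h \<in> alg_hom D ?K" by (auto simp: in_homset g' kerArr_def)
      have "h = g'"
      proof (rule alg_hom_ext[OF h(2) g'(3)])
        fix x assume x: "x \<in> carrier D"
        then have "h x \<in> kerset A B f" using h(2) by (auto simp: alg_hom_def cK)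
        moreover have "compose (carrier D) (\<lambda>x \<in> kerset A B f. x) h = g'" using u h g' by (simp add: kerArr_def)
        ultimately show "h x = g' x" using x by (auto simp: compose_def)
      qed
      then show "u = (D, ?K, g')" using h by simp
    qed
  qed (use assms K kerArr_hom[OF assms(1,2) f] in \<open>auto simp: kerArr_def\<close>)
qed

end

lemma coproductD:
  "\<lbrakk>is_coproduct D Xs S is; T \<in> Obj D; list_all2 (\<lambda>X f. f \<in> homset D X T) Xs fs\<rbrakk> \<Longrightarrow>
    \<exists>!h. h \<in> homset D S T \<and> map (\<lambda>i. Comp D h i) is = fs"
  by (simp only: is_coproduct_def)

lemma productD:
  "\<lbrakk>is_product D Xs P ps; T \<in> Obj D; list_all2 (\<lambda>X f. f \<in> homset D T X) Xs fs\<rbrakk> \<Longrightarrow>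
    \<exists>!h. h \<in> homset D T P \<and> map (\<lambda>p. Comp D p h) ps = fs"
  by (simp only: is_product_def)

section \<open>Cosmash products\<close>

context nvariety
begin

definition cot2 where
  "cot2 X Y T f g = (SOME h. h \<in> alg_hom (copS [X, Y]) T \<and>
     (\<forall>x\<in>carrier X. h (copI [X, Y] 0 x) = f x) \<and> (\<forall>y\<in>carrier Y. h (copI [X, Y] 1 y) = g y))"

definition cot3 where
  "cot3 X Y Z T f g k = (SOME h. h \<in> alg_hom (copS [X, Y, Z]) T \<and>
     (\<forall>x\<in>carrier X. h (copI [X, Y, Z] 0 x) = f x) \<and> (\<forall>y\<in>carrier Y. h (copI [X, Y, Z] 1 y) = g y) \<and>
     (\<forall>z\<in>carrier Z. h (copI [X, Y, Z] 2 z) = k z))"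

lemma cot2:
  assumes "X \<in> V" "Y \<in> V" "T \<in> V" "ahom X T f" "ahom Y T g"
  shows "cot2 X Y T f g \<in> alg_hom (copS [X, Y]) T"
    "x \<in> carrier X \<Longrightarrow> cot2 X Y T f g (copI [X, Y] 0 x) = f x"
    "y \<in> carrier Y \<Longrightarrow> cot2 X Y T f g (copI [X, Y] 1 y) = g y"
proof -
  let ?fs = "\<lambda>m. if m = 0 then (\<lambda>x\<in>carrier X. f x) else (\<lambda>x\<in>carrier Y. g x)"
  have "\<exists>h \<in> alg_hom (copS [X, Y]) T. \<forall>m<length [X, Y]. \<forall>x\<in>carrier ([X, Y] ! m). h (copI [X, Y] m x) = ?fs m x"
    using assms restrict_alg_hom[OF V_alg[OF assms(1)] assms(4)] restrict_alg_hom[OF V_alg[OF assms(2)] assms(5)]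
    by (intro copS_universal) (auto simp: less_Suc_eq simp del: restrict_apply)
  then have "\<exists>h. h \<in> alg_hom (copS [X, Y]) T \<and>
     (\<forall>x\<in>carrier X. h (copI [X, Y] 0 x) = f x) \<and> (\<forall>y\<in>carrier Y. h (copI [X, Y] 1 y) = g y)"
    by (auto simp: less_Suc_eq nth_Cons' all_conj_distrib)
  from someI_ex[OF this, folded cot2_def]
  show "cot2 X Y T f g \<in> alg_hom (copS [X, Y]) T"
    "x \<in> carrier X \<Longrightarrow> cot2 X Y T f g (copI [X, Y] 0 x) = f x"
    "y \<in> carrier Y \<Longrightarrow> cot2 X Y T f g (copI [X, Y] 1 y) = g y" by auto
qed

lemma cot3:
  assumes "X \<in> V" "Y \<in> V" "Z \<in> V" "T \<in> V" "ahom X T f" "ahom Y T g" "ahom Z T k"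
  shows "cot3 X Y Z T f g k \<in> alg_hom (copS [X, Y, Z]) T"
    "x \<in> carrier X \<Longrightarrow> cot3 X Y Z T f g k (copI [X, Y, Z] 0 x) = f x"
    "y \<in> carrier Y \<Longrightarrow> cot3 X Y Z T f g k (copI [X, Y, Z] 1 y) = g y"
    "z \<in> carrier Z \<Longrightarrow> cot3 X Y Z T f g k (copI [X, Y, Z] 2 z) = k z"
proof -
  let ?fs = "\<lambda>m. if m = 0 then (\<lambda>x\<in>carrier X. f x) else if m = 1 then (\<lambda>x\<in>carrier Y. g x) else (\<lambda>x\<in>carrier Z. k x)"
  have "\<exists>h \<in> alg_hom (copS [X, Y, Z]) T. \<forall>m<length [X, Y, Z]. \<forall>x\<in>carrier ([X, Y, Z] ! m). h (copI [X, Y, Z] m x) = ?fs m x"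
    using assms restrict_alg_hom[OF V_alg[OF assms(1)] assms(5)] restrict_alg_hom[OF V_alg[OF assms(2)] assms(6)]
      restrict_alg_hom[OF V_alg[OF assms(3)] assms(7)]
    by (intro copS_universal) (auto simp: less_Suc_eq simp del: restrict_apply)
  then have "\<exists>h. h \<in> alg_hom (copS [X, Y, Z]) T \<and>
     (\<forall>x\<in>carrier X. h (copI [X, Y, Z] 0 x) = f x) \<and> (\<forall>y\<in>carrier Y. h (copI [X, Y, Z] 1 y) = g y) \<and>
     (\<forall>z\<in>carrier Z. h (copI [X, Y, Z] 2 z) = k z)"
    by (auto simp: less_Suc_eq nth_Cons' all_conj_distrib numeral_2_eq_2)
  from someI_ex[OF this, folded cot3_def]
  show "cot3 X Y Z T f g k \<in> alg_hom (copS [X, Y, Z]) T"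
    "x \<in> carrier X \<Longrightarrow> cot3 X Y Z T f g k (copI [X, Y, Z] 0 x) = f x"
    "y \<in> carrier Y \<Longrightarrow> cot3 X Y Z T f g k (copI [X, Y, Z] 1 y) = g y"
    "z \<in> carrier Z \<Longrightarrow> cot3 X Y Z T f g k (copI [X, Y, Z] 2 z) = k z" by auto
qed

lemma inj2:
  assumes "X \<in> V" "Y \<in> V"
  shows "copI [X, Y] 0 \<in> alg_hom X (copS [X, Y])" "copI [X, Y] 1 \<in> alg_hom Y (copS [X, Y])"
  using copI_hom[of 0 "[X, Y]"] copI_hom[of 1 "[X, Y]"] assms by auto

lemma inj3:
  assumes "X \<in> V" "Y \<in> V" "Z \<in> V"
  shows "copI [X, Y, Z] 0 \<in> alg_hom X (copS [X, Y, Z])" "copI [X, Y, Z] 1 \<in> alg_hom Y (copS [X, Y, Z])"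
    "copI [X, Y, Z] 2 \<in> alg_hom Z (copS [X, Y, Z])"
  using copI_hom[of 0 "[X, Y, Z]"] copI_hom[of 1 "[X, Y, Z]"] copI_hom[of 2 "[X, Y, Z]"] assms by auto

lemma unique2:
  assumes "T \<in> V" "ahom (copS [X, Y]) T f" "ahom (copS [X, Y]) T g"
    and "\<And>x. x \<in> carrier X \<Longrightarrow> f (copI [X, Y] 0 x) = g (copI [X, Y] 0 x)"
    and "\<And>y. y \<in> carrier Y \<Longrightarrow> f (copI [X, Y] 1 y) = g (copI [X, Y] 1 y)"
    and "x \<in> carrier (copS [X, Y])"
  shows "f x = g x"
  by (rule copS_hom_unique[OF V_alg[OF assms(1)] assms(2,3) _ assms(6)])
    (use assms(4,5) in \<open>auto simp: less_Suc_eq\<close>)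

lemma coproduct2:
  assumes "X \<in> V" "Y \<in> V"
  shows "is_coproduct C [X, Y] (copS [X, Y]) [copArr [X, Y] 0, copArr [X, Y] 1]"
  using is_coproduct_copS[of "[X, Y]"] assms by (simp add: upt_rec)

lemma coproduct3:
  assumes "X \<in> V" "Y \<in> V" "Z \<in> V"
  shows "is_coproduct C [X, Y, Z] (copS [X, Y, Z]) [copArr [X, Y, Z] 0, copArr [X, Y, Z] 1, copArr [X, Y, Z] 2]"
  using is_coproduct_copS[of "[X, Y, Z]"] assms by (simp add: upt_rec numeral_2_eq_2)

lemma compose_eqI: "\<lbrakk>f \<in> extensional A; \<And>x. x \<in> A \<Longrightarrow> h (i x) = f x\<rbrakk> \<Longrightarrow> compose A h i = f"
  by (auto simp: compose_def extensional_def fun_eq_iff)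

lemma cotuple2:
  assumes "X \<in> V" "Y \<in> V" "T \<in> V" "f \<in> alg_hom X T" "g \<in> alg_hom Y T"
  shows "cotuple C (copS [X, Y]) [copArr [X, Y] 0, copArr [X, Y] 1] T [(X, T, f), (Y, T, g)]
    = (copS [X, Y], T, cot2 X Y T f g)"
proof -
  have fg: "(X, T, f) \<in> homset C X T" "(Y, T, g) \<in> homset C Y T" using assms by (auto simp: in_homset)
  note h = cot2[OF assms(1-3) alg_hom_ahom[OF assms(4)] alg_hom_ahom[OF assms(5)]]
  let ?P = "\<lambda>h. h \<in> homset C (copS [X, Y]) T \<and> map (\<lambda>i. Comp C h i) [copArr [X, Y] 0, copArr [X, Y] 1] = [(X, T, f), (Y, T, g)]"
  have "?P (copS [X, Y], T, cot2 X Y T f g)"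
    unfolding in_homset using assms h
    by (auto simp: copArr_def alg_hom_iff intro!: compose_eqI)
  moreover have "\<exists>!h. ?P h"
    by (rule coproductD[OF coproduct2[OF assms(1,2)]]) (use fg assms(3) in simp_all)
  ultimately show ?thesis unfolding cotuple_def by (intro the1_equality)
qed

lemma cotuple3:
  assumes "X \<in> V" "Y \<in> V" "Z \<in> V" "T \<in> V" "f \<in> alg_hom X T" "g \<in> alg_hom Y T" "k \<in> alg_hom Z T"
  shows "cotuple C (copS [X, Y, Z]) [copArr [X, Y, Z] 0, copArr [X, Y, Z] 1, copArr [X, Y, Z] 2] T
      [(X, T, f), (Y, T, g), (Z, T, k)] = (copS [X, Y, Z], T, cot3 X Y Z T f g k)"
proof -
  have fg: "(X, T, f) \<in> homset C X T" "(Y, T, g) \<in> homset C Y T" "(Z, T, k) \<in> homset C Z T"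
    using assms by (auto simp: in_homset)
  note h = cot3[OF assms(1-4) alg_hom_ahom[OF assms(5)] alg_hom_ahom[OF assms(6)] alg_hom_ahom[OF assms(7)]]
  let ?P = "\<lambda>h. h \<in> homset C (copS [X, Y, Z]) T \<and>
    map (\<lambda>i. Comp C h i) [copArr [X, Y, Z] 0, copArr [X, Y, Z] 1, copArr [X, Y, Z] 2] = [(X, T, f), (Y, T, g), (Z, T, k)]"
  have "?P (copS [X, Y, Z], T, cot3 X Y Z T f g k)"
    unfolding in_homset using assms h
    by (auto simp: copArr_def alg_hom_iff intro!: compose_eqI)
  moreover have "\<exists>!h. ?P h"
    by (rule coproductD[OF coproduct3[OF assms(1-3)]]) (use fg assms(4) in simp_all)
  ultimately show ?thesis unfolding cotuple_def by (intro the1_equality)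
qed

text \<open>An element of a product is zero exactly when its projections are. Both kinds of cosmash
  product thus become explicit subsets of a coproduct, cut out by the vanishing of finitely many
  homomorphisms.\<close>

lemma kernel_tuple:
  assumes "set Xs \<subseteq> V" "A \<in> V" "length fs = length Xs" "\<And>m. m < length Xs \<Longrightarrow> fs ! m \<in> alg_hom A (Xs ! m)"
  defines "K \<equiv> {x \<in> carrier A. \<forall>m<length Xs. (fs ! m) x = \<zero>\<^bsub>Xs ! m\<^esub>}"
  shows "is_kernel C (tuple C (product_alg Xs) (map (product_arr Xs) [0..<length Xs]) A
      (map (\<lambda>m. (A, Xs ! m, fs ! m)) [0..<length Xs])) (subalg A K, A, \<lambda>x\<in>K. x)"
proof -
  let ?F = "map (\<lambda>m. (A, Xs ! m, fs ! m)) [0..<length Xs]"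
  let ?Q = "\<lambda>h. h \<in> homset C A (product_alg Xs) \<and> map (\<lambda>p. Comp C p h) (map (product_arr Xs) [0..<length Xs]) = ?F"
  have X: "Xs ! m \<in> V" if "m < length Xs" for m using assms(1) that by (meson nth_mem subsetD)
  have "list_all2 (\<lambda>X f. f \<in> homset C A X) Xs ?F"
    using assms(2,3,4) X by (auto simp: list_all2_conv_all_nth in_homset)
  then have ex: "\<exists>!h. ?Q h"
    by (intro productD[OF is_product_product_alg[OF assms(1)]]) (use assms(2) in simp)
  then have "?Q (tuple C (product_alg Xs) (map (product_arr Xs) [0..<length Xs]) A ?F)"
    unfolding tuple_def by (rule theI')
  then obtain h where t: "tuple C (product_alg Xs) (map (product_arr Xs) [0..<length Xs]) A ?F = (A, product_alg Xs, h)"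
    and h: "h \<in> alg_hom A (product_alg Xs)"
    and Q: "?Q (A, product_alg Xs, h)" unfolding in_homset by auto
  have ev: "product_proj Xs m (h x) = (fs ! m) x" if "m < length Xs" "x \<in> carrier A" for m x
  proof -
    have "\<forall>m<length Xs. Comp C (product_arr Xs m) (A, product_alg Xs, h) = ?F ! m"
      using Q map_map_upt_eq_iff[of ?F "length Xs" "\<lambda>p. Comp C p (A, product_alg Xs, h)" "product_arr Xs"] by simp
    then have "compose (carrier A) (product_proj Xs m) h = fs ! m" using that(1) by (simp add: product_arr_def)
    then show ?thesis using that(2) by (metis compose_eq)
  qed
  have P: "product_alg Xs \<in> V" by (rule product_alg_in_V[OF assms(1)])
  interpret P: nalg "product_alg Xs" using P by (rule V_nalg)
  have z: "product_proj Xs m \<zero>\<^bsub>product_alg Xs\<^esub> = \<zero>\<^bsub>Xs ! m\<^esub>" if "m < length Xs" for m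
    by (rule ahom_zero[OF P.alg V_alg[OF X[OF that]] alg_hom_ahom[OF product_proj_hom[OF assms(1) that]]])
  have "h x = \<zero>\<^bsub>product_alg Xs\<^esub> \<longleftrightarrow> (\<forall>m<length Xs. (fs ! m) x = \<zero>\<^bsub>Xs ! m\<^esub>)" if x: "x \<in> carrier A" for x
  proof
    assume "\<forall>m<length Xs. (fs ! m) x = \<zero>\<^bsub>Xs ! m\<^esub>"
    then show "h x = \<zero>\<^bsub>product_alg Xs\<^esub>"
      by (rule_tac product_alg_eqI[where Xs = Xs]) (simp_all add: ev x z alg_hom_closed[OF h])
  qed (use ev z x in metis)
  then have "K = kerset A (product_alg Xs) h" by (auto simp: K_def kerset_def)
  then show ?thesis using is_kernel_kerArr[OF assms(2) P h] by (simp add: t kerArr_def)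
qed

definition res1 where "res1 X Y = cot2 X Y X (\<lambda>x\<in>carrier X. x) (zero_map Y X)"
definition res2 where "res2 X Y = cot2 X Y Y (zero_map X Y) (\<lambda>y\<in>carrier Y. y)"

definition ker2 where
  "ker2 X Y = {s \<in> carrier (copS [X, Y]). res1 X Y s = \<zero>\<^bsub>X\<^esub> \<and> res2 X Y s = \<zero>\<^bsub>Y\<^esub>}"

definition cosm where "cosm X Y = subalg (copS [X, Y]) (ker2 X Y)"
definition cosmArr where "cosmArr X Y = (cosm X Y, copS [X, Y], \<lambda>x\<in>ker2 X Y. x)"

lemma id_hom: "X \<in> V \<Longrightarrow> (\<lambda>x\<in>carrier X. x) \<in> alg_hom X X"
  by (intro restrict_alg_hom V_alg) (auto simp: ahom_def)

lemma id_ahom: "ahom X X (\<lambda>x. x)"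
  by (auto simp: ahom_def)

lemma zero_map_ahom: "\<lbrakk>A \<in> V; B \<in> V\<rbrakk> \<Longrightarrow> ahom A B (zero_map A B)"
  using zero_map_hom by (simp add: alg_hom_iff)

lemma res:
  assumes "X \<in> V" "Y \<in> V"
  shows "res1 X Y \<in> alg_hom (copS [X, Y]) X" "res2 X Y \<in> alg_hom (copS [X, Y]) Y"
    "x \<in> carrier X \<Longrightarrow> res1 X Y (copI [X, Y] 0 x) = x" "y \<in> carrier Y \<Longrightarrow> res1 X Y (copI [X, Y] 1 y) = \<zero>\<^bsub>X\<^esub>"
    "x \<in> carrier X \<Longrightarrow> res2 X Y (copI [X, Y] 0 x) = \<zero>\<^bsub>Y\<^esub>" "y \<in> carrier Y \<Longrightarrow> res2 X Y (copI [X, Y] 1 y) = y"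
  using cot2[OF assms assms(1) alg_hom_ahom[OF id_hom[OF assms(1)]] zero_map_ahom[OF assms(2,1)]]
    cot2[OF assms assms(2) zero_map_ahom[OF assms] alg_hom_ahom[OF id_hom[OF assms(2)]]]
  by (simp_all add: res1_def res2_def zero_map_def)

lemma is_cosmash2:
  assumes "X \<in> V" "Y \<in> V"
  shows "is_cosmash2 C X Y (copS [X, Y]) (copArr [X, Y] 0) (copArr [X, Y] 1) (cosmArr X Y)"
  unfolding is_cosmash2_def
proof (intro conjI exI)
  show "is_coproduct C [X, Y] (copS [X, Y]) [copArr [X, Y] 0, copArr [X, Y] 1]"
    by (rule coproduct2[OF assms])
  show "is_product C [X, Y] (product_alg [X, Y]) [product_arr [X, Y] 0, product_arr [X, Y] 1]"
    using is_product_product_alg[of "[X, Y]"] assms by (simp add: upt_rec)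
  have "{x \<in> carrier (copS [X, Y]). \<forall>m<length [X, Y]. ([res1 X Y, res2 X Y] ! m) x = \<zero>\<^bsub>[X, Y] ! m\<^esub>} = ker2 X Y"
    by (auto simp: ker2_def less_Suc_eq all_conj_distrib)
  moreover have "([res1 X Y, res2 X Y] ! m) \<in> alg_hom (copS [X, Y]) ([X, Y] ! m)" if "m < length [X, Y]" for m
    using res[OF assms] that by (auto simp: less_Suc_eq)
  ultimately have "is_kernel C (tuple C (product_alg [X, Y]) (map (product_arr [X, Y]) [0..<length [X, Y]]) (copS [X, Y])
      (map (\<lambda>m. (copS [X, Y], [X, Y] ! m, [res1 X Y, res2 X Y] ! m)) [0..<length [X, Y]])) (cosmArr X Y)"
    using kernel_tuple[of "[X, Y]" "copS [X, Y]" "[res1 X Y, res2 X Y]"] assms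
    by (simp add: cosmArr_def cosm_def)
  then have k: "is_kernel C (tuple C (product_alg [X, Y]) [product_arr [X, Y] 0, product_arr [X, Y] 1] (copS [X, Y])
      [(copS [X, Y], X, res1 X Y), (copS [X, Y], Y, res2 X Y)]) (cosmArr X Y)"
    by (simp add: upt_rec)
  have e1: "cotuple C (copS [X, Y]) [copArr [X, Y] 0, copArr [X, Y] 1] X [ident C X, zero_arr C Y X]
      = (copS [X, Y], X, res1 X Y)"
    unfolding res1_def zero_arr_eq[OF assms(2,1)] cat_simps(4)
    by (intro cotuple2 assms id_hom zero_map_hom)
  have e2: "cotuple C (copS [X, Y]) [copArr [X, Y] 0, copArr [X, Y] 1] Y [zero_arr C X Y, ident C Y]
      = (copS [X, Y], Y, res2 X Y)"
    unfolding res2_def zero_arr_eq[OF assms] cat_simps(4)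
    by (intro cotuple2 assms id_hom zero_map_hom)
  show "is_kernel C (tuple C (product_alg [X, Y]) [product_arr [X, Y] 0, product_arr [X, Y] 1] (copS [X, Y])
       [cotuple C (copS [X, Y]) [copArr [X, Y] 0, copArr [X, Y] 1] X [ident C X, zero_arr C Y X],
        cotuple C (copS [X, Y]) [copArr [X, Y] 0, copArr [X, Y] 1] Y [zero_arr C X Y, ident C Y]])
       (cosmArr X Y)"
    unfolding e1 e2 by (rule k)
qed

definition res12 where "res12 X Y Z = cot3 X Y Z (copS [X, Y]) (copI [X, Y] 0) (copI [X, Y] 1) (zero_map Z (copS [X, Y]))"
definition res13 where "res13 X Y Z = cot3 X Y Z (copS [X, Z]) (copI [X, Z] 0) (zero_map Y (copS [X, Z])) (copI [X, Z] 1)"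
definition res23 where "res23 X Y Z = cot3 X Y Z (copS [Y, Z]) (zero_map X (copS [Y, Z])) (copI [Y, Z] 0) (copI [Y, Z] 1)"

definition ker3 where
  "ker3 X Y Z = {s \<in> carrier (copS [X, Y, Z]). res12 X Y Z s = \<zero>\<^bsub>copS [X, Y]\<^esub> \<and>
     res13 X Y Z s = \<zero>\<^bsub>copS [X, Z]\<^esub> \<and> res23 X Y Z s = \<zero>\<^bsub>copS [Y, Z]\<^esub>}"

definition cosm3 where "cosm3 X Y Z = subalg (copS [X, Y, Z]) (ker3 X Y Z)"
definition cosm3Arr where "cosm3Arr X Y Z = (cosm3 X Y Z, copS [X, Y, Z], \<lambda>x\<in>ker3 X Y Z. x)"

lemma res12:
  assumes "X \<in> V" "Y \<in> V" "Z \<in> V"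
  shows "res12 X Y Z \<in> alg_hom (copS [X, Y, Z]) (copS [X, Y])"
    "x \<in> carrier X \<Longrightarrow> res12 X Y Z (copI [X, Y, Z] 0 x) = copI [X, Y] 0 x"
    "y \<in> carrier Y \<Longrightarrow> res12 X Y Z (copI [X, Y, Z] 1 y) = copI [X, Y] 1 y"
    "z \<in> carrier Z \<Longrightarrow> res12 X Y Z (copI [X, Y, Z] 2 z) = \<zero>\<^bsub>copS [X, Y]\<^esub>"
  using cot3[OF assms copS_in_V alg_hom_ahom[OF inj2(1)[OF assms(1,2)]] alg_hom_ahom[OF inj2(2)[OF assms(1,2)]] zero_map_ahom[OF assms(3) copS_in_V]]
  by (simp_all add: res12_def zero_map_def)

lemma res13:
  assumes "X \<in> V" "Y \<in> V" "Z \<in> V"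
  shows "res13 X Y Z \<in> alg_hom (copS [X, Y, Z]) (copS [X, Z])"
    "x \<in> carrier X \<Longrightarrow> res13 X Y Z (copI [X, Y, Z] 0 x) = copI [X, Z] 0 x"
    "y \<in> carrier Y \<Longrightarrow> res13 X Y Z (copI [X, Y, Z] 1 y) = \<zero>\<^bsub>copS [X, Z]\<^esub>"
    "z \<in> carrier Z \<Longrightarrow> res13 X Y Z (copI [X, Y, Z] 2 z) = copI [X, Z] 1 z"
  using cot3[OF assms copS_in_V alg_hom_ahom[OF inj2(1)[OF assms(1,3)]] zero_map_ahom[OF assms(2) copS_in_V] alg_hom_ahom[OF inj2(2)[OF assms(1,3)]]]
  by (simp_all add: res13_def zero_map_def)

lemma res23:
  assumes "X \<in> V" "Y \<in> V" "Z \<in> V"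
  shows "res23 X Y Z \<in> alg_hom (copS [X, Y, Z]) (copS [Y, Z])"
    "x \<in> carrier X \<Longrightarrow> res23 X Y Z (copI [X, Y, Z] 0 x) = \<zero>\<^bsub>copS [Y, Z]\<^esub>"
    "y \<in> carrier Y \<Longrightarrow> res23 X Y Z (copI [X, Y, Z] 1 y) = copI [Y, Z] 0 y"
    "z \<in> carrier Z \<Longrightarrow> res23 X Y Z (copI [X, Y, Z] 2 z) = copI [Y, Z] 1 z"
  using cot3[OF assms copS_in_V zero_map_ahom[OF assms(1) copS_in_V] alg_hom_ahom[OF inj2(1)[OF assms(2,3)]] alg_hom_ahom[OF inj2(2)[OF assms(2,3)]]]
  by (simp_all add: res23_def zero_map_def)

lemma is_cosmash3:
  assumes "X \<in> V" "Y \<in> V" "Z \<in> V"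
  shows "is_cosmash3 C X Y Z (copS [X, Y, Z]) (copArr [X, Y, Z] 0) (copArr [X, Y, Z] 1) (copArr [X, Y, Z] 2)
     (cosm3Arr X Y Z)"
  unfolding is_cosmash3_def
proof (intro conjI exI)
  let ?L = "[copS [X, Y], copS [X, Z], copS [Y, Z]]" and ?F = "[res12 X Y Z, res13 X Y Z, res23 X Y Z]"
  let ?S = "copS [X, Y, Z]" and ?i = "[copArr [X, Y, Z] 0, copArr [X, Y, Z] 1, copArr [X, Y, Z] 2]"
  show "is_coproduct C [X, Y, Z] ?S ?i" by (rule coproduct3[OF assms])
  show "is_coproduct C [X, Y] (copS [X, Y]) [copArr [X, Y] 0, copArr [X, Y] 1]"
    "is_coproduct C [X, Z] (copS [X, Z]) [copArr [X, Z] 0, copArr [X, Z] 1]"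
    "is_coproduct C [Y, Z] (copS [Y, Z]) [copArr [Y, Z] 0, copArr [Y, Z] 1]"
    by (intro coproduct2 assms)+
  show "is_product C ?L (product_alg ?L) [product_arr ?L 0, product_arr ?L 1, product_arr ?L 2]"
    using is_product_product_alg[of ?L] by (simp add: upt_rec numeral_2_eq_2)
  have "{x \<in> carrier ?S. \<forall>m<length ?L. (?F ! m) x = \<zero>\<^bsub>?L ! m\<^esub>} = ker3 X Y Z"
    by (auto simp: ker3_def less_Suc_eq all_conj_distrib)
  moreover have "?F ! m \<in> alg_hom ?S (?L ! m)" if "m < length ?L" for m
    using res12(1)[OF assms] res13(1)[OF assms] res23(1)[OF assms] that by (auto simp: less_Suc_eq)
  ultimately have "is_kernel C (tuple C (product_alg ?L) (map (product_arr ?L) [0..<length ?L]) ?S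
      (map (\<lambda>m. (?S, ?L ! m, ?F ! m)) [0..<length ?L])) (cosm3Arr X Y Z)"
    using kernel_tuple[of ?L ?S ?F] assms
    by (simp add: cosm3Arr_def cosm3_def)
  then have k: "is_kernel C (tuple C (product_alg ?L) [product_arr ?L 0, product_arr ?L 1, product_arr ?L 2] ?S
      [(?S, copS [X, Y], res12 X Y Z), (?S, copS [X, Z], res13 X Y Z), (?S, copS [Y, Z], res23 X Y Z)])
      (cosm3Arr X Y Z)"
    by (simp add: upt_rec numeral_2_eq_2)
  have e12: "cotuple C ?S ?i (copS [X, Y]) [copArr [X, Y] 0, copArr [X, Y] 1, zero_arr C Z (copS [X, Y])] = (?S, copS [X, Y], res12 X Y Z)"
  proof -
    have c: "copArr [X, Y] m = ([X, Y] ! m, copS [X, Y], copI [X, Y] m)" for m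
      by (simp add: copArr_def)
    show ?thesis
      unfolding res12_def zero_arr_eq[OF assms(3) copS_in_V] c nth_Cons_0 nth_Cons_Suc One_nat_def
      by (intro cotuple3[unfolded One_nat_def] inj2[unfolded One_nat_def] assms copS_in_V zero_map_hom)
  qed
  have e13: "cotuple C ?S ?i (copS [X, Z]) [copArr [X, Z] 0, zero_arr C Y (copS [X, Z]), copArr [X, Z] 1] = (?S, copS [X, Z], res13 X Y Z)"
  proof -
    have c: "copArr [X, Z] m = ([X, Z] ! m, copS [X, Z], copI [X, Z] m)" for m
      by (simp add: copArr_def)
    show ?thesis
      unfolding res13_def zero_arr_eq[OF assms(2) copS_in_V] c nth_Cons_0 nth_Cons_Suc One_nat_def
      by (intro cotuple3[unfolded One_nat_def] inj2[unfolded One_nat_def] assms copS_in_V zero_map_hom)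
  qed
  have e23: "cotuple C ?S ?i (copS [Y, Z]) [zero_arr C X (copS [Y, Z]), copArr [Y, Z] 0, copArr [Y, Z] 1] = (?S, copS [Y, Z], res23 X Y Z)"
  proof -
    have c: "copArr [Y, Z] m = ([Y, Z] ! m, copS [Y, Z], copI [Y, Z] m)" for m
      by (simp add: copArr_def)
    show ?thesis
      unfolding res23_def zero_arr_eq[OF assms(1) copS_in_V] c nth_Cons_0 nth_Cons_Suc One_nat_def
      by (intro cotuple3[unfolded One_nat_def] inj2[unfolded One_nat_def] assms copS_in_V zero_map_hom)
  qed
  show "is_kernel C (tuple C (product_alg ?L) [product_arr ?L 0, product_arr ?L 1, product_arr ?L 2] ?S
     [cotuple C ?S ?i (copS [X, Y]) [copArr [X, Y] 0, copArr [X, Y] 1, zero_arr C Z (copS [X, Y])],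
      cotuple C ?S ?i (copS [X, Z]) [copArr [X, Z] 0, zero_arr C Y (copS [X, Z]), copArr [X, Z] 1],
      cotuple C ?S ?i (copS [Y, Z]) [zero_arr C X (copS [Y, Z]), copArr [Y, Z] 0, copArr [Y, Z] 1]])
     (cosm3Arr X Y Z)"
    unfolding e12 e13 e23 by (rule k)
qed

end

section \<open>The comparison map as a restriction of a homomorphism between coproducts\<close>

lemma comparison_Phi_iso:
  "\<lbrakk>cosmash_associative D; X \<in> Obj D; Y \<in> Obj D; Z \<in> Obj D; is_cosmash3 D X Y Z S i j l k3;
    is_cosmash2 D Y Z B b1 b2 k; is_cosmash2 D X (Dom D k) T t1 t2 m\<rbrakk> \<Longrightarrow>
    Defs.is_iso D (comparison_Phi D X S i j l k3 B b1 b2 k T t1 t2 m)"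
  unfolding cosmash_associative_def by blast

context nvariety
begin

lemma carrier_cosm: "carrier (cosm X Y) = ker2 X Y"
  by (simp add: cosm_def subalg_def)

lemma cosm_ops:
  "\<zero>\<^bsub>cosm X Y\<^esub> = \<zero>\<^bsub>copS [X, Y]\<^esub>" "x \<oplus>\<^bsub>cosm X Y\<^esub> y = x \<oplus>\<^bsub>copS [X, Y]\<^esub> y"
  "x \<otimes>\<^bsub>cosm X Y\<^esub> y = x \<otimes>\<^bsub>copS [X, Y]\<^esub> y" "c \<odot>\<^bsub>cosm X Y\<^esub> x = c \<odot>\<^bsub>copS [X, Y]\<^esub> x"
  by (simp_all add: cosm_def subalg_def)

lemma ker2_sub: "ker2 X Y \<subseteq> carrier (copS [X, Y])"
  by (auto simp: ker2_def)

lemma cosm_in_V: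
  assumes "X \<in> V" "Y \<in> V"
  shows "cosm X Y \<in> V" "ahom (cosm X Y) (copS [X, Y]) (\<lambda>x. x)"
proof -
  interpret X: nalg X using assms(1) by (rule V_nalg)
  interpret Y: nalg Y using assms(2) by (rule V_nalg)
  interpret S: nalg "copS [X, Y]" by (rule V_nalg[OF copS_in_V])
  note r = alg_hom_ahom[OF res(1)[OF assms]] alg_hom_ahom[OF res(2)[OF assms]]
  note z = ahom_zero[OF S.alg X.alg r(1)] ahom_zero[OF S.alg Y.alg r(2)]
  show "cosm X Y \<in> V" "ahom (cosm X Y) (copS [X, Y]) (\<lambda>x. x)"
    unfolding cosm_def
    by (rule subalg_in_V[OF copS_in_V ker2_sub]; simp add: ker2_def z ahom_add[OF r(1)] ahom_add[OF r(2)]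
      ahom_mult[OF r(1)] ahom_mult[OF r(2)] ahom_smult[OF r(1)] ahom_smult[OF r(2)])+
qed

definition incl3 where "incl3 X Y Z = cot2 Y Z (copS [X, Y, Z]) (copI [X, Y, Z] 1) (copI [X, Y, Z] 2)"

text \<open>This is \<open>1 + \<iota>\<close> from X + (Y \<diamond> Z) to X + Y + Z; its
  restriction to X \<diamond> (Y \<diamond> Z) is \<Phi>. The kernel inclusion is kept as a
  composite factor because the categorical definition produces it in this form.\<close>

definition phi where
  "phi X Y Z = cot2 X (cosm Y Z) (copS [X, Y, Z]) (copI [X, Y, Z] 0)
    (compose (ker2 Y Z) (incl3 X Y Z) (\<lambda>x\<in>ker2 Y Z. x))"

lemma incl3:
  assumes "X \<in> V" "Y \<in> V" "Z \<in> V"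
  shows "incl3 X Y Z \<in> alg_hom (copS [Y, Z]) (copS [X, Y, Z])"
    "y \<in> carrier Y \<Longrightarrow> incl3 X Y Z (copI [Y, Z] 0 y) = copI [X, Y, Z] 1 y"
    "z \<in> carrier Z \<Longrightarrow> incl3 X Y Z (copI [Y, Z] 1 z) = copI [X, Y, Z] 2 z"
  using cot2[OF assms(2,3) copS_in_V alg_hom_ahom[OF inj3(2)[OF assms]] alg_hom_ahom[OF inj3(3)[OF assms]]]
  by (simp_all add: incl3_def)

lemma incl3_cosm_hom:
  assumes "X \<in> V" "Y \<in> V" "Z \<in> V"
  shows "compose (ker2 Y Z) (incl3 X Y Z) (\<lambda>x\<in>ker2 Y Z. x) \<in> alg_hom (cosm Y Z) (copS [X, Y, Z])"
  using compose_alg_hom[OF V_alg[OF cosm_in_V(1)[OF assms(2,3)]]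
    restrict_alg_hom[OF V_alg[OF cosm_in_V(1)[OF assms(2,3)]] cosm_in_V(2)[OF assms(2,3)]] incl3(1)[OF assms]]
  by (simp add: carrier_cosm)

lemma phi:
  assumes "X \<in> V" "Y \<in> V" "Z \<in> V"
  shows "phi X Y Z \<in> alg_hom (copS [X, cosm Y Z]) (copS [X, Y, Z])"
    "x \<in> carrier X \<Longrightarrow> phi X Y Z (copI [X, cosm Y Z] 0 x) = copI [X, Y, Z] 0 x"
    "w \<in> ker2 Y Z \<Longrightarrow> phi X Y Z (copI [X, cosm Y Z] 1 w) = incl3 X Y Z w"
  using cot2[OF assms(1) cosm_in_V(1)[OF assms(2,3)] copS_in_V alg_hom_ahom[OF inj3(1)[OF assms]]
      alg_hom_ahom[OF incl3_cosm_hom[OF assms]]]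
  by (simp_all add: phi_def carrier_cosm compose_def)

text \<open>Setting Y or Z to zero in X + Y + Z annihilates Y \<diamond> Z, so these two
  restrictions of \<open>phi\<close> factor through the retraction onto X. Setting X to zero leaves
  the retraction onto Y \<diamond> Z. All three vanish on X \<diamond> (Y \<diamond> Z).\<close>

lemma phi_ker3:
  assumes "X \<in> V" "Y \<in> V" "Z \<in> V" and t: "t \<in> ker2 X (cosm Y Z)"
  shows "phi X Y Z t \<in> ker3 X Y Z"
proof -
  let ?W = "cosm Y Z"
  have W: "?W \<in> V" by (rule cosm_in_V[OF assms(2,3)])
  note p = phi[OF assms(1-3)] note q = incl3[OF assms(1-3)]
  note rX = res[OF assms(1) W] note rY = res[OF assms(2,3)]
  note r12 = res12[OF assms(1-3)] note r13 = res13[OF assms(1-3)] note r23 = res23[OF assms(1-3)]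
  have tS: "t \<in> carrier (copS [X, ?W])" and t0: "res1 X ?W t = \<zero>\<^bsub>X\<^esub>" "res2 X ?W t = \<zero>\<^bsub>?W\<^esub>"
    using t by (auto simp: ker2_def)
  have ah: "ahom A D (\<lambda>x. g (f x))" if "f \<in> alg_hom A B" "g \<in> alg_hom B D" for A B D f g
    using ahom_comp[OF alg_hom_ahom[OF that(1)] alg_hom_ahom[OF that(2)]] .
  have W0: "res1 Y Z w = \<zero>\<^bsub>Y\<^esub>" "res2 Y Z w = \<zero>\<^bsub>Z\<^esub>" "w \<in> carrier (copS [Y, Z])" if "w \<in> ker2 Y Z" for w
    using that by (auto simp: ker2_def)
  have i2: "copI [A, B] 0 \<zero>\<^bsub>A\<^esub> = \<zero>\<^bsub>copS [A, B]\<^esub>" "copI [A, B] 1 \<zero>\<^bsub>B\<^esub> = \<zero>\<^bsub>copS [A, B]\<^esub>"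
    if "A \<in> V" "B \<in> V" for A B
    using ahom_zero[OF V_alg V_alg alg_hom_ahom[OF inj2(1)]] ahom_zero[OF V_alg V_alg alg_hom_ahom[OF inj2(2)]] that
    by simp_all
  have a1: "res12 X Y Z (incl3 X Y Z b) = copI [X, Y] 1 (res1 Y Z b)" if "b \<in> carrier (copS [Y, Z])" for b
    by (rule unique2[OF copS_in_V ah[OF q(1) r12(1)] ah[OF rY(1) inj2(2)[OF assms(1,2)]] _ _ that])
      (simp_all add: q r12 rY i2 assms flip: One_nat_def)
  have a2: "res13 X Y Z (incl3 X Y Z b) = copI [X, Z] 1 (res2 Y Z b)" if "b \<in> carrier (copS [Y, Z])" for b
    by (rule unique2[OF copS_in_V ah[OF q(1) r13(1)] ah[OF rY(2) inj2(2)[OF assms(1,3)]] _ _ that])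
      (simp_all add: q r13 rY i2 assms flip: One_nat_def)
  have a3: "res23 X Y Z (incl3 X Y Z b) = b" if "b \<in> carrier (copS [Y, Z])" for b
    by (rule unique2[OF copS_in_V ah[OF q(1) r23(1)] id_ahom _ _ that])
      (simp_all add: q r23 rY flip: One_nat_def)
  have "res12 X Y Z (phi X Y Z t) = copI [X, Y] 0 (res1 X ?W t)"
    by (rule unique2[OF copS_in_V ah[OF p(1) r12(1)] ah[OF rX(1) inj2(1)[OF assms(1,2)]] _ _ tS])
      (simp_all add: p r12 rX carrier_cosm W0 a1 i2 assms flip: One_nat_def)
  moreover have "res13 X Y Z (phi X Y Z t) = copI [X, Z] 0 (res1 X ?W t)"
    by (rule unique2[OF copS_in_V ah[OF p(1) r13(1)] ah[OF rX(1) inj2(1)[OF assms(1,3)]] _ _ tS])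
      (simp_all add: p r13 rX carrier_cosm W0 a2 i2 assms flip: One_nat_def)
  moreover have "res23 X Y Z (phi X Y Z t) = res2 X ?W t"
    by (rule unique2[OF copS_in_V ah[OF p(1) r23(1)] ahom_comp[OF alg_hom_ahom[OF rX(2)] cosm_in_V(2)[OF assms(2,3)]] _ _ tS])
      (simp_all add: p r23 rX carrier_cosm W0 a3 cosm_ops assms flip: One_nat_def)
  moreover have "phi X Y Z t \<in> carrier (copS [X, Y, Z])" using p(1) tS by (rule alg_hom_closed)
  ultimately show ?thesis by (simp add: ker3_def t0 i2 assms cosm_ops)
qed

lemma cosm3_in_V:
  assumes "X \<in> V" "Y \<in> V" "Z \<in> V"
  shows "cosm3 X Y Z \<in> V" "ahom (cosm3 X Y Z) (copS [X, Y, Z]) (\<lambda>x. x)"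
proof -
  interpret S: nalg "copS [X, Y, Z]" by (rule V_nalg[OF copS_in_V])
  note r = alg_hom_ahom[OF res12(1)[OF assms]] alg_hom_ahom[OF res13(1)[OF assms]] alg_hom_ahom[OF res23(1)[OF assms]]
  note z = r[THEN ahom_zero[OF S.alg V_alg[OF copS_in_V]]]
  interpret A: nalg "copS [X, Y]" by (rule V_nalg[OF copS_in_V])
  interpret B: nalg "copS [X, Z]" by (rule V_nalg[OF copS_in_V])
  interpret D: nalg "copS [Y, Z]" by (rule V_nalg[OF copS_in_V])
  show "cosm3 X Y Z \<in> V" "ahom (cosm3 X Y Z) (copS [X, Y, Z]) (\<lambda>x. x)"
    unfolding cosm3_def
    by (rule subalg_in_V[OF copS_in_V]; auto simp: ker3_def z r[THEN ahom_add] r[THEN ahom_mult] r[THEN ahom_smult])+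
qed

text \<open>The comparison arrow is identified with the restriction of \<open>phi\<close> to the two
  kernels, and an inverse arrow makes it a bijection of sets. These two conclusions are all that
  later arguments take from cosmash associativity.\<close>

theorem phi_bijective:
  assumes assoc: "cosmash_associative C" and XYZ: "X \<in> V" "Y \<in> V" "Z \<in> V"
  shows phi_injective: "\<lbrakk>t \<in> ker2 X (cosm Y Z); phi X Y Z t = \<zero>\<^bsub>copS [X, Y, Z]\<^esub>\<rbrakk> \<Longrightarrow> t = \<zero>\<^bsub>copS [X, cosm Y Z]\<^esub>"
    and phi_surjective: "s \<in> ker3 X Y Z \<Longrightarrow> \<exists>t\<in>ker2 X (cosm Y Z). phi X Y Z t = s"
proof -
  let ?W = "cosm Y Z" let ?S = "copS [X, Y, Z]" let ?T = "copS [X, cosm Y Z]"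
  have W: "?W \<in> V" by (rule cosm_in_V[OF XYZ(2,3)])
  let ?cmp = "comparison_Phi C X ?S (copArr [X, Y, Z] 0) (copArr [X, Y, Z] 1) (copArr [X, Y, Z] 2) (cosm3Arr X Y Z)
     (copS [Y, Z]) (copArr [Y, Z] 0) (copArr [Y, Z] 1) (cosmArr Y Z) ?T (copArr [X, ?W] 0) (copArr [X, ?W] 1) (cosmArr X ?W)"
  have iso: "Defs.is_iso C ?cmp"
    by (rule comparison_Phi_iso[OF assoc _ _ _ is_cosmash3[OF XYZ] is_cosmash2[OF XYZ(2,3)]])
      (use XYZ is_cosmash2[OF XYZ(1) W] in \<open>simp_all add: cosmArr_def\<close>)
  have inner: "cotuple C (copS [Y, Z]) [copArr [Y, Z] 0, copArr [Y, Z] 1] ?S [copArr [X, Y, Z] 1, copArr [X, Y, Z] 2]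
      = (copS [Y, Z], ?S, incl3 X Y Z)"
    using cotuple2[OF XYZ(2,3) copS_in_V inj3(2,3)[OF XYZ]] by (simp add: copArr_def incl3_def numeral_2_eq_2)
  have c0: "Comp C (copArr [X, Y, Z] 0) (ident C X) = (X, ?S, copI [X, Y, Z] 0)"
    using inj3(1)[OF XYZ] by (auto simp: copArr_def alg_hom_iff intro!: compose_eqI)
  have c1: "Comp C (copS [Y, Z], ?S, incl3 X Y Z) (cosmArr Y Z)
      = (?W, ?S, compose (ker2 Y Z) (incl3 X Y Z) (\<lambda>x\<in>ker2 Y Z. x))"
    by (simp add: cosmArr_def carrier_cosm)
  have sum: "sum_arr C ?T [copArr [X, ?W] 0, copArr [X, ?W] 1] ?S [copArr [X, Y, Z] 0,
      cotuple C (copS [Y, Z]) [copArr [Y, Z] 0, copArr [Y, Z] 1] ?S [copArr [X, Y, Z] 1, copArr [X, Y, Z] 2]]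
      [ident C X, cosmArr Y Z] = (?T, ?S, phi X Y Z)"
    unfolding sum_arr_def inner phi_def
    using cotuple2[OF XYZ(1) W copS_in_V inj3(1)[OF XYZ] incl3_cosm_hom[OF XYZ]] c0 c1 by simp
  let ?K2 = "ker2 X ?W" let ?K3 = "ker3 X Y Z"
  define f where "f = (\<lambda>x\<in>?K2. phi X Y Z x)"
  have K2V: "cosm X ?W \<in> V" by (rule cosm_in_V[OF XYZ(1) W])
  have K3V: "cosm3 X Y Z \<in> V" by (rule cosm3_in_V[OF XYZ])
  have cK3: "carrier (cosm3 X Y Z) = ?K3" by (simp add: cosm3_def subalg_def)
  have fh: "f \<in> alg_hom (cosm X ?W) (cosm3 X Y Z)"
  proof -
    have "ahom (cosm X ?W) ?S (phi X Y Z)"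
      using ahom_comp[OF cosm_in_V(2)[OF XYZ(1) W] alg_hom_ahom[OF phi(1)[OF XYZ]]] .
    then have "ahom (cosm X ?W) (cosm3 X Y Z) (phi X Y Z)"
      using phi_ker3[OF XYZ] by (auto simp: ahom_def carrier_cosm cosm3_def subalg_def)
    from restrict_alg_hom[OF V_alg[OF K2V] this] show ?thesis by (simp add: f_def carrier_cosm)
  qed
  \<comment> \<open>The inclusion of the ternary kernel is injective on elements, so the
    factorisation is unique and the definite description has the expected value.\<close>
  have cmp: "?cmp = (cosm X ?W, cosm3 X Y Z, f)"
    unfolding comparison_Phi_def sum
  proof (rule the_equality)
    show "(cosm X ?W, cosm3 X Y Z, f) \<in> homset C (Dom C (cosmArr X ?W)) (Dom C (cosm3Arr X Y Z)) \<and>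
      Comp C (cosm3Arr X Y Z) (cosm X ?W, cosm3 X Y Z, f) = Comp C (?T, ?S, phi X Y Z) (cosmArr X ?W)"
    proof
      show "(cosm X ?W, cosm3 X Y Z, f) \<in> homset C (Dom C (cosmArr X ?W)) (Dom C (cosm3Arr X Y Z))"
        using fh K2V K3V by (simp add: in_homset cosmArr_def cosm3Arr_def)
      show "Comp C (cosm3Arr X Y Z) (cosm X ?W, cosm3 X Y Z, f) = Comp C (?T, ?S, phi X Y Z) (cosmArr X ?W)"
        using phi_ker3[OF XYZ] by (auto simp: cosmArr_def cosm3Arr_def compose_def carrier_cosm f_def fun_eq_iff)
    qed
    fix \<phi> assume h: "\<phi> \<in> homset C (Dom C (cosmArr X ?W)) (Dom C (cosm3Arr X Y Z)) \<and>
      Comp C (cosm3Arr X Y Z) \<phi> = Comp C (?T, ?S, phi X Y Z) (cosmArr X ?W)"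
    then obtain g where g: "\<phi> = (cosm X ?W, cosm3 X Y Z, g)" "g \<in> alg_hom (cosm X ?W) (cosm3 X Y Z)"
      by (auto simp: in_homset cosmArr_def cosm3Arr_def)
    have "g = f"
    proof (rule alg_hom_ext[OF g(2) fh])
      fix x assume x: "x \<in> carrier (cosm X ?W)"
      have "compose ?K2 (\<lambda>x\<in>?K3. x) g = compose ?K2 (phi X Y Z) (\<lambda>x\<in>?K2. x)"
        using h g by (simp add: cosmArr_def cosm3Arr_def carrier_cosm)
      from fun_cong[OF this, of x] show "g x = f x"
        using x alg_hom_closed[OF g(2) x] by (simp add: compose_def carrier_cosm cK3 f_def)
    qed
    then show "\<phi> = (cosm X ?W, cosm3 X Y Z, f)" using g by simp
  qed
  obtain g where g: "g \<in> alg_hom (cosm3 X Y Z) (cosm X ?W)"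
    and gf: "compose ?K2 g f = (\<lambda>x\<in>?K2. x)" and fg: "compose ?K3 f g = (\<lambda>x\<in>?K3. x)"
    using iso unfolding cmp Defs.is_iso_def by (auto simp: in_homset carrier_cosm cK3)
  have gf': "g (phi X Y Z t) = t" if "t \<in> ?K2" for t
    using fun_cong[OF gf, of t] that by (simp add: compose_def f_def)
  {
    assume t: "t \<in> ?K2" "phi X Y Z t = \<zero>\<^bsub>?S\<^esub>"
    interpret T: nalg ?T by (rule V_nalg[OF copS_in_V])
    interpret S: nalg ?S by (rule V_nalg[OF copS_in_V])
    interpret K: nalg "cosm X ?W" by (rule V_nalg[OF K2V])
    have z: "\<zero>\<^bsub>?T\<^esub> \<in> ?K2" using K.M.zero_closed by (simp add: carrier_cosm cosm_ops)
    have "phi X Y Z \<zero>\<^bsub>?T\<^esub> = \<zero>\<^bsub>?S\<^esub>"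
      by (rule ahom_zero[OF T.alg S.alg alg_hom_ahom[OF phi(1)[OF XYZ]]])
    then show "t = \<zero>\<^bsub>?T\<^esub>" using gf'[OF t(1)] gf'[OF z] t(2) by simp
  next
    assume s: "s \<in> ?K3"
    then have "g s \<in> ?K2" using alg_hom_closed[OF g, of s] by (simp add: carrier_cosm cK3)
    moreover have "phi X Y Z (g s) = s"
      using fun_cong[OF fg, of s] s calculation by (simp add: compose_def f_def)
    ultimately show "\<exists>t\<in>?K2. phi X Y Z t = s" by auto
  }
qed

end

section \<open>Members of the variety in other types\<close>

context nvariety
begin

text \<open>Test algebras are built on product types. If such an algebra satisfies the defining
  identities and its carrier embeds into \<open>'u\<close>, an isomorphic copy belongs to
  \<open>V\<close>, and the universal properties apply to it as well.\<close>

definition vmember :: "('k, 'p) module \<Rightarrow> bool" where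
  "vmember T \<longleftrightarrow> is_algebra T \<and> (\<forall>p\<in>I. is_identity T p) \<and> (\<exists>c :: 'p \<Rightarrow> 'u. inj_on c (carrier T))"

lemma vmember_iso:
  assumes "vmember (T :: ('k, 'p) module)"
  obtains T' c d where "T' \<in> V" "ahom T T' c" "ahom T' T d" "\<And>x. x \<in> carrier T \<Longrightarrow> d (c x) = x"
proof -
  obtain c :: "'p \<Rightarrow> 'u" where c: "inj_on c (carrier T)" and T: "is_algebra T" "\<forall>p\<in>I. is_identity T p"
    using assms by (auto simp: vmember_def)
  have "image_alg c T \<in> V"
    using is_algebra_image_alg[OF T(1) c] is_identity_image_alg[OF T(1) c] T(2)
    by (simp add: V_eq variety_def)
  then show ?thesis
    using ahom_image_alg[OF T(1) c] ahom_image_alg_inv[OF T(1) c] c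
    by (intro that[of "image_alg c T" c "inv_into (carrier T) c"]) (auto simp: inv_into_f_f)
qed

lemma ex_cot2:
  assumes "vmember T" "X \<in> V" "Y \<in> V" "ahom X T f" "ahom Y T g"
  shows "\<exists>h. ahom (copS [X, Y]) T h \<and> (\<forall>x\<in>carrier X. h (copI [X, Y] 0 x) = f x) \<and>
    (\<forall>y\<in>carrier Y. h (copI [X, Y] 1 y) = g y)"
proof -
  obtain T' c d where T': "T' \<in> V" "ahom T T' c" "ahom T' T d" "\<And>x. x \<in> carrier T \<Longrightarrow> d (c x) = x"
    using vmember_iso[OF assms(1)] by metis
  note h = cot2[OF assms(2,3) T'(1) ahom_comp[OF assms(4) T'(2)] ahom_comp[OF assms(5) T'(2)]]
  show ?thesis
    by (rule exI[of _ "\<lambda>x. d (cot2 X Y T' (\<lambda>x. c (f x)) (\<lambda>x. c (g x)) x)"])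
      (simp add: ahom_comp[OF alg_hom_ahom[OF h(1)] T'(3)] h(2,3) T'(4) ahom_closed[OF assms(4)] ahom_closed[OF assms(5)]
        flip: One_nat_def)
qed

lemma ex_cot3:
  assumes "vmember T" "X \<in> V" "Y \<in> V" "Z \<in> V" "ahom X T f" "ahom Y T g" "ahom Z T k"
  shows "\<exists>h. ahom (copS [X, Y, Z]) T h \<and> (\<forall>x\<in>carrier X. h (copI [X, Y, Z] 0 x) = f x) \<and>
    (\<forall>y\<in>carrier Y. h (copI [X, Y, Z] 1 y) = g y) \<and> (\<forall>z\<in>carrier Z. h (copI [X, Y, Z] 2 z) = k z)"
proof -
  obtain T' c d where T': "T' \<in> V" "ahom T T' c" "ahom T' T d" "\<And>x. x \<in> carrier T \<Longrightarrow> d (c x) = x"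
    using vmember_iso[OF assms(1)] by metis
  note h = cot3[OF assms(2-4) T'(1) ahom_comp[OF assms(5) T'(2)] ahom_comp[OF assms(6) T'(2)] ahom_comp[OF assms(7) T'(2)]]
  show ?thesis
    by (rule exI[of _ "\<lambda>x. d (cot3 X Y Z T' (\<lambda>x. c (f x)) (\<lambda>x. c (g x)) (\<lambda>x. c (k x)) x)"])
      (simp add: ahom_comp[OF alg_hom_ahom[OF h(1)] T'(3)] h(2-4) T'(4) ahom_closed[OF assms(5)]
        ahom_closed[OF assms(6)] ahom_closed[OF assms(7)] flip: One_nat_def)
qed

lemma copS2_induct [consumes 1, case_names left right zero add smult mult]:
  assumes "x \<in> carrier (copS [X, Y])"
    and "\<And>y. y \<in> carrier X \<Longrightarrow> P (copI [X, Y] 0 y)" "\<And>y. y \<in> carrier Y \<Longrightarrow> P (copI [X, Y] 1 y)"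
    and "P \<zero>\<^bsub>copS [X, Y]\<^esub>"
    and "\<And>x y. \<lbrakk>x \<in> carrier (copS [X, Y]); y \<in> carrier (copS [X, Y]); P x; P y\<rbrakk> \<Longrightarrow> P (x \<oplus>\<^bsub>copS [X, Y]\<^esub> y)"
    and "\<And>c x. \<lbrakk>x \<in> carrier (copS [X, Y]); P x\<rbrakk> \<Longrightarrow> P (c \<odot>\<^bsub>copS [X, Y]\<^esub> x)"
    and "\<And>x y. \<lbrakk>x \<in> carrier (copS [X, Y]); y \<in> carrier (copS [X, Y]); P x; P y\<rbrakk> \<Longrightarrow> P (x \<otimes>\<^bsub>copS [X, Y]\<^esub> y)"
  shows "P x"
proof (rule copS_induct[OF assms(1), of P])
  fix m y assume "m < length [X, Y]" "y \<in> carrier ([X, Y] ! m)"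
  then show "P (copI [X, Y] m y)" using assms(2,3) by (auto simp: less_Suc_eq)
qed (use assms in auto)

section \<open>Cyclic algebras\<close>

definition gen0 :: "nat \<times> 'u" where "gen0 = (0, undefined)"

text \<open>The free algebra on one generator, with the relation \<open>x\<^sup>2 = 0\<close> if \<open>sq\<close> holds.\<close>

definition cycF :: "bool \<Rightarrow> (('k, 'u) module \<times> (nat \<times> 'u \<Rightarrow> 'u)) set" where
  "cycF sq = {(T, a). T \<in> V \<and> range a \<subseteq> carrier T \<and> (\<forall>g. g \<noteq> gen0 \<longrightarrow> a g = \<zero>\<^bsub>T\<^esub>) \<and>
     (sq \<longrightarrow> a gen0 \<otimes>\<^bsub>T\<^esub> a gen0 = \<zero>\<^bsub>T\<^esub>)}"

definition cyc where "cyc sq = palg (cycF sq)"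
definition cgen where "cgen sq = pq (cycF sq) (TGen gen0)"

lemma admissible_cycF: "admissible (cycF sq)"
  by (auto simp: admissible_def cycF_def)

lemma cyc_in_V [simp]: "cyc sq \<in> V"
  unfolding cyc_def by (rule palg_in_V[OF admissible_cycF])

lemma cgen_in [simp]: "cgen sq \<in> carrier (cyc sq)"
  by (simp add: cgen_def cyc_def)

lemma cgen_sq: "cgen True \<otimes>\<^bsub>cyc True\<^esub> cgen True = \<zero>\<^bsub>cyc True\<^esub>"
  unfolding cgen_def cyc_def pq_ops pq_eq_iff term_eq_def by (auto simp: cycF_def)

lemma cyc_induct [consumes 1, case_names gen zero add smult mult]:
  assumes "x \<in> carrier (cyc sq)"
    and "P (cgen sq)" "P \<zero>\<^bsub>cyc sq\<^esub>"
    and "\<And>x y. \<lbrakk>x \<in> carrier (cyc sq); y \<in> carrier (cyc sq); P x; P y\<rbrakk> \<Longrightarrow> P (x \<oplus>\<^bsub>cyc sq\<^esub> y)"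
    and "\<And>c x. \<lbrakk>x \<in> carrier (cyc sq); P x\<rbrakk> \<Longrightarrow> P (c \<odot>\<^bsub>cyc sq\<^esub> x)"
    and "\<And>x y. \<lbrakk>x \<in> carrier (cyc sq); y \<in> carrier (cyc sq); P x; P y\<rbrakk> \<Longrightarrow> P (x \<otimes>\<^bsub>cyc sq\<^esub> y)"
  shows "P x"
proof -
  have "P (pq (cycF sq) (TGen g))" for g
  proof (cases "g = gen0")
    case True
    then show ?thesis using assms(2) by (simp add: cgen_def)
  next
    case False
    then have "pq (cycF sq) (TGen g) = \<zero>\<^bsub>cyc sq\<^esub>"
      unfolding cyc_def pq_ops pq_eq_iff term_eq_def by (cases g) (auto simp: cycF_def)
    then show ?thesis using assms(3) by simp
  qed
  then show ?thesis using palg_induct[of x "cycF sq" P] assms unfolding cyc_def by blast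
qed

lemma cyc_hom_V:
  assumes "T \<in> V" "t \<in> carrier T" "sq \<Longrightarrow> t \<otimes>\<^bsub>T\<^esub> t = \<zero>\<^bsub>T\<^esub>"
  shows "\<exists>f. ahom (cyc sq) T f \<and> f (cgen sq) = t"
proof -
  interpret T: nalg T using assms(1) by (rule V_nalg)
  define a where "a g = (if g = gen0 then t else \<zero>\<^bsub>T\<^esub>)" for g :: "nat \<times> 'u"
  have a: "(T, a) \<in> cycF sq" using assms by (auto simp: cycF_def a_def)
  show ?thesis
    by (rule exI[of _ "pev (cycF sq) T a"])
      (simp add: cyc_def cgen_def alg_hom_ahom[OF pev_hom[OF admissible_cycF a]] pev_pq[OF a], simp add: a_def)
qed

lemma cyc_hom:
  assumes "vmember T" "t \<in> carrier T" "sq \<Longrightarrow> t \<otimes>\<^bsub>T\<^esub> t = \<zero>\<^bsub>T\<^esub>"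
  shows "\<exists>f. ahom (cyc sq) T f \<and> f (cgen sq) = t"
proof -
  obtain T' c d where T': "T' \<in> V" "ahom T T' c" "ahom T' T d" "\<And>x. x \<in> carrier T \<Longrightarrow> d (c x) = x"
    using vmember_iso[OF assms(1)] by metis
  have "is_algebra T" using assms(1) by (simp add: vmember_def)
  then have "sq \<Longrightarrow> c t \<otimes>\<^bsub>T'\<^esub> c t = \<zero>\<^bsub>T'\<^esub>"
    using ahom_mult[OF T'(2) assms(2,2)] assms(3) ahom_zero[OF _ V_alg[OF T'(1)] T'(2)] by simp
  then obtain f where "ahom (cyc sq) T' f" "f (cgen sq) = c t"
    using cyc_hom_V[OF T'(1) ahom_closed[OF T'(2) assms(2)]] by blast
  then show ?thesis using ahom_comp[OF _ T'(3)] T'(4)[OF assms(2)] by (intro exI[of _ "\<lambda>x. d (f x)"]) simp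
qed

end

section \<open>Words and the truncated tensor product\<close>

primrec wlen :: "naword \<Rightarrow> nat" where
  "wlen (Var i) = 1"
| "wlen (Mul u v) = wlen u + wlen v"

lemma wlen_pos: "wlen w > 0"
  by (induction w) auto

lemma wlen_occurrences: "(\<forall>i\<ge>N. occurrences i w = 0) \<Longrightarrow> wlen w = (\<Sum>i<N. occurrences i w)"
proof (induction w)
  case (Var j)
  then have "j < N" by (auto simp: not_le[symmetric])
  then show ?case by (simp add: if_distrib cong: if_cong)
qed (simp add: sum.distrib)

lemma occurrences_bound: "\<exists>N. \<forall>i\<ge>N. occurrences i w = 0"
proof (induction w)
  case (Var j)
  then show ?case by (intro exI[of _ "Suc j"]) auto
next
  case (Mul u v)
  then obtain M N where "\<forall>i\<ge>M. occurrences i u = 0" "\<forall>i\<ge>N. occurrences i v = 0" by auto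
  then show ?case by (intro exI[of _ "max M N"]) auto
qed

text \<open>The length of a word is the sum of the entries of its type.\<close>

lemma wlen_homogeneous:
  assumes "homogeneous p" "u \<in> Poly_Mapping.keys p" "v \<in> Poly_Mapping.keys p"
  shows "wlen u = wlen v"
proof -
  have e: "occurrences i u = occurrences i v" for i using assms unfolding homogeneous_def by blast
  obtain N where N: "\<forall>i\<ge>N. occurrences i u = 0" using occurrences_bound by blast
  have "wlen u = (\<Sum>i<N. occurrences i u)" using N by (rule wlen_occurrences)
  also have "\<dots> = (\<Sum>i<N. occurrences i v)" by (simp only: e)
  also have "\<dots> = wlen v" using N unfolding e by (rule wlen_occurrences[symmetric])
  finally show ?thesis .
qed

text \<open>\<open>A \<otimes> t K[t]/t\<^sup>4\<close>, the triple \<open>(a\<^sub>1, a\<^sub>2, a\<^sub>3)\<close> being \<open>a\<^sub>1 t + a\<^sub>2 t\<^sup>2 + a\<^sub>3 t\<^sup>3\<close>.  By homogeneity it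
  satisfies the identities of \<open>A\<close>; evaluating at \<open>a t\<close> extracts the parts of
  degree at most 3.\<close>

definition trunc :: "('k::field, 'u) module \<Rightarrow> ('k, 'u \<times> 'u \<times> 'u) module" where
  "trunc A = \<lparr>carrier = carrier A \<times> carrier A \<times> carrier A,
     monoid.mult = (\<lambda>(a1, a2, a3) (b1, b2, b3). (\<zero>\<^bsub>A\<^esub>, a1 \<otimes>\<^bsub>A\<^esub> b1, a1 \<otimes>\<^bsub>A\<^esub> b2 \<oplus>\<^bsub>A\<^esub> a2 \<otimes>\<^bsub>A\<^esub> b1)),
     one = undefined, zero = (\<zero>\<^bsub>A\<^esub>, \<zero>\<^bsub>A\<^esub>, \<zero>\<^bsub>A\<^esub>),
     add = (\<lambda>(a1, a2, a3) (b1, b2, b3). (a1 \<oplus>\<^bsub>A\<^esub> b1, a2 \<oplus>\<^bsub>A\<^esub> b2, a3 \<oplus>\<^bsub>A\<^esub> b3)),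
     smult = (\<lambda>c (a1, a2, a3). (c \<odot>\<^bsub>A\<^esub> a1, c \<odot>\<^bsub>A\<^esub> a2, c \<odot>\<^bsub>A\<^esub> a3))\<rparr>"

lemma trunc_simps:
  "carrier (trunc A) = carrier A \<times> carrier A \<times> carrier A"
  "(a1, a2, a3) \<otimes>\<^bsub>trunc A\<^esub> (b1, b2, b3) = (\<zero>\<^bsub>A\<^esub>, a1 \<otimes>\<^bsub>A\<^esub> b1, a1 \<otimes>\<^bsub>A\<^esub> b2 \<oplus>\<^bsub>A\<^esub> a2 \<otimes>\<^bsub>A\<^esub> b1)"
  "(a1, a2, a3) \<oplus>\<^bsub>trunc A\<^esub> (b1, b2, b3) = (a1 \<oplus>\<^bsub>A\<^esub> b1, a2 \<oplus>\<^bsub>A\<^esub> b2, a3 \<oplus>\<^bsub>A\<^esub> b3)"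
  "c \<odot>\<^bsub>trunc A\<^esub> (a1, a2, a3) = (c \<odot>\<^bsub>A\<^esub> a1, c \<odot>\<^bsub>A\<^esub> a2, c \<odot>\<^bsub>A\<^esub> a3)"
  "\<zero>\<^bsub>trunc A\<^esub> = (\<zero>\<^bsub>A\<^esub>, \<zero>\<^bsub>A\<^esub>, \<zero>\<^bsub>A\<^esub>)"
  by (simp_all add: trunc_def)

context nalg
begin

lemma add_left_comm: "\<lbrakk>x \<in> carrier A; y \<in> carrier A; z \<in> carrier A\<rbrakk> \<Longrightarrow> x \<oplus> (y \<oplus> z) = y \<oplus> (x \<oplus> z)"
  by (rule M.a_lcomm)

lemmas bilin = sm_add_left sm_add_right sm_sm mult_add_left mult_add_right mult_sm_left mult_sm_right

lemma is_algebra_trunc: "is_algebra (trunc A)"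
  by (rule is_algebraI) (auto simp: trunc_simps bilin add_assoc zero_add, simp_all add: add_comm add_left_comm)

text \<open>For a word of length 2 the coefficient of t cubed is the mixed term
  \<open>a1 i \<otimes> a2 j \<oplus> a2 i \<otimes> a1 j\<close>, which is not a word value in A.
  Polarisation writes it as a combination of the word values at a1 + a2, a1 and a2, so that
  identities of A can be applied to it.\<close>

lemma word_value_trunc:
  assumes "\<And>i. a1 i \<in> carrier A" "\<And>i. a2 i \<in> carrier A" "\<And>i. a3 i \<in> carrier A"
  shows "word_value (trunc A) (\<lambda>i. (a1 i, a2 i, a3 i)) w =
    (if wlen w = 1 then (word_value A a1 w, word_value A a2 w, word_value A a3 w)
     else if wlen w = 2 then (\<zero>, word_value A a1 w, word_value A (\<lambda>i. a1 i \<oplus> a2 i) w \<oplus>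
       ((-1) \<odot> word_value A a1 w \<oplus> (-1) \<odot> word_value A a2 w))
     else if wlen w = 3 then (\<zero>, \<zero>, word_value A a1 w) else (\<zero>, \<zero>, \<zero>))"
proof (induction w)
  case (Mul u v)
  have r: "range a1 \<subseteq> carrier A" "range a2 \<subseteq> carrier A" "range (\<lambda>i. a1 i \<oplus> a2 i) \<subseteq> carrier A" using assms by auto
  note cl = r[THEN word_value_closed]
  have len: "wlen u > 0" "wlen v > 0" by (rule wlen_pos)+
  show ?case
  proof (cases "wlen u = 1 \<and> wlen v = 1")
    case True
    then obtain i j where ij: "u = Var i" "v = Var j"
      using len by (cases u; cases v) (auto simp: wlen_pos dest: add_is_1[THEN iffD1] simp: wlen_pos[THEN less_imp_neq[THEN not_sym]])
    have "(a1 i \<oplus> a2 i) \<otimes> (a1 j \<oplus> a2 j) \<oplus> ((-1) \<odot> (a1 i \<otimes> a1 j) \<oplus> (-1) \<odot> (a2 i \<otimes> a2 j)) =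
      a1 i \<otimes> a2 j \<oplus> a2 i \<otimes> a1 j" (is "?l = ?r")
    proof -
      have "?l = ((-1) \<odot> (a1 i \<otimes> a1 j) \<oplus> a1 i \<otimes> a1 j) \<oplus> (((-1) \<odot> (a2 i \<otimes> a2 j) \<oplus> a2 i \<otimes> a2 j) \<oplus> ?r)"
        using assms by (simp add: bilin add_assoc add_comm add_left_comm del: sm_minus_one_add)
      then show ?thesis using assms by (simp add: zero_add)
    qed
    then show ?thesis using assms by (simp add: ij trunc_simps)
  next
    case False
    then show ?thesis using Mul.IH len cl assms by (auto simp: trunc_simps zero_add M.r_zero split: if_splits)
  qed
qed simp

lemma finsum_smult_add:
  assumes "f \<in> S \<rightarrow> carrier A" "g \<in> S \<rightarrow> carrier A" "finite S"
  shows "(\<Oplus>w\<in>S. c w \<odot> (f w \<oplus> g w)) = (\<Oplus>w\<in>S. c w \<odot> f w) \<oplus> (\<Oplus>w\<in>S. c w \<odot> g w)"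
proof -
  have "(\<Oplus>w\<in>S. c w \<odot> (f w \<oplus> g w)) = (\<Oplus>w\<in>S. c w \<odot> f w \<oplus> c w \<odot> g w)"
    using assms by (intro M.finsum_cong') (auto simp: Pi_iff sm_add_right)
  also have "\<dots> = (\<Oplus>w\<in>S. c w \<odot> f w) \<oplus> (\<Oplus>w\<in>S. c w \<odot> g w)"
    using assms by (intro M.finsum_addf) (auto simp: Pi_iff)
  finally show ?thesis .
qed

lemma finsum_smult_smult:
  assumes "f \<in> S \<rightarrow> carrier A" "finite S"
  shows "(\<Oplus>w\<in>S. c w \<odot> (d \<odot> f w)) = d \<odot> (\<Oplus>w\<in>S. c w \<odot> f w)"
proof -
  have "d \<odot> (\<Oplus>w\<in>S. c w \<odot> f w) = (\<Oplus>w\<in>S. d \<odot> (c w \<odot> f w))"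
    using assms M.finsum_smult_ldistr[of S d "\<lambda>w. c w \<odot> f w"] by (auto simp: field_ring_def Pi_iff)
  also have "\<dots> = (\<Oplus>w\<in>S. c w \<odot> (d \<odot> f w))"
    using assms by (intro M.finsum_cong') (auto simp: Pi_iff sm_sm mult.commute)
  finally show ?thesis ..
qed

text \<open>All words of a homogeneous p have one length n. For fixed n each coordinate of the value
  of p is zero or a combination of values of the same p in A, taken at a1, a2, a3 or a1 + a2, and
  all of these vanish. With words of several lengths a coordinate would see only a part of
  p.\<close>

lemma is_identity_trunc:
  assumes "homogeneous p" "is_identity A p"
  shows "is_identity (trunc A) p"
  unfolding is_identity_def
proof (intro allI impI)
  interpret N: nalg "trunc A" by (rule nalg.intro[OF is_algebra_trunc])
  fix a :: "nat \<Rightarrow> _" assume a: "range a \<subseteq> carrier (trunc A)"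
  define a1 a2 a3 where "a1 i = fst (a i)" and "a2 i = fst (snd (a i))" and "a3 i = snd (snd (a i))" for i
  have aeq: "a = (\<lambda>i. (a1 i, a2 i, a3 i))" by (simp add: a1_def a2_def a3_def)
  have ai: "a1 i \<in> carrier A" "a2 i \<in> carrier A" "a3 i \<in> carrier A" for i
  proof -
    have "a i \<in> carrier (trunc A)" using a by auto
    then show "a1 i \<in> carrier A" "a2 i \<in> carrier A" "a3 i \<in> carrier A"
      by (auto simp: trunc_simps a1_def a2_def a3_def mem_Times_iff)
  qed
  let ?S = "Poly_Mapping.keys p" and ?c = "Poly_Mapping.lookup p"
  have r: "range a1 \<subseteq> carrier A" "range a2 \<subseteq> carrier A" "range a3 \<subseteq> carrier A" "range (\<lambda>i. a1 i \<oplus> a2 i) \<subseteq> carrier A"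
    using ai by auto
  have z: "poly_value A b p = \<zero>" if "range b \<subseteq> carrier A" for b using assms(2) that by (simp add: is_identity_def)
  note z = r[THEN z, unfolded poly_value_def]
  have cl: "\<And>w. word_value (trunc A) a w \<in> carrier (trunc A)" using a by simp
  have lin: "f (poly_value (trunc A) a p) = (\<Oplus>w\<in>?S. ?c w \<odot> f (word_value (trunc A) a w))"
    if f: "f = fst \<or> f = (\<lambda>x. fst (snd x)) \<or> f = (\<lambda>x. snd (snd x))" for f
  proof -
    have s: "f (c \<odot>\<^bsub>trunc A\<^esub> x) = c \<odot> f x" if "x \<in> carrier (trunc A)" for x c
      using f by (cases x) (auto simp: trunc_simps)
    have cf: "f x \<in> carrier A" if "x \<in> carrier (trunc A)" for x
      using f that by (cases x) (auto simp: trunc_simps)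
    have "f (poly_value (trunc A) a p) = (\<Oplus>w\<in>?S. f (?c w \<odot>\<^bsub>trunc A\<^esub> word_value (trunc A) a w))"
      unfolding poly_value_def
    proof (rule linear_finsum[OF is_algebra_trunc alg])
      show "f \<zero>\<^bsub>trunc A\<^esub> = \<zero>" using f by (auto simp: trunc_simps)
      show "f (x \<oplus>\<^bsub>trunc A\<^esub> y) = f x \<oplus> f y" for x y using f by (cases x; cases y) (auto simp: trunc_simps)
    qed (use cf cl in auto)
    also have "\<dots> = (\<Oplus>w\<in>?S. ?c w \<odot> f (word_value (trunc A) a w))"
      using cf cl by (intro M.finsum_cong') (auto simp: s)
    finally show ?thesis .
  qed
  have wc: "word_value A b w \<in> carrier A" if "range b \<subseteq> carrier A" for b w using that by simp
  note wc = r[THEN wc]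
  have cong: "(\<Oplus>w\<in>?S. ?c w \<odot> f w) = (\<Oplus>w\<in>?S. ?c w \<odot> g w)"
    if "\<And>w. w \<in> ?S \<Longrightarrow> f w = g w" "\<And>w. g w \<in> carrier A" for f g
    using that by (intro M.finsum_cong') auto
  have "poly_value (trunc A) a p = (\<zero>, \<zero>, \<zero>)"
  proof (cases "?S = {}")
    case True
    then show ?thesis by (simp add: poly_value_def trunc_simps)
  next
    case False
    then obtain u where "u \<in> ?S" by blast
    define n where "n = wlen u"
    have n: "wlen w = n" if "w \<in> ?S" for w
      using wlen_homogeneous[OF assms(1) that \<open>u \<in> ?S\<close>] by (simp add: n_def)
    have wv: "word_value (trunc A) a w = word_value (trunc A) (\<lambda>i. (a1 i, a2 i, a3 i)) w" for w
      by (simp add: aeq)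
    note wv = wv[unfolded word_value_trunc[of a1 a2 a3, OF ai]]
    have "fst (poly_value (trunc A) a p) = \<zero>"
    proof -
      have "fst (poly_value (trunc A) a p) = (\<Oplus>w\<in>?S. ?c w \<odot> (if n = 1 then word_value A a1 w else \<zero>))"
        unfolding lin[of fst, simplified] by (rule cong) (auto simp: wv n wc)
      then show ?thesis using z by (cases "n = 1") (simp_all add: M.finsum_zero)
    qed
    moreover have "fst (snd (poly_value (trunc A) a p)) = \<zero>"
    proof -
      have "fst (snd (poly_value (trunc A) a p)) = (\<Oplus>w\<in>?S. ?c w \<odot>
          (if n = 1 then word_value A a2 w else if n = 2 then word_value A a1 w else \<zero>))"
        unfolding lin[of "\<lambda>x. fst (snd x)", simplified] by (rule cong) (auto simp: wv n wc)
      then show ?thesis using z by (cases "n = 1"; cases "n = 2") (simp_all add: M.finsum_zero)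
    qed
    moreover have "snd (snd (poly_value (trunc A) a p)) = \<zero>"
    proof -
      have "snd (snd (poly_value (trunc A) a p)) = (\<Oplus>w\<in>?S. ?c w \<odot>
          (if n = 1 then word_value A a3 w else if n = 2 then word_value A (\<lambda>i. a1 i \<oplus> a2 i) w \<oplus>
             ((-1) \<odot> word_value A a1 w \<oplus> (-1) \<odot> word_value A a2 w)
           else if n = 3 then word_value A a1 w else \<zero>))"
        unfolding lin[of "\<lambda>x. snd (snd x)", simplified] by (rule cong) (auto simp: wv n wc)
      moreover have "(\<Oplus>w\<in>?S. ?c w \<odot> (word_value A (\<lambda>i. a1 i \<oplus> a2 i) w \<oplus>
             ((-1) \<odot> word_value A a1 w \<oplus> (-1) \<odot> word_value A a2 w))) = \<zero>"
        using wc z by (simp add: finsum_smult_add finsum_smult_smult Pi_iff)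
      ultimately show ?thesis using z
        by (cases "n = 1"; cases "n = 2"; cases "n = 3") (simp_all add: M.finsum_zero)
    qed
    ultimately show ?thesis by (simp add: prod_eq_iff)
  qed
  then show "poly_value (trunc A) a p = \<zero>\<^bsub>trunc A\<^esub>" by (simp add: trunc_simps)
qed

end

lemma (in nvariety) vmember_trunc: "A \<in> V \<Longrightarrow> vmember (trunc A)"
proof -
  assume A: "A \<in> V"
  interpret A: nalg A using A by (rule V_nalg)
  \<comment> \<open>A triple is named by the formal sum of three generators, so \<open>code\<close>
    embeds triples into \<open>'u\<close> as well.\<close>
  have "inj (\<lambda>(a, b, c). code (TAdd (TGen (0, a)) (TAdd (TGen (0, b)) (TGen (0, c)))))"
    using inj_code by (auto simp: inj_def)
  then have "\<exists>c :: 'u \<times> 'u \<times> 'u \<Rightarrow> 'u. inj_on c (carrier (trunc A))"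
    by (meson inj_on_subset subset_UNIV)
  then show ?thesis
    using A A.is_identity_trunc A.is_algebra_trunc homog by (auto simp: vmember_def V_eq variety_def)
qed

section \<open>Rebracketing words of degree 3\<close>

definition opA :: "('k::field, 'u) module \<Rightarrow> bool \<Rightarrow> 'u \<Rightarrow> 'u \<Rightarrow> 'u" where
  "opA A e a b = (if e then b \<otimes>\<^bsub>A\<^esub> a else a \<otimes>\<^bsub>A\<^esub> b)"

text \<open>The four words have a as outermost factor, on either side of the product of b and c in
  either order. In \<open>k g h\<close> the first index belongs to the outer operation, the second
  to the inner one.\<close>

definition rcomb :: "('k::field, 'u) module \<Rightarrow> (bool \<Rightarrow> bool \<Rightarrow> 'k) \<Rightarrow> 'u \<Rightarrow> 'u \<Rightarrow> 'u \<Rightarrow> 'u" where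
  "rcomb A k a b c =
     (k False False \<odot>\<^bsub>A\<^esub> opA A False a (opA A False b c) \<oplus>\<^bsub>A\<^esub> k False True \<odot>\<^bsub>A\<^esub> opA A False a (opA A True b c)) \<oplus>\<^bsub>A\<^esub>
     (k True False \<odot>\<^bsub>A\<^esub> opA A True a (opA A False b c) \<oplus>\<^bsub>A\<^esub> k True True \<odot>\<^bsub>A\<^esub> opA A True a (opA A True b c))"

text \<open>All indices from 2 on receive c, so that the total assignment stays inside the
  carrier.\<close>

definition assign3 :: "'u \<Rightarrow> 'u \<Rightarrow> 'u \<Rightarrow> nat \<Rightarrow> 'u" where
  "assign3 a b c i = (if i = 0 then a else if i = 1 then b else c)"

context nalg
begin

lemma opA_closed [simp]: "\<lbrakk>a \<in> carrier A; b \<in> carrier A\<rbrakk> \<Longrightarrow> opA A e a b \<in> carrier A"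
  by (simp add: opA_def)

lemma opA_zero [simp]: "a \<in> carrier A \<Longrightarrow> opA A e a \<zero> = \<zero>" "a \<in> carrier A \<Longrightarrow> opA A e \<zero> a = \<zero>"
  by (simp_all add: opA_def)

lemma opA_add:
  assumes "a \<in> carrier A" "b \<in> carrier A" "c \<in> carrier A"
  shows "opA A e a (b \<oplus> c) = opA A e a b \<oplus> opA A e a c" "opA A e (a \<oplus> b) c = opA A e a c \<oplus> opA A e b c"
  using assms by (simp_all add: opA_def bilin)

lemma opA_smult:
  assumes "a \<in> carrier A" "b \<in> carrier A"
  shows "opA A e a (k \<odot> b) = k \<odot> opA A e a b" "opA A e (k \<odot> a) b = k \<odot> opA A e a b"
  using assms by (simp_all add: opA_def bilin)

lemma rcomb_closed [simp]: "\<lbrakk>a \<in> carrier A; b \<in> carrier A; c \<in> carrier A\<rbrakk> \<Longrightarrow> rcomb A k a b c \<in> carrier A"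
  by (simp add: rcomb_def)

lemmas ac = add_assoc add_comm add_left_comm

lemma rcomb_add: "\<lbrakk>a \<in> carrier A; b \<in> carrier A; c \<in> carrier A\<rbrakk> \<Longrightarrow>
    rcomb A k a b c \<oplus> rcomb A l a b c = rcomb A (\<lambda>g h. k g h + l g h) a b c"
  by (simp add: rcomb_def bilin ac)

lemma rcomb_smult: "\<lbrakk>a \<in> carrier A; b \<in> carrier A; c \<in> carrier A\<rbrakk> \<Longrightarrow>
    d \<odot> rcomb A k a b c = rcomb A (\<lambda>g h. d * k g h) a b c"
  by (simp add: rcomb_def bilin)

lemma rcomb_zero: "\<lbrakk>a \<in> carrier A; b \<in> carrier A; c \<in> carrier A\<rbrakk> \<Longrightarrow> rcomb A (\<lambda>g h. 0) a b c = \<zero>"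
  by (simp add: rcomb_def zero_add)

lemma trunc_proj:
  "fst (x \<oplus>\<^bsub>trunc A\<^esub> y) = fst x \<oplus> fst y" "fst (snd (x \<oplus>\<^bsub>trunc A\<^esub> y)) = fst (snd x) \<oplus> fst (snd y)"
  "snd (snd (x \<oplus>\<^bsub>trunc A\<^esub> y)) = snd (snd x) \<oplus> snd (snd y)"
  "fst (c \<odot>\<^bsub>trunc A\<^esub> x) = c \<odot> fst x" "fst (snd (c \<odot>\<^bsub>trunc A\<^esub> x)) = c \<odot> fst (snd x)"
  "snd (snd (c \<odot>\<^bsub>trunc A\<^esub> x)) = c \<odot> snd (snd x)"
  "fst (x \<otimes>\<^bsub>trunc A\<^esub> y) = \<zero>" "fst (snd (x \<otimes>\<^bsub>trunc A\<^esub> y)) = fst x \<otimes> fst y"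
  "snd (snd (x \<otimes>\<^bsub>trunc A\<^esub> y)) = fst x \<otimes> fst (snd y) \<oplus> fst (snd x) \<otimes> fst y"
  by (cases x; cases y; simp add: trunc_simps)+

lemma add_zero [simp]: "x \<in> carrier A \<Longrightarrow> x \<oplus> \<zero> = x"
  by (rule M.r_zero)

lemma zero_in [simp]: "\<zero> \<in> carrier A"
  by (rule M.zero_closed)

lemma add_in [simp]: "\<lbrakk>x \<in> carrier A; y \<in> carrier A\<rbrakk> \<Longrightarrow> x \<oplus> y \<in> carrier A"
  by (rule M.a_closed)

lemma trunc_closed:
  "x \<in> carrier (trunc A) \<Longrightarrow> fst x \<in> carrier A" "x \<in> carrier (trunc A) \<Longrightarrow> fst (snd x) \<in> carrier A"
  "x \<in> carrier (trunc A) \<Longrightarrow> snd (snd x) \<in> carrier A"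
  by (auto simp: trunc_simps)

end

locale cosmash_variety = nvariety I V code
  for I :: "'k::field napoly set" and V :: "('k, 'u) module set" and code :: "('k, nat \<times> 'u) alg_term \<Rightarrow> 'u" +
  assumes assoc: "cosmash_associative (alg_category V)"
begin

lemma copS_cyc_induct [consumes 2, case_names left right zero add smult mult]:
  assumes "x \<in> carrier (copS [cyc False, Y])" and Y: "Y \<in> V"
    and "P (copI [cyc False, Y] 0 (cgen False))" "\<And>y. y \<in> carrier Y \<Longrightarrow> P (copI [cyc False, Y] 1 y)"
    and "P \<zero>\<^bsub>copS [cyc False, Y]\<^esub>"
    and "\<And>x y. \<lbrakk>x \<in> carrier (copS [cyc False, Y]); y \<in> carrier (copS [cyc False, Y]); P x; P y\<rbrakk> \<Longrightarrow> P (x \<oplus>\<^bsub>copS [cyc False, Y]\<^esub> y)"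
    and "\<And>c x. \<lbrakk>x \<in> carrier (copS [cyc False, Y]); P x\<rbrakk> \<Longrightarrow> P (c \<odot>\<^bsub>copS [cyc False, Y]\<^esub> x)"
    and "\<And>x y. \<lbrakk>x \<in> carrier (copS [cyc False, Y]); y \<in> carrier (copS [cyc False, Y]); P x; P y\<rbrakk> \<Longrightarrow> P (x \<otimes>\<^bsub>copS [cyc False, Y]\<^esub> y)"
  shows "P x"
proof (rule copS2_induct[OF assms(1)])
  note h = alg_hom_ahom[OF inj2(1)[OF cyc_in_V Y]]
  note cl = alg_hom_closed[OF inj2(1)[OF cyc_in_V Y]]
  fix y assume "y \<in> carrier (cyc False)"
  then show "P (copI [cyc False, Y] 0 y)"
    by (induction rule: cyc_induct)
      (use assms cl in \<open>simp_all add: ahom_add[OF h] ahom_smult[OF h] ahom_mult[OF h] ahom_zero[OF V_alg[OF cyc_in_V] V_alg[OF copS_in_V] h]\<close>)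
qed (use assms in auto)

abbreviation FF where "FF \<equiv> copS [cyc False, cyc False]"

text \<open>\<psi> is the substitution of b t and c t for the two generators of the free algebra
  \<open>FF\<close>, with values in the truncated tensor product.\<close>

definition spec2 :: "('k, 'u) module \<Rightarrow> 'u \<Rightarrow> 'u \<Rightarrow> ('u \<Rightarrow> 'u \<times> 'u \<times> 'u) \<Rightarrow> bool" where
  "spec2 A b c \<psi> \<longleftrightarrow> A \<in> V \<and> b \<in> carrier A \<and> c \<in> carrier A \<and> ahom FF (trunc A) \<psi> \<and>
     \<psi> (copI [cyc False, cyc False] 0 (cgen False)) = (b, \<zero>\<^bsub>A\<^esub>, \<zero>\<^bsub>A\<^esub>) \<and>
     \<psi> (copI [cyc False, cyc False] 1 (cgen False)) = (c, \<zero>\<^bsub>A\<^esub>, \<zero>\<^bsub>A\<^esub>)"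

lemma FF_induct [consumes 1, case_names left right zero add smult mult]:
  assumes "x \<in> carrier FF"
    and "P (copI [cyc False, cyc False] 0 (cgen False))" "P (copI [cyc False, cyc False] 1 (cgen False))"
    and "P \<zero>\<^bsub>FF\<^esub>"
    and "\<And>x y. \<lbrakk>x \<in> carrier FF; y \<in> carrier FF; P x; P y\<rbrakk> \<Longrightarrow> P (x \<oplus>\<^bsub>FF\<^esub> y)"
    and "\<And>c x. \<lbrakk>x \<in> carrier FF; P x\<rbrakk> \<Longrightarrow> P (c \<odot>\<^bsub>FF\<^esub> x)"
    and "\<And>x y. \<lbrakk>x \<in> carrier FF; y \<in> carrier FF; P x; P y\<rbrakk> \<Longrightarrow> P (x \<otimes>\<^bsub>FF\<^esub> y)"
  shows "P x"
proof (rule copS_cyc_induct[OF assms(1) cyc_in_V])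
  note h = alg_hom_ahom[OF inj2(2)[OF cyc_in_V cyc_in_V], unfolded One_nat_def]
  note cl = alg_hom_closed[OF inj2(2)[OF cyc_in_V cyc_in_V], unfolded One_nat_def]
  fix y assume "y \<in> carrier (cyc False)"
  then show "P (copI [cyc False, cyc False] 1 y)"
    by (induction rule: cyc_induct)
      (use assms cl in \<open>simp_all add: ahom_add[OF h] ahom_smult[OF h] ahom_mult[OF h] ahom_zero[OF V_alg[OF cyc_in_V] V_alg[OF copS_in_V] h]\<close>)
qed (use assms in auto)

lemma spec2D:
  assumes "spec2 A b c \<psi>"
  shows "A \<in> V" "b \<in> carrier A" "c \<in> carrier A" "ahom FF (trunc A) \<psi>"
      "\<psi> (copI [cyc False, cyc False] 0 (cgen False)) = (b, \<zero>\<^bsub>A\<^esub>, \<zero>\<^bsub>A\<^esub>)"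
      "\<psi> (copI [cyc False, cyc False] (Suc 0) (cgen False)) = (c, \<zero>\<^bsub>A\<^esub>, \<zero>\<^bsub>A\<^esub>)"
      "\<psi> \<zero>\<^bsub>FF\<^esub> = (\<zero>\<^bsub>A\<^esub>, \<zero>\<^bsub>A\<^esub>, \<zero>\<^bsub>A\<^esub>)"
      "x \<in> carrier FF \<Longrightarrow> \<psi> x \<in> carrier (trunc A)"
  using assms ahom_zero[OF V_alg[OF copS_in_V] nalg.is_algebra_trunc[OF V_nalg]]
  by (auto simp: spec2_def trunc_simps(5) dest: ahom_closed)

text \<open>The four scalars have to serve all algebras and all substitutions at once. The degree 2
  terms in one variable alone are not computed: they are taken from the substitutions in which the
  other variable is zero, and these disappear on the cosmash product.\<close>

definition value2 :: "'k \<Rightarrow> 'k \<Rightarrow> 'k \<Rightarrow> 'k \<Rightarrow> 'u \<Rightarrow> bool" where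
  "value2 \<alpha> \<beta> \<gamma> \<delta> x \<longleftrightarrow> (\<forall>A b c \<psi> \<psi>b \<psi>c. spec2 A b c \<psi> \<and> spec2 A b \<zero>\<^bsub>A\<^esub> \<psi>b \<and> spec2 A \<zero>\<^bsub>A\<^esub> c \<psi>c \<longrightarrow>
     fst (\<psi> x) = \<alpha> \<odot>\<^bsub>A\<^esub> b \<oplus>\<^bsub>A\<^esub> \<beta> \<odot>\<^bsub>A\<^esub> c \<and> fst (\<psi>b x) = \<alpha> \<odot>\<^bsub>A\<^esub> b \<and> fst (\<psi>c x) = \<beta> \<odot>\<^bsub>A\<^esub> c \<and>
     fst (snd (\<psi> x)) = (fst (snd (\<psi>b x)) \<oplus>\<^bsub>A\<^esub> fst (snd (\<psi>c x))) \<oplus>\<^bsub>A\<^esub>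
        (\<gamma> \<odot>\<^bsub>A\<^esub> (b \<otimes>\<^bsub>A\<^esub> c) \<oplus>\<^bsub>A\<^esub> \<delta> \<odot>\<^bsub>A\<^esub> (c \<otimes>\<^bsub>A\<^esub> b)))"

lemma value2I:
  assumes "\<And>A b c \<psi> \<psi>b \<psi>c. \<lbrakk>nalg A; spec2 A b c \<psi>; spec2 A b \<zero>\<^bsub>A\<^esub> \<psi>b; spec2 A \<zero>\<^bsub>A\<^esub> c \<psi>c\<rbrakk> \<Longrightarrow>
     fst (\<psi> x) = \<alpha> \<odot>\<^bsub>A\<^esub> b \<oplus>\<^bsub>A\<^esub> \<beta> \<odot>\<^bsub>A\<^esub> c \<and> fst (\<psi>b x) = \<alpha> \<odot>\<^bsub>A\<^esub> b \<and> fst (\<psi>c x) = \<beta> \<odot>\<^bsub>A\<^esub> c \<and>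
     fst (snd (\<psi> x)) = (fst (snd (\<psi>b x)) \<oplus>\<^bsub>A\<^esub> fst (snd (\<psi>c x))) \<oplus>\<^bsub>A\<^esub>
        (\<gamma> \<odot>\<^bsub>A\<^esub> (b \<otimes>\<^bsub>A\<^esub> c) \<oplus>\<^bsub>A\<^esub> \<delta> \<odot>\<^bsub>A\<^esub> (c \<otimes>\<^bsub>A\<^esub> b))"
  shows "value2 \<alpha> \<beta> \<gamma> \<delta> x"
  unfolding value2_def
proof (intro allI impI, elim conjE)
  fix A b c \<psi> \<psi>b \<psi>c assume "spec2 A b c \<psi>" "spec2 A b \<zero>\<^bsub>A\<^esub> \<psi>b" "spec2 A \<zero>\<^bsub>A\<^esub> c \<psi>c"
  moreover from this have "nalg A" using spec2D(1) V_nalg by blast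
  ultimately show "fst (\<psi> x) = \<alpha> \<odot>\<^bsub>A\<^esub> b \<oplus>\<^bsub>A\<^esub> \<beta> \<odot>\<^bsub>A\<^esub> c \<and> fst (\<psi>b x) = \<alpha> \<odot>\<^bsub>A\<^esub> b \<and> fst (\<psi>c x) = \<beta> \<odot>\<^bsub>A\<^esub> c \<and>
     fst (snd (\<psi> x)) = (fst (snd (\<psi>b x)) \<oplus>\<^bsub>A\<^esub> fst (snd (\<psi>c x))) \<oplus>\<^bsub>A\<^esub>
        (\<gamma> \<odot>\<^bsub>A\<^esub> (b \<otimes>\<^bsub>A\<^esub> c) \<oplus>\<^bsub>A\<^esub> \<delta> \<odot>\<^bsub>A\<^esub> (c \<otimes>\<^bsub>A\<^esub> b))" using assms[of A b c \<psi> \<psi>b \<psi>c] by simp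
qed

lemma value2D:
  assumes "value2 \<alpha> \<beta> \<gamma> \<delta> x" "spec2 A b c \<psi>" "spec2 A b \<zero>\<^bsub>A\<^esub> \<psi>b" "spec2 A \<zero>\<^bsub>A\<^esub> c \<psi>c"
  shows "fst (\<psi> x) = \<alpha> \<odot>\<^bsub>A\<^esub> b \<oplus>\<^bsub>A\<^esub> \<beta> \<odot>\<^bsub>A\<^esub> c" "fst (\<psi>b x) = \<alpha> \<odot>\<^bsub>A\<^esub> b" "fst (\<psi>c x) = \<beta> \<odot>\<^bsub>A\<^esub> c"
     "fst (snd (\<psi> x)) = (fst (snd (\<psi>b x)) \<oplus>\<^bsub>A\<^esub> fst (snd (\<psi>c x))) \<oplus>\<^bsub>A\<^esub>
        (\<gamma> \<odot>\<^bsub>A\<^esub> (b \<otimes>\<^bsub>A\<^esub> c) \<oplus>\<^bsub>A\<^esub> \<delta> \<odot>\<^bsub>A\<^esub> (c \<otimes>\<^bsub>A\<^esub> b))"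
  using assms unfolding value2_def by blast+

lemma ex_value2: "x \<in> carrier FF \<Longrightarrow> \<exists>\<alpha> \<beta> \<gamma> \<delta>. value2 \<alpha> \<beta> \<gamma> \<delta> x"
proof (induction x rule: FF_induct)
  case left
  have "value2 1 0 0 0 (copI [cyc False, cyc False] 0 (cgen False))"
  proof (rule value2I)
    fix A b c \<psi> \<psi>b \<psi>c assume s: "spec2 A b c \<psi>" "spec2 A b \<zero>\<^bsub>A\<^esub> \<psi>b" "spec2 A \<zero>\<^bsub>A\<^esub> c \<psi>c" and "nalg A"
    then interpret A: nalg A by simp
    show "fst (\<psi> (copI [cyc False, cyc False] 0 (cgen False))) = 1 \<odot>\<^bsub>A\<^esub> b \<oplus>\<^bsub>A\<^esub> 0 \<odot>\<^bsub>A\<^esub> c \<and>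
      fst (\<psi>b (copI [cyc False, cyc False] 0 (cgen False))) = 1 \<odot>\<^bsub>A\<^esub> b \<and>
      fst (\<psi>c (copI [cyc False, cyc False] 0 (cgen False))) = 0 \<odot>\<^bsub>A\<^esub> c \<and>
      fst (snd (\<psi> (copI [cyc False, cyc False] 0 (cgen False)))) =
        (fst (snd (\<psi>b (copI [cyc False, cyc False] 0 (cgen False)))) \<oplus>\<^bsub>A\<^esub>
         fst (snd (\<psi>c (copI [cyc False, cyc False] 0 (cgen False))))) \<oplus>\<^bsub>A\<^esub>
        (0 \<odot>\<^bsub>A\<^esub> (b \<otimes>\<^bsub>A\<^esub> c) \<oplus>\<^bsub>A\<^esub> 0 \<odot>\<^bsub>A\<^esub> (c \<otimes>\<^bsub>A\<^esub> b))"
      using spec2D(2,3)[OF s(1)] by (simp add: s[THEN spec2D(5)])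
  qed
  then show ?case by blast
next
  case right
  have "value2 0 1 0 0 (copI [cyc False, cyc False] 1 (cgen False))"
  proof (rule value2I, goal_cases)
    case (1 A b c \<psi> \<psi>b \<psi>c)
    then interpret A: nalg A by simp
    note s = 1(2-4)
    show ?case using spec2D(2,3)[OF s(1)] by (simp add: s[THEN spec2D(6)])
  qed
  then show ?case by blast
next
  case zero
  have "value2 0 0 0 0 \<zero>\<^bsub>FF\<^esub>"
  proof (rule value2I, goal_cases)
    case (1 A b c \<psi> \<psi>b \<psi>c)
    then interpret A: nalg A by simp
    note s = 1(2-4)
    show ?case using spec2D(2,3)[OF s(1)] by (simp add: s[THEN spec2D(7)])
  qed
  then show ?case by blast
next
  case (add x y)
  then obtain \<alpha> \<beta> \<gamma> \<delta> \<alpha>' \<beta>' \<gamma>' \<delta>' where *: "value2 \<alpha> \<beta> \<gamma> \<delta> x" "value2 \<alpha>' \<beta>' \<gamma>' \<delta>' y" by blast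
  have "value2 (\<alpha> + \<alpha>') (\<beta> + \<beta>') (\<gamma> + \<gamma>') (\<delta> + \<delta>') (x \<oplus>\<^bsub>FF\<^esub> y)"
  proof (rule value2I, goal_cases)
    case (1 A b c \<psi> \<psi>b \<psi>c)
    then interpret A: nalg A by simp
    note s = 1(2-4)
    show ?case using spec2D(2,3)[OF s(1)] A.trunc_closed[OF spec2D(8)[OF s(2) add(1)]] A.trunc_closed[OF spec2D(8)[OF s(3) add(1)]]
        A.trunc_closed[OF spec2D(8)[OF s(2) add(2)]] A.trunc_closed[OF spec2D(8)[OF s(3) add(2)]]
      by (simp add: s[THEN spec2D(4), THEN ahom_add] add(1,2) A.trunc_proj value2D[OF *(1) s] value2D[OF *(2) s] A.bilin A.ac)
  qed
  then show ?case by blast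
next
  case (smult d x)
  then obtain \<alpha> \<beta> \<gamma> \<delta> where *: "value2 \<alpha> \<beta> \<gamma> \<delta> x" by blast
  have "value2 (d * \<alpha>) (d * \<beta>) (d * \<gamma>) (d * \<delta>) (d \<odot>\<^bsub>FF\<^esub> x)"
  proof (rule value2I, goal_cases)
    case (1 A b c \<psi> \<psi>b \<psi>c)
    then interpret A: nalg A by simp
    note s = 1(2-4)
    show ?case using spec2D(2,3)[OF s(1)] A.trunc_closed[OF spec2D(8)[OF s(2) smult(1)]] A.trunc_closed[OF spec2D(8)[OF s(3) smult(1)]]
      by (simp add: s[THEN spec2D(4), THEN ahom_smult] smult(1) A.trunc_proj value2D[OF * s] A.bilin A.ac)
  qed
  then show ?case by blast
next
  case (mult x y)
  then obtain \<alpha> \<beta> \<gamma> \<delta> \<alpha>' \<beta>' \<gamma>' \<delta>' where *: "value2 \<alpha> \<beta> \<gamma> \<delta> x" "value2 \<alpha>' \<beta>' \<gamma>' \<delta>' y" by blast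
  have "value2 0 0 (\<alpha> * \<beta>') (\<beta> * \<alpha>') (x \<otimes>\<^bsub>FF\<^esub> y)"
  proof (rule value2I, goal_cases)
    case (1 A b c \<psi> \<psi>b \<psi>c)
    then interpret A: nalg A by simp
    note s = 1(2-4)
    show ?case using spec2D(2,3)[OF s(1)] A.trunc_closed[OF spec2D(8)[OF s(2) mult(1)]] A.trunc_closed[OF spec2D(8)[OF s(3) mult(1)]]
        A.trunc_closed[OF spec2D(8)[OF s(2) mult(2)]] A.trunc_closed[OF spec2D(8)[OF s(3) mult(2)]]
      by (simp add: s[THEN spec2D(4), THEN ahom_mult] mult(1,2) A.trunc_proj value2D[OF *(1) s] value2D[OF *(2) s] A.bilin A.ac mult.commute)
  qed
  then show ?case by blast
qed

lemma ex_trunc_hom: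
  assumes "A \<in> V" "a \<in> carrier A"
  shows "\<exists>f. ahom (cyc False) (trunc A) f \<and> f (cgen False) = (a, \<zero>\<^bsub>A\<^esub>, \<zero>\<^bsub>A\<^esub>)"
proof -
  interpret A: nalg A using assms(1) by (rule V_nalg)
  show ?thesis using assms by (intro cyc_hom[OF vmember_trunc]) (auto simp: trunc_simps)
qed

text \<open>The substitutions with one variable set to zero can be chosen to factor through the
  retractions of the coproduct, which vanish at w. Only the two mixed terms of degree 2
  survive.\<close>

lemma spec2_ker2:
  assumes w: "w \<in> ker2 (cyc False) (cyc False)"
  shows "\<exists>\<gamma> \<delta>. \<forall>A b c \<psi>. spec2 A b c \<psi> \<longrightarrow> fst (\<psi> w) = \<zero>\<^bsub>A\<^esub> \<and>
     fst (snd (\<psi> w)) = \<gamma> \<odot>\<^bsub>A\<^esub> (b \<otimes>\<^bsub>A\<^esub> c) \<oplus>\<^bsub>A\<^esub> \<delta> \<odot>\<^bsub>A\<^esub> (c \<otimes>\<^bsub>A\<^esub> b)"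
proof -
  have wF: "w \<in> carrier FF" using w ker2_sub by blast
  obtain \<alpha> \<beta> \<gamma> \<delta> where *: "value2 \<alpha> \<beta> \<gamma> \<delta> w" using ex_value2[OF wF] by blast
  have "fst (\<psi> w) = \<zero>\<^bsub>A\<^esub> \<and> fst (snd (\<psi> w)) = \<gamma> \<odot>\<^bsub>A\<^esub> (b \<otimes>\<^bsub>A\<^esub> c) \<oplus>\<^bsub>A\<^esub> \<delta> \<odot>\<^bsub>A\<^esub> (c \<otimes>\<^bsub>A\<^esub> b)"
    if s: "spec2 A b c \<psi>" for A b c \<psi>
  proof -
    interpret A: nalg A using spec2D(1)[OF s] by (rule V_nalg)
    obtain f g where fg: "ahom (cyc False) (trunc A) f" "f (cgen False) = (b, \<zero>\<^bsub>A\<^esub>, \<zero>\<^bsub>A\<^esub>)"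
      "ahom (cyc False) (trunc A) g" "g (cgen False) = (c, \<zero>\<^bsub>A\<^esub>, \<zero>\<^bsub>A\<^esub>)"
      using ex_trunc_hom spec2D(1,2,3)[OF s] by metis
    note r = res[OF cyc_in_V cyc_in_V, unfolded One_nat_def]
    have z: "f \<zero>\<^bsub>cyc False\<^esub> = (\<zero>\<^bsub>A\<^esub>, \<zero>\<^bsub>A\<^esub>, \<zero>\<^bsub>A\<^esub>)" "g \<zero>\<^bsub>cyc False\<^esub> = (\<zero>\<^bsub>A\<^esub>, \<zero>\<^bsub>A\<^esub>, \<zero>\<^bsub>A\<^esub>)"
      using ahom_zero[OF V_alg[OF cyc_in_V] A.is_algebra_trunc fg(1)] ahom_zero[OF V_alg[OF cyc_in_V] A.is_algebra_trunc fg(3)]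
      by (simp_all add: trunc_simps)
    have sb: "spec2 A b \<zero>\<^bsub>A\<^esub> (\<lambda>x. f (res1 (cyc False) (cyc False) x))"
      using spec2D(1,2)[OF s] ahom_comp[OF alg_hom_ahom[OF r(1)] fg(1)] by (simp add: spec2_def r z fg)
    have sc: "spec2 A \<zero>\<^bsub>A\<^esub> c (\<lambda>x. g (res2 (cyc False) (cyc False) x))"
      using spec2D(1,3)[OF s] ahom_comp[OF alg_hom_ahom[OF r(2)] fg(3)] by (simp add: spec2_def r z fg)
    have w0: "res1 (cyc False) (cyc False) w = \<zero>\<^bsub>cyc False\<^esub>" "res2 (cyc False) (cyc False) w = \<zero>\<^bsub>cyc False\<^esub>"
      using w by (auto simp: ker2_def)
    note v = value2D[OF * s sb sc, unfolded w0 z fst_conv snd_conv]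
    show ?thesis using v(1,4) spec2D(2,3)[OF s] by (simp flip: v(2,3))
  qed
  then show ?thesis by blast
qed

abbreviation WW where "WW \<equiv> cosm (cyc False) (cyc False)"
abbreviation TT where "TT \<equiv> copS [cyc False, WW]"

lemma WW_in_V [simp]: "WW \<in> V"
  by (rule cosm_in_V[OF cyc_in_V cyc_in_V])

text \<open>The substitution a t, b t, c t on X + (Y \<diamond> Z): the generator of X goes to a t,
  and Y \<diamond> Z is mapped by \<psi>. In the application H is a map out of X + Y + Z composed
  with \<open>phi\<close>.\<close>

definition spec3 :: "('k, 'u) module \<Rightarrow> 'u \<Rightarrow> 'u \<Rightarrow> 'u \<Rightarrow> ('u \<Rightarrow> 'u \<times> 'u \<times> 'u) \<Rightarrow> ('u \<Rightarrow> 'u \<times> 'u \<times> 'u) \<Rightarrow> bool" where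
  "spec3 A a b c \<psi> H \<longleftrightarrow> spec2 A b c \<psi> \<and> a \<in> carrier A \<and> ahom TT (trunc A) H \<and>
     H (copI [cyc False, WW] 0 (cgen False)) = (a, \<zero>\<^bsub>A\<^esub>, \<zero>\<^bsub>A\<^esub>) \<and>
     (\<forall>w \<in> ker2 (cyc False) (cyc False). H (copI [cyc False, WW] (Suc 0) w) = \<psi> w)"

lemma spec3D:
  assumes "spec3 A a b c \<psi> H"
  shows "spec2 A b c \<psi>" "a \<in> carrier A" "ahom TT (trunc A) H"
      "H (copI [cyc False, WW] 0 (cgen False)) = (a, \<zero>\<^bsub>A\<^esub>, \<zero>\<^bsub>A\<^esub>)"
      "w \<in> ker2 (cyc False) (cyc False) \<Longrightarrow> H (copI [cyc False, WW] (Suc 0) w) = \<psi> w"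
      "H \<zero>\<^bsub>TT\<^esub> = (\<zero>\<^bsub>A\<^esub>, \<zero>\<^bsub>A\<^esub>, \<zero>\<^bsub>A\<^esub>)"
      "x \<in> carrier TT \<Longrightarrow> H x \<in> carrier (trunc A)"
  using assms ahom_zero[OF V_alg[OF copS_in_V] nalg.is_algebra_trunc[OF V_nalg]] spec2D(1)[of A b c \<psi>]
  by (auto simp: spec3_def trunc_simps(5) dest: ahom_closed)

text \<open>The zero homomorphism, which takes the place of \<psi> when b and c are zero.\<close>

definition zfun :: "('k, 'u) module \<Rightarrow> 'u \<Rightarrow> 'u \<times> 'u \<times> 'u" where
  "zfun A x = (\<zero>\<^bsub>A\<^esub>, \<zero>\<^bsub>A\<^esub>, \<zero>\<^bsub>A\<^esub>)"

text \<open>Degree 3 parts of the elements of the coproduct, up to terms in one of the summands.\<close>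

definition value3 :: "'k \<Rightarrow> 'k \<Rightarrow> 'k \<Rightarrow> (bool \<Rightarrow> bool \<Rightarrow> 'k) \<Rightarrow> 'u \<Rightarrow> bool" where
  "value3 \<mu> \<gamma> \<delta> k t \<longleftrightarrow> (\<forall>A a b c \<psi> H Ha Hw. spec3 A a b c \<psi> H \<and>
      spec3 A a \<zero>\<^bsub>A\<^esub> \<zero>\<^bsub>A\<^esub> (zfun A) Ha \<and> spec3 A \<zero>\<^bsub>A\<^esub> b c \<psi> Hw \<longrightarrow>
     fst (H t) = \<mu> \<odot>\<^bsub>A\<^esub> a \<and> fst (Ha t) = \<mu> \<odot>\<^bsub>A\<^esub> a \<and> fst (Hw t) = \<zero>\<^bsub>A\<^esub> \<and>
     fst (snd (H t)) = fst (snd (Ha t)) \<oplus>\<^bsub>A\<^esub> (\<gamma> \<odot>\<^bsub>A\<^esub> (b \<otimes>\<^bsub>A\<^esub> c) \<oplus>\<^bsub>A\<^esub> \<delta> \<odot>\<^bsub>A\<^esub> (c \<otimes>\<^bsub>A\<^esub> b)) \<and>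
     fst (snd (Hw t)) = \<gamma> \<odot>\<^bsub>A\<^esub> (b \<otimes>\<^bsub>A\<^esub> c) \<oplus>\<^bsub>A\<^esub> \<delta> \<odot>\<^bsub>A\<^esub> (c \<otimes>\<^bsub>A\<^esub> b) \<and>
     snd (snd (H t)) = (snd (snd (Ha t)) \<oplus>\<^bsub>A\<^esub> snd (snd (Hw t))) \<oplus>\<^bsub>A\<^esub> rcomb A k a b c)"

lemma value3I:
  assumes "\<And>A a b c \<psi> H Ha Hw. \<lbrakk>nalg A; spec3 A a b c \<psi> H; spec3 A a \<zero>\<^bsub>A\<^esub> \<zero>\<^bsub>A\<^esub> (zfun A) Ha; spec3 A \<zero>\<^bsub>A\<^esub> b c \<psi> Hw\<rbrakk> \<Longrightarrow>
     fst (H t) = \<mu> \<odot>\<^bsub>A\<^esub> a \<and> fst (Ha t) = \<mu> \<odot>\<^bsub>A\<^esub> a \<and> fst (Hw t) = \<zero>\<^bsub>A\<^esub> \<and>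
     fst (snd (H t)) = fst (snd (Ha t)) \<oplus>\<^bsub>A\<^esub> (\<gamma> \<odot>\<^bsub>A\<^esub> (b \<otimes>\<^bsub>A\<^esub> c) \<oplus>\<^bsub>A\<^esub> \<delta> \<odot>\<^bsub>A\<^esub> (c \<otimes>\<^bsub>A\<^esub> b)) \<and>
     fst (snd (Hw t)) = \<gamma> \<odot>\<^bsub>A\<^esub> (b \<otimes>\<^bsub>A\<^esub> c) \<oplus>\<^bsub>A\<^esub> \<delta> \<odot>\<^bsub>A\<^esub> (c \<otimes>\<^bsub>A\<^esub> b) \<and>
     snd (snd (H t)) = (snd (snd (Ha t)) \<oplus>\<^bsub>A\<^esub> snd (snd (Hw t))) \<oplus>\<^bsub>A\<^esub> rcomb A k a b c"
  shows "value3 \<mu> \<gamma> \<delta> k t"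
  unfolding value3_def
proof (intro allI impI, elim conjE, goal_cases)
  case (1 A a b c \<psi> H Ha Hw)
  then have "nalg A" using spec3D(1) spec2D(1) V_nalg by blast
  then show ?case using assms[of A a b c \<psi> H Ha Hw] 1 by simp
qed

lemma value3D:
  assumes "value3 \<mu> \<gamma> \<delta> k t" "spec3 A a b c \<psi> H" "spec3 A a \<zero>\<^bsub>A\<^esub> \<zero>\<^bsub>A\<^esub> (zfun A) Ha" "spec3 A \<zero>\<^bsub>A\<^esub> b c \<psi> Hw"
  shows "fst (H t) = \<mu> \<odot>\<^bsub>A\<^esub> a" "fst (Ha t) = \<mu> \<odot>\<^bsub>A\<^esub> a" "fst (Hw t) = \<zero>\<^bsub>A\<^esub>"
     "fst (snd (H t)) = fst (snd (Ha t)) \<oplus>\<^bsub>A\<^esub> (\<gamma> \<odot>\<^bsub>A\<^esub> (b \<otimes>\<^bsub>A\<^esub> c) \<oplus>\<^bsub>A\<^esub> \<delta> \<odot>\<^bsub>A\<^esub> (c \<otimes>\<^bsub>A\<^esub> b))"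
     "fst (snd (Hw t)) = \<gamma> \<odot>\<^bsub>A\<^esub> (b \<otimes>\<^bsub>A\<^esub> c) \<oplus>\<^bsub>A\<^esub> \<delta> \<odot>\<^bsub>A\<^esub> (c \<otimes>\<^bsub>A\<^esub> b)"
     "snd (snd (H t)) = (snd (snd (Ha t)) \<oplus>\<^bsub>A\<^esub> snd (snd (Hw t))) \<oplus>\<^bsub>A\<^esub> rcomb A k a b c"
  using assms unfolding value3_def by blast+

lemma ex_value3:
  assumes "t \<in> carrier TT"
  shows "\<exists>\<mu> \<gamma> \<delta> k. value3 \<mu> \<gamma> \<delta> k t"
  using assms WW_in_V
proof (induction t rule: copS_cyc_induct)
  case left
  have "value3 1 0 0 (\<lambda>_ _. 0) (copI [cyc False, WW] 0 (cgen False))"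
  proof (rule value3I, goal_cases)
    case (1 A a b c \<psi> H Ha Hw)
    then interpret A: nalg A by simp
    note s = 1(2-4)
    show ?case using spec2D(2,3)[OF spec3D(1)[OF s(1)]] spec3D(2)[OF s(1)]
      by (simp add: s[THEN spec3D(4)] A.rcomb_zero)
  qed
  then show ?case by blast
next
  case (right w)
  then have w: "w \<in> ker2 (cyc False) (cyc False)" by (simp add: carrier_cosm)
  obtain \<gamma> \<delta> where *: "\<And>A b c \<psi>. spec2 A b c \<psi> \<Longrightarrow> fst (\<psi> w) = \<zero>\<^bsub>A\<^esub> \<and>
     fst (snd (\<psi> w)) = \<gamma> \<odot>\<^bsub>A\<^esub> (b \<otimes>\<^bsub>A\<^esub> c) \<oplus>\<^bsub>A\<^esub> \<delta> \<odot>\<^bsub>A\<^esub> (c \<otimes>\<^bsub>A\<^esub> b)" using spec2_ker2[OF w] by blast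
  have wF: "w \<in> carrier FF" using w ker2_sub by blast
  have "value3 0 \<gamma> \<delta> (\<lambda>_ _. 0) (copI [cyc False, WW] 1 w)"
  proof (rule value3I, goal_cases)
    case (1 A a b c \<psi> H Ha Hw)
    then interpret A: nalg A by simp
    note s = 1(2-4)
    show ?case using spec2D(2,3)[OF spec3D(1)[OF s(1)]] spec3D(2)[OF s(1)] *[OF spec3D(1)[OF s(1)]]
        A.trunc_closed[OF spec2D(8)[OF spec3D(1)[OF s(1)] wF]]
      by (simp add: s[THEN spec3D(5), OF w] A.rcomb_zero zfun_def)
  qed
  then show ?case by blast
next
  case zero
  have "value3 0 0 0 (\<lambda>_ _. 0) \<zero>\<^bsub>TT\<^esub>"
  proof (rule value3I, goal_cases)
    case (1 A a b c \<psi> H Ha Hw)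
    then interpret A: nalg A by simp
    note s = 1(2-4)
    show ?case using spec2D(2,3)[OF spec3D(1)[OF s(1)]] spec3D(2)[OF s(1)]
      by (simp add: s[THEN spec3D(6)] A.rcomb_zero)
  qed
  then show ?case by blast
next
  case (add x y)
  then obtain \<mu> \<gamma> \<delta> k \<mu>' \<gamma>' \<delta>' k' where *: "value3 \<mu> \<gamma> \<delta> k x" "value3 \<mu>' \<gamma>' \<delta>' k' y" by blast
  have "value3 (\<mu> + \<mu>') (\<gamma> + \<gamma>') (\<delta> + \<delta>') (\<lambda>g h. k g h + k' g h) (x \<oplus>\<^bsub>TT\<^esub> y)"
  proof (rule value3I, goal_cases)
    case (1 A a b c \<psi> H Ha Hw)
    then interpret A: nalg A by simp
    note s = 1(2-4)
    note cl = spec2D(2,3)[OF spec3D(1)[OF s(1)]] spec3D(2)[OF s(1)]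
    show ?case using cl A.trunc_closed[OF spec3D(7)[OF s(2) add(1)]] A.trunc_closed[OF spec3D(7)[OF s(3) add(1)]]
        A.trunc_closed[OF spec3D(7)[OF s(2) add(2)]] A.trunc_closed[OF spec3D(7)[OF s(3) add(2)]]
      by (simp add: s[THEN spec3D(3), THEN ahom_add] add(1,2) A.trunc_proj value3D[OF *(1) s] value3D[OF *(2) s] A.bilin A.ac
        flip: A.rcomb_add)
  qed
  then show ?case by blast
next
  case (smult d x)
  then obtain \<mu> \<gamma> \<delta> k where *: "value3 \<mu> \<gamma> \<delta> k x" by blast
  have "value3 (d * \<mu>) (d * \<gamma>) (d * \<delta>) (\<lambda>g h. d * k g h) (d \<odot>\<^bsub>TT\<^esub> x)"
  proof (rule value3I, goal_cases)
    case (1 A a b c \<psi> H Ha Hw)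
    then interpret A: nalg A by simp
    note s = 1(2-4)
    note cl = spec2D(2,3)[OF spec3D(1)[OF s(1)]] spec3D(2)[OF s(1)]
    show ?case using cl A.trunc_closed[OF spec3D(7)[OF s(2) smult(1)]] A.trunc_closed[OF spec3D(7)[OF s(3) smult(1)]]
      by (simp add: s[THEN spec3D(3), THEN ahom_smult] smult(1) A.trunc_proj value3D[OF * s] A.bilin A.ac flip: A.rcomb_smult)
  qed
  then show ?case by blast
next
  case (mult x y)
  then obtain \<mu> \<gamma> \<delta> k \<mu>' \<gamma>' \<delta>' k' where *: "value3 \<mu> \<gamma> \<delta> k x" "value3 \<mu>' \<gamma>' \<delta>' k' y" by blast
  \<comment> \<open>In degree 3 the mixed part of a product pairs the multiple of a in one factor
    with the part in b and c of the other. So a is outermost, and g tells whether it stands on the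
    left (from x) or on the right (from y).\<close>
  define k'' where "k'' g h = (if g then \<mu>' * (if h then \<delta> else \<gamma>) else \<mu> * (if h then \<delta>' else \<gamma>'))" for g h
  have "value3 0 0 0 k'' (x \<otimes>\<^bsub>TT\<^esub> y)"
  proof (rule value3I, goal_cases)
    case (1 A a b c \<psi> H Ha Hw)
    then interpret A: nalg A by simp
    note s = 1(2-4)
    note cl = spec2D(2,3)[OF spec3D(1)[OF s(1)]] spec3D(2)[OF s(1)]
    show ?case using cl A.trunc_closed[OF spec3D(7)[OF s(2) mult(1)]] A.trunc_closed[OF spec3D(7)[OF s(3) mult(1)]]
        A.trunc_closed[OF spec3D(7)[OF s(2) mult(2)]] A.trunc_closed[OF spec3D(7)[OF s(3) mult(2)]]
      by (simp add: s[THEN spec3D(3), THEN ahom_mult] mult(1,2) A.trunc_proj value3D[OF *(1) s] value3D[OF *(2) s]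
        A.bilin A.ac rcomb_def opA_def k''_def mult.commute)
  qed
  then show ?case by blast
qed

text \<open>Surjectivity of \<open>\<Phi>\<close> on free algebras lets any variable of a multilinear word of degree 3
  be moved to the outside; homogeneity makes the resulting identity exact.\<close>

theorem multilinear_outside:
  assumes w: "\<And>i. i < 3 \<Longrightarrow> occurrences i w = 1" and len: "wlen w = 3"
  shows "\<exists>k. \<forall>A\<in>V. \<forall>a\<in>carrier A. \<forall>b\<in>carrier A. \<forall>c\<in>carrier A. word_value A (assign3 a b c) w = rcomb A k a b c"
proof -
  let ?F = "cyc False" let ?S = "copS [cyc False, cyc False, cyc False]" let ?g = "cgen False"
  let ?i = "copI [cyc False, cyc False, cyc False]"
  note FV = cyc_in_V[of False]
  note i3 = inj3[OF FV FV FV] 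
  define xs where "xs = assign3 (?i 0 ?g) (?i 1 ?g) (?i 2 ?g)"
  have xs: "range xs \<subseteq> carrier ?S"
    using alg_hom_closed[OF i3(1)] alg_hom_closed[OF i3(2)] alg_hom_closed[OF i3(3)] by (auto simp: xs_def assign3_def)
  define s where "s = word_value ?S xs w"
  interpret S: nalg ?S by (rule V_nalg[OF copS_in_V])
  have kill: "f s = \<zero>\<^bsub>copS Xs\<^esub>" if "ahom ?S (copS Xs) f" "f (xs i) = \<zero>\<^bsub>copS Xs\<^esub>" "i < 3" for f Xs i
  proof -
    interpret B: nalg "copS Xs" by (rule V_nalg[OF copS_in_V])
    have "f s = word_value (copS Xs) (f \<circ> xs) w"
      unfolding s_def by (rule ahom_word_value[OF S.alg that(1) xs])
    also have "\<dots> = \<zero>\<^bsub>copS Xs\<^esub>"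
      using that w[OF that(3)] xs by (intro B.word_value_zero[of _ i]) (auto dest: ahom_closed)
    finally show ?thesis .
  qed
  \<comment> \<open>Each of the three variables occurs in w, so setting any one generator to zero
    sends s to zero.\<close>
  have "s \<in> ker3 ?F ?F ?F"
    unfolding ker3_def
    using kill[OF alg_hom_ahom[OF res12(1)[OF FV FV FV]], of 2] kill[OF alg_hom_ahom[OF res13(1)[OF FV FV FV]], of 1]
      kill[OF alg_hom_ahom[OF res23(1)[OF FV FV FV]], of 0] xs
    by (simp add: s_def xs_def assign3_def res12[OF FV FV FV] res13[OF FV FV FV, unfolded One_nat_def] res23[OF FV FV FV])
  then obtain t where t: "t \<in> ker2 ?F WW" "phi ?F ?F ?F t = s"
    using phi_surjective[OF assoc FV FV FV] by blast
  then have tT: "t \<in> carrier TT" using ker2_sub by blast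
  obtain \<mu> \<gamma> \<delta> k where *: "value3 \<mu> \<gamma> \<delta> k t" using ex_value3[OF tT] by blast
  have "word_value A (assign3 a b c) w = rcomb A k a b c"
    if A: "A \<in> V" and abc: "a \<in> carrier A" "b \<in> carrier A" "c \<in> carrier A" for A a b c
  proof -
    interpret A: nalg A using A by (rule V_nalg)
    obtain fa where fa: "ahom ?F (trunc A) fa" "fa ?g = (a, \<zero>\<^bsub>A\<^esub>, \<zero>\<^bsub>A\<^esub>)" using ex_trunc_hom[OF A abc(1)] by blast
    obtain fb where fb: "ahom ?F (trunc A) fb" "fb ?g = (b, \<zero>\<^bsub>A\<^esub>, \<zero>\<^bsub>A\<^esub>)" using ex_trunc_hom[OF A abc(2)] by blast
    obtain fc where fc: "ahom ?F (trunc A) fc" "fc ?g = (c, \<zero>\<^bsub>A\<^esub>, \<zero>\<^bsub>A\<^esub>)" using ex_trunc_hom[OF A abc(3)] by blast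
    obtain h where h: "ahom ?S (trunc A) h" "h (?i 0 ?g) = fa ?g" "h (?i 1 ?g) = fb ?g" "h (?i 2 ?g) = fc ?g"
      using ex_cot3[OF vmember_trunc[OF A] FV FV FV fa(1) fb(1) fc(1)] by (metis cgen_in)
    define \<psi> where "\<psi> = (\<lambda>x. h (incl3 ?F ?F ?F x))"
    note q = incl3[OF FV FV FV] note p = phi[OF FV FV FV] note r = res[OF FV WW_in_V]
    have \<psi>: "spec2 A b c \<psi>"
      using A abc ahom_comp[OF alg_hom_ahom[OF q(1)] h(1)] h(3,4)
      by (simp add: spec2_def \<psi>_def q[unfolded One_nat_def] fb fc)
    have H: "spec3 A a b c \<psi> (\<lambda>x. h (phi ?F ?F ?F x))"
      using \<psi> abc ahom_comp[OF alg_hom_ahom[OF p(1)] h(1)] h(2)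
      by (simp add: spec3_def p[unfolded One_nat_def] fa \<psi>_def)
    have faz: "fa \<zero>\<^bsub>?F\<^esub> = (\<zero>\<^bsub>A\<^esub>, \<zero>\<^bsub>A\<^esub>, \<zero>\<^bsub>A\<^esub>)"
      using ahom_zero[OF V_alg[OF FV] A.is_algebra_trunc fa(1)] by (simp add: trunc_simps)
    have zb: "spec2 A \<zero>\<^bsub>A\<^esub> \<zero>\<^bsub>A\<^esub> (zfun A)"
      using A by (simp add: spec2_def zfun_def ahom_def trunc_simps)
    have Ha: "spec3 A a \<zero>\<^bsub>A\<^esub> \<zero>\<^bsub>A\<^esub> (zfun A) (\<lambda>x. fa (res1 ?F WW x))"
      using zb abc ahom_comp[OF alg_hom_ahom[OF r(1)] fa(1)]
      by (simp add: spec3_def r[unfolded One_nat_def] fa faz carrier_cosm, simp add: zfun_def)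
    have \<psi>W: "ahom WW (trunc A) \<psi>"
      using ahom_comp[OF cosm_in_V(2)[OF FV FV] spec2D(4)[OF \<psi>]] .
    have \<psi>z: "\<psi> \<zero>\<^bsub>WW\<^esub> = (\<zero>\<^bsub>A\<^esub>, \<zero>\<^bsub>A\<^esub>, \<zero>\<^bsub>A\<^esub>)"
      using ahom_zero[OF V_alg[OF WW_in_V] A.is_algebra_trunc \<psi>W] by (simp add: trunc_simps)
    have Hw: "spec3 A \<zero>\<^bsub>A\<^esub> b c \<psi> (\<lambda>x. \<psi> (res2 ?F WW x))"
      using \<psi> ahom_comp[OF alg_hom_ahom[OF r(2)] \<psi>W]
      by (simp add: spec3_def r[unfolded One_nat_def] \<psi>z carrier_cosm)
    have t0: "res1 ?F WW t = \<zero>\<^bsub>?F\<^esub>" "res2 ?F WW t = \<zero>\<^bsub>WW\<^esub>" using t(1) by (auto simp: ker2_def)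
    \<comment> \<open>The two correction terms in \<open>value3\<close> are evaluations through the
      retractions of X + (Y \<diamond> Z), which vanish at t. The coefficient of t cubed is
      therefore exactly the combination with a outermost.\<close>
    have "snd (snd (h s)) = rcomb A k a b c"
      using value3D(6)[OF * H Ha Hw] abc by (simp add: t(2) t0 faz \<psi>z)
    moreover have "h s = word_value (trunc A) (\<lambda>i. (assign3 a b c i, \<zero>\<^bsub>A\<^esub>, \<zero>\<^bsub>A\<^esub>)) w"
    proof -
      have "h \<circ> xs = (\<lambda>i. (assign3 a b c i, \<zero>\<^bsub>A\<^esub>, \<zero>\<^bsub>A\<^esub>))"
        using h by (auto simp: xs_def assign3_def fa fb fc fun_eq_iff)
      then show ?thesis using ahom_word_value[OF S.alg h(1) xs] by (simp add: s_def)
    qed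
    moreover have "\<dots> = (\<zero>\<^bsub>A\<^esub>, \<zero>\<^bsub>A\<^esub>, word_value A (assign3 a b c) w)"
      using abc by (subst A.word_value_trunc) (simp_all add: len assign3_def)
    ultimately show ?thesis by simp
  qed
  then show ?thesis by blast
qed

end

lemma opA_flip: "opA A e a b = opA A (\<not> e) b a"
  by (simp add: opA_def)

definition lcomb :: "('k::field, 'u) module \<Rightarrow> (bool \<Rightarrow> bool \<Rightarrow> 'k) \<Rightarrow> 'u \<Rightarrow> 'u \<Rightarrow> 'u \<Rightarrow> 'u" where
  "lcomb A k a b c =
     (k False False \<odot>\<^bsub>A\<^esub> opA A False (opA A False a b) c \<oplus>\<^bsub>A\<^esub> k False True \<odot>\<^bsub>A\<^esub> opA A False (opA A True a b) c) \<oplus>\<^bsub>A\<^esub>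
     (k True False \<odot>\<^bsub>A\<^esub> opA A True (opA A False a b) c \<oplus>\<^bsub>A\<^esub> k True True \<odot>\<^bsub>A\<^esub> opA A True (opA A True a b) c)"

text \<open>A word bracketed to the left has c outermost; read through the opposite outer operation
  it is a right-normed word in c, a, b. Facts about \<open>rcomb\<close> carry over by cyclic
  permutation.\<close>

lemma (in nalg) lcomb_eq:
  assumes "a \<in> carrier A" "b \<in> carrier A" "c \<in> carrier A"
  shows "lcomb A k a b c = rcomb A (\<lambda>e. k (\<not> e)) c a b"
  using assms by (simp add: rcomb_def lcomb_def opA_flip[of A True _ c] opA_flip[of A False _ c] ac)

context cosmash_variety
begin

definition opw where "opw e u v = (if e then Mul v u else Mul u v)"

lemma word_value_opw: "word_value A a (opw e u v) = opA A e (word_value A a u) (word_value A a v)"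
  by (simp add: opw_def opA_def)

lemma ex_reassoc: "\<exists>M. \<forall>A\<in>V. \<forall>a\<in>carrier A. \<forall>b\<in>carrier A. \<forall>c\<in>carrier A. \<forall>e f.
    opA A e (opA A f a b) c = rcomb A (M e f) a b c"
proof -
  have "\<exists>k. \<forall>A\<in>V. \<forall>a\<in>carrier A. \<forall>b\<in>carrier A. \<forall>c\<in>carrier A. opA A e (opA A f a b) c = rcomb A k a b c" for e f
  proof -
    have "wlen (opw e (opw f (Var 0) (Var 1)) (Var 2)) = 3" by (simp add: opw_def)
    moreover have "occurrences i (opw e (opw f (Var 0) (Var 1)) (Var 2)) = 1" if "i < 3" for i
      using that by (auto simp: opw_def numeral_3_eq_3 less_Suc_eq)
    ultimately show ?thesis
      using multilinear_outside[of "opw e (opw f (Var 0) (Var 1)) (Var 2)"] by (simp add: word_value_opw assign3_def)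
  qed
  then show ?thesis by metis
qed

lemma ex_reassoc': "\<exists>N. \<forall>A\<in>V. \<forall>a\<in>carrier A. \<forall>b\<in>carrier A. \<forall>c\<in>carrier A. \<forall>p q.
    opA A p a (opA A q b c) = lcomb A (N p q) a b c"
proof -
  have "\<exists>k. \<forall>A\<in>V. \<forall>a\<in>carrier A. \<forall>b\<in>carrier A. \<forall>c\<in>carrier A. opA A p a (opA A q b c) = lcomb A k a b c" for p q
  proof -
    \<comment> \<open>The variable moved outside is always \<open>Var 0\<close>, so c takes this
      index, and a and b become \<open>Var 1\<close> and \<open>Var 2\<close>.\<close>
    let ?w = "opw p (Var 1) (opw q (Var 2) (Var 0))"
    have "wlen ?w = 3" by (simp add: opw_def)
    moreover have "occurrences i ?w = 1" if "i < 3" for i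
      using that by (auto simp: opw_def numeral_3_eq_3 less_Suc_eq)
    ultimately obtain k where k: "\<And>A a b c. \<lbrakk>A \<in> V; a \<in> carrier A; b \<in> carrier A; c \<in> carrier A\<rbrakk> \<Longrightarrow>
        word_value A (assign3 a b c) ?w = rcomb A k a b c"
      using multilinear_outside[of ?w] by blast
    have "opA A p a (opA A q b c) = lcomb A (\<lambda>e. k (\<not> e)) a b c"
      if "A \<in> V" "a \<in> carrier A" "b \<in> carrier A" "c \<in> carrier A" for A a b c
      using k[OF that(1,4,2,3)] nalg.lcomb_eq[OF V_nalg[OF that(1)] that(2-4), of "\<lambda>e. k (\<not> e)"]
      by (simp add: word_value_opw assign3_def)
    then show ?thesis by blast
  qed
  then show ?thesis by metis
qed

text \<open>Chosen once for the whole variety, the coefficients become the 4 x 4 matrix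
  \<open>M\<close> of a basis change between left and right bracketings; \<open>reassoc_left\<close>
  is the candidate for its inverse \<open>N\<close>.\<close>

definition reassoc_right where "reassoc_right = (SOME M. \<forall>A\<in>V. \<forall>a\<in>carrier A. \<forall>b\<in>carrier A. \<forall>c\<in>carrier A. \<forall>e f.
    opA A e (opA A f a b) c = rcomb A (M e f) a b c)"
definition reassoc_left where "reassoc_left = (SOME N. \<forall>A\<in>V. \<forall>a\<in>carrier A. \<forall>b\<in>carrier A. \<forall>c\<in>carrier A. \<forall>p q.
    opA A p a (opA A q b c) = lcomb A (N p q) a b c)"

lemma reassoc: "\<lbrakk>A \<in> V; a \<in> carrier A; b \<in> carrier A; c \<in> carrier A\<rbrakk> \<Longrightarrow>
    opA A e (opA A f a b) c = rcomb A (reassoc_right e f) a b c"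
  using someI_ex[OF ex_reassoc, folded reassoc_right_def] by blast

lemma reassoc': "\<lbrakk>A \<in> V; a \<in> carrier A; b \<in> carrier A; c \<in> carrier A\<rbrakk> \<Longrightarrow>
    opA A p a (opA A q b c) = lcomb A (reassoc_left p q) a b c"
  using someI_ex[OF ex_reassoc', folded reassoc_left_def] by blast

section \<open>Independence of right-normed words\<close>

abbreviation KK where "KK \<equiv> cyc True"

lemma cyc_elem: "x \<in> carrier KK \<Longrightarrow> \<exists>c. x = c \<odot>\<^bsub>KK\<^esub> cgen True"
proof (induction x rule: cyc_induct)
  interpret K: nalg KK by (rule V_nalg[OF cyc_in_V])
  case gen
  show ?case by (rule exI[of _ 1]) simp
next
  interpret K: nalg KK by (rule V_nalg[OF cyc_in_V])
  case zero
  show ?case by (rule exI[of _ 0]) simp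
next
  interpret K: nalg KK by (rule V_nalg[OF cyc_in_V])
  case (add x y)
  then obtain c d where "x = c \<odot>\<^bsub>KK\<^esub> cgen True" "y = d \<odot>\<^bsub>KK\<^esub> cgen True" by blast
  then show ?case by (intro exI[of _ "c + d"]) (simp add: K.bilin)
next
  interpret K: nalg KK by (rule V_nalg[OF cyc_in_V])
  case (smult d x)
  then obtain c where "x = c \<odot>\<^bsub>KK\<^esub> cgen True" by blast
  then show ?case by (intro exI[of _ "d * c"]) (simp add: K.bilin)
next
  interpret K: nalg KK by (rule V_nalg[OF cyc_in_V])
  case (mult x y)
  then obtain c d where "x = c \<odot>\<^bsub>KK\<^esub> cgen True" "y = d \<odot>\<^bsub>KK\<^esub> cgen True" by blast
  then show ?case by (intro exI[of _ 0]) (simp add: K.bilin cgen_sq)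
qed

lemma cyc_mult_zero: "\<lbrakk>x \<in> carrier KK; y \<in> carrier KK\<rbrakk> \<Longrightarrow> x \<otimes>\<^bsub>KK\<^esub> y = \<zero>\<^bsub>KK\<^esub>"
proof -
  interpret K: nalg KK by (rule V_nalg[OF cyc_in_V])
  assume "x \<in> carrier KK" "y \<in> carrier KK"
  then show ?thesis using cyc_elem[of x] cyc_elem[of y] by (auto simp: K.bilin cgen_sq)
qed

text \<open>Let y generate \<open>KK\<close>, so y y = 0. The span E of all y g and g y contains KK
  \<diamond> G, because KK + G = K y + G + E and the retractions remove the first two parts.
  Rebracketing shows y E = 0 and that E absorbs G; hence a product of y h with an element v of E
  becomes y times elements of E, which is zero.\<close>

lemma cosm_mult_zero:
  assumes G: "G \<in> V" and w: "w \<in> ker2 KK G" "w' \<in> ker2 KK G"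
  shows "w \<otimes>\<^bsub>copS [KK, G]\<^esub> w' = \<zero>\<^bsub>copS [KK, G]\<^esub>"
proof -
  let ?B = "copS [KK, G]"
  have BV: "?B \<in> V" by (rule copS_in_V)
  interpret B: nalg ?B by (rule V_nalg[OF BV])
  interpret K: nalg KK by (rule V_nalg[OF cyc_in_V])
  interpret G: nalg G by (rule V_nalg[OF G])
  note i = inj2[OF cyc_in_V[of True] G, THEN alg_hom_ahom]
  define y where "y = copI [KK, G] 0 (cgen True)"
  have yB: "y \<in> carrier ?B" unfolding y_def by (rule ahom_closed[OF i(1) cgen_in])
  have yy: "opA ?B e y y = \<zero>\<^bsub>?B\<^esub>" for e
    using ahom_mult[OF i(1) cgen_in cgen_in] ahom_zero[OF K.alg B.alg i(1)] by (simp add: cgen_sq y_def opA_def)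
  define Gs where "Gs = copI [KK, G] 1 ` carrier G"
  have GsB: "g \<in> carrier ?B" if "g \<in> Gs" for g using that ahom_closed[OF i(2)] by (auto simp: Gs_def)
  have Gs: "\<zero>\<^bsub>?B\<^esub> \<in> Gs" "g \<oplus>\<^bsub>?B\<^esub> g' \<in> Gs" "c \<odot>\<^bsub>?B\<^esub> g \<in> Gs" "g \<otimes>\<^bsub>?B\<^esub> g' \<in> Gs" "opA ?B e g g' \<in> Gs"
    if gg: "g \<in> Gs" "g' \<in> Gs" for g g' c e
  proof -
    obtain u u' where u: "u \<in> carrier G" "u' \<in> carrier G" "g = copI [KK, G] 1 u" "g' = copI [KK, G] 1 u'"
      using gg by (auto simp: Gs_def)
    show "\<zero>\<^bsub>?B\<^esub> \<in> Gs" using ahom_zero[OF G.alg B.alg i(2)] by (force simp: Gs_def)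
    have GsI: "copI [KK, G] 1 x \<in> Gs" if "x \<in> carrier G" for x using that by (auto simp: Gs_def)
    show "g \<oplus>\<^bsub>?B\<^esub> g' \<in> Gs" using GsI[of "u \<oplus>\<^bsub>G\<^esub> u'"] u ahom_add[OF i(2) u(1,2)] by simp
    show "c \<odot>\<^bsub>?B\<^esub> g \<in> Gs" using GsI[of "c \<odot>\<^bsub>G\<^esub> u"] u ahom_smult[OF i(2) u(1)] by simp
    show a: "g \<otimes>\<^bsub>?B\<^esub> g' \<in> Gs" using GsI[of "u \<otimes>\<^bsub>G\<^esub> u'"] u ahom_mult[OF i(2) u(1,2)] by simp
    have "g' \<otimes>\<^bsub>?B\<^esub> g \<in> Gs" using GsI[of "u' \<otimes>\<^bsub>G\<^esub> u"] u ahom_mult[OF i(2) u(2,1)] by simp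
    then show "opA ?B e g g' \<in> Gs" using a by (simp add: opA_def)
  qed
  \<comment> \<open>One element of G on each side of y is enough, because both operations are linear
    in g.\<close>
  define E where "E = {opA ?B False y g \<oplus>\<^bsub>?B\<^esub> opA ?B True y g' |g g'. g \<in> Gs \<and> g' \<in> Gs}"
  have z: "\<zero>\<^bsub>?B\<^esub> \<in> Gs" using ahom_zero[OF G.alg B.alg i(2)] by (force simp: Gs_def)
  have EI: "opA ?B False y g \<oplus>\<^bsub>?B\<^esub> opA ?B True y g' \<in> E" if "g \<in> Gs" "g' \<in> Gs" for g g'
    using that by (auto simp: E_def)
  have E0: "\<zero>\<^bsub>?B\<^esub> \<in> E" using EI[OF z z] yB by simp
  have EB: "u \<in> carrier ?B" if "u \<in> E" for u using that yB GsB by (auto simp: E_def)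
  have Eadd: "u \<oplus>\<^bsub>?B\<^esub> v \<in> E" if uv: "u \<in> E" "v \<in> E" for u v
  proof -
    obtain g g' h h' where gh: "g \<in> Gs" "g' \<in> Gs" "u = opA ?B False y g \<oplus>\<^bsub>?B\<^esub> opA ?B True y g'"
      "h \<in> Gs" "h' \<in> Gs" "v = opA ?B False y h \<oplus>\<^bsub>?B\<^esub> opA ?B True y h'" using uv unfolding E_def by blast
    have "u \<oplus>\<^bsub>?B\<^esub> v = opA ?B False y (g \<oplus>\<^bsub>?B\<^esub> h) \<oplus>\<^bsub>?B\<^esub> opA ?B True y (g' \<oplus>\<^bsub>?B\<^esub> h')"
      using gh yB GsB by (simp add: B.opA_add B.ac)
    then show ?thesis using EI[of "g \<oplus>\<^bsub>?B\<^esub> h" "g' \<oplus>\<^bsub>?B\<^esub> h'"] gh Gs(2) by simp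
  qed
  have Esm: "c \<odot>\<^bsub>?B\<^esub> u \<in> E" if u: "u \<in> E" for u c
  proof -
    obtain g g' where gh: "g \<in> Gs" "g' \<in> Gs" "u = opA ?B False y g \<oplus>\<^bsub>?B\<^esub> opA ?B True y g'"
      using u unfolding E_def by blast
    have "c \<odot>\<^bsub>?B\<^esub> u = opA ?B False y (c \<odot>\<^bsub>?B\<^esub> g) \<oplus>\<^bsub>?B\<^esub> opA ?B True y (c \<odot>\<^bsub>?B\<^esub> g')"
      using gh yB GsB by (simp add: B.opA_smult B.sm_add_right)
    then show ?thesis using EI[of "c \<odot>\<^bsub>?B\<^esub> g" "c \<odot>\<^bsub>?B\<^esub> g'"] gh Gs(3) by simp
  qed
  have Eop: "opA ?B e y g \<in> E" if "g \<in> Gs" for e g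
    using EI[OF that z] EI[OF z that] yB GsB[OF that] by (cases e) simp_all
  \<comment> \<open>Moving the bracket to the left creates the factor y y.\<close>
  have ann: "opA ?B e y (opA ?B f y x) = \<zero>\<^bsub>?B\<^esub>" if "x \<in> carrier ?B" for e f x
    using reassoc'[OF BV yB yB that, of e f] that by (simp add: lcomb_def yy)
  have annE: "opA ?B e y u = \<zero>\<^bsub>?B\<^esub>" if "u \<in> E" for e u
    using that yB GsB unfolding E_def by (auto simp: B.opA_add ann)
  have lin_E: "rcomb ?B k y g h \<in> E" if "g \<in> Gs" "h \<in> Gs" for k g h
    unfolding rcomb_def using that by (intro Eadd Esm Eop Gs)
  have E_G: "opA ?B e u g \<in> E" if u: "u \<in> E" and g: "g \<in> Gs" for e u g
  proof -
    obtain h h' where gh: "h \<in> Gs" "h' \<in> Gs" "u = opA ?B False y h \<oplus>\<^bsub>?B\<^esub> opA ?B True y h'"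
      using u unfolding E_def by blast
    have "opA ?B e u g = rcomb ?B (reassoc_right e False) y h g \<oplus>\<^bsub>?B\<^esub> rcomb ?B (reassoc_right e True) y h' g"
      using gh g yB GsB by (simp add: B.opA_add reassoc[OF BV])
    then show ?thesis using gh g by (simp add: Eadd lin_E)
  qed
  have G_E: "opA ?B e g u \<in> E" if "u \<in> E" "g \<in> Gs" for e u g
    using E_G[OF that, of "\<not> e"] by (simp add: opA_flip[of ?B e g u])
  \<comment> \<open>Moving the bracket to the right turns (y h) v into y applied to products of h
    and v. These lie in E, which y annihilates.\<close>
  have E_E: "u \<otimes>\<^bsub>?B\<^esub> v = \<zero>\<^bsub>?B\<^esub>" if u: "u \<in> E" and v: "v \<in> E" for u v
  proof -
    obtain h h' where gh: "h \<in> Gs" "h' \<in> Gs" "u = opA ?B False y h \<oplus>\<^bsub>?B\<^esub> opA ?B True y h'"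
      using u unfolding E_def by blast
    have "opA ?B False u v = rcomb ?B (reassoc_right False False) y h v \<oplus>\<^bsub>?B\<^esub> rcomb ?B (reassoc_right False True) y h' v"
      using gh EB[OF v] yB GsB by (simp add: B.opA_add reassoc[OF BV])
    also have "\<dots> = \<zero>\<^bsub>?B\<^esub>" using gh v by (simp add: rcomb_def annE G_E)
    finally show ?thesis by (simp add: opA_def)
  qed
  have dec: "\<exists>c. \<exists>g\<in>Gs. \<exists>u\<in>E. b = (c \<odot>\<^bsub>?B\<^esub> y \<oplus>\<^bsub>?B\<^esub> g) \<oplus>\<^bsub>?B\<^esub> u" if "b \<in> carrier ?B" for b
    using that
  proof (induction b rule: copS2_induct)
    case (left x)
    then obtain c where "x = c \<odot>\<^bsub>KK\<^esub> cgen True" using cyc_elem by blast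
    then have "copI [KK, G] 0 x = (c \<odot>\<^bsub>?B\<^esub> y \<oplus>\<^bsub>?B\<^esub> \<zero>\<^bsub>?B\<^esub>) \<oplus>\<^bsub>?B\<^esub> \<zero>\<^bsub>?B\<^esub>"
      using yB by (simp add: y_def ahom_smult[OF i(1)])
    then show ?case using z E0 by blast
  next
    case (right x)
    then have g: "copI [KK, G] 1 x \<in> Gs" by (auto simp: Gs_def)
    have "copI [KK, G] 1 x = (0 \<odot>\<^bsub>?B\<^esub> y \<oplus>\<^bsub>?B\<^esub> copI [KK, G] 1 x) \<oplus>\<^bsub>?B\<^esub> \<zero>\<^bsub>?B\<^esub>"
      using yB GsB[OF g] by simp
    then show ?case using g E0 by blast
  next
    case zero
    have "\<zero>\<^bsub>?B\<^esub> = (0 \<odot>\<^bsub>?B\<^esub> y \<oplus>\<^bsub>?B\<^esub> \<zero>\<^bsub>?B\<^esub>) \<oplus>\<^bsub>?B\<^esub> \<zero>\<^bsub>?B\<^esub>" using yB by simp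
    then show ?case using z E0 by blast
  next
    case (add a b)
    then obtain c g u d h v where *: "g \<in> Gs" "u \<in> E" "a = (c \<odot>\<^bsub>?B\<^esub> y \<oplus>\<^bsub>?B\<^esub> g) \<oplus>\<^bsub>?B\<^esub> u"
      "h \<in> Gs" "v \<in> E" "b = (d \<odot>\<^bsub>?B\<^esub> y \<oplus>\<^bsub>?B\<^esub> h) \<oplus>\<^bsub>?B\<^esub> v" by blast
    have "a \<oplus>\<^bsub>?B\<^esub> b = ((c + d) \<odot>\<^bsub>?B\<^esub> y \<oplus>\<^bsub>?B\<^esub> (g \<oplus>\<^bsub>?B\<^esub> h)) \<oplus>\<^bsub>?B\<^esub> (u \<oplus>\<^bsub>?B\<^esub> v)"
      using * yB GsB EB by (simp add: B.bilin B.ac)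
    then show ?case using * Gs(2) Eadd by blast
  next
    case (smult d a)
    then obtain c g u where *: "g \<in> Gs" "u \<in> E" "a = (c \<odot>\<^bsub>?B\<^esub> y \<oplus>\<^bsub>?B\<^esub> g) \<oplus>\<^bsub>?B\<^esub> u" by blast
    have "d \<odot>\<^bsub>?B\<^esub> a = ((d * c) \<odot>\<^bsub>?B\<^esub> y \<oplus>\<^bsub>?B\<^esub> (d \<odot>\<^bsub>?B\<^esub> g)) \<oplus>\<^bsub>?B\<^esub> (d \<odot>\<^bsub>?B\<^esub> u)"
      using * yB GsB EB by (simp add: B.bilin)
    then show ?case using * Gs(3) Esm by blast
  next
    case (mult a b)
    then obtain c g u d h v where *: "g \<in> Gs" "u \<in> E" "a = (c \<odot>\<^bsub>?B\<^esub> y \<oplus>\<^bsub>?B\<^esub> g) \<oplus>\<^bsub>?B\<^esub> u"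
      "h \<in> Gs" "v \<in> E" "b = (d \<odot>\<^bsub>?B\<^esub> y \<oplus>\<^bsub>?B\<^esub> h) \<oplus>\<^bsub>?B\<^esub> v" by blast
    let ?r = "(c \<odot>\<^bsub>?B\<^esub> opA ?B False y h \<oplus>\<^bsub>?B\<^esub> d \<odot>\<^bsub>?B\<^esub> opA ?B True y g) \<oplus>\<^bsub>?B\<^esub> (opA ?B False g v \<oplus>\<^bsub>?B\<^esub> opA ?B False u h)"
    have r: "?r \<in> E" using * by (intro Eadd Esm Eop G_E E_G)
    have "y \<otimes>\<^bsub>?B\<^esub> v = \<zero>\<^bsub>?B\<^esub>" "u \<otimes>\<^bsub>?B\<^esub> y = \<zero>\<^bsub>?B\<^esub>" "y \<otimes>\<^bsub>?B\<^esub> y = \<zero>\<^bsub>?B\<^esub>"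
      using annE[OF *(5), of False] annE[OF *(2), of True] yy[of False] by (simp_all add: opA_def)
    then have "a \<otimes>\<^bsub>?B\<^esub> b = (0 \<odot>\<^bsub>?B\<^esub> y \<oplus>\<^bsub>?B\<^esub> g \<otimes>\<^bsub>?B\<^esub> h) \<oplus>\<^bsub>?B\<^esub> ?r"
      using * yB GsB EB E_E[OF *(2,5)] by (simp add: B.bilin B.ac opA_def)
    then show ?case using * Gs(4) r by blast
  qed
  \<comment> \<open>The first retraction reads off the coefficient of y, the second the component in
    G; both are zero for w.\<close>
  have ker_E: "w \<in> E" if w: "w \<in> ker2 KK G" for w
  proof -
    have wB: "w \<in> carrier ?B" and w0: "res1 KK G w = \<zero>\<^bsub>KK\<^esub>" "res2 KK G w = \<zero>\<^bsub>G\<^esub>"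
      using w by (auto simp: ker2_def)
    obtain c g u where *: "g \<in> Gs" "u \<in> E" "w = (c \<odot>\<^bsub>?B\<^esub> y \<oplus>\<^bsub>?B\<^esub> g) \<oplus>\<^bsub>?B\<^esub> u" using dec[OF wB] by blast
    obtain g0 where g0: "g0 \<in> carrier G" "g = copI [KK, G] 1 g0" using *(1) by (auto simp: Gs_def)
    note r = res[OF cyc_in_V[of True] G]
    note r1 = alg_hom_ahom[OF r(1)] and r2 = alg_hom_ahom[OF r(2)]
    have hop: "f (opA ?B e p q) = opA A' e (f p) (f q)" if "ahom ?B A' f" "p \<in> carrier ?B" "q \<in> carrier ?B" for f e p q and A' :: "('k, 'u) module"
      using that by (simp add: opA_def ahom_mult)
    obtain h h' where gh: "h \<in> Gs" "h' \<in> Gs" "u = opA ?B False y h \<oplus>\<^bsub>?B\<^esub> opA ?B True y h'"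
      using *(2) unfolding E_def by blast
    have r1G: "res1 KK G k = \<zero>\<^bsub>KK\<^esub>" if "k \<in> Gs" for k using that r(4) by (auto simp: Gs_def)
    have r2y: "res2 KK G y = \<zero>\<^bsub>G\<^esub>" unfolding y_def by (rule r(5)) simp
    have r1u: "res1 KK G u = \<zero>\<^bsub>KK\<^esub>"
      using gh yB GsB ahom_closed[OF r1 yB] by (simp add: ahom_add[OF r1] hop[OF r1] r1G)
    have r2u: "res2 KK G u = \<zero>\<^bsub>G\<^esub>"
      using gh yB GsB ahom_closed[OF r2 GsB] by (simp add: ahom_add[OF r2] hop[OF r2] r2y)
    have "res1 KK G w = c \<odot>\<^bsub>KK\<^esub> cgen True"
      using * yB GsB EB by (simp add: ahom_add[OF r1] ahom_smult[OF r1] r1u r1G, simp add: y_def r(3))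
    then have "c \<odot>\<^bsub>?B\<^esub> y = \<zero>\<^bsub>?B\<^esub>"
      using w0 ahom_smult[OF i(1) cgen_in, of c] ahom_zero[OF K.alg B.alg i(1)] by (simp add: y_def)
    moreover have "res2 KK G w = g0"
      using * yB GsB EB g0 r(6)[OF g0(1)] by (simp add: ahom_add[OF r2] ahom_smult[OF r2] r2u r2y)
    then have "g = \<zero>\<^bsub>?B\<^esub>" using w0 g0 ahom_zero[OF G.alg B.alg i(2)] by simp
    ultimately show ?thesis using *(2,3) EB by simp
  qed
  show ?thesis using E_E[OF ker_E ker_E] w by blast
qed

end

section \<open>Test algebras in which products of three elements vanish\<close>

lemma (in nalg) poly_value_superset:
  assumes "finite S" "Poly_Mapping.keys p \<subseteq> S" "range a \<subseteq> carrier A"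
  shows "poly_value A a p = (\<Oplus>w\<in>S. Poly_Mapping.lookup p w \<odot> word_value A a w)"
  unfolding poly_value_def
  by (rule M.add.finprod_mono_neutral_cong_left)
    (use assms in \<open>auto simp: in_keys_iff\<close>)

lemma wlen_1: "wlen w = 1 \<Longrightarrow> \<exists>i. w = Var i"
proof (cases w)
  case (Mul u v)
  then show "wlen w = 1 \<Longrightarrow> ?thesis" using wlen_pos[of u] wlen_pos[of v] by simp
qed simp

lemma wlen_2: "wlen w = 2 \<Longrightarrow> \<exists>i j. w = Mul (Var i) (Var j)"
proof (cases w)
  case (Mul u v)
  assume "wlen w = 2"
  then have "wlen u = 1" "wlen v = 1" using Mul wlen_pos[of u] wlen_pos[of v] by simp_all
  then show ?thesis using Mul wlen_1 by blast
qed simp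

lemma same_type_Mul_Var:
  assumes "\<And>x. occurrences x w = occurrences x (Mul (Var i) (Var j))" "w = Mul (Var k) (Var l)"
  shows "k = i \<and> l = j \<or> k = j \<and> l = i"
proof -
  have *: "(if x = k then 1 else 0) + (if x = l then 1 else 0) = (if x = i then 1 else 0) + (if x = j then 1 else (0::nat))" for x
    using assms(1)[of x] assms(2) by (simp only: occurrences.simps)
  show ?thesis using *[of i] *[of j] by (cases "i = k"; cases "i = l"; cases "j = k"; cases "j = l"; cases "i = j") simp_all
qed

context nvariety
begin

definition free2 where
  "free2 \<longleftrightarrow> (\<forall>\<alpha> \<beta>. (\<forall>A\<in>V. \<forall>a\<in>carrier A. \<forall>b\<in>carrier A. \<alpha> \<odot>\<^bsub>A\<^esub> (a \<otimes>\<^bsub>A\<^esub> b) \<oplus>\<^bsub>A\<^esub> \<beta> \<odot>\<^bsub>A\<^esub> (b \<otimes>\<^bsub>A\<^esub> a) = \<zero>\<^bsub>A\<^esub>) \<longrightarrow> \<alpha> = 0 \<and> \<beta> = 0)"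

definition prod_nonzero where
  "prod_nonzero \<longleftrightarrow> (\<exists>A\<in>V. \<exists>a\<in>carrier A. \<exists>b\<in>carrier A. a \<otimes>\<^bsub>A\<^esub> b \<noteq> \<zero>\<^bsub>A\<^esub>)"

definition anti where
  "anti \<longleftrightarrow> prod_nonzero \<and> (\<forall>A\<in>V. \<forall>a\<in>carrier A. \<forall>b\<in>carrier A. a \<otimes>\<^bsub>A\<^esub> b \<oplus>\<^bsub>A\<^esub> b \<otimes>\<^bsub>A\<^esub> a = \<zero>\<^bsub>A\<^esub>)"

lemma free2_prod_nonzero: "free2 \<Longrightarrow> prod_nonzero"
proof (rule ccontr)
  assume "free2" "\<not> prod_nonzero"
  then have "\<forall>A\<in>V. \<forall>a\<in>carrier A. \<forall>b\<in>carrier A. 1 \<odot>\<^bsub>A\<^esub> (a \<otimes>\<^bsub>A\<^esub> b) \<oplus>\<^bsub>A\<^esub> 0 \<odot>\<^bsub>A\<^esub> (b \<otimes>\<^bsub>A\<^esub> a) = \<zero>\<^bsub>A\<^esub>"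
    unfolding prod_nonzero_def using V_nalg by (auto simp: nalg.sm_one nalg.sm_zero_left nalg.zero_in nalg.add_zero)
  then have "(1 :: 'k) = 0" using \<open>free2\<close> unfolding free2_def by blast
  then show False by simp
qed

text \<open>Squares are required to vanish, rather than mere anticommutativity, because in
  characteristic 2 the weaker condition would not yield a defining identity x x.\<close>

definition class2_ok :: "('k, 'p) module \<Rightarrow> bool" where
  "class2_ok B \<longleftrightarrow> is_algebra B \<and>
     (\<forall>x\<in>carrier B. \<forall>y\<in>carrier B. \<forall>z\<in>carrier B. (x \<otimes>\<^bsub>B\<^esub> y) \<otimes>\<^bsub>B\<^esub> z = \<zero>\<^bsub>B\<^esub> \<and> z \<otimes>\<^bsub>B\<^esub> (x \<otimes>\<^bsub>B\<^esub> y) = \<zero>\<^bsub>B\<^esub>) \<and>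
     (free2 \<or> anti \<and> (\<forall>x\<in>carrier B. x \<otimes>\<^bsub>B\<^esub> x = \<zero>\<^bsub>B\<^esub>))"

text \<open>By homogeneity p has a single length. Length 1 would kill all of \<open>V\<close>,
  length 3 or more vanishes in B. In length 2 the two possible words are x y and y x, or just x x:
  under \<open>free2\<close> no such p exists, and in the remaining case p is a multiple of x x or
  of x y + y x, both of which are zero in B.\<close>

lemma class2_identity:
  assumes B: "class2_ok (B :: ('k, 'p) module)" and p: "p \<in> I"
  shows "is_identity B p"
proof (cases "Poly_Mapping.keys p = {}")
  case True
  interpret B: nalg B by (rule nalg.intro) (use B in \<open>simp add: class2_ok_def\<close>)
  show ?thesis unfolding is_identity_def poly_value_def True by simp
next
  case False
  let ?S = "Poly_Mapping.keys p" and ?c = "Poly_Mapping.lookup p"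
  interpret B: nalg B by (rule nalg.intro) (use B in \<open>simp add: class2_ok_def\<close>)
  obtain u where u: "u \<in> ?S" using False by blast
  have cu: "?c u \<noteq> 0" using u by (simp add: in_keys_iff)
  have hom: "homogeneous p" by (rule homog[OF p])
  have len: "wlen w = wlen u" if "w \<in> ?S" for w by (rule wlen_homogeneous[OF hom that u])
  have occ: "occurrences i w = occurrences i u" if "w \<in> ?S" for w i using hom u that unfolding homogeneous_def by blast
  have idV: "poly_value A a p = \<zero>\<^bsub>A\<^esub>" if "A \<in> V" "range a \<subseteq> carrier A" for A a
    using that p by (simp add: V_eq variety_def is_identity_def)
  have pn: "prod_nonzero" using B free2_prod_nonzero unfolding class2_ok_def anti_def by blast
  consider "wlen u = 1" | "wlen u = 2" | "wlen u \<ge> 3" using wlen_pos[of u] by linarith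
  then show ?thesis
  proof cases
    case 1
    obtain i where i: "u = Var i" using wlen_1[OF 1] by blast
    have "?S \<subseteq> {u}"
    proof
      fix w assume w: "w \<in> ?S"
      then obtain j where "w = Var j" using len[OF w] 1 wlen_1 by metis
      then show "w \<in> {u}" using occ[OF w, of i] by (auto simp: i split: if_splits)
    qed
    obtain A a b where A: "A \<in> V" "a \<in> carrier A" "b \<in> carrier A" "a \<otimes>\<^bsub>A\<^esub> b \<noteq> \<zero>\<^bsub>A\<^esub>" using pn by (auto simp: prod_nonzero_def)
    interpret A: nalg A using A(1) by (rule V_nalg)
    have "\<zero>\<^bsub>A\<^esub> = ?c u \<odot>\<^bsub>A\<^esub> a"
      using idV[OF A(1), of "\<lambda>_. a"] A.poly_value_superset[OF _ \<open>?S \<subseteq> {u}\<close>, of "\<lambda>_. a"] A(2)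
      by (simp add: i)
    then have "a = \<zero>\<^bsub>A\<^esub>" using A.sm_eq_zero[of "?c u" a] cu A(2) by simp
    then show ?thesis using A(3,4) by simp
  next
    case 2
    obtain i j where ij: "u = Mul (Var i) (Var j)" using wlen_2[OF 2] by blast
    define v where "v = Mul (Var j) (Var i)"
    have "?S \<subseteq> {u, v}"
    proof
      fix w assume w: "w \<in> ?S"
      then obtain k l where "w = Mul (Var k) (Var l)" using len[OF w] 2 wlen_2 by metis
      then show "w \<in> {u, v}" using same_type_Mul_Var[OF occ[OF w, unfolded ij]] by (auto simp: ij v_def)
    qed
    show ?thesis
    proof (cases "i = j")
      case True
      then have S: "?S \<subseteq> {u}" using \<open>?S \<subseteq> {u, v}\<close> by (simp add: ij v_def)
      have sq: "?c u \<odot>\<^bsub>A\<^esub> (a \<otimes>\<^bsub>A\<^esub> a) = \<zero>\<^bsub>A\<^esub>" if "A \<in> V" "a \<in> carrier A" for A a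
      proof -
        interpret A: nalg A using that(1) by (rule V_nalg)
        show ?thesis using idV[OF that(1), of "\<lambda>_. a"] A.poly_value_superset[OF _ S, of "\<lambda>_. a"] that(2) by (simp add: ij)
      qed
      \<comment> \<open>A multiple of x x as identity polarises to a relation between x y and y x,
        against \<open>free2\<close>.\<close>
      have pol: "?c u \<odot>\<^bsub>A\<^esub> (a \<otimes>\<^bsub>A\<^esub> b) \<oplus>\<^bsub>A\<^esub> ?c u \<odot>\<^bsub>A\<^esub> (b \<otimes>\<^bsub>A\<^esub> a) = \<zero>\<^bsub>A\<^esub>" if "A \<in> V" "a \<in> carrier A" "b \<in> carrier A" for A a b
      proof -
        interpret A: nalg A using that(1) by (rule V_nalg)
        have "\<zero>\<^bsub>A\<^esub> = ?c u \<odot>\<^bsub>A\<^esub> ((a \<oplus>\<^bsub>A\<^esub> b) \<otimes>\<^bsub>A\<^esub> (a \<oplus>\<^bsub>A\<^esub> b))" using sq[OF that(1), of "a \<oplus>\<^bsub>A\<^esub> b"] that by simp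
        also have "\<dots> = (?c u \<odot>\<^bsub>A\<^esub> (a \<otimes>\<^bsub>A\<^esub> a) \<oplus>\<^bsub>A\<^esub> ?c u \<odot>\<^bsub>A\<^esub> (b \<otimes>\<^bsub>A\<^esub> b)) \<oplus>\<^bsub>A\<^esub> (?c u \<odot>\<^bsub>A\<^esub> (a \<otimes>\<^bsub>A\<^esub> b) \<oplus>\<^bsub>A\<^esub> ?c u \<odot>\<^bsub>A\<^esub> (b \<otimes>\<^bsub>A\<^esub> a))"
          using that by (simp add: A.bilin A.ac)
        finally show ?thesis using that by (simp add: sq)
      qed
      have "\<not> free2" using pol cu unfolding free2_def by blast
      then have "\<forall>x\<in>carrier B. x \<otimes>\<^bsub>B\<^esub> x = \<zero>\<^bsub>B\<^esub>" using B by (simp add: class2_ok_def)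
      moreover have "a j \<in> carrier B" if "range a \<subseteq> carrier B" for a :: "nat \<Rightarrow> 'p" using that by auto
      ultimately show ?thesis unfolding is_identity_def
        using B.poly_value_superset[OF _ S] by (simp add: ij True)
    next
      case False
      then have uv: "u \<noteq> v" by (simp add: ij v_def)
      have pv: "?c u \<odot>\<^bsub>A\<^esub> (a \<otimes>\<^bsub>A\<^esub> b) \<oplus>\<^bsub>A\<^esub> ?c v \<odot>\<^bsub>A\<^esub> (b \<otimes>\<^bsub>A\<^esub> a) = \<zero>\<^bsub>A\<^esub>" if "A \<in> V" "a \<in> carrier A" "b \<in> carrier A" for A a b
      proof -
        interpret A: nalg A using that(1) by (rule V_nalg)
        have "range (\<lambda>n. if n = i then a else b) \<subseteq> carrier A" using that by auto
        from A.poly_value_superset[OF _ \<open>?S \<subseteq> {u, v}\<close> this] idV[OF that(1) this] show ?thesis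
          using that uv False by (simp add: ij v_def)
      qed
      then have "\<not> free2" using cu unfolding free2_def by blast
      then have an: "anti" and sq: "\<And>x. x \<in> carrier B \<Longrightarrow> x \<otimes>\<^bsub>B\<^esub> x = \<zero>\<^bsub>B\<^esub>" using B by (auto simp: class2_ok_def)
      obtain A a b where A: "A \<in> V" "a \<in> carrier A" "b \<in> carrier A" "a \<otimes>\<^bsub>A\<^esub> b \<noteq> \<zero>\<^bsub>A\<^esub>" using pn by (auto simp: prod_nonzero_def)
      interpret A: nalg A using A(1) by (rule V_nalg)
      have "a \<otimes>\<^bsub>A\<^esub> b \<oplus>\<^bsub>A\<^esub> b \<otimes>\<^bsub>A\<^esub> a = \<zero>\<^bsub>A\<^esub>" using an A by (simp add: anti_def)
      then have ba: "b \<otimes>\<^bsub>A\<^esub> a = (-1) \<odot>\<^bsub>A\<^esub> (a \<otimes>\<^bsub>A\<^esub> b)"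
        using A.M.minus_equality[of "b \<otimes>\<^bsub>A\<^esub> a" "a \<otimes>\<^bsub>A\<^esub> b"] A(2,3) by (simp add: A.sm_uminus A.add_comm)
      \<comment> \<open>Since y x = - x y in \<open>V\<close> while some product is nonzero, the two
        coefficients of p must be equal.\<close>
      have "(?c u - ?c v) \<odot>\<^bsub>A\<^esub> (a \<otimes>\<^bsub>A\<^esub> b) = \<zero>\<^bsub>A\<^esub>"
        using pv[OF A(1-3)] A(2,3) by (simp add: ba A.sm_sm flip: A.sm_add_left)
      then have cuv: "?c u = ?c v" using A.sm_eq_zero[of "?c u - ?c v" "a \<otimes>\<^bsub>A\<^esub> b"] A by auto
      have anB: "x \<otimes>\<^bsub>B\<^esub> y \<oplus>\<^bsub>B\<^esub> y \<otimes>\<^bsub>B\<^esub> x = \<zero>\<^bsub>B\<^esub>" if "x \<in> carrier B" "y \<in> carrier B" for x y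
        using sq[of "x \<oplus>\<^bsub>B\<^esub> y"] sq[of x] sq[of y] that by (simp add: B.bilin B.add_comm)
      show ?thesis unfolding is_identity_def
      proof (intro allI impI)
        fix a :: "nat \<Rightarrow> 'p" assume a: "range a \<subseteq> carrier B"
        then have ai: "a i \<in> carrier B" "a j \<in> carrier B" by auto
        have "poly_value B a p = ?c u \<odot>\<^bsub>B\<^esub> (a i \<otimes>\<^bsub>B\<^esub> a j) \<oplus>\<^bsub>B\<^esub> ?c v \<odot>\<^bsub>B\<^esub> (a j \<otimes>\<^bsub>B\<^esub> a i)"
          using B.poly_value_superset[OF _ \<open>?S \<subseteq> {u, v}\<close> a] uv ai by (simp add: ij v_def)
        also have "\<dots> = \<zero>\<^bsub>B\<^esub>" using anB[OF ai] ai by (simp add: cuv flip: B.sm_add_right)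
        finally show "poly_value B a p = \<zero>\<^bsub>B\<^esub>" .
      qed
    qed
  next
    case 3
    have z: "word_value B a w = \<zero>\<^bsub>B\<^esub>" if "w \<in> ?S" "range a \<subseteq> carrier B" for a w
    proof -
      have "wlen w \<ge> 3" using 3 len[OF that(1)] by simp
      then obtain s t where w: "w = Mul s t" by (cases w) auto
      note cl = B.word_value_closed[OF that(2)]
      show ?thesis
      proof (cases s)
        case (Var k)
        then obtain t1 t2 where "t = Mul t1 t2" using \<open>wlen w \<ge> 3\<close> w by (cases t) auto
        then show ?thesis using B w cl by (simp add: class2_ok_def)
      next
        case (Mul s1 s2)
        then show ?thesis using B w cl by (simp add: class2_ok_def)
      qed
    qed
    show ?thesis unfolding is_identity_def
    proof (intro allI impI)
      fix a :: "nat \<Rightarrow> 'p" assume a: "range a \<subseteq> carrier B"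
      have "poly_value B a p = (\<Oplus>\<^bsub>B\<^esub>w\<in>?S. \<zero>\<^bsub>B\<^esub>)"
        unfolding poly_value_def by (rule B.M.finsum_cong') (use z a in auto)
      then show "poly_value B a p = \<zero>\<^bsub>B\<^esub>" by (simp add: B.M.finsum_zero)
    qed
  qed
qed

text \<open>\<open>K x \<oplus> W \<oplus> W \<oplus> W\<close>, where \<open>x w\<close> and \<open>w x\<close> land in the last two summands as \<open>(w, 0)\<close>
  and \<open>(\<kappa> w, \<nu> w)\<close>: all products of three elements vanish, so that only the identities of
  degree 2 of the variety matter.\<close>

definition outer_alg :: "'k \<Rightarrow> 'k \<Rightarrow> ('k, 'u) module \<Rightarrow> ('k, 'k \<times> 'u \<times> 'u \<times> 'u) module" where
  "outer_alg \<kappa> \<nu> W = \<lparr>carrier = UNIV \<times> carrier W \<times> carrier W \<times> carrier W,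
     monoid.mult = (\<lambda>(c, w, _, _) (c', w', _, _). (0, \<zero>\<^bsub>W\<^esub>, c \<odot>\<^bsub>W\<^esub> w' \<oplus>\<^bsub>W\<^esub> (\<kappa> * c') \<odot>\<^bsub>W\<^esub> w, (\<nu> * c') \<odot>\<^bsub>W\<^esub> w)),
     one = undefined, zero = (0, \<zero>\<^bsub>W\<^esub>, \<zero>\<^bsub>W\<^esub>, \<zero>\<^bsub>W\<^esub>),
     add = (\<lambda>(c, w, p, q) (c', w', p', q'). (c + c', w \<oplus>\<^bsub>W\<^esub> w', p \<oplus>\<^bsub>W\<^esub> p', q \<oplus>\<^bsub>W\<^esub> q')),
     smult = (\<lambda>d (c, w, p, q). (d * c, d \<odot>\<^bsub>W\<^esub> w, d \<odot>\<^bsub>W\<^esub> p, d \<odot>\<^bsub>W\<^esub> q))\<rparr>"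

lemma outer_alg_simps:
  "carrier (outer_alg \<kappa> \<nu> W) = UNIV \<times> carrier W \<times> carrier W \<times> carrier W"
  "(c, w, p, q) \<otimes>\<^bsub>outer_alg \<kappa> \<nu> W\<^esub> (c', w', p', q') = (0, \<zero>\<^bsub>W\<^esub>, c \<odot>\<^bsub>W\<^esub> w' \<oplus>\<^bsub>W\<^esub> (\<kappa> * c') \<odot>\<^bsub>W\<^esub> w, (\<nu> * c') \<odot>\<^bsub>W\<^esub> w)"
  "(c, w, p, q) \<oplus>\<^bsub>outer_alg \<kappa> \<nu> W\<^esub> (c', w', p', q') = (c + c', w \<oplus>\<^bsub>W\<^esub> w', p \<oplus>\<^bsub>W\<^esub> p', q \<oplus>\<^bsub>W\<^esub> q')"
  "d \<odot>\<^bsub>outer_alg \<kappa> \<nu> W\<^esub> (c, w, p, q) = (d * c, d \<odot>\<^bsub>W\<^esub> w, d \<odot>\<^bsub>W\<^esub> p, d \<odot>\<^bsub>W\<^esub> q)"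
  "\<zero>\<^bsub>outer_alg \<kappa> \<nu> W\<^esub> = (0, \<zero>\<^bsub>W\<^esub>, \<zero>\<^bsub>W\<^esub>, \<zero>\<^bsub>W\<^esub>)"
  by (simp_all add: outer_alg_def)

lemma is_algebra_outer_alg:
  assumes "is_algebra W"
  shows "is_algebra (outer_alg \<kappa> \<nu> W)"
proof -
  interpret W: nalg W by (rule nalg.intro) fact
  show ?thesis
    by (rule is_algebraI) (auto simp: outer_alg_simps W.bilin W.add_assoc algebra_simps, simp_all add: W.ac)
qed

text \<open>The pair (0, 1) puts x w and w x into different summands and keeps them independent; the
  pair (-1, 0) makes w x = - x w and all squares zero.\<close>

definition outer_ok :: "'k \<Rightarrow> 'k \<Rightarrow> bool" where
  "outer_ok \<kappa> \<nu> \<longleftrightarrow> free2 \<and> \<kappa> = 0 \<and> \<nu> = 1 \<or> anti \<and> \<kappa> = -1 \<and> \<nu> = 0"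

lemma vmember_outer_alg:
  assumes W: "W \<in> V" and k: "outer_ok \<kappa> \<nu>"
  shows "vmember (outer_alg \<kappa> \<nu> W)"
proof -
  interpret W: nalg W using W by (rule V_nalg)
  have inj: "inj (\<lambda>(k, a, b, c). code (TAdd (TSmul k TZero) (TAdd (TGen (0, a)) (TAdd (TGen (0, b)) (TGen (0, c))))))"
    using inj_code by (auto simp: inj_def)
  have "class2_ok (outer_alg \<kappa> \<nu> W)"
    unfolding class2_ok_def
  proof (intro conjI)
    show "is_algebra (outer_alg \<kappa> \<nu> W)" by (rule is_algebra_outer_alg[OF W.alg])
    have "c \<odot>\<^bsub>W\<^esub> w \<oplus>\<^bsub>W\<^esub> (- c) \<odot>\<^bsub>W\<^esub> w = \<zero>\<^bsub>W\<^esub>" if "w \<in> carrier W" for c w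
      using W.sm_add_left[OF that, of c "- c"] that by simp
    then show "free2 \<or> anti \<and> (\<forall>x\<in>carrier (outer_alg \<kappa> \<nu> W). x \<otimes>\<^bsub>outer_alg \<kappa> \<nu> W\<^esub> x = \<zero>\<^bsub>outer_alg \<kappa> \<nu> W\<^esub>)"
      using k by (auto simp: outer_ok_def outer_alg_simps)
  qed (auto simp: outer_alg_simps)
  then show ?thesis
    using class2_identity is_algebra_outer_alg[OF W.alg] inj_on_subset[OF inj subset_UNIV]
    unfolding vmember_def by blast
qed

end

context cosmash_variety
begin

text \<open>The relation x x = 0 does not collapse the generator, since it can be sent to the
  element (1, 0, 0, 0), which is nonzero and has square zero.\<close>

lemma cgen_nonzero:
  assumes "outer_ok \<kappa> \<nu>"
  shows "cgen True \<noteq> \<zero>\<^bsub>KK\<^esub>"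
proof
  assume z: "cgen True = \<zero>\<^bsub>KK\<^esub>"
  interpret Z: nalg zero_alg by (rule V_nalg[OF zero_alg(1)])
  obtain f where f: "ahom KK (outer_alg \<kappa> \<nu> zero_alg) f" "f (cgen True) = (1, \<zero>\<^bsub>zero_alg\<^esub>, \<zero>\<^bsub>zero_alg\<^esub>, \<zero>\<^bsub>zero_alg\<^esub>)"
    using cyc_hom[OF vmember_outer_alg[OF zero_alg(1) assms], of "(1, \<zero>\<^bsub>zero_alg\<^esub>, \<zero>\<^bsub>zero_alg\<^esub>, \<zero>\<^bsub>zero_alg\<^esub>)" True]
    by (auto simp: outer_alg_simps)
  then show False using z ahom_zero[OF V_alg[OF cyc_in_V] is_algebra_outer_alg[OF Z.alg] f(1)] by (simp add: outer_alg_simps)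
qed

text \<open>Products of elements (0, w, 0, 0) are zero in \<open>outer_alg\<close>. The inclusion of
  W is therefore multiplicative exactly because the multiplication of W is zero.\<close>

lemma ex_outer_alg_hom:
  assumes W: "W \<in> V" and k: "outer_ok \<kappa> \<nu>"
    and zero: "\<And>x y. \<lbrakk>x \<in> carrier W; y \<in> carrier W\<rbrakk> \<Longrightarrow> x \<otimes>\<^bsub>W\<^esub> y = \<zero>\<^bsub>W\<^esub>"
  shows "\<exists>h. ahom (copS [KK, W]) (outer_alg \<kappa> \<nu> W) h \<and>
    h (copI [KK, W] 0 (cgen True)) = (1, \<zero>\<^bsub>W\<^esub>, \<zero>\<^bsub>W\<^esub>, \<zero>\<^bsub>W\<^esub>) \<and>
    (\<forall>w\<in>carrier W. h (copI [KK, W] 1 w) = (0, w, \<zero>\<^bsub>W\<^esub>, \<zero>\<^bsub>W\<^esub>))"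
proof -
  interpret W: nalg W using W by (rule V_nalg)
  note D = vmember_outer_alg[OF W k]
  obtain f where f: "ahom KK (outer_alg \<kappa> \<nu> W) f" "f (cgen True) = (1, \<zero>\<^bsub>W\<^esub>, \<zero>\<^bsub>W\<^esub>, \<zero>\<^bsub>W\<^esub>)"
    using cyc_hom[OF D, of "(1, \<zero>\<^bsub>W\<^esub>, \<zero>\<^bsub>W\<^esub>, \<zero>\<^bsub>W\<^esub>)" True] by (auto simp: outer_alg_simps)
  have g: "ahom W (outer_alg \<kappa> \<nu> W) (\<lambda>w. (0, w, \<zero>\<^bsub>W\<^esub>, \<zero>\<^bsub>W\<^esub>))"
    by (auto simp: ahom_def outer_alg_simps zero)
  obtain h where "ahom (copS [KK, W]) (outer_alg \<kappa> \<nu> W) h" "\<forall>x\<in>carrier KK. h (copI [KK, W] 0 x) = f x"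
    "\<forall>y\<in>carrier W. h (copI [KK, W] 1 y) = (0, y, \<zero>\<^bsub>W\<^esub>, \<zero>\<^bsub>W\<^esub>)"
    using ex_cot2[OF D cyc_in_V W f(1) g] by blast
  then show ?thesis using f(2) by (intro exI[of _ h]) auto
qed

text \<open>The element x w + w' x is evaluated to (0, 0, w + \<kappa> w', \<nu> w').\<close>

lemma outer_alg_op_value:
  assumes W: "W \<in> V" and k: "outer_ok \<kappa> \<nu>"
    and zero: "\<And>x y. \<lbrakk>x \<in> carrier W; y \<in> carrier W\<rbrakk> \<Longrightarrow> x \<otimes>\<^bsub>W\<^esub> y = \<zero>\<^bsub>W\<^esub>"
    and w: "w \<in> carrier W" "w' \<in> carrier W"
    and eq: "opA (copS [KK, W]) False (copI [KK, W] 0 (cgen True)) (copI [KK, W] 1 w) \<oplus>\<^bsub>copS [KK, W]\<^esub>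
       opA (copS [KK, W]) True (copI [KK, W] 0 (cgen True)) (copI [KK, W] 1 w') = \<zero>\<^bsub>copS [KK, W]\<^esub>"
  shows "w \<oplus>\<^bsub>W\<^esub> \<kappa> \<odot>\<^bsub>W\<^esub> w' = \<zero>\<^bsub>W\<^esub>" "\<nu> \<odot>\<^bsub>W\<^esub> w' = \<zero>\<^bsub>W\<^esub>"
proof -
  interpret W: nalg W using W by (rule V_nalg)
  let ?T = "copS [KK, W]" let ?x = "copI [KK, W] 0 (cgen True)"
  interpret T: nalg ?T by (rule V_nalg[OF copS_in_V])
  note i = inj2[OF cyc_in_V[of True] W, THEN alg_hom_ahom]
  have c: "?x \<in> carrier ?T" "copI [KK, W] 1 w \<in> carrier ?T" "copI [KK, W] 1 w' \<in> carrier ?T"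
    using ahom_closed[OF i(1) cgen_in] ahom_closed[OF i(2)] w by blast+
  obtain h where h: "ahom ?T (outer_alg \<kappa> \<nu> W) h" "h ?x = (1, \<zero>\<^bsub>W\<^esub>, \<zero>\<^bsub>W\<^esub>, \<zero>\<^bsub>W\<^esub>)"
    "\<forall>w\<in>carrier W. h (copI [KK, W] 1 w) = (0, w, \<zero>\<^bsub>W\<^esub>, \<zero>\<^bsub>W\<^esub>)" using ex_outer_alg_hom[OF W k zero] by blast
  have "\<zero>\<^bsub>outer_alg \<kappa> \<nu> W\<^esub> = h (?x \<otimes>\<^bsub>?T\<^esub> copI [KK, W] 1 w \<oplus>\<^bsub>?T\<^esub> copI [KK, W] 1 w' \<otimes>\<^bsub>?T\<^esub> ?x)"
    using eq ahom_zero[OF T.alg is_algebra_outer_alg[OF W.alg] h(1)] by (simp add: opA_def)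
  also have "\<dots> = (1, \<zero>\<^bsub>W\<^esub>, \<zero>\<^bsub>W\<^esub>, \<zero>\<^bsub>W\<^esub>) \<otimes>\<^bsub>outer_alg \<kappa> \<nu> W\<^esub> (0, w, \<zero>\<^bsub>W\<^esub>, \<zero>\<^bsub>W\<^esub>) \<oplus>\<^bsub>outer_alg \<kappa> \<nu> W\<^esub>
      (0, w', \<zero>\<^bsub>W\<^esub>, \<zero>\<^bsub>W\<^esub>) \<otimes>\<^bsub>outer_alg \<kappa> \<nu> W\<^esub> (1, \<zero>\<^bsub>W\<^esub>, \<zero>\<^bsub>W\<^esub>, \<zero>\<^bsub>W\<^esub>)"
    unfolding ahom_add[OF h(1) T.mult_closed[OF c(1,2)] T.mult_closed[OF c(3,1)]] ahom_mult[OF h(1) c(1,2)]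
      ahom_mult[OF h(1) c(3,1)] h(2) using h(3) w by (simp del: One_nat_def)
  also have "\<dots> = (0, \<zero>\<^bsub>W\<^esub>, w \<oplus>\<^bsub>W\<^esub> \<kappa> \<odot>\<^bsub>W\<^esub> w', \<nu> \<odot>\<^bsub>W\<^esub> w')" using w by (simp add: outer_alg_simps)
  finally have "(0 :: 'k, \<zero>\<^bsub>W\<^esub>, \<zero>\<^bsub>W\<^esub>, \<zero>\<^bsub>W\<^esub>) = (0, \<zero>\<^bsub>W\<^esub>, w \<oplus>\<^bsub>W\<^esub> \<kappa> \<odot>\<^bsub>W\<^esub> w', \<nu> \<odot>\<^bsub>W\<^esub> w')"
    by (simp only: outer_alg_simps)
  then have "\<zero>\<^bsub>W\<^esub> = w \<oplus>\<^bsub>W\<^esub> \<kappa> \<odot>\<^bsub>W\<^esub> w'" "\<zero>\<^bsub>W\<^esub> = \<nu> \<odot>\<^bsub>W\<^esub> w'" by blast+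
  then show "w \<oplus>\<^bsub>W\<^esub> \<kappa> \<odot>\<^bsub>W\<^esub> w' = \<zero>\<^bsub>W\<^esub>" "\<nu> \<odot>\<^bsub>W\<^esub> w' = \<zero>\<^bsub>W\<^esub>" by simp_all
qed

text \<open>Here \<open>X = Y = K x\<close> with \<open>x\<^sup>2 = 0\<close>.  By injectivity of \<open>\<Phi>\<close> the equation already holds in
  \<open>X + (Y \<diamond> G)\<close>, and there it can be evaluated in \<open>outer_alg\<close> because \<open>Y \<diamond> G\<close> has zero
  multiplication.\<close>

lemma outer_independent:
  assumes G: "G \<in> V" and k: "outer_ok \<kappa> \<nu>" and w: "w \<in> ker2 KK G" "w' \<in> ker2 KK G"
    and eq: "opA (copS [KK, KK, G]) False (copI [KK, KK, G] 0 (cgen True)) (incl3 KK KK G w) \<oplus>\<^bsub>copS [KK, KK, G]\<^esub>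
       opA (copS [KK, KK, G]) True (copI [KK, KK, G] 0 (cgen True)) (incl3 KK KK G w') = \<zero>\<^bsub>copS [KK, KK, G]\<^esub>"
  shows "w \<oplus>\<^bsub>copS [KK, G]\<^esub> \<kappa> \<odot>\<^bsub>copS [KK, G]\<^esub> w' = \<zero>\<^bsub>copS [KK, G]\<^esub>" "\<nu> \<odot>\<^bsub>copS [KK, G]\<^esub> w' = \<zero>\<^bsub>copS [KK, G]\<^esub>"
proof -
  let ?W = "cosm KK G" let ?T = "copS [KK, cosm KK G]" let ?x = "copI [KK, cosm KK G] 0 (cgen True)"
  note KV = cyc_in_V[of True]
  have W: "?W \<in> V" by (rule cosm_in_V[OF KV G])
  interpret W: nalg ?W using W by (rule V_nalg)
  interpret K: nalg KK by (rule V_nalg[OF KV])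
  interpret T: nalg ?T by (rule V_nalg[OF copS_in_V])
  note i = inj2[OF KV W, THEN alg_hom_ahom]
  have wW: "w \<in> carrier ?W" "w' \<in> carrier ?W" using w by (simp_all add: carrier_cosm)
  have c: "?x \<in> carrier ?T" "copI [KK, ?W] 1 w \<in> carrier ?T" "copI [KK, ?W] 1 w' \<in> carrier ?T"
    using ahom_closed[OF i(1) cgen_in] ahom_closed[OF i(2)] wW by blast+
  define t where "t = opA ?T False ?x (copI [KK, ?W] 1 w) \<oplus>\<^bsub>?T\<^esub> opA ?T True ?x (copI [KK, ?W] 1 w')"
  have hop: "f (opA ?T e p q) = opA A' e (f p) (f q)" if "ahom ?T A' f" "p \<in> carrier ?T" "q \<in> carrier ?T" for f e p q and A' :: "('k, 'u) module"
    using that by (simp add: opA_def ahom_mult)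
  have ht: "f t = opA A' False (f ?x) (f (copI [KK, ?W] 1 w)) \<oplus>\<^bsub>A'\<^esub> opA A' True (f ?x) (f (copI [KK, ?W] 1 w'))"
    if "ahom ?T A' f" for f and A' :: "('k, 'u) module"
    unfolding t_def using c by (simp only: ahom_add[OF that] hop[OF that] T.opA_closed)
  note r = res[OF KV W] note p = phi[OF KV KV G]
  have "t \<in> ker2 KK ?W"
    unfolding ker2_def using c r(3)[OF cgen_in] r(5)[OF cgen_in] r(4)[OF wW(1)] r(4)[OF wW(2)] r(6)[OF wW(1)] r(6)[OF wW(2)] wW
    by (simp add: ht[OF alg_hom_ahom[OF r(1)]] ht[OF alg_hom_ahom[OF r(2)]], simp add: t_def)
  moreover have "phi KK KK G t = \<zero>\<^bsub>copS [KK, KK, G]\<^esub>"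
    unfolding ht[OF alg_hom_ahom[OF p(1)]] p(2)[OF cgen_in] p(3)[OF w(1)] p(3)[OF w(2)] by (rule eq)
  ultimately have t0: "t = \<zero>\<^bsub>?T\<^esub>" by (rule phi_injective[OF assoc KV KV G])
  have zero: "x \<otimes>\<^bsub>?W\<^esub> y = \<zero>\<^bsub>?W\<^esub>" if "x \<in> carrier ?W" "y \<in> carrier ?W" for x y
    using cosm_mult_zero[OF G, of x y] that by (simp add: carrier_cosm cosm_ops)
  show "w \<oplus>\<^bsub>copS [KK, G]\<^esub> \<kappa> \<odot>\<^bsub>copS [KK, G]\<^esub> w' = \<zero>\<^bsub>copS [KK, G]\<^esub>" "\<nu> \<odot>\<^bsub>copS [KK, G]\<^esub> w' = \<zero>\<^bsub>copS [KK, G]\<^esub>"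
    using outer_alg_op_value[OF W k zero wW t0[unfolded t_def]] by (simp_all add: cosm_ops)
qed

end

section \<open>Independence in degrees 2, 3 and 4\<close>

lemma ahom_opA: "\<lbrakk>ahom A B f; x \<in> carrier A; y \<in> carrier A\<rbrakk> \<Longrightarrow> f (opA A e x y) = opA B e (f x) (f y)"
  by (simp add: opA_def ahom_mult)

lemma ahom_rcomb:
  assumes "is_algebra A" "ahom A B f" "a \<in> carrier A" "b \<in> carrier A" "c \<in> carrier A"
  shows "f (rcomb A k a b c) = rcomb B k (f a) (f b) (f c)"
proof -
  interpret A: nalg A by (rule nalg.intro) fact
  show ?thesis using assms(3-) by (simp add: rcomb_def ahom_add[OF assms(2)] ahom_smult[OF assms(2)] ahom_opA[OF assms(2)])
qed

context cosmash_variety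
begin

lemma ker2_closed:
  assumes G: "G \<in> V"
  shows "u \<in> ker2 KK G \<Longrightarrow> v \<in> ker2 KK G \<Longrightarrow> u \<oplus>\<^bsub>copS [KK, G]\<^esub> v \<in> ker2 KK G"
    "u \<in> ker2 KK G \<Longrightarrow> c \<odot>\<^bsub>copS [KK, G]\<^esub> u \<in> ker2 KK G"
    "\<zero>\<^bsub>copS [KK, G]\<^esub> \<in> ker2 KK G"
proof -
  interpret W: nalg "cosm KK G" by (rule V_nalg[OF cosm_in_V(1)[OF cyc_in_V G]])
  show "u \<in> ker2 KK G \<Longrightarrow> v \<in> ker2 KK G \<Longrightarrow> u \<oplus>\<^bsub>copS [KK, G]\<^esub> v \<in> ker2 KK G"
    "u \<in> ker2 KK G \<Longrightarrow> c \<odot>\<^bsub>copS [KK, G]\<^esub> u \<in> ker2 KK G"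
    "\<zero>\<^bsub>copS [KK, G]\<^esub> \<in> ker2 KK G"
    using W.add_in[of u v] W.sm_closed[of u c] W.zero_in by (simp_all add: carrier_cosm cosm_ops)
qed

lemma ker2_op:
  assumes G: "G \<in> V" and g: "g \<in> carrier G"
  shows "opA (copS [KK, G]) e (copI [KK, G] 0 (cgen True)) (copI [KK, G] 1 g) \<in> ker2 KK G"
proof -
  let ?B = "copS [KK, G]"
  interpret B: nalg ?B by (rule V_nalg[OF copS_in_V])
  interpret K: nalg KK by (rule V_nalg[OF cyc_in_V])
  interpret G: nalg G by (rule V_nalg[OF G])
  note i = inj2[OF cyc_in_V[of True] G, THEN alg_hom_ahom]
  note r = res[OF cyc_in_V[of True] G]
  note c = ahom_closed[OF i(1) cgen_in] ahom_closed[OF i(2) g]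
  show ?thesis unfolding ker2_def
    using c g by (simp add: ahom_opA[OF alg_hom_ahom[OF r(1)] c] ahom_opA[OF alg_hom_ahom[OF r(2)] c] r(3)[OF cgen_in] r(5)[OF cgen_in]
      r(4)[OF g] r(6)[OF g] del: One_nat_def)
qed

lemma ker2_rcomb:
  assumes G: "G \<in> V" and g: "g \<in> carrier G" "h \<in> carrier G"
  shows "rcomb (copS [KK, G]) k (copI [KK, G] 0 (cgen True)) (copI [KK, G] 1 g) (copI [KK, G] 1 h) \<in> ker2 KK G"
proof -
  interpret G: nalg G by (rule V_nalg[OF G])
  note i = inj2[OF cyc_in_V[of True] G, THEN alg_hom_ahom]
  have "opA (copS [KK, G]) e (copI [KK, G] 0 (cgen True)) (opA (copS [KK, G]) f (copI [KK, G] 1 g) (copI [KK, G] 1 h)) \<in> ker2 KK G" for e f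
    using ker2_op[OF G G.opA_closed[OF g], of e f] by (simp only: ahom_opA[OF i(2) g])
  then show ?thesis unfolding rcomb_def by (intro ker2_closed[OF G])
qed

text \<open>The case W = \<open>KK\<close>, whose multiplication is zero, with multiples of its
  nonzero generator in place of w and w'.\<close>

lemma indep2:
  assumes k: "outer_ok \<kappa> \<nu>"
    and eq: "\<alpha> \<odot>\<^bsub>copS [KK, KK]\<^esub> opA (copS [KK, KK]) False (copI [KK, KK] 0 (cgen True)) (copI [KK, KK] 1 (cgen True)) \<oplus>\<^bsub>copS [KK, KK]\<^esub>
       \<beta> \<odot>\<^bsub>copS [KK, KK]\<^esub> opA (copS [KK, KK]) True (copI [KK, KK] 0 (cgen True)) (copI [KK, KK] 1 (cgen True)) = \<zero>\<^bsub>copS [KK, KK]\<^esub>"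
  shows "\<alpha> + \<kappa> * \<beta> = 0" "\<nu> * \<beta> = 0"
proof -
  let ?B = "copS [KK, KK]"
  interpret B: nalg ?B by (rule V_nalg[OF copS_in_V])
  interpret K: nalg KK by (rule V_nalg[OF cyc_in_V])
  note i = inj2[OF cyc_in_V[of True] cyc_in_V[of True], THEN alg_hom_ahom]
  note c = ahom_closed[OF i(1) cgen_in] ahom_closed[OF i(2) cgen_in]
  have *: "opA ?B False (copI [KK, KK] 0 (cgen True)) (copI [KK, KK] 1 (\<alpha> \<odot>\<^bsub>KK\<^esub> cgen True)) \<oplus>\<^bsub>?B\<^esub>
      opA ?B True (copI [KK, KK] 0 (cgen True)) (copI [KK, KK] 1 (\<beta> \<odot>\<^bsub>KK\<^esub> cgen True)) = \<zero>\<^bsub>?B\<^esub>"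
    using eq c by (simp only: ahom_smult[OF i(2) cgen_in] B.opA_smult)
  note v = outer_alg_op_value[OF cyc_in_V k cyc_mult_zero _ _ *]
  have "(\<alpha> + \<kappa> * \<beta>) \<odot>\<^bsub>KK\<^esub> cgen True = \<zero>\<^bsub>KK\<^esub>" "(\<nu> * \<beta>) \<odot>\<^bsub>KK\<^esub> cgen True = \<zero>\<^bsub>KK\<^esub>"
    using v by (simp_all add: K.bilin)
  then show "\<alpha> + \<kappa> * \<beta> = 0" "\<nu> * \<beta> = 0"
    using K.sm_eq_zero[OF _ cgen_in] cgen_nonzero[OF k] by blast+
qed

definition sq_zero :: "('k, 'u) module \<Rightarrow> 'u \<Rightarrow> bool" where
  "sq_zero A a \<longleftrightarrow> a \<in> carrier A \<and> a \<otimes>\<^bsub>A\<^esub> a = \<zero>\<^bsub>A\<^esub>"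

lemma sq_zero_image:
  assumes "ahom KK A f" "is_algebra A"
  shows "sq_zero A (f (cgen True))"
  using ahom_mult[OF assms(1) cgen_in cgen_in] ahom_zero[OF V_alg[OF cyc_in_V] assms(2,1)] ahom_closed[OF assms(1) cgen_in]
  by (simp add: sq_zero_def cgen_sq)

lemma cyc_hom': "\<lbrakk>A \<in> V; sq_zero A a\<rbrakk> \<Longrightarrow> \<exists>f. ahom KK A f \<and> f (cgen True) = a"
  by (rule cyc_hom_V) (simp_all add: sq_zero_def)

lemma incl3_op:
  assumes G: "G \<in> V" and g: "g \<in> carrier G"
  shows "incl3 KK KK G (opA (copS [KK, G]) e (copI [KK, G] 0 (cgen True)) (copI [KK, G] 1 g)) =
    opA (copS [KK, KK, G]) e (copI [KK, KK, G] 1 (cgen True)) (copI [KK, KK, G] 2 g)"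
proof -
  note i = inj2[OF cyc_in_V[of True] G, THEN alg_hom_ahom]
  note q = incl3[OF cyc_in_V[of True] cyc_in_V[of True] G]
  show ?thesis
    by (simp only: ahom_opA[OF alg_hom_ahom[OF q(1)] ahom_closed[OF i(1) cgen_in] ahom_closed[OF i(2) g]] q(2)[OF cgen_in] q(3)[OF g])
qed

text \<open>The squares are required to vanish so that a, b, c are images of generators of copies of
  \<open>KK\<close>. Such a triple then detects elements of coproducts of these copies, which is how
  degree 4 is reduced to degree 3.\<close>

definition indep3 :: "('k, 'u) module \<Rightarrow> 'u \<Rightarrow> 'u \<Rightarrow> 'u \<Rightarrow> bool" where
  "indep3 A a b c \<longleftrightarrow> A \<in> V \<and> sq_zero A a \<and> sq_zero A b \<and> sq_zero A c \<and>
     (\<forall>k. rcomb A k a b c = \<zero>\<^bsub>A\<^esub> \<longrightarrow> (\<forall>e f. k e f = 0))"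

text \<open>The generic triple in KK + KK + KK works. Grouping a relation by its outer operation
  gives x w + w' x = 0 with w, w' in KK \<diamond> KK; \<open>outer_independent\<close> yields w =
  w' = 0, and \<open>indep2\<close> finishes in degree 2.\<close>

lemma ex_indep3:
  assumes "free2"
  shows "\<exists>A a b c. indep3 A a b c"
proof -
  have k: "outer_ok 0 1" using assms by (simp add: outer_ok_def)
  let ?S = "copS [KK, KK, KK]" let ?B = "copS [KK, KK]" let ?g = "cgen True"
  let ?i = "copI [KK, KK, KK]" let ?j = "copI [KK, KK]"
  note KV = cyc_in_V[of True]
  interpret B: nalg ?B by (rule V_nalg[OF copS_in_V])
  interpret S: nalg ?S by (rule V_nalg[OF copS_in_V])
  note i = inj3[OF KV KV KV, THEN alg_hom_ahom]
  note q = alg_hom_ahom[OF incl3(1)[OF KV KV KV]]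
  note c = ahom_closed[OF i(1) cgen_in] ahom_closed[OF i(2) cgen_in] ahom_closed[OF i(3) cgen_in]
  have "indep3 ?S (?i 0 ?g) (?i 1 ?g) (?i 2 ?g)"
    unfolding indep3_def
  proof (intro conjI allI impI)
    show "sq_zero ?S (?i 0 ?g)" "sq_zero ?S (?i 1 ?g)" "sq_zero ?S (?i 2 ?g)"
      by (intro sq_zero_image i S.alg)+
    fix k e f assume eq: "rcomb ?S k (?i 0 ?g) (?i 1 ?g) (?i 2 ?g) = \<zero>\<^bsub>?S\<^esub>"
    define w where "w e = k e False \<odot>\<^bsub>?B\<^esub> opA ?B False (?j 0 ?g) (?j 1 ?g) \<oplus>\<^bsub>?B\<^esub> k e True \<odot>\<^bsub>?B\<^esub> opA ?B True (?j 0 ?g) (?j 1 ?g)" for e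
    have wK: "w e \<in> ker2 KK KK" for e unfolding w_def by (intro ker2_closed ker2_op KV cgen_in)
    have qw: "incl3 KK KK KK (w e) = k e False \<odot>\<^bsub>?S\<^esub> opA ?S False (?i 1 ?g) (?i 2 ?g) \<oplus>\<^bsub>?S\<^esub> k e True \<odot>\<^bsub>?S\<^esub> opA ?S True (?i 1 ?g) (?i 2 ?g)" for e
    proof -
      have o: "opA ?B f (?j 0 ?g) (?j 1 ?g) \<in> carrier ?B" for f using ker2_op[OF KV cgen_in] ker2_sub by blast
      show ?thesis unfolding w_def by (simp only: ahom_add[OF q B.sm_closed[OF o] B.sm_closed[OF o]] ahom_smult[OF q o] incl3_op[OF KV cgen_in])
    qed
    have "opA ?S False (?i 0 ?g) (incl3 KK KK KK (w False)) \<oplus>\<^bsub>?S\<^esub> opA ?S True (?i 0 ?g) (incl3 KK KK KK (w True)) = rcomb ?S k (?i 0 ?g) (?i 1 ?g) (?i 2 ?g)"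
      unfolding qw rcomb_def using c by (simp only: S.opA_add S.opA_smult S.opA_closed S.sm_closed)
    also note eq
    finally have z: "w False \<oplus>\<^bsub>?B\<^esub> 0 \<odot>\<^bsub>?B\<^esub> w True = \<zero>\<^bsub>?B\<^esub>" "1 \<odot>\<^bsub>?B\<^esub> w True = \<zero>\<^bsub>?B\<^esub>"
      by (rule outer_independent[OF KV k wK wK])+
    have wB: "w e \<in> carrier ?B" for e using wK ker2_sub by blast
    then have "w e = \<zero>\<^bsub>?B\<^esub>" using z by (cases e) simp_all
    then show "k e f = 0" using indep2[OF k, of "k e False" "k e True"] unfolding w_def by (cases f) simp_all
  qed simp
  then show ?thesis by blast
qed

lemma ex_hom_to_indep:
  assumes A: "A \<in> V" "sq_zero A a" "sq_zero A b" "sq_zero A c"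
  shows "\<exists>h. ahom (copS [KK, copS [KK, KK]]) A h \<and> h (copI [KK, copS [KK, KK]] 0 (cgen True)) = a \<and>
     h (copI [KK, copS [KK, KK]] 1 (copI [KK, KK] 0 (cgen True))) = b \<and>
     h (copI [KK, copS [KK, KK]] 1 (copI [KK, KK] 1 (cgen True))) = c"
proof -
  note KV = cyc_in_V[of True]
  obtain fa fb fc where f: "ahom KK A fa" "fa (cgen True) = a" "ahom KK A fb" "fb (cgen True) = b" "ahom KK A fc" "fc (cgen True) = c"
    using cyc_hom'[OF A(1)] A(2-4) by metis
  note g = cot2[OF KV KV A(1) f(3,5)]
  note h = cot2[OF KV copS_in_V A(1) f(1) alg_hom_ahom[OF g(1)]]
  note i = inj2[OF KV KV, THEN alg_hom_ahom]
  show ?thesis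
    by (intro exI[of _ "cot2 KK (copS [KK, KK]) A fa (cot2 KK KK A fb fc)"] conjI alg_hom_ahom[OF h(1)])
      (simp_all only: h(2)[OF cgen_in] h(3)[OF ahom_closed[OF i(1) cgen_in]] h(3)[OF ahom_closed[OF i(2) cgen_in]]
        g(2)[OF cgen_in] g(3)[OF cgen_in] f)
qed

text \<open>The last two letters are placed together in G = KK + KK, so that w and w' in KK
  \<diamond> G are combinations of words of degree 3. These vanish by
  \<open>outer_independent\<close>, and evaluation at an independent triple makes their coefficients
  vanish.\<close>

lemma ex_indep4:
  assumes "free2"
  shows "\<exists>A\<in>V. \<exists>a\<in>carrier A. \<exists>b\<in>carrier A. \<exists>c\<in>carrier A. \<exists>d\<in>carrier A. \<forall>k.
    opA A False a (rcomb A (k False) b c d) \<oplus>\<^bsub>A\<^esub> opA A True a (rcomb A (k True) b c d) = \<zero>\<^bsub>A\<^esub> \<longrightarrow> (\<forall>e f g. k e f g = 0)"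
proof -
  have k: "outer_ok 0 1" using assms by (simp add: outer_ok_def)
  let ?G = "copS [KK, KK]" let ?S = "copS [KK, KK, copS [KK, KK]]" let ?B = "copS [KK, copS [KK, KK]]" let ?g = "cgen True"
  let ?i = "copI [KK, KK, copS [KK, KK]]" let ?j = "copI [KK, copS [KK, KK]]" let ?z = "copI [KK, KK] 0 ?g" let ?t = "copI [KK, KK] 1 ?g"
  note KV = cyc_in_V[of True] note GV = copS_in_V[of "[KK, KK]"]
  interpret B: nalg ?B by (rule V_nalg[OF copS_in_V])
  interpret S: nalg ?S by (rule V_nalg[OF copS_in_V])
  note i = inj3[OF KV KV GV, THEN alg_hom_ahom]
  note ig = inj2[OF KV KV, THEN alg_hom_ahom] note j = inj2[OF KV GV, THEN alg_hom_ahom]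
  have z: "?z \<in> carrier ?G" by (rule ahom_closed[OF ig(1) cgen_in])
  have t: "?t \<in> carrier ?G" by (rule ahom_closed[OF ig(2) cgen_in])
  note q = incl3[OF KV KV GV]
  note c = ahom_closed[OF i(1) cgen_in] ahom_closed[OF i(2) cgen_in] ahom_closed[OF i(3) z] ahom_closed[OF i(3) t]
  note cj = ahom_closed[OF j(1) cgen_in] ahom_closed[OF j(2) z] ahom_closed[OF j(2) t]
  obtain A a b c' where ind: "indep3 A a b c'" using ex_indep3[OF assms] by blast
  then have A: "A \<in> V" "sq_zero A a" "sq_zero A b" "sq_zero A c'" by (simp_all add: indep3_def)
  interpret A: nalg A using A(1) by (rule V_nalg)
  obtain h where h: "ahom ?B A h" "h (?j 0 ?g) = a" "h (?j 1 ?z) = b" "h (?j 1 ?t) = c'"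
    using ex_hom_to_indep[OF A] by blast
  have "k e f g = 0"
    if eq: "opA ?S False (?i 0 ?g) (rcomb ?S (k False) (?i 1 ?g) (?i 2 ?z) (?i 2 ?t)) \<oplus>\<^bsub>?S\<^esub>
      opA ?S True (?i 0 ?g) (rcomb ?S (k True) (?i 1 ?g) (?i 2 ?z) (?i 2 ?t)) = \<zero>\<^bsub>?S\<^esub>" for k e f g
  proof -
    define w where "w e = rcomb ?B (k e) (?j 0 ?g) (?j 1 ?z) (?j 1 ?t)" for e
    have wK: "w e \<in> ker2 KK ?G" for e unfolding w_def by (rule ker2_rcomb[OF GV z t])
    have qw: "incl3 KK KK ?G (w e) = rcomb ?S (k e) (?i 1 ?g) (?i 2 ?z) (?i 2 ?t)" for e
      unfolding w_def ahom_rcomb[OF B.alg alg_hom_ahom[OF q(1)] cj] q(2)[OF cgen_in] q(3)[OF z] q(3)[OF t] ..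
    have zz: "w False \<oplus>\<^bsub>?B\<^esub> 0 \<odot>\<^bsub>?B\<^esub> w True = \<zero>\<^bsub>?B\<^esub>" "1 \<odot>\<^bsub>?B\<^esub> w True = \<zero>\<^bsub>?B\<^esub>"
      by (rule outer_independent[OF GV k wK wK], simp only: qw, rule eq)+
    have wB: "w e \<in> carrier ?B" for e using wK ker2_sub by blast
    then have "w e = \<zero>\<^bsub>?B\<^esub>" using zz by (cases e) simp_all
    then have "h (w e) = \<zero>\<^bsub>A\<^esub>" using ahom_zero[OF B.alg A.alg h(1)] by simp
    then have "rcomb A (k e) a b c' = \<zero>\<^bsub>A\<^esub>"
      unfolding w_def ahom_rcomb[OF B.alg h(1) cj] h(2-4) .
    then show ?thesis using ind by (simp add: indep3_def)
  qed
  then show ?thesis using c by (intro bexI[OF _ copS_in_V]) blast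
qed

text \<open>The anticommutative instance of the same argument, with w' = 0: x w is nonzero because w
  = y z is nonzero in KK \<diamond> KK.\<close>

lemma ex_anti3:
  assumes "anti"
  shows "\<exists>A\<in>V. \<exists>a b c. sq_zero A a \<and> sq_zero A b \<and> sq_zero A c \<and> a \<otimes>\<^bsub>A\<^esub> (b \<otimes>\<^bsub>A\<^esub> c) \<noteq> \<zero>\<^bsub>A\<^esub>"
proof -
  have k: "outer_ok (-1) 0" using assms by (simp add: outer_ok_def)
  let ?S = "copS [KK, KK, KK]" let ?B = "copS [KK, KK]" let ?g = "cgen True"
  let ?i = "copI [KK, KK, KK]" let ?j = "copI [KK, KK]"
  note KV = cyc_in_V[of True]
  interpret B: nalg ?B by (rule V_nalg[OF copS_in_V])
  interpret S: nalg ?S by (rule V_nalg[OF copS_in_V])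
  note i = inj3[OF KV KV KV, THEN alg_hom_ahom]
  note q = alg_hom_ahom[OF incl3(1)[OF KV KV KV]]
  note c = ahom_closed[OF i(1) cgen_in] ahom_closed[OF i(2) cgen_in] ahom_closed[OF i(3) cgen_in]
  let ?w = "opA ?B False (?j 0 ?g) (?j 1 ?g)"
  have w: "?w \<in> ker2 KK KK" by (rule ker2_op[OF KV cgen_in])
  then have wB: "?w \<in> carrier ?B" using ker2_sub by blast
  have oB: "opA ?B True (?j 0 ?g) (?j 1 ?g) \<in> carrier ?B" using ker2_op[OF KV cgen_in] ker2_sub by blast
  have nz: "?w \<noteq> \<zero>\<^bsub>?B\<^esub>"
  proof
    assume "?w = \<zero>\<^bsub>?B\<^esub>"
    then have "1 \<odot>\<^bsub>?B\<^esub> ?w \<oplus>\<^bsub>?B\<^esub> 0 \<odot>\<^bsub>?B\<^esub> opA ?B True (?j 0 ?g) (?j 1 ?g) = \<zero>\<^bsub>?B\<^esub>" using oB by simp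
    from indep2(1)[OF k this] show False by simp
  qed
  have "opA ?S False (?i 0 ?g) (opA ?S False (?i 1 ?g) (?i 2 ?g)) \<noteq> \<zero>\<^bsub>?S\<^esub>"
  proof
    assume z: "opA ?S False (?i 0 ?g) (opA ?S False (?i 1 ?g) (?i 2 ?g)) = \<zero>\<^bsub>?S\<^esub>"
    have "opA ?S False (?i 0 ?g) (incl3 KK KK KK ?w) \<oplus>\<^bsub>?S\<^esub> opA ?S True (?i 0 ?g) (incl3 KK KK KK \<zero>\<^bsub>?B\<^esub>) = \<zero>\<^bsub>?S\<^esub>"
      unfolding incl3_op[OF KV cgen_in] ahom_zero[OF B.alg S.alg q] z using c by simp
    from outer_independent(1)[OF KV k w ker2_closed(3)[OF KV] this]
    show False using nz wB by simp
  qed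
  then have "?i 0 ?g \<otimes>\<^bsub>?S\<^esub> (?i 1 ?g \<otimes>\<^bsub>?S\<^esub> ?i 2 ?g) \<noteq> \<zero>\<^bsub>?S\<^esub>" by (simp only: opA_def if_False not_False_eq_True)
  moreover have "sq_zero ?S (?i 0 ?g)" "sq_zero ?S (?i 1 ?g)" "sq_zero ?S (?i 2 ?g)"
    by (intro sq_zero_image i S.alg)+
  ultimately show ?thesis using copS_in_V by blast
qed

lemma ex_anti4:
  assumes "anti"
  shows "\<exists>A\<in>V. \<exists>a\<in>carrier A. \<exists>b\<in>carrier A. \<exists>c\<in>carrier A. \<exists>d\<in>carrier A. a \<otimes>\<^bsub>A\<^esub> (b \<otimes>\<^bsub>A\<^esub> (c \<otimes>\<^bsub>A\<^esub> d)) \<noteq> \<zero>\<^bsub>A\<^esub>"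
proof -
  have k: "outer_ok (-1) 0" using assms by (simp add: outer_ok_def)
  let ?G = "copS [KK, KK]" let ?S = "copS [KK, KK, copS [KK, KK]]" let ?B = "copS [KK, copS [KK, KK]]" let ?g = "cgen True"
  let ?i = "copI [KK, KK, copS [KK, KK]]" let ?j = "copI [KK, copS [KK, KK]]" let ?z = "copI [KK, KK] 0 ?g" let ?t = "copI [KK, KK] 1 ?g"
  note KV = cyc_in_V[of True] note GV = copS_in_V[of "[KK, KK]"]
  interpret B: nalg ?B by (rule V_nalg[OF copS_in_V])
  interpret G: nalg ?G by (rule V_nalg[OF copS_in_V])
  interpret S: nalg ?S by (rule V_nalg[OF copS_in_V])
  note i = inj3[OF KV KV GV, THEN alg_hom_ahom]
  note ig = inj2[OF KV KV, THEN alg_hom_ahom] note j = inj2[OF KV GV, THEN alg_hom_ahom]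
  have z: "?z \<in> carrier ?G" by (rule ahom_closed[OF ig(1) cgen_in])
  have t: "?t \<in> carrier ?G" by (rule ahom_closed[OF ig(2) cgen_in])
  note q = alg_hom_ahom[OF incl3(1)[OF KV KV GV]]
  note c = ahom_closed[OF i(1) cgen_in] ahom_closed[OF i(2) cgen_in] ahom_closed[OF i(3) z] ahom_closed[OF i(3) t]
  have zt: "?z \<otimes>\<^bsub>?G\<^esub> ?t \<in> carrier ?G" using z t by (rule G.mult_closed)
  obtain A a b c' where A: "A \<in> V" "sq_zero A a" "sq_zero A b" "sq_zero A c'" "a \<otimes>\<^bsub>A\<^esub> (b \<otimes>\<^bsub>A\<^esub> c') \<noteq> \<zero>\<^bsub>A\<^esub>"
    using ex_anti3[OF assms] by blast
  interpret A: nalg A using A(1) by (rule V_nalg)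
  obtain h where h: "ahom ?B A h" "h (?j 0 ?g) = a" "h (?j 1 ?z) = b" "h (?j 1 ?t) = c'"
    using ex_hom_to_indep[OF A(1-4)] by blast
  let ?w = "opA ?B False (?j 0 ?g) (?j 1 (?z \<otimes>\<^bsub>?G\<^esub> ?t))"
  have w: "?w \<in> ker2 KK ?G" by (rule ker2_op[OF GV zt])
  then have wB: "?w \<in> carrier ?B" using ker2_sub by blast
  have e1: "h ?w = opA A False a (h (?j 1 (?z \<otimes>\<^bsub>?G\<^esub> ?t)))"
    by (simp only: ahom_opA[OF h(1) ahom_closed[OF j(1) cgen_in] ahom_closed[OF j(2) zt]] h(2))
  have e2: "h (?j 1 (?z \<otimes>\<^bsub>?G\<^esub> ?t)) = b \<otimes>\<^bsub>A\<^esub> c'"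
    by (simp only: ahom_mult[OF j(2) z t] ahom_mult[OF h(1) ahom_closed[OF j(2) z] ahom_closed[OF j(2) t]] h(3,4))
  have "h ?w = a \<otimes>\<^bsub>A\<^esub> (b \<otimes>\<^bsub>A\<^esub> c')" unfolding e1 e2 by (simp only: opA_def if_False)
  then have nz: "?w \<noteq> \<zero>\<^bsub>?B\<^esub>" using A(5) ahom_zero[OF B.alg A.alg h(1)] by auto
  have "opA ?S False (?i 0 ?g) (opA ?S False (?i 1 ?g) (?i 2 (?z \<otimes>\<^bsub>?G\<^esub> ?t))) \<noteq> \<zero>\<^bsub>?S\<^esub>"
  proof
    assume z0: "opA ?S False (?i 0 ?g) (opA ?S False (?i 1 ?g) (?i 2 (?z \<otimes>\<^bsub>?G\<^esub> ?t))) = \<zero>\<^bsub>?S\<^esub>"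
    have "opA ?S False (?i 0 ?g) (incl3 KK KK ?G ?w) \<oplus>\<^bsub>?S\<^esub> opA ?S True (?i 0 ?g) (incl3 KK KK ?G \<zero>\<^bsub>?B\<^esub>) = \<zero>\<^bsub>?S\<^esub>"
      unfolding incl3_op[OF GV zt] ahom_zero[OF B.alg S.alg q] z0 using c by simp
    from outer_independent(1)[OF GV k w ker2_closed(3)[OF GV] this]
    show False using nz wB by simp
  qed
  then have "?i 0 ?g \<otimes>\<^bsub>?S\<^esub> (?i 1 ?g \<otimes>\<^bsub>?S\<^esub> (?i 2 ?z \<otimes>\<^bsub>?S\<^esub> ?i 2 ?t)) \<noteq> \<zero>\<^bsub>?S\<^esub>"
    by (simp only: opA_def if_False not_False_eq_True ahom_mult[OF i(3) z t])
  then show ?thesis using c copS_in_V[of "[KK, KK, ?G]"] by blast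
qed

section \<open>The anticommutative and the commutative case\<close>

lemma ex_scalar_reassoc:
  assumes "\<And>A a b. \<lbrakk>A \<in> V; a \<in> carrier A; b \<in> carrier A\<rbrakk> \<Longrightarrow> a \<otimes>\<^bsub>A\<^esub> b = s \<odot>\<^bsub>A\<^esub> (b \<otimes>\<^bsub>A\<^esub> a)"
  shows "\<exists>l. \<forall>A\<in>V. \<forall>a\<in>carrier A. \<forall>b\<in>carrier A. \<forall>c\<in>carrier A. (a \<otimes>\<^bsub>A\<^esub> b) \<otimes>\<^bsub>A\<^esub> c = l \<odot>\<^bsub>A\<^esub> (a \<otimes>\<^bsub>A\<^esub> (b \<otimes>\<^bsub>A\<^esub> c))"
proof -
  let ?k = "reassoc_right False False"
  \<comment> \<open>Replacing the opposite operation by the multiplication costs one factor s for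
    each index \<open>True\<close>.\<close>
  let ?l = "?k False False + ?k False True * s + ?k True False * s + ?k True True * s * s"
  have "(a \<otimes>\<^bsub>A\<^esub> b) \<otimes>\<^bsub>A\<^esub> c = ?l \<odot>\<^bsub>A\<^esub> (a \<otimes>\<^bsub>A\<^esub> (b \<otimes>\<^bsub>A\<^esub> c))"
    if A: "A \<in> V" "a \<in> carrier A" "b \<in> carrier A" "c \<in> carrier A" for A a b c
  proof -
    interpret A: nalg A using A(1) by (rule V_nalg)
    have s: "c \<otimes>\<^bsub>A\<^esub> b = s \<odot>\<^bsub>A\<^esub> (b \<otimes>\<^bsub>A\<^esub> c)" "(b \<otimes>\<^bsub>A\<^esub> c) \<otimes>\<^bsub>A\<^esub> a = s \<odot>\<^bsub>A\<^esub> (a \<otimes>\<^bsub>A\<^esub> (b \<otimes>\<^bsub>A\<^esub> c))"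
      by (rule assms[OF A(1)]; use A in \<open>simp\<close>)+
    show ?thesis using reassoc[OF A, of False False] A(2-)
      by (simp add: opA_def rcomb_def s A.bilin A.add_assoc mult.assoc)
  qed
  then show ?thesis by blast
qed

text \<open>Write P for a (b c). A cyclic shift of the letters multiplies P by - l, and exchanging
  the last two multiplies it by -1. The cube of the shift gives 1 + l^3 = 0, and reaching P c b a in
  two ways gives l + l^2 = 0, so l = -1. Degree 4 then yields a sign contradiction unless 2 =
  0.\<close>

lemma anti_char2:
  assumes "anti"
  shows "(2 :: 'k) = 0"
proof -
  have sw: "a \<otimes>\<^bsub>A\<^esub> b = (-1) \<odot>\<^bsub>A\<^esub> (b \<otimes>\<^bsub>A\<^esub> a)" if A: "A \<in> V" "a \<in> carrier A" "b \<in> carrier A" for A a b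
  proof -
    interpret A: nalg A using A(1) by (rule V_nalg)
    have "a \<otimes>\<^bsub>A\<^esub> b \<oplus>\<^bsub>A\<^esub> b \<otimes>\<^bsub>A\<^esub> a = \<zero>\<^bsub>A\<^esub>" using assms A by (simp add: anti_def)
    then show ?thesis
      using A.M.minus_equality[of "a \<otimes>\<^bsub>A\<^esub> b" "b \<otimes>\<^bsub>A\<^esub> a"] A(2,3) by (simp add: A.sm_uminus)
  qed
  obtain l where l: "\<And>A a b c. \<lbrakk>A \<in> V; a \<in> carrier A; b \<in> carrier A; c \<in> carrier A\<rbrakk> \<Longrightarrow>
      (a \<otimes>\<^bsub>A\<^esub> b) \<otimes>\<^bsub>A\<^esub> c = l \<odot>\<^bsub>A\<^esub> (a \<otimes>\<^bsub>A\<^esub> (b \<otimes>\<^bsub>A\<^esub> c))"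
    using ex_scalar_reassoc[of "-1"] sw by blast
  have l1: "l = -1"
  proof -
    obtain A a b c where A: "A \<in> V" "sq_zero A a" "sq_zero A b" "sq_zero A c" "a \<otimes>\<^bsub>A\<^esub> (b \<otimes>\<^bsub>A\<^esub> c) \<noteq> \<zero>\<^bsub>A\<^esub>"
      using ex_anti3[OF assms] by blast
    interpret A: nalg A using A(1) by (rule V_nalg)
    define P where "P x y z = x \<otimes>\<^bsub>A\<^esub> (y \<otimes>\<^bsub>A\<^esub> z)" for x y z
    have abc: "a \<in> carrier A" "b \<in> carrier A" "c \<in> carrier A" using A by (simp_all add: sq_zero_def)
    have Pc: "P x y z \<in> carrier A" if "x \<in> carrier A" "y \<in> carrier A" "z \<in> carrier A" for x y z using that by (simp add: P_def)
    have cyc: "P z x y = (- l) \<odot>\<^bsub>A\<^esub> P x y z" if "x \<in> carrier A" "y \<in> carrier A" "z \<in> carrier A" for x y z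
      using sw[OF A(1), of z "x \<otimes>\<^bsub>A\<^esub> y"] l[OF A(1) that] that by (simp add: P_def A.sm_sm)
    have swp: "P x z y = (-1) \<odot>\<^bsub>A\<^esub> P x y z" if "x \<in> carrier A" "y \<in> carrier A" "z \<in> carrier A" for x y z
      using sw[OF A(1), of z y] that by (simp add: P_def A.mult_sm_right)
    have "P a b c = (- l) \<odot>\<^bsub>A\<^esub> P b c a" using cyc[OF abc(2,3,1)] .
    also have "P b c a = (- l) \<odot>\<^bsub>A\<^esub> P c a b" using cyc[OF abc(3,1,2)] .
    also have "P c a b = (- l) \<odot>\<^bsub>A\<^esub> P a b c" using cyc[OF abc] .
    finally have P3: "P a b c = (- l * l * l) \<odot>\<^bsub>A\<^esub> P a b c" using Pc[OF abc] by (simp add: A.sm_sm mult.assoc)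
    have "(1 + l * l * l) \<odot>\<^bsub>A\<^esub> P a b c = \<zero>\<^bsub>A\<^esub>"
    proof -
      have "(1 + l * l * l) \<odot>\<^bsub>A\<^esub> P a b c = P a b c \<oplus>\<^bsub>A\<^esub> (l * l * l) \<odot>\<^bsub>A\<^esub> P a b c"
        using Pc[OF abc] by (simp add: A.sm_add_left)
      also have "\<dots> = (- l * l * l) \<odot>\<^bsub>A\<^esub> P a b c \<oplus>\<^bsub>A\<^esub> (l * l * l) \<odot>\<^bsub>A\<^esub> P a b c" by (subst (1) P3) simp
      also have "\<dots> = \<zero>\<^bsub>A\<^esub>" using Pc[OF abc] by (simp flip: A.sm_add_left)
      finally show ?thesis .
    qed
    then have e1: "1 + l * l * l = 0" using A.sm_eq_zero[OF _ Pc[OF abc]] A(5) by (auto simp: P_def)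
    have "P c b a = (- l) \<odot>\<^bsub>A\<^esub> P b a c" using cyc[OF abc(2,1,3)] .
    also have "P b a c = (- l) \<odot>\<^bsub>A\<^esub> P a c b" using cyc[OF abc(1,3,2)] .
    also have "P a c b = (-1) \<odot>\<^bsub>A\<^esub> P a b c" using swp[OF abc] .
    finally have "P c b a = (- (l * l)) \<odot>\<^bsub>A\<^esub> P a b c" using Pc[OF abc] by (simp add: A.sm_sm)
    moreover have "P c b a = (-1) \<odot>\<^bsub>A\<^esub> P c a b" using swp[OF abc(3,1,2)] .
    moreover have "P c a b = (- l) \<odot>\<^bsub>A\<^esub> P a b c" using cyc[OF abc] .
    ultimately have "l \<odot>\<^bsub>A\<^esub> P a b c = (- (l * l)) \<odot>\<^bsub>A\<^esub> P a b c" using Pc[OF abc] by (simp add: A.sm_sm)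
    then have "(l + l * l) \<odot>\<^bsub>A\<^esub> P a b c = \<zero>\<^bsub>A\<^esub>"
      using Pc[OF abc] A.sm_add_left[OF Pc[OF abc], of "- (l * l)" "l * l"] by (simp add: A.sm_add_left)
    then have "l + l * l = 0" using A.sm_eq_zero[OF _ Pc[OF abc]] A(5) by (auto simp: P_def)
    then have "l * (l + 1) = 0" by (simp add: algebra_simps)
    moreover have "l \<noteq> 0" using e1 by auto
    ultimately show "l = -1" by (simp add: eq_neg_iff_add_eq_0)
  qed
  obtain A a b c d where A: "A \<in> V" "a \<in> carrier A" "b \<in> carrier A" "c \<in> carrier A" "d \<in> carrier A"
    "a \<otimes>\<^bsub>A\<^esub> (b \<otimes>\<^bsub>A\<^esub> (c \<otimes>\<^bsub>A\<^esub> d)) \<noteq> \<zero>\<^bsub>A\<^esub>" using ex_anti4[OF assms] by blast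
  interpret A: nalg A using A(1) by (rule V_nalg)
  let ?Q = "a \<otimes>\<^bsub>A\<^esub> (b \<otimes>\<^bsub>A\<^esub> (c \<otimes>\<^bsub>A\<^esub> d))"
  have Q: "?Q \<in> carrier A" using A(2-5) by simp
  note l' = l[OF A(1), unfolded l1]
  \<comment> \<open>Two rebracketings pass through (a b)(c d) and give the sign +1; the three that
    pass through (a (b c)) d give -1.\<close>
  have "((a \<otimes>\<^bsub>A\<^esub> b) \<otimes>\<^bsub>A\<^esub> c) \<otimes>\<^bsub>A\<^esub> d = ?Q"
    using A(2-5) l'[of "a \<otimes>\<^bsub>A\<^esub> b" c d] l'[of a b "c \<otimes>\<^bsub>A\<^esub> d"] by (simp add: A.sm_sm)
  moreover have "((a \<otimes>\<^bsub>A\<^esub> b) \<otimes>\<^bsub>A\<^esub> c) \<otimes>\<^bsub>A\<^esub> d = (-1) \<odot>\<^bsub>A\<^esub> ?Q"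
    using A(2-5) l'[of a b c] l'[of a "b \<otimes>\<^bsub>A\<^esub> c" d] l'[of b c d] by (simp add: A.bilin)
  ultimately have "?Q \<oplus>\<^bsub>A\<^esub> ?Q = \<zero>\<^bsub>A\<^esub>" using A.sm_minus_one_add[OF Q] by simp
  then have "(1 + 1) \<odot>\<^bsub>A\<^esub> ?Q = \<zero>\<^bsub>A\<^esub>" using A.sm_add_left[OF Q, of 1 1] Q by simp
  then show ?thesis using A.sm_eq_zero[OF _ Q] A(6) by auto
qed

text \<open>With P for a (b c), the cube of the cyclic shift gives P = l^3 P, and the reversal of
  the letters gives l P = l^2 P. Together they yield P = l P for the given a, b, c. No equation l =
  1 is claimed, since P may be zero throughout.\<close>

lemma comm_assoc:
  assumes comm: "\<And>A a b. \<lbrakk>A \<in> V; a \<in> carrier A; b \<in> carrier A\<rbrakk> \<Longrightarrow> a \<otimes>\<^bsub>A\<^esub> b = b \<otimes>\<^bsub>A\<^esub> a"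
    and A: "A \<in> V" and abc: "a \<in> carrier A" "b \<in> carrier A" "c \<in> carrier A"
  shows "a \<otimes>\<^bsub>A\<^esub> (b \<otimes>\<^bsub>A\<^esub> c) = (a \<otimes>\<^bsub>A\<^esub> b) \<otimes>\<^bsub>A\<^esub> c"
proof -
  interpret A: nalg A using A by (rule V_nalg)
  have "a \<otimes>\<^bsub>A\<^esub> b = 1 \<odot>\<^bsub>A\<^esub> (b \<otimes>\<^bsub>A\<^esub> a)" if "A \<in> V" "a \<in> carrier A" "b \<in> carrier A" for A a b
    using comm[OF that] nalg.sm_one[OF V_nalg[OF that(1)]] nalg.mult_closed[OF V_nalg[OF that(1)]] that by simp
  then obtain l where l: "\<And>a b c. \<lbrakk>a \<in> carrier A; b \<in> carrier A; c \<in> carrier A\<rbrakk> \<Longrightarrow>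
      (a \<otimes>\<^bsub>A\<^esub> b) \<otimes>\<^bsub>A\<^esub> c = l \<odot>\<^bsub>A\<^esub> (a \<otimes>\<^bsub>A\<^esub> (b \<otimes>\<^bsub>A\<^esub> c))"
    using ex_scalar_reassoc[of 1] A by blast
  define P where "P x y z = x \<otimes>\<^bsub>A\<^esub> (y \<otimes>\<^bsub>A\<^esub> z)" for x y z
  have Pc: "P x y z \<in> carrier A" if "x \<in> carrier A" "y \<in> carrier A" "z \<in> carrier A" for x y z using that by (simp add: P_def)
  have cyc: "P z x y = l \<odot>\<^bsub>A\<^esub> P x y z" if "x \<in> carrier A" "y \<in> carrier A" "z \<in> carrier A" for x y z
    using comm[OF A, of z "x \<otimes>\<^bsub>A\<^esub> y"] l[OF that] that by (simp add: P_def)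
  have swp: "P x z y = P x y z" if "x \<in> carrier A" "y \<in> carrier A" "z \<in> carrier A" for x y z
    using comm[OF A that(2,3)] by (simp add: P_def)
  have "P a b c = l \<odot>\<^bsub>A\<^esub> P b c a" using cyc[OF abc(2,3,1)] .
  also have "P b c a = l \<odot>\<^bsub>A\<^esub> P c a b" using cyc[OF abc(3,1,2)] .
  also have "P c a b = l \<odot>\<^bsub>A\<^esub> P a b c" using cyc[OF abc] .
  finally have 1: "P a b c = (l * (l * l)) \<odot>\<^bsub>A\<^esub> P a b c" using Pc[OF abc] by (simp add: A.sm_sm)
  have "l \<odot>\<^bsub>A\<^esub> P a b c = P c a b" using cyc[OF abc] ..
  also have "P c a b = P c b a" using swp[OF abc(3,2,1)] .
  also have "P c b a = l \<odot>\<^bsub>A\<^esub> P b a c" using cyc[OF abc(2,1,3)] .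
  also have "P b a c = l \<odot>\<^bsub>A\<^esub> P a c b" using cyc[OF abc(1,3,2)] .
  also have "P a c b = P a b c" using swp[OF abc] .
  finally have 2: "l \<odot>\<^bsub>A\<^esub> P a b c = (l * l) \<odot>\<^bsub>A\<^esub> P a b c" using Pc[OF abc] by (simp add: A.sm_sm)
  have "P a b c = l \<odot>\<^bsub>A\<^esub> ((l * l) \<odot>\<^bsub>A\<^esub> P a b c)" unfolding A.sm_sm[OF Pc[OF abc]] by (rule 1)
  also have "\<dots> = l \<odot>\<^bsub>A\<^esub> (l \<odot>\<^bsub>A\<^esub> P a b c)" unfolding 2 ..
  also have "\<dots> = (l * l) \<odot>\<^bsub>A\<^esub> P a b c" by (rule A.sm_sm[OF Pc[OF abc]])
  also have "\<dots> = l \<odot>\<^bsub>A\<^esub> P a b c" by (rule 2[symmetric])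
  finally show ?thesis using l[OF abc] by (simp add: P_def)
qed

end

section \<open>Two-by-two matrices\<close>

type_synonym 'k mat2 = "bool \<Rightarrow> bool \<Rightarrow> 'k"

definition det2 :: "'k::field mat2 \<Rightarrow> 'k" where
  "det2 m = m False False * m True True - m False True * m True False"

definition tr2 :: "'k::field mat2 \<Rightarrow> 'k" where
  "tr2 m = m False False + m True True"

definition one2 :: "'k::field mat2" where
  "one2 y e = (if y = e then 1 else 0)"

definition mul2 :: "'k::field mat2 \<Rightarrow> 'k mat2 \<Rightarrow> 'k mat2" where
  "mul2 a b y e = (\<Sum>t\<in>UNIV. a y t * b t e)"

lemma cayley_hamilton2: "det2 m * one2 y e = tr2 m * m y e - mul2 m m y e"
  by (cases y; cases e) (simp_all add: det2_def one2_def tr2_def mul2_def UNIV_bool algebra_simps)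

text \<open>A singular matrix has rank at most one, so the image of k is parallel to every
  column.\<close>

lemma singular_image2:
  assumes "det2 m = (0 :: 'k::field)"
  shows "(\<Sum>e\<in>UNIV. m True e * k e) * m False x = (\<Sum>e\<in>UNIV. m False e * k e) * m True x"
proof -
  have "m False False * m True True = m False True * m True False" using assms by (simp add: det2_def)
  then show ?thesis by (cases x) (simp_all add: UNIV_bool algebra_simps)
qed

text \<open>A linear space of 2 x 2 matrices of rank at most one has a common kernel vector or a
  common image line. Take a nonzero member \<open>n i\<close> with kernel vector k. If some
  \<open>n j\<close> moves k, then singularity of sums with \<open>n i\<close> puts all vectors
  \<open>n l k\<close> on the image line of \<open>n i\<close>, and singularity of sums with
  \<open>n j\<close> puts every column on that line. The determinant is quadratic, so pairwise sums
  suffice.\<close>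

lemma singular_space2:
  fixes n :: "'i \<Rightarrow> 'k::field mat2"
  assumes sing: "\<And>i. det2 (n i) = 0" "\<And>i j. det2 (\<lambda>y e. n i y e + n j y e) = 0"
  shows "(\<exists>u. (u False \<noteq> 0 \<or> u True \<noteq> 0) \<and> (\<forall>i y. (\<Sum>e\<in>UNIV. n i y e * u e) = 0)) \<or>
    (\<exists>\<theta>. (\<theta> False \<noteq> 0 \<or> \<theta> True \<noteq> 0) \<and> (\<forall>i e. (\<Sum>y\<in>UNIV. \<theta> y * n i y e) = 0))"
proof (cases "\<forall>i y e. n i y e = 0")
  case True
  then show ?thesis by (intro disjI1 exI[of _ "\<lambda>_. 1"]) simp
next
  case False
  then obtain i y e0 where nz: "n i y e0 \<noteq> 0" by blast
  \<comment> \<open>A vector orthogonal to a nonzero row y of the singular matrix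
    \<open>n i\<close>.\<close>
  define k where "k e = (if e then - n i y False else n i y True)" for e
  have k0: "k False \<noteq> 0 \<or> k True \<noteq> 0" using nz by (cases e0) (auto simp: k_def)
  have nk: "(\<Sum>e\<in>UNIV. n i x e * k e) = 0" for x
  proof -
    have "n i False False * n i True True = n i False True * n i True False" using sing(1)[of i] by (simp add: det2_def)
    then show ?thesis by (cases x; cases y) (simp_all add: UNIV_bool k_def algebra_simps)
  qed
  define v where "v j x = (\<Sum>e\<in>UNIV. n j x e * k e)" for j x
  have vi: "v i x = 0" for x using nk by (simp add: v_def)
  have s1: "v j True * n j False x = v j False * n j True x" for j x
    using singular_image2[OF sing(1)[of j], of k x] by (simp add: v_def)
  have s2: "(v j True + v l True) * (n j False x + n l False x) = (v j False + v l False) * (n j True x + n l True x)" for j l x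
    using singular_image2[OF sing(2)[of j l], of k x] by (simp add: v_def sum.distrib distrib_right)
  show ?thesis
  proof (cases "\<forall>j x. v j x = 0")
    case True
    then show ?thesis using k0 by (intro disjI1 exI[of _ k]) (simp add: v_def)
  next
    case False
    then obtain j where m0: "v j False \<noteq> 0 \<or> v j True \<noteq> 0" by (metis (full_types))
    have vn: "v l True * n i False x = v l False * n i True x" for l x
      using s2[of l i x] s1[of l x] by (simp add: vi distrib_left)
    have col: "n i False e0 \<noteq> 0 \<or> n i True e0 \<noteq> 0" using nz by (cases y) auto
    \<comment> \<open>All vectors \<open>v l\<close> lie on the line spanned by a nonzero column of
      \<open>n i\<close>.\<close>
    have par: "v l True * v j False = v l False * v j True" for l
    proof (cases "n i False e0 = 0")
      case True
      then have "v l False = 0" "v j False = 0" using vn[of l e0] vn[of j e0] col by auto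
      then show ?thesis by simp
    next
      case False
      have "v l True * v j False * n i False e0 = v j False * (v l False * n i True e0)"
        by (simp add: mult_ac flip: vn[of l e0])
      also have "\<dots> = v l False * v j True * n i False e0"
        by (simp add: mult_ac vn[of j e0])
      finally have "v l True * v j False * n i False e0 = v l False * v j True * n i False e0" .
      then show ?thesis using False by simp
    qed
    have "v j True * n l False x = v j False * n l True x" for l x
    proof -
      have c: "v l True * n j False x + v j True * n l False x = v l False * n j True x + v j False * n l True x"
        using s2[of l j x] s1[of l x] s1[of j x] by (simp add: algebra_simps)
      have "v l True * n j False x = v l False * n j True x"
      proof (cases "v j False = 0")
        case True
        then have "v l False = 0" "n j False x = 0" using par[of l] m0 s1[of j x] by auto
        then show ?thesis by simp
      next
        case False
        have "v j False * (v l True * n j False x) = (v l True * v j False) * n j False x" by simp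
        also have "\<dots> = v l False * (v j True * n j False x)" by (simp add: par)
        also have "\<dots> = v j False * (v l False * n j True x)" by (simp add: s1)
        finally have "v j False * (v l True * n j False x) = v j False * (v l False * n j True x)" .
        then show ?thesis using False by simp
      qed
      then show ?thesis using c by simp
    qed
    then show ?thesis using m0
      by (intro disjI2 exI[of _ "\<lambda>y. if y then - v j False else v j True"]) (auto simp: UNIV_bool)
  qed
qed

definition comb2 :: "('i::finite \<Rightarrow> 'k::field mat2) \<Rightarrow> ('i \<Rightarrow> 'k) \<Rightarrow> 'k mat2" where
  "comb2 H c y e = (\<Sum>i\<in>UNIV. c i * H i y e)"

lemma comb2_unit: "comb2 H (\<lambda>j. if j = i then 1 else 0) y e = H i y e"
  by (simp add: comb2_def if_distrib[of "\<lambda>x. x * _"] cong: if_cong)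

lemma comb2_add: "comb2 H (\<lambda>i. c i + d i) y e = comb2 H c y e + comb2 H d y e"
  by (simp add: comb2_def distrib_right sum.distrib)

lemma comb2_scale: "comb2 H (\<lambda>i. a * c i) y e = a * comb2 H c y e"
  by (simp add: comb2_def sum_distrib_left mult.assoc)

lemma comb2_mul:
  assumes K: "\<And>i j y e. mul2 (H i) (H j) y e = (\<Sum>k\<in>UNIV. K i j k * H k y e)"
  shows "mul2 (comb2 H c) (comb2 H d) y e = comb2 H (\<lambda>k. \<Sum>i\<in>UNIV. \<Sum>j\<in>UNIV. c i * d j * K i j k) y e"
proof -
  have "mul2 (comb2 H c) (comb2 H d) y e = (\<Sum>t\<in>UNIV. \<Sum>i\<in>UNIV. \<Sum>j\<in>UNIV. c i * d j * (H i y t * H j t e))"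
    by (simp add: mul2_def comb2_def sum_product mult_ac)
  also have "\<dots> = (\<Sum>i\<in>UNIV. \<Sum>j\<in>UNIV. \<Sum>t\<in>UNIV. c i * d j * (H i y t * H j t e))"
    by (subst sum.swap, intro sum.cong refl, rule sum.swap)
  also have "\<dots> = (\<Sum>i\<in>UNIV. \<Sum>j\<in>UNIV. c i * d j * mul2 (H i) (H j) y e)"
    by (simp add: mul2_def sum_distrib_left)
  also have "\<dots> = (\<Sum>i\<in>UNIV. \<Sum>j\<in>UNIV. \<Sum>k\<in>UNIV. c i * d j * K i j k * H k y e)"
    by (simp add: K sum_distrib_left mult.assoc)
  also have "\<dots> = (\<Sum>i\<in>UNIV. \<Sum>k\<in>UNIV. \<Sum>j\<in>UNIV. c i * d j * K i j k * H k y e)"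
    by (rule sum.cong[OF refl], rule sum.swap)
  also have "\<dots> = (\<Sum>k\<in>UNIV. \<Sum>i\<in>UNIV. \<Sum>j\<in>UNIV. c i * d j * K i j k * H k y e)"
    by (rule sum.swap)
  also have "\<dots> = comb2 H (\<lambda>k. \<Sum>i\<in>UNIV. \<Sum>j\<in>UNIV. c i * d j * K i j k) y e"
    by (simp add: comb2_def sum_distrib_right)
  finally show ?thesis .
qed

text \<open>If all combinations were singular, \<open>singular_space2\<close> would give a common
  vector in the kernels or in the left kernels, against the assumptions. For an invertible element
  m, Cayley-Hamilton writes the identity as a combination of m and m^2, which lie in the
  span.\<close>

lemma ex_comb2_one:
  fixes H :: "'i::finite \<Rightarrow> 'k::field mat2"
  assumes K: "\<And>i j y e. mul2 (H i) (H j) y e = (\<Sum>k\<in>UNIV. K i j k * H k y e)"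
    and ker: "\<And>u. (\<And>i y. (\<Sum>e\<in>UNIV. H i y e * u e) = 0) \<Longrightarrow> u False = 0 \<and> u True = 0"
    and im: "\<And>\<theta>. (\<And>i e. (\<Sum>y\<in>UNIV. \<theta> y * H i y e) = 0) \<Longrightarrow> \<theta> False = 0 \<and> \<theta> True = 0"
  shows "\<exists>d. comb2 H d = one2"
proof -
  have "\<exists>d. det2 (comb2 H d) \<noteq> 0"
  proof (rule ccontr)
    assume "\<nexists>d. det2 (comb2 H d) \<noteq> 0"
    then have z: "det2 (comb2 H d) = 0" for d by blast
    have e1: "comb2 H (\<lambda>j. if j = i then 1 else 0) = H i" for i by (intro ext) (rule comb2_unit)
    have e2: "comb2 H (\<lambda>k. (if k = i then 1 else 0) + (if k = j then 1 else 0)) = (\<lambda>y e. H i y e + H j y e)" for i j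
      by (intro ext) (simp only: comb2_add comb2_unit)
    show False
      using singular_space2[of H, OF z[of "\<lambda>j. if j = i then 1 else 0" for i, unfolded e1]
          z[of "\<lambda>k. (if k = i then 1 else 0) + (if k = j then 1 else 0)" for i j, unfolded e2]] ker im by blast
  qed
  then obtain d where d: "det2 (comb2 H d) \<noteq> 0" by blast
  define k where "k l = (\<Sum>i\<in>UNIV. \<Sum>j\<in>UNIV. d i * d j * K i j l)" for l
  have sq: "mul2 (comb2 H d) (comb2 H d) y e = comb2 H k y e" for y e
    unfolding comb2_mul[OF K] k_def ..
  let ?D = "det2 (comb2 H d)" and ?t = "tr2 (comb2 H d)"
  have "comb2 H (\<lambda>i. inverse ?D * (?t * d i + (-1) * k i)) y e = one2 y e" for y e
  proof -
    have "comb2 H (\<lambda>i. inverse ?D * (?t * d i + (-1) * k i)) y e = inverse ?D * (?t * comb2 H d y e - mul2 (comb2 H d) (comb2 H d) y e)"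
      by (simp only: comb2_add comb2_scale sq) simp
    also have "\<dots> = inverse ?D * (?D * one2 y e)" by (simp only: cayley_hamilton2)
    also have "\<dots> = one2 y e" using d by simp
    finally show ?thesis .
  qed
  then show ?thesis by (intro exI[of _ "\<lambda>i. inverse ?D * (?t * d i + (-1) * k i)"] ext)
qed

text \<open>An algebra of matrices with a character \<open>\<epsilon>\<close> that extends to a linear functional \<open>D\<close> has a
  common eigenvector: the elements \<open>T c - \<epsilon>(c)\<close> are singular, since otherwise the
  identity matrix is of this form by the Cayley-Hamilton theorem.\<close>

lemma common_eigenvector:
  fixes H :: "'i::finite \<Rightarrow> 'k::field mat2"
  assumes K: "\<And>i j y e. mul2 (H i) (H j) y e = (\<Sum>k\<in>UNIV. K i j k * H k y e)"
    and eps: "\<And>i j. (\<Sum>k\<in>UNIV. K i j k * \<epsilon> k) = \<epsilon> i * \<epsilon> j"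
    and D: "\<And>i. (\<Sum>y\<in>UNIV. \<Sum>e\<in>UNIV. D y e * H i y e) = \<epsilon> i"
    and i0: "\<epsilon> i0 \<noteq> 0"
  shows "\<exists>u \<chi>. (u False \<noteq> 0 \<or> u True \<noteq> 0) \<and> (\<forall>i y. (\<Sum>e\<in>UNIV. H i y e * u e) = \<chi> i * u y)"
proof -
  define E where "E c = (\<Sum>i\<in>UNIV. c i * \<epsilon> i)" for c
  have Eadd: "E (\<lambda>i. c i + d i) = E c + E d" for c d by (simp add: E_def distrib_right sum.distrib)
  have Esc: "E (\<lambda>i. a * c i) = a * E c" for a c by (simp add: E_def sum_distrib_left mult.assoc)
  have Eu: "E (\<lambda>j. if j = i then 1 else 0) = \<epsilon> i" for i
    by (simp add: E_def if_distrib[of "\<lambda>x. x * _"] cong: if_cong)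
  define P where "P c d k = (\<Sum>i\<in>UNIV. \<Sum>j\<in>UNIV. c i * d j * K i j k)" for c d k
  have mulP: "mul2 (comb2 H c) (comb2 H d) y e = comb2 H (P c d) y e" for c d y e
    unfolding comb2_mul[OF K] P_def ..
  have EP: "E (P c d) = E c * E d" for c d
  proof -
    have "E (P c d) = (\<Sum>k\<in>UNIV. \<Sum>i\<in>UNIV. \<Sum>j\<in>UNIV. c i * d j * (K i j k * \<epsilon> k))"
      by (simp add: E_def P_def sum_distrib_right mult.assoc)
    also have "\<dots> = (\<Sum>i\<in>UNIV. \<Sum>k\<in>UNIV. \<Sum>j\<in>UNIV. c i * d j * (K i j k * \<epsilon> k))"
      by (rule sum.swap)
    also have "\<dots> = (\<Sum>i\<in>UNIV. \<Sum>j\<in>UNIV. \<Sum>k\<in>UNIV. c i * d j * (K i j k * \<epsilon> k))"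
      by (rule sum.cong[OF refl], rule sum.swap)
    also have "\<dots> = (\<Sum>i\<in>UNIV. \<Sum>j\<in>UNIV. c i * d j * (\<epsilon> i * \<epsilon> j))"
      by (simp add: eps flip: sum_distrib_left)
    also have "\<dots> = E c * E d" by (simp add: E_def sum_product mult_ac)
    finally show ?thesis .
  qed
  have DT: "(\<Sum>y\<in>UNIV. \<Sum>e\<in>UNIV. D y e * comb2 H c y e) = E c" for c
  proof -
    have "(\<Sum>y\<in>UNIV. \<Sum>e\<in>UNIV. D y e * comb2 H c y e) = (\<Sum>y\<in>UNIV. \<Sum>e\<in>UNIV. \<Sum>i\<in>UNIV. c i * (D y e * H i y e))"
      by (simp add: comb2_def sum_distrib_left mult_ac)
    also have "\<dots> = (\<Sum>y\<in>UNIV. \<Sum>i\<in>UNIV. \<Sum>e\<in>UNIV. c i * (D y e * H i y e))"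
      by (intro sum.cong refl, rule sum.swap)
    also have "\<dots> = (\<Sum>i\<in>UNIV. \<Sum>y\<in>UNIV. \<Sum>e\<in>UNIV. c i * (D y e * H i y e))" by (rule sum.swap)
    also have "\<dots> = E c" by (simp add: E_def D flip: sum_distrib_left)
    finally show ?thesis .
  qed
  have sing: "det2 (\<lambda>y e. comb2 H c y e - E c * one2 y e) = 0" for c
  proof (rule ccontr)
    define j where "j y e = comb2 H c y e - E c * one2 y e" for y e
    assume "det2 (\<lambda>y e. comb2 H c y e - E c * one2 y e) \<noteq> 0"
    then have dj: "det2 j \<noteq> 0" by (simp add: j_def[abs_def])
    have jj: "mul2 j j y e = comb2 H (P c c) y e - 2 * E c * comb2 H c y e + E c * E c * one2 y e" for y e
      unfolding mulP[symmetric] by (cases y; cases e) (simp_all add: mul2_def j_def one2_def UNIV_bool algebra_simps)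
    \<comment> \<open>In det j = (tr j) j - j^2 with j = \<open>comb2 H c\<close> - E c, the terms
      in the span collect to \<open>comb2 H c3\<close>, and the scalars that remain add up to - E
      c3. So \<open>comb2 H c3\<close> is the scalar matrix det j + E c3.\<close>
    define c3 where "c3 i = (tr2 j + 2 * E c) * c i + (-1) * P c c i" for i
    have E3: "E c3 = tr2 j * E c + E c * E c" unfolding c3_def Eadd Esc EP by (simp add: algebra_simps)
    have T3: "comb2 H c3 y e = (det2 j + E c3) * one2 y e" for y e
    proof -
      have "det2 j * one2 y e = tr2 j * j y e - mul2 j j y e" by (rule cayley_hamilton2)
      also have "\<dots> = comb2 H c3 y e - E c3 * one2 y e"
        unfolding jj E3 c3_def comb2_add comb2_scale by (simp add: j_def algebra_simps)
      finally show ?thesis by (simp add: algebra_simps)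
    qed
    define d where "d k = (if k = i0 then 1 else (0::'k))" for k
    define a where "a = det2 j + E c3"
    have Pa: "comb2 H (P c3 d) y e = a * comb2 H d y e" for y e
      unfolding mulP[symmetric] mul2_def T3 a_def by (cases y) (simp_all add: one2_def UNIV_bool)
    \<comment> \<open>Different coefficients may give the same matrix. The functional
      \<open>D\<close> shows that E depends on the matrix alone, so E (P c3 d) can be computed both
      multiplicatively and from the scalar matrix; comparison leaves det j * E d = 0.\<close>
    have "E (P c3 d) = (\<Sum>y\<in>UNIV. \<Sum>e\<in>UNIV. D y e * (a * comb2 H d y e))"
      unfolding DT[symmetric] Pa ..
    also have "\<dots> = a * (\<Sum>y\<in>UNIV. \<Sum>e\<in>UNIV. D y e * comb2 H d y e)"
      by (simp add: sum_distrib_left mult_ac)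
    finally have "E (P c3 d) = (det2 j + E c3) * E d" unfolding DT a_def .
    then have "det2 j * E d = 0" by (simp add: EP algebra_simps)
    moreover have "E d \<noteq> 0" using Eu[of i0] i0 by (simp add: d_def[abs_def])
    ultimately show False using dj by simp
  qed
  define n where "n i y e = H i y e - \<epsilon> i * one2 y e" for i y e
  have n1: "det2 (n i) = 0" for i
  proof -
    have "n i = (\<lambda>y e. comb2 H (\<lambda>j. if j = i then 1 else 0) y e - E (\<lambda>j. if j = i then 1 else 0) * one2 y e)"
      by (intro ext) (simp only: comb2_unit Eu n_def)
    then show ?thesis by (simp only: sing)
  qed
  have n2: "det2 (\<lambda>y e. n i y e + n j y e) = 0" for i j
  proof -
    let ?c = "\<lambda>k. (if k = i then 1 else 0) + (if k = j then 1 else (0::'k))"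
    have "(\<lambda>y e. n i y e + n j y e) = (\<lambda>y e. comb2 H ?c y e - E ?c * one2 y e)"
      by (intro ext) (simp only: comb2_add comb2_unit Eadd Eu n_def, simp add: algebra_simps)
    then show ?thesis by (simp only: sing)
  qed
  have Hn: "(\<Sum>e\<in>UNIV. H i y e * u e) = (\<Sum>e\<in>UNIV. n i y e * u e) + \<epsilon> i * u y" for i y u
    by (cases y) (simp_all add: n_def one2_def UNIV_bool algebra_simps)
  show ?thesis
  proof (rule disjE[OF singular_space2[of n, OF n1 n2]])
    assume "\<exists>u. (u False \<noteq> 0 \<or> u True \<noteq> 0) \<and> (\<forall>i y. (\<Sum>e\<in>UNIV. n i y e * u e) = 0)"
    then obtain u where "u False \<noteq> 0 \<or> u True \<noteq> 0" "\<forall>i y. (\<Sum>e\<in>UNIV. n i y e * u e) = 0" by blast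
    then show ?thesis by (intro exI[of _ u] exI[of _ \<epsilon>]) (simp add: Hn)
  next
    assume "\<exists>\<theta>. (\<theta> False \<noteq> 0 \<or> \<theta> True \<noteq> 0) \<and> (\<forall>i e. (\<Sum>y\<in>UNIV. \<theta> y * n i y e) = 0)"
    then obtain \<theta> where t: "\<theta> False \<noteq> 0 \<or> \<theta> True \<noteq> 0" "\<forall>i e. (\<Sum>y\<in>UNIV. \<theta> y * n i y e) = 0" by blast
    \<comment> \<open>In dimension two \<theta> annihilates just the line through u. That line
      contains the image of every \<open>n i\<close>, so u is an eigenvector of each of
      them.\<close>
    define u where "u y = (if y then - \<theta> False else \<theta> True)" for y
    have "\<exists>s. \<forall>y. (\<Sum>e\<in>UNIV. n i y e * u e) = s * u y" for i
    proof -
      define x where "x y = (\<Sum>e\<in>UNIV. n i y e * u e)" for y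
      have c: "\<theta> False * n i False e + \<theta> True * n i True e = 0" for e
        using t(2)[rule_format, of i e] by (simp add: UNIV_bool algebra_simps)
      have "\<theta> False * x False + \<theta> True * x True =
          (\<theta> False * n i False False + \<theta> True * n i True False) * u False + (\<theta> False * n i False True + \<theta> True * n i True True) * u True"
        by (simp add: x_def UNIV_bool algebra_simps)
      then have x0: "\<theta> False * x False + \<theta> True * x True = 0" by (simp add: c)
      have "\<exists>s. \<forall>y. x y = s * u y"
      proof (cases "\<theta> False = 0")
        case True
        then have "x True = 0" "\<theta> True \<noteq> 0" using x0 t(1) by auto
        then show ?thesis using True
          by (intro exI[of _ "x False / \<theta> True"] allI) (auto simp: u_def)
      next
        case False
        have "x False = - x True / \<theta> False * \<theta> True" using x0 False by (simp add: field_simps add_eq_0_iff)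
        then show ?thesis using False
          by (intro exI[of _ "- x True / \<theta> False"] allI) (auto simp: u_def)
      qed
      then show ?thesis by (simp add: x_def)
    qed
    then obtain s where s: "\<And>i y. (\<Sum>e\<in>UNIV. n i y e * u e) = s i * u y" by metis
    show ?thesis
    proof (intro exI[of _ u] exI[of _ "\<lambda>i. s i + \<epsilon> i"] conjI allI)
      show "u False \<noteq> 0 \<or> u True \<noteq> 0" using t(1) by (auto simp: u_def)
    qed (simp add: Hn s distrib_right)
  qed
qed

lemma sum_UNIV_bool_prod: "(\<Sum>i\<in>UNIV. f i) = (\<Sum>x\<in>UNIV. \<Sum>y\<in>UNIV. f (x, y))" for f :: "bool \<times> bool \<Rightarrow> 'k::field"
  by (simp add: sum.cartesian_product UNIV_Times_UNIV)

text \<open>As with a multiplicative unitary, slicing M in two ways gives two families of matrices,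
  \<open>H\<close> and \<open>L\<close>, each of which spans an algebra by the pentagon equation. On
  the first the diagonal indicator \<epsilon> is a character. The identity matrix in the second span
  is the same thing as a functional that induces \<epsilon> on the first, and
  \<open>common_eigenvector\<close> applies.\<close>

lemma pentagon_eigenvector:
  fixes M N :: "bool \<Rightarrow> bool \<Rightarrow> bool \<Rightarrow> bool \<Rightarrow> 'k::field"
  assumes NM: "\<And>p q g h. (\<Sum>e\<in>UNIV. \<Sum>f\<in>UNIV. N p q e f * M e f g h) = (if g = p \<and> h = q then 1 else 0)"
    and MN: "\<And>e f e' f'. (\<Sum>g\<in>UNIV. \<Sum>h\<in>UNIV. M e f g h * N g h e' f') = (if e' = e \<and> f' = f then 1 else 0)"
    and pent: "\<And>e f g r x y. (\<Sum>p\<in>UNIV. M e f p y * M p g r x) =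
       (\<Sum>p\<in>UNIV. \<Sum>q\<in>UNIV. \<Sum>t\<in>UNIV. M f g p q * M e p r t * M t q x y)"
  shows "\<exists>u \<chi>. (u False \<noteq> 0 \<or> u True \<noteq> 0) \<and> (\<forall>f g h. (\<Sum>e\<in>UNIV. M e f g h * u e) = \<chi> f g * u h)"
proof -
  define H where "H i y e = M e (snd i) (fst i) y" for i :: "bool \<times> bool" and y e
  define L where "L i r g = M (snd i) g r (fst i)" for i :: "bool \<times> bool" and r g
  \<comment> \<open>The pentagon multiplied by N on the side of f, g, which removes the factor
    \<open>M f g p q\<close>. The left side becomes an entry of a product of two matrices
    \<open>H\<close>.\<close>
  have p1: "(\<Sum>t\<in>UNIV. M t q x y * M e p r t) = (\<Sum>f\<in>UNIV. \<Sum>g\<in>UNIV. N p q f g * (\<Sum>p'\<in>UNIV. M e f p' y * M p' g r x))" for e p q r x y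
  proof -
    have "(\<Sum>f\<in>UNIV. \<Sum>g\<in>UNIV. N p q f g * (\<Sum>p'\<in>UNIV. M e f p' y * M p' g r x)) =
      (\<Sum>a\<in>UNIV. \<Sum>b\<in>UNIV. (\<Sum>f\<in>UNIV. \<Sum>g\<in>UNIV. N p q f g * M f g a b) * (\<Sum>t\<in>UNIV. M e a r t * M t b x y))"
      unfolding pent by (simp add: UNIV_bool algebra_simps)
    also have "\<dots> = (\<Sum>t\<in>UNIV. M t q x y * M e p r t)"
      unfolding NM by (cases p; cases q) (simp_all add: UNIV_bool mult.commute)
    finally show ?thesis ..
  qed
  \<comment> \<open>The pentagon multiplied by N on the side of x, y, which removes the factor
    \<open>M t q x y\<close>; the left side becomes an entry of a product of two matrices
    \<open>L\<close>.\<close>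
  have p2: "(\<Sum>p\<in>UNIV. M e p r t * M f g p q) = (\<Sum>x\<in>UNIV. \<Sum>y\<in>UNIV. (\<Sum>p\<in>UNIV. M e f p y * M p g r x) * N x y t q)" for e f g r t q
  proof -
    have "(\<Sum>x\<in>UNIV. \<Sum>y\<in>UNIV. (\<Sum>p\<in>UNIV. M e f p y * M p g r x) * N x y t q) =
      (\<Sum>a\<in>UNIV. \<Sum>b\<in>UNIV. (\<Sum>p\<in>UNIV. M f g p b * M e p r a) * (\<Sum>x\<in>UNIV. \<Sum>y\<in>UNIV. M a b x y * N x y t q))"
      unfolding pent by (simp add: UNIV_bool algebra_simps)
    also have "\<dots> = (\<Sum>p\<in>UNIV. M e p r t * M f g p q)"
      unfolding MN by (cases t; cases q) (simp_all add: UNIV_bool mult.commute)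
    finally show ?thesis ..
  qed
  define KH where "KH i j k = (\<Sum>g\<in>UNIV. N (snd j) (snd i) (snd k) g * M (fst k) g (fst j) (fst i))" for i j k :: "bool \<times> bool"
  have H: "mul2 (H i) (H j) y e = (\<Sum>k\<in>UNIV. KH i j k * H k y e)" for i j y e
  proof -
    have "mul2 (H i) (H j) y e = (\<Sum>t\<in>UNIV. M t (snd i) (fst i) y * M e (snd j) (fst j) t)"
      by (simp add: mul2_def H_def)
    also have "\<dots> = (\<Sum>k\<in>UNIV. KH i j k * H k y e)"
      unfolding p1 sum_UNIV_bool_prod by (simp add: KH_def H_def UNIV_bool algebra_simps)
    finally show ?thesis .
  qed
  \<comment> \<open>Contracting the structure constants with \<epsilon> leaves the product of N and
    M, hence Kronecker symbols: \<epsilon> is multiplicative.\<close>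
  define \<epsilon> where "\<epsilon> i = (if fst i = snd i then 1 else (0::'k))" for i :: "bool \<times> bool"
  have eps: "(\<Sum>k\<in>UNIV. KH i j k * \<epsilon> k) = \<epsilon> i * \<epsilon> j" for i j
  proof -
    have "(\<Sum>k\<in>UNIV. KH i j k * \<epsilon> k) = (\<Sum>e\<in>UNIV. \<Sum>f\<in>UNIV. N (snd j) (snd i) e f * M e f (fst j) (fst i))"
      unfolding sum_UNIV_bool_prod by (simp add: KH_def \<epsilon>_def UNIV_bool algebra_simps)
    also have "\<dots> = \<epsilon> i * \<epsilon> j" unfolding NM by (auto simp: \<epsilon>_def)
    finally show ?thesis .
  qed
  define KL where "KL i j k = (\<Sum>y\<in>UNIV. N (fst k) y (fst i) (fst j) * M (snd i) (snd j) (snd k) y)" for i j k :: "bool \<times> bool"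
  have L: "mul2 (L i) (L j) r g = (\<Sum>k\<in>UNIV. KL i j k * L k r g)" for i j r g
  proof -
    have "mul2 (L i) (L j) r g = (\<Sum>p\<in>UNIV. M (snd i) p r (fst i) * M (snd j) g p (fst j))"
      by (simp add: mul2_def L_def)
    also have "\<dots> = (\<Sum>k\<in>UNIV. KL i j k * L k r g)"
      unfolding p2 sum_UNIV_bool_prod by (simp add: KL_def L_def UNIV_bool algebra_simps)
    finally show ?thesis .
  qed
  \<comment> \<open>A common kernel vector on either side is contracted with N; the inverse returns
    the vector itself, which is therefore zero.\<close>
  have "\<exists>d. comb2 L d = one2"
  proof (rule ex_comb2_one[of L KL, OF L])
    fix u assume u: "\<And>i y. (\<Sum>e\<in>UNIV. L i y e * u e) = 0"
    have "u f = 0" for f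
    proof -
      have "(\<Sum>g\<in>UNIV. \<Sum>h\<in>UNIV. (\<Sum>b\<in>UNIV. L (h, False) g b * u b) * N g h False f) =
        (\<Sum>b\<in>UNIV. u b * (\<Sum>g\<in>UNIV. \<Sum>h\<in>UNIV. M False b g h * N g h False f))"
        by (simp add: L_def UNIV_bool algebra_simps)
      then show ?thesis unfolding u MN by (cases f) (simp_all add: UNIV_bool)
    qed
    then show "u False = 0 \<and> u True = 0" by simp
  next
    fix \<theta> assume t: "\<And>i e. (\<Sum>y\<in>UNIV. \<theta> y * L i y e) = 0"
    have "\<theta> p = 0" for p
    proof -
      have "(\<Sum>e\<in>UNIV. \<Sum>f\<in>UNIV. N p False e f * (\<Sum>g\<in>UNIV. \<theta> g * L (False, e) g f)) =
        (\<Sum>g\<in>UNIV. \<theta> g * (\<Sum>e\<in>UNIV. \<Sum>f\<in>UNIV. N p False e f * M e f g False))"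
        by (simp add: L_def UNIV_bool algebra_simps)
      then show ?thesis unfolding t NM by (cases p) (simp_all add: UNIV_bool)
    qed
    then show "\<theta> False = 0 \<and> \<theta> True = 0" by simp
  qed
  then obtain d where d: "comb2 L d = one2" by blast
  \<comment> \<open>\<open>L (y, e) r g\<close> and \<open>H (r, g) y e\<close> are the same entry
    of M, so the coefficients of the identity matrix form a functional with value \<epsilon> on
    \<open>H\<close>.\<close>
  have D: "(\<Sum>y\<in>UNIV. \<Sum>e\<in>UNIV. d (y, e) * H i y e) = \<epsilon> i" for i
    using fun_cong[OF fun_cong[OF d, of "fst i"], of "snd i"]
    by (simp add: comb2_def sum_UNIV_bool_prod L_def H_def one2_def \<epsilon>_def)
  obtain u \<chi> where u: "u False \<noteq> 0 \<or> u True \<noteq> 0" "\<And>i y. (\<Sum>e\<in>UNIV. H i y e * u e) = \<chi> i * u y"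
    using common_eigenvector[of H KH \<epsilon> "\<lambda>y e. d (y, e)" "(True, True)", OF H eps D] by (auto simp: \<epsilon>_def)
  have "(\<Sum>e\<in>UNIV. M e f g h * u e) = \<chi> (g, f) * u h" for f g h
    using u(2)[of "(g, f)" h] by (simp add: H_def)
  then show ?thesis using u(1) by (intro exI[of _ u] exI[of _ "\<lambda>f g. \<chi> (g, f)"]) simp
qed

section \<open>The pentagon equation\<close>

context nalg
begin

lemma rcomb_unit:
  assumes "a \<in> carrier A" "b \<in> carrier A" "c \<in> carrier A"
  shows "opA A p a (opA A q b c) = rcomb A (\<lambda>g h. if g = p \<and> h = q then 1 else 0) a b c"
  using assms by (cases p; cases q) (simp_all add: rcomb_def)

lemma lcomb_unit:
  assumes "a \<in> carrier A" "b \<in> carrier A" "c \<in> carrier A"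
  shows "opA A e (opA A f a b) c = lcomb A (\<lambda>e' f'. if e' = e \<and> f' = f then 1 else 0) a b c"
  using assms by (cases e; cases f) (simp_all add: lcomb_def)

lemma lcomb_add: "\<lbrakk>a \<in> carrier A; b \<in> carrier A; c \<in> carrier A\<rbrakk> \<Longrightarrow>
    lcomb A k a b c \<oplus> lcomb A l a b c = lcomb A (\<lambda>g h. k g h + l g h) a b c"
  by (simp add: lcomb_eq rcomb_add)

lemma lcomb_smult: "\<lbrakk>a \<in> carrier A; b \<in> carrier A; c \<in> carrier A\<rbrakk> \<Longrightarrow>
    d \<odot> lcomb A k a b c = lcomb A (\<lambda>g h. d * k g h) a b c"
  by (simp add: lcomb_eq rcomb_smult)

lemma rcomb_swap: "\<lbrakk>a \<in> carrier A; b \<in> carrier A; c \<in> carrier A\<rbrakk> \<Longrightarrow>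
    rcomb A k a c b = rcomb A (\<lambda>g h. k g (\<not> h)) a b c"
  by (simp add: rcomb_def opA_flip[of A True c] opA_flip[of A False c] ac)

lemma lcomb_swap: "\<lbrakk>a \<in> carrier A; b \<in> carrier A; c \<in> carrier A\<rbrakk> \<Longrightarrow>
    lcomb A k b a c = lcomb A (\<lambda>e f. k e (\<not> f)) a b c"
  by (simp add: lcomb_def opA_flip[of A True b] opA_flip[of A False b] ac)

definition rcomb4 :: "(bool \<Rightarrow> bool \<Rightarrow> bool \<Rightarrow> 'k) \<Rightarrow> 'u \<Rightarrow> 'u \<Rightarrow> 'u \<Rightarrow> 'u \<Rightarrow> 'u" where
  "rcomb4 k a b c d = opA A False a (rcomb A (k False) b c d) \<oplus> opA A True a (rcomb A (k True) b c d)"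

lemma rcomb4_add: "\<lbrakk>a \<in> carrier A; b \<in> carrier A; c \<in> carrier A; d \<in> carrier A\<rbrakk> \<Longrightarrow>
    rcomb4 k a b c d \<oplus> rcomb4 l a b c d = rcomb4 (\<lambda>g h i. k g h i + l g h i) a b c d"
  by (simp add: rcomb4_def opA_add ac flip: rcomb_add)

lemma rcomb4_smult: "\<lbrakk>a \<in> carrier A; b \<in> carrier A; c \<in> carrier A; d \<in> carrier A\<rbrakk> \<Longrightarrow>
    s \<odot> rcomb4 k a b c d = rcomb4 (\<lambda>g h i. s * k g h i) a b c d"
  by (simp add: rcomb4_def opA_smult sm_add_right flip: rcomb_smult)

lemma rcomb4_op: "\<lbrakk>a \<in> carrier A; b \<in> carrier A; c \<in> carrier A; d \<in> carrier A\<rbrakk> \<Longrightarrow>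
    opA A r a (rcomb A k b c d) = rcomb4 (\<lambda>r' x y. if r' = r then k x y else 0) a b c d"
  by (cases r) (simp_all add: rcomb4_def rcomb_zero)

lemma rcomb4_inner: "\<lbrakk>a \<in> carrier A; b \<in> carrier A; c \<in> carrier A; d \<in> carrier A\<rbrakk> \<Longrightarrow>
    rcomb A k a b (opA A q c d) = rcomb4 (\<lambda>r x y. if y = q then k r x else 0) a b c d"
  by (cases q) (simp_all add: rcomb4_def rcomb_def opA_add opA_smult zero_add)

lemma poly_value_diff:
  assumes "range a \<subseteq> carrier A" "v \<noteq> w"
  shows "poly_value A a (word_poly v - word_poly w) = word_value A a v \<oplus> (-1) \<odot> word_value A a w"
proof -
  have "Poly_Mapping.keys (word_poly v - word_poly w :: 'k napoly) \<subseteq> {v, w}"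
    using keys_diff[of "word_poly v" "word_poly w :: 'k napoly"] by (simp add: insert_commute)
  from poly_value_superset[OF _ this assms(1)] show ?thesis
    using assms by (simp add: lookup_minus lookup_single)
qed

end

context cosmash_variety
begin

lemma rcomb_inj:
  assumes "free2"
    and eq: "\<And>A a b c. \<lbrakk>A \<in> V; a \<in> carrier A; b \<in> carrier A; c \<in> carrier A\<rbrakk> \<Longrightarrow> rcomb A k a b c = rcomb A l a b c"
  shows "k g h = l g h"
proof -
  obtain A a b c where ind: "indep3 A a b c" using ex_indep3[OF assms(1)] by blast
  then have A: "A \<in> V" "a \<in> carrier A" "b \<in> carrier A" "c \<in> carrier A" by (simp_all add: indep3_def sq_zero_def)
  interpret A: nalg A using A(1) by (rule V_nalg)
  have "rcomb A (\<lambda>g h. (-1) * l g h + k g h) a b c = (-1) \<odot>\<^bsub>A\<^esub> rcomb A l a b c \<oplus>\<^bsub>A\<^esub> rcomb A k a b c"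
    using A by (simp only: A.rcomb_smult A.rcomb_add)
  also have "\<dots> = \<zero>\<^bsub>A\<^esub>" using A eq[OF A] by simp
  finally have "(-1) * l g h + k g h = 0" using ind unfolding indep3_def by blast
  then show ?thesis by simp
qed

lemma lcomb_inj:
  assumes "free2"
    and eq: "\<And>A a b c. \<lbrakk>A \<in> V; a \<in> carrier A; b \<in> carrier A; c \<in> carrier A\<rbrakk> \<Longrightarrow> lcomb A k a b c = lcomb A l a b c"
  shows "k g h = l g h"
proof -
  have "rcomb A (\<lambda>e. k (\<not> e)) a b c = rcomb A (\<lambda>e. l (\<not> e)) a b c"
    if "A \<in> V" "a \<in> carrier A" "b \<in> carrier A" "c \<in> carrier A" for A a b c
    using eq[OF that(1,3,4,2)] nalg.lcomb_eq[OF V_nalg[OF that(1)] that(3,4,2)] by simp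
  from rcomb_inj[OF assms(1) this, of "\<not> g" h] show ?thesis by simp
qed

lemma rcomb4_inj:
  assumes "free2"
    and eq: "\<And>A a b c d. \<lbrakk>A \<in> V; a \<in> carrier A; b \<in> carrier A; c \<in> carrier A; d \<in> carrier A\<rbrakk> \<Longrightarrow>
      nalg.rcomb4 A k a b c d = nalg.rcomb4 A l a b c d"
  shows "k e g h = l e g h"
proof -
  obtain A a b c d where A: "A \<in> V" "a \<in> carrier A" "b \<in> carrier A" "c \<in> carrier A" "d \<in> carrier A"
    and ind: "\<And>k. opA A False a (rcomb A (k False) b c d) \<oplus>\<^bsub>A\<^esub> opA A True a (rcomb A (k True) b c d) = \<zero>\<^bsub>A\<^esub> \<Longrightarrow> (\<forall>e f g. k e f g = 0)"
    using ex_indep4[OF assms(1)] by blast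
  interpret A: nalg A using A(1) by (rule V_nalg)
  have cl: "A.rcomb4 k a b c d \<in> carrier A" for k using A by (simp add: A.rcomb4_def)
  have "A.rcomb4 (\<lambda>e g h. (-1) * l e g h + k e g h) a b c d = (-1) \<odot>\<^bsub>A\<^esub> A.rcomb4 l a b c d \<oplus>\<^bsub>A\<^esub> A.rcomb4 k a b c d"
    using A by (simp only: A.rcomb4_smult A.rcomb4_add)
  also have "\<dots> = \<zero>\<^bsub>A\<^esub>" using cl eq[OF A] by simp
  finally have "(-1) * l e g h + k e g h = 0" unfolding A.rcomb4_def by (drule_tac ind) blast
  then show ?thesis by simp
qed

lemma lcomb_rcomb:
  assumes A: "A \<in> V" "a \<in> carrier A" "b \<in> carrier A" "c \<in> carrier A"
  shows "lcomb A k a b c = rcomb A (\<lambda>g h. \<Sum>e\<in>UNIV. \<Sum>f\<in>UNIV. k e f * reassoc_right e f g h) a b c"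
proof -
  interpret A: nalg A using A(1) by (rule V_nalg)
  have "lcomb A k a b c = rcomb A (\<lambda>g h. (k False False * reassoc_right False False g h + k False True * reassoc_right False True g h) +
      (k True False * reassoc_right True False g h + k True True * reassoc_right True True g h)) a b c"
    unfolding lcomb_def using A by (simp only: reassoc[OF A] A.rcomb_smult A.rcomb_add)
  also have "(\<lambda>g h. (k False False * reassoc_right False False g h + k False True * reassoc_right False True g h) +
      (k True False * reassoc_right True False g h + k True True * reassoc_right True True g h)) =
      (\<lambda>g h. \<Sum>e\<in>UNIV. \<Sum>f\<in>UNIV. k e f * reassoc_right e f g h)"
    by (intro ext) (simp add: UNIV_bool algebra_simps)
  finally show ?thesis .
qed

lemma rcomb_lcomb:
  assumes A: "A \<in> V" "a \<in> carrier A" "b \<in> carrier A" "c \<in> carrier A"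
  shows "rcomb A k a b c = lcomb A (\<lambda>e f. \<Sum>g\<in>UNIV. \<Sum>h\<in>UNIV. k g h * reassoc_left g h e f) a b c"
proof -
  interpret A: nalg A using A(1) by (rule V_nalg)
  have "rcomb A k a b c = lcomb A (\<lambda>e f. (k False False * reassoc_left False False e f + k False True * reassoc_left False True e f) +
      (k True False * reassoc_left True False e f + k True True * reassoc_left True True e f)) a b c"
    unfolding rcomb_def using A by (simp only: reassoc'[OF A] A.lcomb_smult A.lcomb_add)
  also have "(\<lambda>e f. (k False False * reassoc_left False False e f + k False True * reassoc_left False True e f) +
      (k True False * reassoc_left True False e f + k True True * reassoc_left True True e f)) =
      (\<lambda>e f. \<Sum>g\<in>UNIV. \<Sum>h\<in>UNIV. k g h * reassoc_left g h e f)"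
    by (intro ext) (simp add: UNIV_bool algebra_simps)
  finally show ?thesis .
qed

text \<open>Rebracketing to the left and back does not change a word, and coefficients of
  independent words can be compared.\<close>

lemma reassoc_left_reassoc_right:
  assumes "free2"
  shows "(\<Sum>e\<in>UNIV. \<Sum>f\<in>UNIV. reassoc_left p q e f * reassoc_right e f g h) = (if g = p \<and> h = q then 1 else 0)"
proof (rule rcomb_inj[OF assms, of "\<lambda>g h. \<Sum>e\<in>UNIV. \<Sum>f\<in>UNIV. reassoc_left p q e f * reassoc_right e f g h" "\<lambda>g h. if g = p \<and> h = q then 1 else 0"])
  fix A a b c assume A: "A \<in> V" "a \<in> carrier A" "b \<in> carrier A" "c \<in> carrier A"
  interpret A: nalg A using A(1) by (rule V_nalg)
  show "rcomb A (\<lambda>g h. \<Sum>e\<in>UNIV. \<Sum>f\<in>UNIV. reassoc_left p q e f * reassoc_right e f g h) a b c =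
      rcomb A (\<lambda>g h. if g = p \<and> h = q then 1 else 0) a b c"
    using reassoc'[OF A, of p q] A.rcomb_unit[OF A(2-4), of p q] lcomb_rcomb[OF A, of "reassoc_left p q"] by simp
qed

lemma reassoc_right_reassoc_left:
  assumes "free2"
  shows "(\<Sum>g\<in>UNIV. \<Sum>h\<in>UNIV. reassoc_right e f g h * reassoc_left g h e' f') = (if e' = e \<and> f' = f then 1 else 0)"
proof (rule lcomb_inj[OF assms, of "\<lambda>e' f'. \<Sum>g\<in>UNIV. \<Sum>h\<in>UNIV. reassoc_right e f g h * reassoc_left g h e' f'" "\<lambda>e' f'. if e' = e \<and> f' = f then 1 else 0"])
  fix A a b c assume A: "A \<in> V" "a \<in> carrier A" "b \<in> carrier A" "c \<in> carrier A"
  interpret A: nalg A using A(1) by (rule V_nalg)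
  show "lcomb A (\<lambda>e' f'. \<Sum>g\<in>UNIV. \<Sum>h\<in>UNIV. reassoc_right e f g h * reassoc_left g h e' f') a b c =
      lcomb A (\<lambda>e' f'. if e' = e \<and> f' = f then 1 else 0) a b c"
    using reassoc[OF A, of e f] A.lcomb_unit[OF A(2-4), of e f] rcomb_lcomb[OF A, of "reassoc_right e f"] by simp
qed

text \<open>Two ways of moving the brackets of \<open>((a b) c) d\<close> to the right.\<close>

lemma pentagon:
  assumes "free2"
  shows "(\<Sum>p\<in>UNIV. reassoc_right e f p y * reassoc_right p g r x) =
       (\<Sum>p\<in>UNIV. \<Sum>q\<in>UNIV. \<Sum>t\<in>UNIV. reassoc_right f g p q * reassoc_right e p r t * reassoc_right t q x y)"
proof (rule rcomb4_inj[OF assms, of "\<lambda>r x y. \<Sum>p\<in>UNIV. reassoc_right e f p y * reassoc_right p g r x"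
      "\<lambda>r x y. \<Sum>p\<in>UNIV. \<Sum>q\<in>UNIV. \<Sum>t\<in>UNIV. reassoc_right f g p q * reassoc_right e p r t * reassoc_right t q x y"])
  fix A a b c d assume A: "A \<in> V" "a \<in> carrier A" "b \<in> carrier A" "c \<in> carrier A" "d \<in> carrier A"
  interpret A: nalg A using A(1) by (rule V_nalg)
  let ?M = "reassoc_right :: bool \<Rightarrow> bool \<Rightarrow> bool \<Rightarrow> bool \<Rightarrow> 'k"
  let ?L = "\<lambda>k. A.rcomb4 k a b c d"
  have ab: "opA A g a b \<in> carrier A" using A by simp
  \<comment> \<open>Two rebracketings: g(a, b) is treated as a single letter, and the route passes
    through its products with those of c and d.\<close>
  have way1: "opA A e (opA A f (opA A g a b) c) d = ?L (\<lambda>r x y. \<Sum>p\<in>UNIV. ?M e f p y * ?M p g r x)"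
  proof -
    have i: "opA A p (opA A g a b) (opA A q c d) = ?L (\<lambda>r x y. if y = q then ?M p g r x else 0)" for p q
      using A by (simp add: reassoc[OF A(1)] A.rcomb4_inner)
    have "opA A e (opA A f (opA A g a b) c) d = rcomb A (?M e f) (opA A g a b) c d" by (rule reassoc[OF A(1) ab A(4,5)])
    also have "\<dots> = ?L (\<lambda>r x y. (?M e f False False * (if y = False then ?M False g r x else 0) + ?M e f False True * (if y = True then ?M False g r x else 0)) +
       (?M e f True False * (if y = False then ?M True g r x else 0) + ?M e f True True * (if y = True then ?M True g r x else 0)))"
      unfolding rcomb_def i using A by (simp only: A.rcomb4_smult A.rcomb4_add)
    also have "(\<lambda>r x y. (?M e f False False * (if y = False then ?M False g r x else 0) + ?M e f False True * (if y = True then ?M False g r x else 0)) +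
       (?M e f True False * (if y = False then ?M True g r x else 0) + ?M e f True True * (if y = True then ?M True g r x else 0))) =
       (\<lambda>r x y. \<Sum>p\<in>UNIV. ?M e f p y * ?M p g r x)"
      by (intro ext) (auto simp: UNIV_bool)
    finally show ?thesis .
  qed
  \<comment> \<open>Three rebracketings: inside the product of a, b, c, then with the product of b
    and c as a single letter, then among b, c and d.\<close>
  have way2: "opA A e (opA A f (opA A g a b) c) d = ?L (\<lambda>r x y. \<Sum>p\<in>UNIV. \<Sum>q\<in>UNIV. \<Sum>t\<in>UNIV. ?M f g p q * ?M e p r t * ?M t q x y)"
  proof -
    have i: "opA A r a (opA A t (opA A q b c) d) = ?L (\<lambda>r' x y. if r' = r then ?M t q x y else 0)" for r t q
      using A by (simp add: reassoc[OF A(1)] A.rcomb4_op)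
    have j: "opA A e (opA A p a (opA A q b c)) d = ?L (\<lambda>r x y. \<Sum>t\<in>UNIV. ?M e p r t * ?M t q x y)" for p q
    proof -
      have "opA A e (opA A p a (opA A q b c)) d = rcomb A (?M e p) a (opA A q b c) d"
        using A by (intro reassoc) simp_all
      also have "\<dots> = ?L (\<lambda>r x y. (?M e p False False * (if r = False then ?M False q x y else 0) + ?M e p False True * (if r = False then ?M True q x y else 0)) +
         (?M e p True False * (if r = True then ?M False q x y else 0) + ?M e p True True * (if r = True then ?M True q x y else 0)))"
        unfolding rcomb_def i using A by (simp only: A.rcomb4_smult A.rcomb4_add)
      also have "(\<lambda>r x y. (?M e p False False * (if r = False then ?M False q x y else 0) + ?M e p False True * (if r = False then ?M True q x y else 0)) +
         (?M e p True False * (if r = True then ?M False q x y else 0) + ?M e p True True * (if r = True then ?M True q x y else 0))) =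
         (\<lambda>r x y. \<Sum>t\<in>UNIV. ?M e p r t * ?M t q x y)"
        by (intro ext) (auto simp: UNIV_bool)
      finally show ?thesis .
    qed
    have "opA A e (opA A f (opA A g a b) c) d = opA A e (rcomb A (?M f g) a b c) d" using reassoc[OF A(1-4)] by simp
    also have "\<dots> = (?M f g False False \<odot>\<^bsub>A\<^esub> opA A e (opA A False a (opA A False b c)) d \<oplus>\<^bsub>A\<^esub> ?M f g False True \<odot>\<^bsub>A\<^esub> opA A e (opA A False a (opA A True b c)) d) \<oplus>\<^bsub>A\<^esub>
       (?M f g True False \<odot>\<^bsub>A\<^esub> opA A e (opA A True a (opA A False b c)) d \<oplus>\<^bsub>A\<^esub> ?M f g True True \<odot>\<^bsub>A\<^esub> opA A e (opA A True a (opA A True b c)) d)"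
      unfolding rcomb_def using A by (simp add: A.opA_add A.opA_smult)
    also have "\<dots> = ?L (\<lambda>r x y. (?M f g False False * (\<Sum>t\<in>UNIV. ?M e False r t * ?M t False x y) + ?M f g False True * (\<Sum>t\<in>UNIV. ?M e False r t * ?M t True x y)) +
       (?M f g True False * (\<Sum>t\<in>UNIV. ?M e True r t * ?M t False x y) + ?M f g True True * (\<Sum>t\<in>UNIV. ?M e True r t * ?M t True x y)))"
      unfolding j using A by (simp only: A.rcomb4_smult A.rcomb4_add)
    also have "(\<lambda>r x y. (?M f g False False * (\<Sum>t\<in>UNIV. ?M e False r t * ?M t False x y) + ?M f g False True * (\<Sum>t\<in>UNIV. ?M e False r t * ?M t True x y)) +
       (?M f g True False * (\<Sum>t\<in>UNIV. ?M e True r t * ?M t False x y) + ?M f g True True * (\<Sum>t\<in>UNIV. ?M e True r t * ?M t True x y))) =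
       (\<lambda>r x y. \<Sum>p\<in>UNIV. \<Sum>q\<in>UNIV. \<Sum>t\<in>UNIV. ?M f g p q * ?M e p r t * ?M t q x y)"
      by (intro ext) (simp add: UNIV_bool algebra_simps)
    finally show ?thesis .
  qed
  show "?L (\<lambda>r x y. \<Sum>p\<in>UNIV. ?M e f p y * ?M p g r x) = ?L (\<lambda>r x y. \<Sum>p\<in>UNIV. \<Sum>q\<in>UNIV. \<Sum>t\<in>UNIV. ?M f g p q * ?M e p r t * ?M t q x y)"
    using way1 way2 by simp
qed

text \<open>Write u(b, c) for the combination of the two multiplications with coefficients from the
  eigenvector, and likewise w(a, b). The eigenvector property says that u(w(a, b), c) is a
  combination of a with u(b, c). If u is symmetric or antisymmetric, exchanging b and c costs a sign
  and the permutations of three letters give a contradiction; otherwise u and its flip are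
  independent, and cyclic permutation forces u to vanish.\<close>

lemma not_free2: "\<not> free2"
proof
  assume f2: "free2"
  obtain u \<chi> where u0: "u False \<noteq> (0 :: 'k) \<or> u True \<noteq> 0"
    and ev: "\<And>f g h. (\<Sum>e\<in>UNIV. reassoc_right e f g h * u e) = \<chi> f g * u h"
    using pentagon_eigenvector[of reassoc_left reassoc_right, OF reassoc_left_reassoc_right[OF f2] reassoc_right_reassoc_left[OF f2] pentagon[OF f2]] by blast
  define wx where "wx w g = (\<Sum>f\<in>UNIV. w f * \<chi> f g)" for w g
  have law: "lcomb A (\<lambda>e f. u e * w f) a b c = rcomb A (\<lambda>g h. wx w g * u h) a b c"
    if "A \<in> V" "a \<in> carrier A" "b \<in> carrier A" "c \<in> carrier A" for A a b c w
  proof -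
    have "(\<Sum>e\<in>UNIV. \<Sum>f\<in>UNIV. u e * w f * reassoc_right e f g h) = wx w g * u h" for g h
    proof -
      have "(\<Sum>e\<in>UNIV. \<Sum>f\<in>UNIV. u e * w f * reassoc_right e f g h) = (\<Sum>f\<in>UNIV. w f * (\<Sum>e\<in>UNIV. reassoc_right e f g h * u e))"
        by (simp add: UNIV_bool algebra_simps)
      also have "\<dots> = wx w g * u h" unfolding ev by (simp add: wx_def UNIV_bool algebra_simps)
      finally show ?thesis .
    qed
    then show ?thesis using lcomb_rcomb[OF that, of "\<lambda>e f. u e * w f"] by simp
  qed
  show False
  proof (cases "u False * u False = u True * u True")
    case True
    define l where "l = u True / u False"
    have uF: "u False \<noteq> 0" using True u0 by auto
    have ul: "u (\<not> h) = l * u h" for h using uF True by (cases h) (simp_all add: l_def field_simps)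
    have uT: "u True \<noteq> 0" using uF True by auto
    have ll: "l * l = 1" using uF uT True by (simp add: l_def)
    have sw: "lcomb A (\<lambda>e f. u e * w f) a c b = l \<odot>\<^bsub>A\<^esub> lcomb A (\<lambda>e f. u e * w f) a b c"
      if A: "A \<in> V" "a \<in> carrier A" "b \<in> carrier A" "c \<in> carrier A" for A a b c w
    proof -
      interpret A: nalg A using A(1) by (rule V_nalg)
      show ?thesis unfolding law[OF A] law[OF A(1,2,4,3)] A.rcomb_swap[OF A(2-4)] A.rcomb_smult[OF A(2-4)]
        by (simp add: ul mult_ac)
    qed
    have "u False * (if False = False then 1 else 0) = l * (u False * (if (\<not> False) = False then 1 else (0::'k)))"
    proof (rule lcomb_inj[OF f2, of "\<lambda>e f. u e * (if f = False then 1 else 0)" "\<lambda>e f. l * (u e * (if (\<not> f) = False then 1 else 0))"])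
      fix A a b c assume A: "A \<in> V" "a \<in> carrier A" "b \<in> carrier A" "c \<in> carrier A"
      interpret A: nalg A using A(1) by (rule V_nalg)
      define F where "F w x y z = lcomb A (\<lambda>e f. u e * w f) x y z" for w x y z
      define w v where "w f = (if f = False then 1 else (0::'k))" and "v f = w (\<not> f)" for f
      have Fc: "F w x y z \<in> carrier A" if "x \<in> carrier A" "y \<in> carrier A" "z \<in> carrier A" for w x y z
        using that by (simp add: F_def A.lcomb_eq)
      have s12: "F w x y z = F v y x z" "F v x y z = F w y x z" if "x \<in> carrier A" "y \<in> carrier A" "z \<in> carrier A" for x y z
        unfolding F_def v_def using A.lcomb_swap[OF that(2,1,3)] by simp_all
      have s23: "F w' x z y = l \<odot>\<^bsub>A\<^esub> F w' x y z" if "x \<in> carrier A" "y \<in> carrier A" "z \<in> carrier A" for w' x y z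
        unfolding F_def by (rule sw[OF A(1) that])
      \<comment> \<open>Alternating the two adjacent transpositions three times each gives the
        identity permutation. It flips w three times, and the factors combine to l^3 = l, so u(w(a,
        b), c) equals l times its flipped version.\<close>
      have "F w a b c = F v b a c" by (rule s12(1)[OF A(2-4)])
      also have "\<dots> = l \<odot>\<^bsub>A\<^esub> F v b c a" by (rule s23[OF A(3,4,2)])
      also have "F v b c a = F w c b a" by (rule s12(2)[OF A(3,4,2)])
      also have "F w c b a = l \<odot>\<^bsub>A\<^esub> F w c a b" by (rule s23[OF A(4,2,3)])
      also have "F w c a b = F v a c b" by (rule s12(1)[OF A(4,2,3)])
      also have "F v a c b = l \<odot>\<^bsub>A\<^esub> F v a b c" by (rule s23[OF A(2-4)])
      finally have "F w a b c = l \<odot>\<^bsub>A\<^esub> F v a b c"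
        using Fc[OF A(2-4), of v] by (simp add: A.sm_sm ll)
      then show "lcomb A (\<lambda>e f. u e * (if f = False then 1 else 0)) a b c =
          lcomb A (\<lambda>e f. l * (u e * (if (\<not> f) = False then 1 else 0))) a b c"
        using A by (simp add: F_def v_def w_def A.lcomb_smult)
    qed
    then show False using uF by simp
  next
    case False
    \<comment> \<open>If the coefficients of the outer operation vanish, so does u(w(a, b), c);
      independence of the left-normed words then gives w = 0.\<close>
    have inj: "w False = 0 \<and> w True = 0" if "\<And>g. wx w g = 0" for w
    proof -
      have "u e * w f = 0" for e f
      proof (rule lcomb_inj[OF f2, of "\<lambda>e f. u e * w f" "\<lambda>e f. 0"])
        fix A a b c assume A: "A \<in> V" "a \<in> carrier A" "b \<in> carrier A" "c \<in> carrier A"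
        interpret A: nalg A using A(1) by (rule V_nalg)
        show "lcomb A (\<lambda>e f. u e * w f) a b c = lcomb A (\<lambda>e f. 0) a b c"
          using A unfolding law[OF A] that by (simp add: A.lcomb_eq A.rcomb_zero)
      qed
      then show ?thesis using u0 by auto
    qed
    define D where "D = \<chi> False False * \<chi> True True - \<chi> False True * \<chi> True False"
    have D: "D \<noteq> 0"
    proof
      assume D0: "D = 0"
      \<comment> \<open>If \<chi> were singular, the rows of its adjugate would be mapped to zero.
        Injectivity of \<open>wx\<close> then makes \<chi> zero, which contradicts injectivity
        again.\<close>
      have "wx (\<lambda>f. if f then - \<chi> False False else \<chi> True False) g = 0" for g
        using D0 by (cases g) (simp_all add: wx_def UNIV_bool D_def algebra_simps)
      from inj[OF this] have z1: "\<chi> True False = 0" "\<chi> False False = 0" by auto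
      have "wx (\<lambda>f. if f then - \<chi> False True else \<chi> True True) g = 0" for g
        using D0 by (cases g) (simp_all add: wx_def UNIV_bool D_def algebra_simps)
      from inj[OF this] have z2: "\<chi> True True = 0" "\<chi> False True = 0" by auto
      have "wx (\<lambda>f. 1) g = 0" for g by (cases g) (simp_all add: wx_def UNIV_bool z1 z2)
      from inj[OF this] show False by simp
    qed
    \<comment> \<open>Cramer's rule for the solution of
      \<open>wx t g = u (\<not> g)\<close>.\<close>
    define t where "t f = (if f then (\<chi> False False * u False - \<chi> False True * u True) / D
      else (\<chi> True True * u True - \<chi> True False * u False) / D)" for f
    have t: "wx t g = u (\<not> g)" for g
    proof -
      have "D * wx t g = D * u (\<not> g)"
      proof -
        have "D * wx t g = (\<chi> True True * u True - \<chi> True False * u False) * \<chi> False g + (\<chi> False False * u False - \<chi> False True * u True) * \<chi> True g"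
          using D by (simp add: wx_def UNIV_bool t_def distrib_left)
        also have "\<dots> = D * u (\<not> g)" by (cases g) (simp_all add: D_def algebra_simps)
        finally show ?thesis .
      qed
      then show ?thesis using D by simp
    qed
    \<comment> \<open>u(u(a, b), c) read from c is the flip of u applied to c and u(a, b), so by the
      choice of t it equals u(t(c, a), b). Exchanging c and a inside and expanding once more returns
      to words with a outermost and b, c in flipped order.\<close>
    have key: "wx u g * u h = wx (\<lambda>f. t (\<not> f)) g * u (\<not> h)" for g h
    proof (rule rcomb_inj[OF f2, of "\<lambda>g h. wx u g * u h" "\<lambda>g h. wx (\<lambda>f. t (\<not> f)) g * u (\<not> h)"])
      fix A a b c assume A: "A \<in> V" "a \<in> carrier A" "b \<in> carrier A" "c \<in> carrier A"
      interpret A: nalg A using A(1) by (rule V_nalg)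
      have "rcomb A (\<lambda>g h. wx u g * u h) a b c = lcomb A (\<lambda>e f. u e * u f) a b c" unfolding law[OF A] ..
      also have "\<dots> = rcomb A (\<lambda>e f. wx t e * u f) c a b" unfolding A.lcomb_eq[OF A(2-4)] t ..
      also have "\<dots> = lcomb A (\<lambda>e f. u e * t f) c a b" unfolding law[OF A(1,4,2,3)] ..
      also have "\<dots> = lcomb A (\<lambda>e f. u e * t (\<not> f)) a c b" by (rule A.lcomb_swap[OF A(2,4,3)])
      also have "\<dots> = rcomb A (\<lambda>g h. wx (\<lambda>f. t (\<not> f)) g * u h) a c b" by (rule law[OF A(1,2,4,3)])
      also have "\<dots> = rcomb A (\<lambda>g h. wx (\<lambda>f. t (\<not> f)) g * u (\<not> h)) a b c" by (rule A.rcomb_swap[OF A(2-4)])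
      finally show "rcomb A (\<lambda>g h. wx u g * u h) a b c = rcomb A (\<lambda>g h. wx (\<lambda>f. t (\<not> f)) g * u (\<not> h)) a b c" .
    qed
    \<comment> \<open>The vectors u and flipped u are not proportional in this case, so both of
      their coefficients in \<open>key\<close> are zero.\<close>
    have "wx u g = 0" for g
    proof -
      define s r where "s = wx u g" and "r = wx (\<lambda>f. t (\<not> f)) g"
      have k: "s * u False = r * u True" "s * u True = r * u False" using key[of g False] key[of g True] by (simp_all add: s_def r_def)
      have "s * (u False * u False) = r * u True * u False" using k(1) by (simp flip: mult.assoc)
      also have "\<dots> = s * (u True * u True)" using k(2) by (simp add: mult_ac)
      finally show ?thesis using False by (simp add: s_def)
    qed
    from inj[OF this] show False using u0 by simp
  qed
qed

end

section \<open>Commutativity and associativity of the variety\<close>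

theorem theorem8p14:
  fixes V :: "('k::field, 'u) module set"
  assumes "infinite (UNIV :: 'u set)"
    and "\<exists>f :: 'k \<Rightarrow> 'u. inj f"
    and "homogeneous_variety V"
    and "cosmash_associative (alg_category V)"
  shows "(satisfies V poly_comm \<or>
      satisfies V (word_poly (Mul (Var 0) (Var 1))) \<or>
      satisfies V (word_poly (Var 0))) \<and>
    V \<subseteq> CA"
proof -
  obtain I where I: "\<forall>p\<in>I. homogeneous p" "V = variety I"
    using assms(3) unfolding homogeneous_variety_def by blast
  obtain code :: "('k, nat \<times> 'u) alg_term \<Rightarrow> 'u" where code: "inj code"
    using ex_inj_alg_term[OF assms(1)] assms(2) by blast
  interpret cosmash_variety I V code
    using I(1) by unfold_locales (rule I(2), blast, rule code, rule assms(4))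
  have comm: "a \<otimes>\<^bsub>A\<^esub> b = b \<otimes>\<^bsub>A\<^esub> a" if pn: "prod_nonzero" and A: "A \<in> V" "a \<in> carrier A" "b \<in> carrier A" for A a b
  proof -
    obtain \<alpha> \<beta> where rel: "\<And>A a b. \<lbrakk>A \<in> V; a \<in> carrier A; b \<in> carrier A\<rbrakk> \<Longrightarrow> \<alpha> \<odot>\<^bsub>A\<^esub> (a \<otimes>\<^bsub>A\<^esub> b) \<oplus>\<^bsub>A\<^esub> \<beta> \<odot>\<^bsub>A\<^esub> (b \<otimes>\<^bsub>A\<^esub> a) = \<zero>\<^bsub>A\<^esub>"
      and ab: "\<alpha> \<noteq> 0 \<or> \<beta> \<noteq> 0" using not_free2 unfolding free2_def by blast
    obtain B x y where B: "B \<in> V" "x \<in> carrier B" "y \<in> carrier B" "x \<otimes>\<^bsub>B\<^esub> y \<noteq> \<zero>\<^bsub>B\<^esub>"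
      using pn unfolding prod_nonzero_def by blast
    interpret B: nalg B using B(1) by (rule V_nalg)
    \<comment> \<open>Elimination of y x from the relation for x, y and the relation for y, x. A
      nonzero product then forces \<alpha> = \<beta> or \<alpha> = - \<beta>.\<close>
    have "(\<alpha> * \<alpha> - \<beta> * \<beta>) \<odot>\<^bsub>B\<^esub> (x \<otimes>\<^bsub>B\<^esub> y) =
      \<alpha> \<odot>\<^bsub>B\<^esub> (\<alpha> \<odot>\<^bsub>B\<^esub> (x \<otimes>\<^bsub>B\<^esub> y) \<oplus>\<^bsub>B\<^esub> \<beta> \<odot>\<^bsub>B\<^esub> (y \<otimes>\<^bsub>B\<^esub> x)) \<oplus>\<^bsub>B\<^esub> (- \<beta>) \<odot>\<^bsub>B\<^esub> (\<alpha> \<odot>\<^bsub>B\<^esub> (y \<otimes>\<^bsub>B\<^esub> x) \<oplus>\<^bsub>B\<^esub> \<beta> \<odot>\<^bsub>B\<^esub> (x \<otimes>\<^bsub>B\<^esub> y))"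
    proof -
      have "\<alpha> \<odot>\<^bsub>B\<^esub> (\<alpha> \<odot>\<^bsub>B\<^esub> (x \<otimes>\<^bsub>B\<^esub> y) \<oplus>\<^bsub>B\<^esub> \<beta> \<odot>\<^bsub>B\<^esub> (y \<otimes>\<^bsub>B\<^esub> x)) \<oplus>\<^bsub>B\<^esub> (- \<beta>) \<odot>\<^bsub>B\<^esub> (\<alpha> \<odot>\<^bsub>B\<^esub> (y \<otimes>\<^bsub>B\<^esub> x) \<oplus>\<^bsub>B\<^esub> \<beta> \<odot>\<^bsub>B\<^esub> (x \<otimes>\<^bsub>B\<^esub> y)) =
         (\<alpha> * \<alpha> + - \<beta> * \<beta>) \<odot>\<^bsub>B\<^esub> (x \<otimes>\<^bsub>B\<^esub> y) \<oplus>\<^bsub>B\<^esub> (\<alpha> * \<beta> + - \<beta> * \<alpha>) \<odot>\<^bsub>B\<^esub> (y \<otimes>\<^bsub>B\<^esub> x)"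
        using B(2,3) unfolding B.sm_add_left[OF B.mult_closed[OF B(2,3)]] B.sm_add_left[OF B.mult_closed[OF B(3,2)]]
        by (simp add: B.sm_add_right B.sm_sm B.ac)
      then show ?thesis using B(2,3) by (simp add: mult.commute)
    qed
    also have "\<dots> = \<zero>\<^bsub>B\<^esub>" using rel[OF B(1-3)] rel[OF B(1,3,2)] by simp
    finally have "\<alpha> * \<alpha> - \<beta> * \<beta> = 0" using B.sm_eq_zero[of "\<alpha> * \<alpha> - \<beta> * \<beta>" "x \<otimes>\<^bsub>B\<^esub> y"] B by auto
    then have "(\<alpha> - \<beta>) * (\<alpha> + \<beta>) = 0" by (simp add: algebra_simps)
    then consider "\<alpha> = \<beta>" | "\<beta> = - \<alpha>" by (auto simp: add_eq_0_iff)
    then show ?thesis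
    proof cases
      case 1
      have "p \<otimes>\<^bsub>D\<^esub> q \<oplus>\<^bsub>D\<^esub> q \<otimes>\<^bsub>D\<^esub> p = \<zero>\<^bsub>D\<^esub>" if D: "D \<in> V" "p \<in> carrier D" "q \<in> carrier D" for D p q
      proof -
        interpret D: nalg D using D(1) by (rule V_nalg)
        have "\<beta> \<odot>\<^bsub>D\<^esub> (p \<otimes>\<^bsub>D\<^esub> q \<oplus>\<^bsub>D\<^esub> q \<otimes>\<^bsub>D\<^esub> p) = \<zero>\<^bsub>D\<^esub>" using rel[OF D] D 1 by (simp add: D.sm_add_right)
        then show ?thesis using D.sm_eq_zero ab 1 D by auto
      qed
      then have an: "anti" using pn by (simp add: anti_def)
      \<comment> \<open>In characteristic 2 anticommutativity is commutativity.\<close>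
      have "(-1 :: 'k) = 1" using anti_char2[OF an] by (metis add_eq_0_iff one_add_one)
      interpret A: nalg A using A(1) by (rule V_nalg)
      have "a \<otimes>\<^bsub>A\<^esub> b \<oplus>\<^bsub>A\<^esub> (-1) \<odot>\<^bsub>A\<^esub> (b \<otimes>\<^bsub>A\<^esub> a) = \<zero>\<^bsub>A\<^esub>"
        using an A unfolding \<open>(-1 :: 'k) = 1\<close> by (simp add: anti_def)
      then show ?thesis using A.eq_if_diff_zero[of "a \<otimes>\<^bsub>A\<^esub> b" "b \<otimes>\<^bsub>A\<^esub> a"] A by simp
    next
      case 2
      interpret A: nalg A using A(1) by (rule V_nalg)
      have "\<alpha> \<odot>\<^bsub>A\<^esub> (a \<otimes>\<^bsub>A\<^esub> b \<oplus>\<^bsub>A\<^esub> (-1) \<odot>\<^bsub>A\<^esub> (b \<otimes>\<^bsub>A\<^esub> a)) = \<zero>\<^bsub>A\<^esub>"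
        using rel[OF A] A 2 by (simp add: A.sm_add_right A.sm_sm)
      then have "a \<otimes>\<^bsub>A\<^esub> b \<oplus>\<^bsub>A\<^esub> (-1) \<odot>\<^bsub>A\<^esub> (b \<otimes>\<^bsub>A\<^esub> a) = \<zero>\<^bsub>A\<^esub>" using A.sm_eq_zero ab 2 A by auto
      then show ?thesis using A.eq_if_diff_zero[of "a \<otimes>\<^bsub>A\<^esub> b" "b \<otimes>\<^bsub>A\<^esub> a"] A by simp
    qed
  qed
  \<comment> \<open>A zero multiplication is commutative as well, so \<open>poly_comm\<close> is an
    identity whether or not \<open>prod_nonzero\<close> holds.\<close>
  have zero: "a \<otimes>\<^bsub>A\<^esub> b = \<zero>\<^bsub>A\<^esub>" if "\<not> prod_nonzero" "A \<in> V" "a \<in> carrier A" "b \<in> carrier A" for A a b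
    using that unfolding prod_nonzero_def by blast
  have comm': "a \<otimes>\<^bsub>A\<^esub> b = b \<otimes>\<^bsub>A\<^esub> a" if "A \<in> V" "a \<in> carrier A" "b \<in> carrier A" for A a b
    using that comm zero by (cases prod_nonzero) simp_all
  have pc: "is_identity A poly_comm" if A: "A \<in> V" for A
    unfolding is_identity_def
  proof (intro allI impI)
    interpret A: nalg A using A by (rule V_nalg)
    fix a :: "nat \<Rightarrow> 'u" assume a: "range a \<subseteq> carrier A"
    then have c: "a i \<in> carrier A" for i by auto
    show "poly_value A a poly_comm = \<zero>\<^bsub>A\<^esub>"
      using A.poly_value_diff[OF a, of "Mul (Var 0) (Var 1)" "Mul (Var 1) (Var 0)"] comm'[OF A c c, of 0 1]
        A.sm_minus_one_add[OF A.mult_closed[OF c c], of 1 0] c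
      by (simp add: poly_comm_def A.add_comm)
  qed
  have pa: "is_identity A poly_assoc" if A: "A \<in> V" for A
    unfolding is_identity_def
  proof (intro allI impI)
    interpret A: nalg A using A by (rule V_nalg)
    fix a :: "nat \<Rightarrow> 'u" assume a: "range a \<subseteq> carrier A"
    then have c: "a i \<in> carrier A" for i by auto
    show "poly_value A a poly_assoc = \<zero>\<^bsub>A\<^esub>"
      using A.poly_value_diff[OF a, of "Mul (Var 0) (Mul (Var 1) (Var 2))" "Mul (Mul (Var 0) (Var 1)) (Var 2)"]
        comm_assoc[OF comm' A c c c, of 0 1 2] A.sm_minus_one_add[OF A.mult_closed[OF A.mult_closed[OF c c] c], of 0 1 2] c
      by (simp add: poly_assoc_def A.add_comm)
  qed
  show ?thesis
  proof
    show "satisfies V poly_comm \<or> satisfies V (word_poly (Mul (Var 0) (Var 1))) \<or> satisfies V (word_poly (Var 0))"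
      using pc by (simp add: satisfies_def)
    show "V \<subseteq> CA" using pc pa V_alg by (auto simp: CA_def variety_def)
  qed
qed

end
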